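(* For $\alpha\in(0,\pi)$ define $$p_1(\alpha)=2g_2(e^{i\alpha})\eta_1(e^{i\alpha})-3g_3(e^{i\alpha}),\qquad p_2(\alpha)=2g_2(e^{i\alpha})\eta_2(e^{i\alpha})-3g_3(e^{i\alpha})e^{i\alpha},$$ $$P(\alpha)=\mathrm{Im}\big(\overline{p_1(\alpha)}\,p_2(\alpha)\big).$$ Then there exists $\alpha_0\in(\pi/3,\pi/2)$ such that $P(\alpha_0)=0$. In particular, there exists a complete improper affine front $\psi:(\mathbb{C}/[1,e^{i\alpha_0}])\setminus\{[0]\}\to\mathbb{R}^3$ (hence of genus $1$) whose total curvature is $-8\pi$.
   Context: **Elliptic functions.** For $\tau\in\mathbb{C}$ with $\mathrm{Im}\,\tau>0$, $[1,\tau]=\{m+n\tau:m,n\in\mathbb{Z}\}$, and $[x]$ denotes the class of $x$ in $\mathbb{C}/[1,\tau]$. Put $g_2(\tau)=60\sum_{\omega\in[1,\tau]\setminus\{0\}}\omega^{-4}$ and $g_3(\tau)=140\sum_{\omega\in[1,\tau]\setminus\{0\}}\omega^{-6}$. Let $\wp$ be the Weierstrass $\wp$-function of $[1,\tau]$ and $\zeta$ the Weierstrass zeta function ($\zeta'=-\wp$, $\lim_{z\to0}(\zeta(z)-1/z)=0$), and let $\eta_1(\tau)=\zeta(z+1)-\zeta(z)$, $\eta_2(\tau)=\zeta(z+\tau)-\zeta(z)$ (constants independent of $z$). **Improper affine fronts.** Let $\Sigma$ be a connected Riemann surface and let $F,G:\Sigma\to\mathbb{C}$ be holomorphic functions with $(dF,dG)\neq(0,0)$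 everywhere, satisfying the period condition $\mathrm{Re}\int_\gamma F\,dG=0$ for every closed curve $\gamma$ in $\Sigma$. The map $$\psi=\Big(G+\overline{F},\ \tfrac12(|G|^2-|F|^2)+\mathrm{Re}\big(GF-2\int F\,dG\big)\Big):\Sigma\to\mathbb{C}\times\mathbb{R}=\mathbb{R}^3$$ is called an improper affine front with Weierstrass data $(F,G)$. The flat fundamental form is $ds^2=|dF|^2+|dG|^2+dF\,dG+\overline{dF\,dG}$. **Completeness, genus.** $\psi$ is complete if there is a symmetric bilinear form $T$ with compact support on $\Sigma$ such that $T+ds^2$ is a complete Riemannian metric on $\Sigma$. It is known that then $\Sigma$ is biholomorphic to a compact Riemann surface $\overline\Sigma$ minus finitely many (at least one) points and $F,G$ extend meromorphically to $\overline\Sigma$. The genus of $\psi$ is the genus of $\overline\Sigma$. **Total curvature.** The total curvature is the integral over $\Sigma$ of the Gaussian curvature of the Riemannian metric $2(|dF|^2+|dG|^2)$ with respect to its area element. It equals $-2\pi\deg\rho$, where $\rho=dF/dG$ is a meromorphic map from $\overline\Sigma$ to $\mathbb{C}\cup\{\infty\}$. *)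

theory Defs
  imports "HOL-Complex_Analysis.Complex_Analysis"
begin

section \<open>Elliptic functions of the lattice \<open>[1,\<tau>]\<close>\<close>

definition lattice :: "complex \<Rightarrow> complex set" where
  "lattice \<tau> = {of_int m + of_int n * \<tau> | m n. True}"

definition eis_g2 :: "complex \<Rightarrow> complex" where
  "eis_g2 \<tau> = 60 * (\<Sum>\<^sub>\<infinity>\<omega>\<in>lattice \<tau> - {0}. 1 / \<omega> ^ 4)"

definition eis_g3 :: "complex \<Rightarrow> complex" where
  "eis_g3 \<tau> = 140 * (\<Sum>\<^sub>\<infinity>\<omega>\<in>lattice \<tau> - {0}. 1 / \<omega> ^ 6)"

definition wp :: "complex \<Rightarrow> complex \<Rightarrow> complex" where
  "wp \<tau> z = 1 / z ^ 2 + (\<Sum>\<^sub>\<infinity>\<omega>\<in>lattice \<tau> - {0}. 1 / (z - \<omega>) ^ 2 - 1 / \<omega> ^ 2)"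

text \<open>The two conditions determine the zeta function on the complement of the lattice, which is
  connected; its values at lattice points are irrelevant and are never used below.\<close>

definition is_weierstrass_zeta :: "complex \<Rightarrow> (complex \<Rightarrow> complex) \<Rightarrow> bool" where
  "is_weierstrass_zeta \<tau> f \<longleftrightarrow>
     (\<forall>z. z \<notin> lattice \<tau> \<longrightarrow> (f has_field_derivative - wp \<tau> z) (at z)) \<and>
     ((\<lambda>z. f z - 1 / z) \<longlongrightarrow> 0) (at 0)"

definition weierstrass_zeta :: "complex \<Rightarrow> complex \<Rightarrow> complex" where
  "weierstrass_zeta \<tau> = (SOME f. is_weierstrass_zeta \<tau> f)"

definition eta1 :: "complex \<Rightarrow> complex" where
  "eta1 \<tau> = (THE c. \<forall>z. z \<notin> lattice \<tau> \<longrightarrow>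
     weierstrass_zeta \<tau> (z + 1) - weierstrass_zeta \<tau> z = c)"

definition eta2 :: "complex \<Rightarrow> complex" where
  "eta2 \<tau> = (THE c. \<forall>z. z \<notin> lattice \<tau> \<longrightarrow>
     weierstrass_zeta \<tau> (z + \<tau>) - weierstrass_zeta \<tau> z = c)"

definition p1 :: "real \<Rightarrow> complex" where
  "p1 \<alpha> = 2 * eis_g2 (cis \<alpha>) * eta1 (cis \<alpha>) - 3 * eis_g3 (cis \<alpha>)"

definition p2 :: "real \<Rightarrow> complex" where
  "p2 \<alpha> = 2 * eis_g2 (cis \<alpha>) * eta2 (cis \<alpha>) - 3 * eis_g3 (cis \<alpha>) * cis \<alpha>"

definition P :: "real \<Rightarrow> real" where
  "P \<alpha> = Im (cnj (p1 \<alpha>) * p2 \<alpha>)"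


section \<open>Riemann surfaces\<close>

text \<open>A chart is a pair of its domain and its coordinate map; the values of the coordinate
  map outside the domain are irrelevant.\<close>

type_synonym 'a chart = "'a set \<times> ('a \<Rightarrow> complex)"

record 'a surface =
  stop :: "'a topology"
  charts :: "'a chart set"

definition param :: "'a chart \<Rightarrow> complex \<Rightarrow> 'a" where
  "param c = inv_into (fst c) (snd c)"

definition chart_img :: "'a chart \<Rightarrow> complex set" where
  "chart_img c = snd c ` fst c"

definition transition :: "'a chart \<Rightarrow> 'a chart \<Rightarrow> complex \<Rightarrow> complex" where
  "transition c d = snd d \<circ> param c"

text \<open>Second countability is not demanded, since it is automatic (Rado).\<close>

definition riemann_surface :: "'a surface \<Rightarrow> bool" where
  "riemann_surface S \<longleftrightarrow>
     topspace (stop S) \<noteq> {} \<and> connected_space (stop S) \<and> Hausdorff_space (stop S) \<and>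
     (\<Union>c\<in>charts S. fst c) = topspace (stop S) \<and>
     (\<forall>c\<in>charts S. openin (stop S) (fst c) \<and> open (chart_img c) \<and>
        homeomorphic_map (subtopology (stop S) (fst c)) (top_of_set (chart_img c)) (snd c)) \<and>
     (\<forall>c\<in>charts S. \<forall>d\<in>charts S.
        transition c d holomorphic_on snd c ` (fst c \<inter> fst d))"

definition holomorphic_fun :: "'a surface \<Rightarrow> ('a \<Rightarrow> complex) \<Rightarrow> bool" where
  "holomorphic_fun S F \<longleftrightarrow> (\<forall>c\<in>charts S. (F \<circ> param c) holomorphic_on chart_img c)"

text \<open>With \<open>w\<close> the coordinate of the chart \<open>c\<close>, the differential of \<open>F\<close> at \<open>p\<close> is
  \<open>dcoef c F p\<close> times \<open>dw\<close>.\<close>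

definition dcoef :: "'a chart \<Rightarrow> ('a \<Rightarrow> complex) \<Rightarrow> 'a \<Rightarrow> complex" where
  "dcoef c F p = deriv (F \<circ> param c) (snd c p)"

definition holomorphic_map ::
    "'a surface \<Rightarrow> 'b surface \<Rightarrow> ('a \<Rightarrow> 'b) \<Rightarrow> bool" where
  "holomorphic_map S R h \<longleftrightarrow> continuous_map (stop S) (stop R) h \<and>
     (\<forall>c\<in>charts S. \<forall>d\<in>charts R.
        (snd d \<circ> h \<circ> param c) holomorphic_on snd c ` (fst c \<inter> h -` fst d))"

definition biholomorphic_map ::
    "'a surface \<Rightarrow> 'b surface \<Rightarrow> ('a \<Rightarrow> 'b) \<Rightarrow> bool" where
  "biholomorphic_map S R h \<longleftrightarrow>
     bij_betw h (topspace (stop S)) (topspace (stop R)) \<and>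
     holomorphic_map S R h \<and> holomorphic_map R S (inv_into (topspace (stop S)) h)"

definition puncture :: "'a surface \<Rightarrow> 'a set \<Rightarrow> 'a surface" where
  "puncture S E = \<lparr>stop = subtopology (stop S) (topspace (stop S) - E),
                   charts = (\<lambda>(U, \<phi>). (U - E, \<phi>)) ` charts S\<rparr>"

text \<open>Holomorphic 1-forms, by their coefficients in the charts; the genus of a compact Riemann
  surface is the complex dimension of the space of holomorphic 1-forms.\<close>

definition holomorphic_form :: "'a surface \<Rightarrow> ('a chart \<Rightarrow> 'a \<Rightarrow> complex) \<Rightarrow> bool" where
  "holomorphic_form S \<omega> \<longleftrightarrow>
     (\<forall>c\<in>charts S. (\<omega> c \<circ> param c) holomorphic_on chart_img c) \<and>
     (\<forall>c\<in>charts S. \<forall>d\<in>charts S. \<forall>p\<in>fst c \<inter> fst d.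
        \<omega> c p = \<omega> d p * deriv (transition c d) (snd c p))"

definition has_genus :: "'a surface \<Rightarrow> nat \<Rightarrow> bool" where
  "has_genus S g \<longleftrightarrow> riemann_surface S \<and> compact_space (stop S) \<and>
     (\<exists>B. (\<forall>i<g. holomorphic_form S (B i)) \<and>
        (\<forall>\<omega>. holomorphic_form S \<omega> \<longrightarrow>
           (\<exists>!a :: nat \<Rightarrow> complex. (\<forall>i\<ge>g. a i = 0) \<and>
              (\<forall>c\<in>charts S. \<forall>p\<in>fst c. \<omega> c p = (\<Sum>i<g. a i * B i c p)))))"


section \<open>The complex torus \<open>\<complex>/[1,\<tau>]\<close>\<close>

definition cls :: "complex \<Rightarrow> complex \<Rightarrow> complex set" where
  "cls \<tau> x = {z. z - x \<in> lattice \<tau>}"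

text \<open>Quotient topology; the charts are the inverses of the projection restricted to the open
  sets on which it is injective.\<close>

definition torus :: "complex \<Rightarrow> complex set surface" where
  "torus \<tau> = \<lparr>stop = topology (\<lambda>U. U \<subseteq> range (cls \<tau>) \<and> open (cls \<tau> -` U)),
              charts = {(cls \<tau> ` V, inv_into V (cls \<tau>)) | V. open V \<and> inj_on (cls \<tau>) V}\<rparr>"


section \<open>Curves and line integrals\<close>

definition pC1_path :: "'a surface \<Rightarrow> (real \<Rightarrow> 'a) \<Rightarrow> bool" where
  "pC1_path S \<gamma> \<longleftrightarrow> pathin (stop S) \<gamma> \<and>
     (\<forall>c\<in>charts S. \<forall>a b. 0 \<le> a \<and> a < b \<and> b \<le> 1 \<and> \<gamma> ` {a..b} \<subseteq> fst c \<longrightarrow>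
        (snd c \<circ> \<gamma>) piecewise_C1_differentiable_on {a..b})"

text \<open>The integral of the 1-form \<open>F dG\<close> along \<open>\<gamma>\<close>.\<close>

definition line_integral ::
    "('a \<Rightarrow> complex) \<Rightarrow> ('a \<Rightarrow> complex) \<Rightarrow> (real \<Rightarrow> 'a) \<Rightarrow> complex" where
  "line_integral F G \<gamma> =
     integral {0..1} (\<lambda>t. F (\<gamma> t) * vector_derivative (G \<circ> \<gamma>) (at t within {0..1}))"


section \<open>Symmetric bilinear forms and Riemannian metrics\<close>

text \<open>\<open>C\<^sup>k\<close> functions on open subsets of the plane.\<close>

primrec Ck_on :: "nat \<Rightarrow> (complex \<Rightarrow> real) \<Rightarrow> complex set \<Rightarrow> bool" where
  "Ck_on 0 f U \<longleftrightarrow> continuous_on U f"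
| "Ck_on (Suc k) f U \<longleftrightarrow> (\<forall>z\<in>U. f differentiable (at z)) \<and>
     (\<forall>v. Ck_on k (\<lambda>z. frechet_derivative f (at z) v) U)"

text \<open>A field of bilinear forms assigns to a chart \<open>c\<close> and a point \<open>p\<close> of its domain a form on
  the real tangent plane at \<open>p\<close>, which \<open>c\<close> identifies with \<open>\<complex>\<close>.\<close>

type_synonym 'a field2 = "'a chart \<Rightarrow> 'a \<Rightarrow> complex \<Rightarrow> complex \<Rightarrow> real"

definition symmetric_form :: "'a surface \<Rightarrow> 'a field2 \<Rightarrow> bool" where
  "symmetric_form S T \<longleftrightarrow>
     (\<forall>c\<in>charts S. \<forall>p\<in>fst c. bilinear (T c p) \<and> (\<forall>v w. T c p v w = T c p w v)) \<and>
     (\<forall>c\<in>charts S. \<forall>v w k. Ck_on k (\<lambda>z. T c (param c z) v w) (chart_img c)) \<and>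
     (\<forall>c\<in>charts S. \<forall>d\<in>charts S. \<forall>p\<in>fst c \<inter> fst d. \<forall>v w.
        T c p v w = T d p (deriv (transition c d) (snd c p) * v)
                          (deriv (transition c d) (snd c p) * w))"

definition compactly_supported :: "'a surface \<Rightarrow> 'a field2 \<Rightarrow> bool" where
  "compactly_supported S T \<longleftrightarrow>
     (\<exists>K. compactin (stop S) K \<and> (\<forall>c\<in>charts S. \<forall>p\<in>fst c - K. \<forall>v w. T c p v w = 0))"

definition riemannian_metric :: "'a surface \<Rightarrow> 'a field2 \<Rightarrow> bool" where
  "riemannian_metric S g \<longleftrightarrow> symmetric_form S g \<and>
     (\<forall>c\<in>charts S. \<forall>p\<in>fst c. \<forall>v. v \<noteq> 0 \<longrightarrow> g c p v v > 0)"

text \<open>Quantities that are independent of the chart are computed in an arbitrary chart at the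
  given point.\<close>

definition chart_at :: "'a surface \<Rightarrow> 'a \<Rightarrow> 'a chart" where
  "chart_at S p = (SOME c. c \<in> charts S \<and> p \<in> fst c)"

definition speed :: "'a surface \<Rightarrow> 'a field2 \<Rightarrow> (real \<Rightarrow> 'a) \<Rightarrow> real \<Rightarrow> real" where
  "speed S g \<gamma> t = (let c = chart_at S (\<gamma> t); v = vector_derivative (snd c \<circ> \<gamma>) (at t)
                     in sqrt (g c (\<gamma> t) v v))"

definition path_len :: "'a surface \<Rightarrow> 'a field2 \<Rightarrow> (real \<Rightarrow> 'a) \<Rightarrow> ennreal" where
  "path_len S g \<gamma> = (\<integral>\<^sup>+t\<in>{0..1}. ennreal (speed S g \<gamma> t) \<partial>lborel)"

definition rdist :: "'a surface \<Rightarrow> 'a field2 \<Rightarrow> 'a \<Rightarrow> 'a \<Rightarrow> ennreal" where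
  "rdist S g p q = Inf {path_len S g \<gamma> | \<gamma>. pC1_path S \<gamma> \<and> \<gamma> 0 = p \<and> \<gamma> 1 = q}"

definition complete_metric :: "'a surface \<Rightarrow> 'a field2 \<Rightarrow> bool" where
  "complete_metric S g \<longleftrightarrow> riemannian_metric S g \<and>
     (\<forall>s :: nat \<Rightarrow> 'a. range s \<subseteq> topspace (stop S) \<and>
        (\<forall>e>0. \<exists>N. \<forall>m\<ge>N. \<forall>n\<ge>N. rdist S g (s m) (s n) < e) \<longrightarrow>
        (\<exists>p\<in>topspace (stop S). (\<lambda>n. rdist S g (s n) p) \<longlonglongrightarrow> 0))"


section \<open>Gaussian curvature and area\<close>

text \<open>A metric on an open subset of the plane is given by \<open>m z v w\<close>; the coordinate fields
  of \<open>x + \<i>y\<close> are the constant vectors \<open>1\<close> and \<open>\<i>\<close>, which also serve as the tensor indices.\<close>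

type_synonym pmetric = "complex \<Rightarrow> complex \<Rightarrow> complex \<Rightarrow> real"

definition pderiv_dir :: "complex \<Rightarrow> (complex \<Rightarrow> real) \<Rightarrow> complex \<Rightarrow> real" where
  "pderiv_dir e f z = frechet_derivative f (at z) e"

definition metric_det :: "pmetric \<Rightarrow> complex \<Rightarrow> real" where
  "metric_det m z = m z 1 1 * m z \<i> \<i> - (m z 1 \<i>)\<^sup>2"

definition metric_inv :: "pmetric \<Rightarrow> complex \<Rightarrow> complex \<Rightarrow> complex \<Rightarrow> real" where
  "metric_inv m z k l =
     (if k = l then (if k = 1 then m z \<i> \<i> else m z 1 1) else - m z k l) / metric_det m z"

definition christoffel :: "pmetric \<Rightarrow> complex \<Rightarrow> complex \<Rightarrow> complex \<Rightarrow> complex \<Rightarrow> real" where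
  "christoffel m k i j z = (\<Sum>l\<in>{1, \<i>}. metric_inv m z k l *
     (pderiv_dir i (\<lambda>u. m u j l) z + pderiv_dir j (\<lambda>u. m u i l) z
        - pderiv_dir l (\<lambda>u. m u i j) z) / 2)"

text \<open>The \<open>l\<close>-component of \<open>R(e\<^sub>1,e\<^sub>2)e\<^sub>2 = \<nabla>\<^sub>1\<nabla>\<^sub>2e\<^sub>2 - \<nabla>\<^sub>2\<nabla>\<^sub>1e\<^sub>2\<close>, with \<open>e\<^sub>1 = 1\<close> and \<open>e\<^sub>2 = \<i>\<close>.\<close>

definition riem :: "pmetric \<Rightarrow> complex \<Rightarrow> complex \<Rightarrow> real" where
  "riem m l z =
     pderiv_dir 1 (christoffel m l \<i> \<i>) z - pderiv_dir \<i> (christoffel m l 1 \<i>) z +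
     (\<Sum>n\<in>{1, \<i>}. christoffel m n \<i> \<i> z * christoffel m l 1 n z
                  - christoffel m n 1 \<i> z * christoffel m l \<i> n z)"

definition gauss_curv_plane :: "pmetric \<Rightarrow> complex \<Rightarrow> real" where
  "gauss_curv_plane m z = (\<Sum>l\<in>{1, \<i>}. riem m l z * m z l 1) / metric_det m z"

definition local_metric :: "'a field2 \<Rightarrow> 'a chart \<Rightarrow> pmetric" where
  "local_metric g c z = g c (param c z)"

definition gauss_curv :: "'a surface \<Rightarrow> 'a field2 \<Rightarrow> 'a \<Rightarrow> real" where
  "gauss_curv S g p =
     (let c = chart_at S p in gauss_curv_plane (local_metric g c) (snd c p))"

text \<open>The Borel measure given by the area element; it is unique because Riemann surfaces are
  second countable.\<close>

definition area_measure :: "'a surface \<Rightarrow> 'a field2 \<Rightarrow> 'a measure \<Rightarrow> bool" where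
  "area_measure S g M \<longleftrightarrow>
     space M = topspace (stop S) \<and>
     sets M = sigma_sets (topspace (stop S)) {U. openin (stop S) U} \<and>
     (\<forall>c\<in>charts S. \<forall>A\<in>sets M. A \<subseteq> fst c \<longrightarrow>
        emeasure M A =
          (\<integral>\<^sup>+z\<in>snd c ` A. ennreal (sqrt (metric_det (local_metric g c) z)) \<partial>lborel))"

definition has_curvature_integral :: "'a surface \<Rightarrow> 'a field2 \<Rightarrow> real \<Rightarrow> bool" where
  "has_curvature_integral S g k \<longleftrightarrow> riemannian_metric S g \<and>
     (\<exists>M. area_measure S g M \<and> has_bochner_integral M (gauss_curv S g) k)"


section \<open>Improper affine fronts\<close>

text \<open>The indefinite integral of \<open>F dG\<close> is the integral from a base point \<open>p\<^sub>0\<close> up to an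
  additive constant.\<close>

definition improper_affine_front ::
    "'a surface \<Rightarrow> ('a \<Rightarrow> complex) \<Rightarrow> ('a \<Rightarrow> complex) \<Rightarrow> ('a \<Rightarrow> complex \<times> real) \<Rightarrow> bool" where
  "improper_affine_front S F G \<psi> \<longleftrightarrow>
     riemann_surface S \<and> holomorphic_fun S F \<and> holomorphic_fun S G \<and>
     (\<forall>c\<in>charts S. \<forall>p\<in>fst c. (dcoef c F p, dcoef c G p) \<noteq> (0, 0)) \<and>
     (\<forall>\<gamma>. pC1_path S \<gamma> \<and> \<gamma> 0 = \<gamma> 1 \<longrightarrow> Re (line_integral F G \<gamma>) = 0) \<and>
     (\<exists>p\<^sub>0\<in>topspace (stop S). \<exists>k :: real. \<forall>\<gamma>. pC1_path S \<gamma> \<and> \<gamma> 0 = p\<^sub>0 \<longrightarrow>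
        (let p = \<gamma> 1 in
         \<psi> p = (G p + cnj (F p),
                ((cmod (G p))\<^sup>2 - (cmod (F p))\<^sup>2) / 2
                  + Re (G p * F p - 2 * line_integral F G \<gamma>) + k)))"

text \<open>The flat fundamental form, polarized; the product \<open>dF dG\<close> of 1-forms is the symmetric
  product.\<close>

definition flat_form :: "('a \<Rightarrow> complex) \<Rightarrow> ('a \<Rightarrow> complex) \<Rightarrow> 'a field2" where
  "flat_form F G c p v w = (let f = dcoef c F p; g = dcoef c G p in
     Re ((f * v) * cnj (f * w)) + Re ((g * v) * cnj (g * w)) + 2 * Re ((f * v) * (g * w)))"

definition complete_front :: "'a surface \<Rightarrow> ('a \<Rightarrow> complex) \<Rightarrow> ('a \<Rightarrow> complex) \<Rightarrow> bool" where
  "complete_front S F G \<longleftrightarrow>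
     (\<exists>T. symmetric_form S T \<and> compactly_supported S T \<and>
        complete_metric S (\<lambda>c p v w. T c p v w + flat_form F G c p v w))"

text \<open>The compactification may be taken on the same carrier type as \<open>S\<close>, since a Riemann surface
  and its compactification have the same infinite cardinality. Meromorphy of a function in the
  library's sense does not depend on its values at isolated points, so it is meaningful at
  the points of \<open>E\<close>.\<close>

definition front_has_genus ::
    "'a surface \<Rightarrow> ('a \<Rightarrow> complex) \<Rightarrow> ('a \<Rightarrow> complex) \<Rightarrow> nat \<Rightarrow> bool" where
  "front_has_genus S F G n \<longleftrightarrow>
     (\<exists>(R :: 'a surface) E h. has_genus R n \<and>
        finite E \<and> E \<noteq> {} \<and> E \<subseteq> topspace (stop R) \<and>
        biholomorphic_map S (puncture R E) h \<and>
        (\<forall>c\<in>charts R.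
           (F \<circ> inv_into (topspace (stop S)) h \<circ> param c) meromorphic_on chart_img c \<and>
           (G \<circ> inv_into (topspace (stop S)) h \<circ> param c) meromorphic_on chart_img c))"

text \<open>The metric \<open>2(|dF|\<^sup>2 + |dG|\<^sup>2)\<close>, polarized.\<close>

definition curv_form :: "('a \<Rightarrow> complex) \<Rightarrow> ('a \<Rightarrow> complex) \<Rightarrow> 'a field2" where
  "curv_form F G c p v w = (let f = dcoef c F p; g = dcoef c G p in
     2 * (Re ((f * v) * cnj (f * w)) + Re ((g * v) * cnj (g * w))))"

definition has_total_curvature ::
    "'a surface \<Rightarrow> ('a \<Rightarrow> complex) \<Rightarrow> ('a \<Rightarrow> complex) \<Rightarrow> real \<Rightarrow> bool" where
  "has_total_curvature S F G k \<longleftrightarrow> has_curvature_integral S (curv_form F G) k"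

end

theory Submission
  imports Defs
begin


text \<open>The zero of \<open>P\<close> comes from the intermediate value theorem. At pi/2 the
  lattice is invariant under multiplication by \<i>, which forces g3 = 0 and eta2 = -\<i> eta1;
  hence p2 = -\<i> p1 and \<open>P\<close> = -|p1|^2. At pi/3 it is invariant under a primitive
  sixth root of unity \<rho>, which forces g2 = 0; hence p2 = \<rho> p1 and \<open>P\<close> =
  |p1|^2 Im \<rho>. Neither value is 0, since g2 and g3 never vanish together
  (\<open>eis_discriminant\<close>) and since eta1 = 0 at \<i> would contradict the Legendre
  relation. Continuity of \<open>P\<close> rests on an M-test that is uniform in \<tau> on a region
  containing the arc (\<open>continuous_on_lattice_sum\<close>).

  At a zero of \<open>P\<close> the numbers p1 and p2 are linearly dependent over the reals, so some
  a \<noteq> 0 makes a p1 and a p2 purely imaginary (\<open>period_multiplier\<close>). The front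
  then has the data F = a \<open>wp'\<close> and G = \<open>wp\<close> on the punctured torus. A
  primitive of F dG = a \<open>wp'\<close>^2 dz is a \<open>wp'_sq_prim\<close>, which is single
  valued off the lattice and has the additive periods a p1/5 and a p2/5. Its real part therefore
  descends to the surface; this is the period condition and also provides \<psi>. The differentials
  dF = a \<open>wp''\<close> dz and dG = \<open>wp'\<close> dz have no common zero, because wp''' =
  12 wp wp' would otherwise propagate the zero to all derivatives (\<open>wp''_nonzero\<close>).

  Completeness: at the puncture dF has a pole of order 4 and dG one of order 3, so |dF| dominates
  there and the flat form is at least |dF|^2/4. Elsewhere the flat form may degenerate, and a smooth
  cutoff times |dz|^2 is added as T. A multiple of F is Lipschitz for the sum and tends to infinity
  at the puncture, so a Cauchy sequence cannot escape (\<open>complete_metricI\<close>). The genus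
  is 1 because, by Liouville, every holomorphic 1-form on the torus is a constant times dz.

  Total curvature: the metric is \<lambda> |dz|^2, and curvature times area is -2 times the mixed
  derivative of log \<lambda> in z and its conjugate. Instead of counting the degree of dF/dG, this
  is integrated over a period parallelogram. The z-derivative of log \<lambda> plus 4 \<zeta>
  (\<open>curv_h\<close>) has a bounded differential near the puncture, the same derivative in the
  conjugate variable, and the quasi-periods 4 eta1 and 4 eta2. Integrating along the two period
  directions leaves exactly these, and \<open>legendre_relation\<close> turns them into -8 pi.
  Passing from the cell to the surface is the unfolding argument
  \<open>nn_integral_period_cell\<close>.

  The facts about elliptic functions are obtained from the lattice sums by termwise differentiation
  (\<open>has_field_derivative_infsum\<close>) and from Liouville's theorem in the form
  \<open>elliptic_const\<close>.\<close>

section \<open>Locally uniform summation of holomorphic functions\<close>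

text \<open>The finite set \<open>B\<close> is exempt from the majorant: in a lattice sum it
  collects the terms whose poles lie near \<open>D\<close>. Off \<open>B\<close> the M-test gives
  uniform convergence on a closed disc, which passes to complex derivatives by the Weierstrass
  theorem; the finitely many other terms are added back.\<close>

lemma has_field_derivative_infsum:
  fixes f f' :: "'i \<Rightarrow> complex \<Rightarrow> complex"
  assumes "open D" "z \<in> D" "finite B"
    and deriv: "\<And>i w. i \<in> A \<Longrightarrow> w \<in> D \<Longrightarrow> (f i has_field_derivative f' i w) (at w)"
    and bound: "\<And>i w. i \<in> A - B \<Longrightarrow> w \<in> D \<Longrightarrow> norm (f i w) \<le> M i"
    and M: "M summable_on A - B"
  shows "(\<lambda>i. f i z) summable_on A" and "(\<lambda>i. f' i z) summable_on A"
    and "((\<lambda>w. \<Sum>\<^sub>\<infinity>i\<in>A. f i w) has_field_derivative (\<Sum>\<^sub>\<infinity>i\<in>A. f' i z)) (at z)"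
proof -
  define X where "X = A - B"
  define Y where "Y = A \<inter> B"
  have A: "A = X \<union> Y" "X \<inter> Y = {}" and finY: "finite Y"
    using assms(3) by (auto simp: X_def Y_def)
  obtain r where r: "r > 0" "cball z r \<subseteq> D"
    using assms(1,2) open_contains_cball by blast
  have sumX: "(\<lambda>i. f i w) summable_on X" if "w \<in> D" for w
    by (rule abs_summable_summable, rule summable_on_comparison_test[OF M[folded X_def]])
       (use bound that in \<open>auto simp: X_def\<close>)
  have sumA: "(\<lambda>i. f i w) summable_on A" if "w \<in> D" for w
    unfolding A(1) using sumX[OF that] finY A(2)
    by (intro summable_on_Un_disjoint) auto
  have lim: "uniform_limit (cball z r) (\<lambda>Z w. \<Sum>i\<in>Z. f i w) (\<lambda>w. \<Sum>\<^sub>\<infinity>i\<in>X. f i w)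
      (finite_subsets_at_top X)"
    by (rule Weierstrass_m_test_general[where M = M])
       (use bound M r in \<open>auto simp: X_def\<close>)
  have ev: "eventually (\<lambda>Z. continuous_on (cball z r) (\<lambda>w. \<Sum>i\<in>Z. f i w) \<and>
      (\<forall>w\<in>ball z r. ((\<lambda>w. \<Sum>i\<in>Z. f i w) has_field_derivative (\<Sum>i\<in>Z. f' i w)) (at w)))
      (finite_subsets_at_top X)"
  proof (rule eventually_finite_subsets_at_top_weakI, intro conjI ballI)
    fix Z assume Z: "finite Z" "Z \<subseteq> X"
    have D: "((\<lambda>w. \<Sum>i\<in>Z. f i w) has_field_derivative (\<Sum>i\<in>Z. f' i w)) (at w)" if "w \<in> cball z r" for w
      by (intro derivative_intros deriv) (use Z r A that in auto)
    show "continuous_on (cball z r) (\<lambda>w. \<Sum>i\<in>Z. f i w)"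
      by (intro continuous_at_imp_continuous_on ballI DERIV_isCont[OF D])
    show "((\<lambda>w. \<Sum>i\<in>Z. f i w) has_field_derivative (\<Sum>i\<in>Z. f' i w)) (at w)" if "w \<in> ball z r" for w
      using D[of w] that by auto
  qed
  have nb: "finite_subsets_at_top X \<noteq> bot" by (rule finite_subsets_at_top_neq_bot)
  obtain g' where
    g': "\<And>w. w \<in> ball z r \<Longrightarrow> ((\<lambda>w. \<Sum>\<^sub>\<infinity>i\<in>X. f i w) has_field_derivative g' w) (at w) \<and>
            ((\<lambda>Z. \<Sum>i\<in>Z. f' i w) \<longlongrightarrow> g' w) (finite_subsets_at_top X)"
    by (rule has_complex_derivative_uniform_limit[OF ev lim nb r(1)]) blast
  have hs: "((\<lambda>i. f' i z) has_sum g' z) X"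
    using g'[of z] r(1) by (auto simp: has_sum_def)
  have hsA: "((\<lambda>i. f' i z) has_sum (g' z + (\<Sum>i\<in>Y. f' i z))) A"
    unfolding A(1) by (rule has_sum_Un_disjoint[OF hs _ A(2)]) (simp add: finY)
  show "(\<lambda>i. f i z) summable_on A" by (rule sumA[OF assms(2)])
  show "(\<lambda>i. f' i z) summable_on A" using hsA by (rule has_sum_imp_summable)
  have "((\<lambda>w. (\<Sum>\<^sub>\<infinity>i\<in>X. f i w) + (\<Sum>i\<in>Y. f i w)) has_field_derivative
      (g' z + (\<Sum>i\<in>Y. f' i z))) (at z)"
    by (intro derivative_intros deriv) (use g'[of z] r(1) assms(2) in \<open>auto simp: Y_def\<close>)
  also have "g' z + (\<Sum>i\<in>Y. f' i z) = (\<Sum>\<^sub>\<infinity>i\<in>A. f' i z)"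
    using hsA by (simp add: infsumI)
  finally have "((\<lambda>w. (\<Sum>\<^sub>\<infinity>i\<in>X. f i w) + (\<Sum>i\<in>Y. f i w)) has_field_derivative
      (\<Sum>\<^sub>\<infinity>i\<in>A. f' i z)) (at z)" .
  moreover have "(\<Sum>\<^sub>\<infinity>i\<in>A. f i w) = (\<Sum>\<^sub>\<infinity>i\<in>X. f i w) + (\<Sum>i\<in>Y. f i w)" if "w \<in> D" for w
    unfolding A(1) using sumX[OF that] finY A(2) by (subst infsum_Un_disjoint) auto
  ultimately show "((\<lambda>w. \<Sum>\<^sub>\<infinity>i\<in>A. f i w) has_field_derivative (\<Sum>\<^sub>\<infinity>i\<in>A. f' i z)) (at z)"
    using has_field_derivative_transform_within_open[OF _ assms(1,2)] by force
qed

section \<open>Lattices\<close>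

text \<open>With a = |m| and b = |n|, the bound (a + 1)(b + 1) \<le> (a + b + 1)^2 dominates the
  terms by the product of (a + 1)^(-3/2) and (b + 1)^(-3/2), and 3/2 > 1 makes each factor
  summable.\<close>

lemma summable_on_int_pairs:
  "(\<lambda>(m, n). 1 / (\<bar>real_of_int m\<bar> + \<bar>real_of_int n\<bar> + 1) ^ 3) summable_on (UNIV :: (int \<times> int) set)"
proof -
  define h where "h = (\<lambda>m::int. (\<bar>real_of_int m\<bar> + 1) powr - (3/2))"
  have nat: "(\<lambda>n::nat. (real n + 1) powr - (3/2)) summable_on UNIV"
  proof (rule norm_summable_imp_summable_on)
    have "summable (\<lambda>n::nat. real (Suc n) powr - (3/2))"
      by (subst summable_Suc_iff) (simp add: summable_real_powr_iff)
    then show "summable (\<lambda>n::nat. norm ((real n + 1) powr - (3/2)))"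
      by (simp add: add.commute)
  qed
  have 1: "h summable_on range int"
    by (subst summable_on_reindex) (use nat in \<open>auto simp: h_def o_def\<close>)
  have 2: "h summable_on range (\<lambda>n. - int n)"
    by (subst summable_on_reindex) (use nat in \<open>auto simp: h_def o_def inj_on_def\<close>)
  have "x \<in> range int \<union> range (\<lambda>n. - int n)" for x :: int
    by (cases x rule: int_cases2) auto
  then have "range int \<union> range (\<lambda>n. - int n) = UNIV" by blast
  with summable_on_union[OF 1 2] have h: "h summable_on UNIV" by simp
  then have habs: "(\<lambda>m. norm (h m)) summable_on UNIV"
    by (simp add: h_def)
  have "(\<lambda>m. norm (h m) * (\<Sum>\<^sub>\<infinity>n\<in>UNIV. norm (h n))) summable_on UNIV"
    by (rule summable_on_cmult_left) (rule habs)
  have "(\<lambda>(m, n). norm (h m * h n)) summable_on (UNIV \<times> UNIV)"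
  proof (rule summable_on_SigmaI[where g = "\<lambda>m. norm (h m) * (\<Sum>\<^sub>\<infinity>n\<in>UNIV. norm (h n))"])
    show "((\<lambda>n. case (m, n) of (m, n) \<Rightarrow> norm (h m * h n)) has_sum
        norm (h m) * (\<Sum>\<^sub>\<infinity>n\<in>UNIV. norm (h n))) UNIV" for m
      using has_sum_cmult_right[OF has_sum_infsum[OF habs], of "norm (h m)"]
      by (simp only: norm_mult prod.case)
  qed (fact, auto)
  then show ?thesis
    unfolding UNIV_Times_UNIV
  proof (rule summable_on_comparison_test)
    fix x :: "int \<times> int"
    obtain m n where x: "x = (m, n)" by force
    define a b where "a = \<bar>real_of_int m\<bar>" and "b = \<bar>real_of_int n\<bar>"
    have ab: "a \<ge> 0" "b \<ge> 0" by (auto simp: a_def b_def)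
    have "((a + 1) * (b + 1)) powr (3/2) \<le> ((a + b + 1)^2) powr (3/2)"
      by (rule powr_mono2) (use ab in \<open>auto simp: power2_eq_square algebra_simps\<close>)
    also have "\<dots> = (a + b + 1) ^ 3"
    proof -
      have "((a + b + 1)^2) powr (3/2) = ((a + b + 1) powr 2) powr (3/2)"
        using ab by (subst powr_numeral) auto
      also have "\<dots> = (a + b + 1) powr 3" by (simp add: powr_powr)
      also have "\<dots> = (a + b + 1) ^ 3" using ab by (subst powr_numeral) auto
      finally show ?thesis .
    qed
    finally have "1 / (a + b + 1) ^ 3 \<le> 1 / ((a + 1) * (b + 1)) powr (3/2)"
      by (intro divide_left_mono mult_pos_pos) (use ab in auto)
    also have "\<dots> = h m * h n"
    proof -
      have "h m = 1 / (a + 1) powr (3/2)" "h n = 1 / (b + 1) powr (3/2)"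
        by (simp_all only: h_def a_def b_def powr_minus_divide)
      moreover have "((a + 1) * (b + 1)) powr (3/2) = (a + 1) powr (3/2) * (b + 1) powr (3/2)"
        by (rule powr_mult)
      ultimately show ?thesis by (simp only: times_divide_times_eq mult_1)
    qed
    finally show "(case x of (m, n) \<Rightarrow> 1 / (\<bar>real_of_int m\<bar> + \<bar>real_of_int n\<bar> + 1) ^ 3)
        \<le> (case x of (m, n) \<Rightarrow> norm (h m * h n))"
      by (simp add: x a_def b_def h_def)
  qed auto
qed

text \<open>Compares the l1-norm of the real coordinates (x, y) with the modulus of z = x + y
  \<tau>: first |y| \<le> |z| / Im \<tau>, then |x| \<le> |z| + |y| |\<tau>|.\<close>

definition lattice_const :: "complex \<Rightarrow> real" where
  "lattice_const \<tau> = 1 + (1 + norm \<tau>) / Im \<tau>"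

lemma lattice_const_ge_1: "Im \<tau> > 0 \<Longrightarrow> lattice_const \<tau> \<ge> 1"
  by (simp add: lattice_const_def)

lemma lattice_coords_le:
  assumes "Im \<tau> > 0"
  shows "\<bar>x\<bar> + \<bar>y\<bar> \<le> lattice_const \<tau> * norm (of_real x + of_real y * \<tau>)"
proof -
  define z where "z = of_real x + of_real y * \<tau>"
  have "\<bar>y\<bar> * Im \<tau> = \<bar>Im z\<bar>" using assms by (simp add: z_def abs_mult)
  also have "\<dots> \<le> norm z" by (rule abs_Im_le_cmod)
  finally have y: "\<bar>y\<bar> \<le> norm z / Im \<tau>" using assms by (simp add: field_simps)
  have "norm (of_real x :: complex) \<le> norm z + norm (of_real y * \<tau>)"
    unfolding z_def using norm_triangle_ineq4[of "of_real x + of_real y * \<tau>" "of_real y * \<tau>"] by simp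
  then have "\<bar>x\<bar> \<le> norm z + \<bar>y\<bar> * norm \<tau>" by (simp add: norm_mult)
  also have "\<bar>y\<bar> * norm \<tau> \<le> norm z / Im \<tau> * norm \<tau>" by (intro mult_right_mono y) auto
  finally have "\<bar>x\<bar> + \<bar>y\<bar> \<le> norm z + norm z / Im \<tau> * norm \<tau> + norm z / Im \<tau>" using y by simp
  also have "\<dots> = lattice_const \<tau> * norm z" by (simp add: lattice_const_def ring_distribs add_divide_distrib mult_ac)
  finally show ?thesis by (simp add: z_def)
qed

lemma lattice_coords_eq_iff:
  assumes "Im \<tau> > 0"
  shows "of_real x + of_real y * \<tau> = of_real x' + of_real y' * \<tau> \<longleftrightarrow> x = x' \<and> y = y'"
  using assms by (auto simp: complex_eq_iff)

abbreviation lattice_pt :: "complex \<Rightarrow> int \<times> int \<Rightarrow> complex" where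
  "lattice_pt \<tau> \<equiv> (\<lambda>(m, n). of_int m + of_int n * \<tau>)"

lemma bij_betw_lattice_pt:
  assumes "Im \<tau> > 0"
  shows "bij_betw (lattice_pt \<tau>) UNIV (lattice \<tau>)"
    and "bij_betw (lattice_pt \<tau>) (UNIV - {(0, 0)}) (lattice \<tau> - {0})"
proof -
  have eq: "m = m' \<and> n = n'" if "of_int m + of_int n * \<tau> = of_int m' + of_int n' * \<tau>" for m n m' n'
    using lattice_coords_eq_iff[OF assms, of "of_int m" "of_int n" "of_int m'" "of_int n'"] that by simp
  have inj: "inj (lattice_pt \<tau>)"
    unfolding inj_on_def using eq by auto
  have ran: "range (lattice_pt \<tau>) = lattice \<tau>"
    by (auto simp: lattice_def)
  show "bij_betw (lattice_pt \<tau>) UNIV (lattice \<tau>)"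
    using inj ran by (simp add: bij_betw_def)
  have "lattice_pt \<tau> ` (UNIV - {(0,0)}) = lattice \<tau> - {0}"
    using inj ran by (simp add: image_set_diff)
  then show "bij_betw (lattice_pt \<tau>) (UNIV - {(0, 0)}) (lattice \<tau> - {0})"
    using inj by (metis bij_betw_def inj_on_subset subset_UNIV)
qed

lemma lattice_pt_bound:
  assumes "Im \<tau> > 0" and "(m, n) \<noteq> (0, 0)"
  shows "1 / norm (lattice_pt \<tau> (m, n)) ^ 3
      \<le> 8 * lattice_const \<tau> ^ 3 * (1 / (\<bar>real_of_int m\<bar> + \<bar>real_of_int n\<bar> + 1) ^ 3)"
proof -
  define s where "s = \<bar>real_of_int m\<bar> + \<bar>real_of_int n\<bar>"
  have "\<bar>m\<bar> + \<bar>n\<bar> \<ge> 1" using assms(2) by auto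
  then have s: "s \<ge> 1" by (auto simp: s_def)
  have *: "s \<le> lattice_const \<tau> * norm (lattice_pt \<tau> (m, n))"
    using lattice_coords_le[OF assms(1), of "of_int m" "of_int n"] by (simp add: s_def)
  then have pos: "norm (lattice_pt \<tau> (m, n)) > 0"
    using s by (cases "norm (lattice_pt \<tau> (m, n)) = 0") auto
  have "s + 1 \<le> 2 * (lattice_const \<tau> * norm (lattice_pt \<tau> (m, n)))" using * s by simp
  then have "(s + 1) ^ 3 \<le> (2 * (lattice_const \<tau> * norm (lattice_pt \<tau> (m, n)))) ^ 3"
    by (intro power_mono) (use s in auto)
  then have "(s + 1) ^ 3 \<le> 8 * lattice_const \<tau> ^ 3 * norm (lattice_pt \<tau> (m, n)) ^ 3"
    by (simp add: power_mult_distrib)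
  then show ?thesis
    using s pos unfolding s_def[symmetric] by (simp add: field_simps)
qed

lemma lattice_summable:
  assumes "Im \<tau> > 0"
  shows "(\<lambda>\<omega>. 1 / norm \<omega> ^ 3) summable_on (lattice \<tau> - {0})"
proof -
  have "(\<lambda>x. 1 / norm (lattice_pt \<tau> x) ^ 3) summable_on (UNIV - {(0, 0)})"
  proof (rule summable_on_comparison_test)
    show "(\<lambda>x. 8 * lattice_const \<tau> ^ 3 * (case x of (m, n) \<Rightarrow>
        1 / (\<bar>real_of_int m\<bar> + \<bar>real_of_int n\<bar> + 1) ^ 3)) summable_on (UNIV - {(0, 0)})"
      by (intro summable_on_cmult_right summable_on_subset[OF summable_on_int_pairs]) auto
    show "1 / norm (lattice_pt \<tau> x) ^ 3 \<le> 8 * lattice_const \<tau> ^ 3 * (case x of (m, n) \<Rightarrow>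
        1 / (\<bar>real_of_int m\<bar> + \<bar>real_of_int n\<bar> + 1) ^ 3)" if "x \<in> UNIV - {(0, 0)}" for x
      using lattice_pt_bound[OF assms, of "fst x" "snd x"] that by (cases x) auto
  qed auto
  then show ?thesis
    using summable_on_reindex_bij_betw[OF bij_betw_lattice_pt(2)[OF assms],
        of "\<lambda>\<omega>. 1 / norm \<omega> ^ 3"] by blast
qed

lemma finite_lattice_ball:
  assumes "Im \<tau> > 0"
  shows "finite {\<omega> \<in> lattice \<tau>. norm \<omega> \<le> R}"
proof -
  define C where "C = lattice_const \<tau> * R"
  have "{\<omega> \<in> lattice \<tau>. norm \<omega> \<le> R} \<subseteq> lattice_pt \<tau> ` ({- \<lceil>C\<rceil>..\<lceil>C\<rceil>} \<times> {- \<lceil>C\<rceil>..\<lceil>C\<rceil>})"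
  proof safe
    fix \<omega> assume \<omega>: "\<omega> \<in> lattice \<tau>" "norm \<omega> \<le> R"
    then obtain m n where mn: "\<omega> = of_int m + of_int n * \<tau>" by (auto simp: lattice_def)
    have "\<bar>real_of_int m\<bar> + \<bar>real_of_int n\<bar> \<le> lattice_const \<tau> * norm \<omega>"
      using lattice_coords_le[OF assms, of "of_int m" "of_int n"] by (simp add: mn)
    also have "\<dots> \<le> C" unfolding C_def
      using \<omega>(2) lattice_const_ge_1[OF assms] by (intro mult_left_mono) auto
    also have "\<dots> \<le> of_int \<lceil>C\<rceil>" by linarith
    finally have "\<bar>m\<bar> + \<bar>n\<bar> \<le> \<lceil>C\<rceil>" by linarith
    then have "(m, n) \<in> {- \<lceil>C\<rceil>..\<lceil>C\<rceil>} \<times> {- \<lceil>C\<rceil>..\<lceil>C\<rceil>}" by auto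
    then show "\<omega> \<in> lattice_pt \<tau> ` ({- \<lceil>C\<rceil>..\<lceil>C\<rceil>} \<times> {- \<lceil>C\<rceil>..\<lceil>C\<rceil>})"
      unfolding mn by (intro image_eqI[of _ _ "(m, n)"]) auto
  qed
  then show ?thesis by (rule finite_subset) auto
qed

lemma lattice_0 [simp, intro]: "0 \<in> lattice \<tau>"
  by (auto simp: lattice_def intro!: exI[of _ 0])

lemma lattice_1 [simp, intro]: "1 \<in> lattice \<tau>"
  unfolding lattice_def by (rule CollectI, rule exI[of _ 1], rule exI[of _ 0]) auto

lemma lattice_tau [simp, intro]: "\<tau> \<in> lattice \<tau>"
  unfolding lattice_def by (rule CollectI, rule exI[of _ 0], rule exI[of _ 1]) auto

lemma lattice_add [intro]: "x \<in> lattice \<tau> \<Longrightarrow> y \<in> lattice \<tau> \<Longrightarrow> x + y \<in> lattice \<tau>"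
proof -
  assume "x \<in> lattice \<tau>" "y \<in> lattice \<tau>"
  then obtain a b c d where "x = of_int a + of_int b * \<tau>" "y = of_int c + of_int d * \<tau>"
    by (auto simp: lattice_def)
  then have "x + y = of_int (a + c) + of_int (b + d) * \<tau>" by (simp add: algebra_simps)
  then show ?thesis unfolding lattice_def by blast
qed

lemma lattice_uminus [intro]: "x \<in> lattice \<tau> \<Longrightarrow> - x \<in> lattice \<tau>"
proof -
  assume "x \<in> lattice \<tau>"
  then obtain a b where "x = of_int a + of_int b * \<tau>" by (auto simp: lattice_def)
  then have "- x = of_int (- a) + of_int (- b) * \<tau>" by (simp add: algebra_simps)
  then show ?thesis unfolding lattice_def by blast
qed

lemma lattice_uminus_iff [simp]: "- x \<in> lattice \<tau> \<longleftrightarrow> x \<in> lattice \<tau>"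
  using lattice_uminus[of x \<tau>] lattice_uminus[of "- x" \<tau>] by auto

lemma lattice_diff [intro]: "x \<in> lattice \<tau> \<Longrightarrow> y \<in> lattice \<tau> \<Longrightarrow> x - y \<in> lattice \<tau>"
  using lattice_add[of x \<tau> "- y"] by auto

lemma lattice_add_iff: "\<omega> \<in> lattice \<tau> \<Longrightarrow> z + \<omega> \<in> lattice \<tau> \<longleftrightarrow> z \<in> lattice \<tau>"
  using lattice_add[of z \<tau> \<omega>] lattice_diff[of "z + \<omega>" \<tau> \<omega>] by auto

lemma countable_lattice: "countable (lattice \<tau>)"
proof -
  have "lattice \<tau> = range (lattice_pt \<tau>)" by (auto simp: lattice_def)
  then show ?thesis by auto
qed

lemma closed_lattice_subset:
  assumes "Im \<tau> > 0" "X \<subseteq> lattice \<tau>"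
  shows "closed X"
proof -
  have "\<not> z islimpt X" for z
  proof
    assume "z islimpt X"
    then have "infinite (X \<inter> ball z 1)" by (simp add: islimpt_eq_infinite_ball)
    moreover have "X \<inter> ball z 1 \<subseteq> {\<omega> \<in> lattice \<tau>. norm \<omega> \<le> norm z + 1}"
    proof safe
      fix x assume x: "x \<in> X" "x \<in> ball z 1"
      show "x \<in> lattice \<tau>" using x assms(2) by auto
      show "norm x \<le> norm z + 1"
        using x(2) norm_triangle_sub[of x z] by (simp add: dist_norm norm_minus_commute)
    qed
    ultimately show False
      using finite_lattice_ball[OF assms(1)] finite_subset by blast
  qed
  then show ?thesis by (simp add: closed_limpt)
qed

lemma open_Compl_lattice_subset:
  assumes "Im \<tau> > 0" "X \<subseteq> lattice \<tau>"
  shows "open (- X)"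
  using closed_lattice_subset[OF assms] by (simp add: open_Compl)

lemma connected_Compl_lattice: "connected (- lattice \<tau>)"
  using connected_open_diff_countable[of "UNIV :: complex set" "lattice \<tau>"] countable_lattice
  by (simp add: Compl_eq_Diff_UNIV connected_UNIV)

lemma lattice_isolated:
  assumes "Im \<tau> > 0"
  obtains r where "r > 0" "ball 0 r \<inter> lattice \<tau> = {0}"
proof -
  have "open (- (lattice \<tau> - {0}))" by (rule open_Compl_lattice_subset[OF assms]) auto
  moreover have "0 \<in> - (lattice \<tau> - {0})" by simp
  ultimately obtain r where r: "r > 0" "ball 0 r \<subseteq> - (lattice \<tau> - {0})"
    using open_contains_ball by blast
  show ?thesis
    by (rule that[of r]) (use r in auto)
qed


section \<open>The Weierstrass functions\<close>

definition zeta_terms :: "complex \<Rightarrow> complex \<Rightarrow> complex" where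
  "zeta_terms \<omega> z = 1 / (z - \<omega>) + 1 / \<omega> + z / \<omega> ^ 2"

text \<open>\<open>zeta_reg\<close>, \<open>wp_reg\<close> and \<open>wp'_reg\<close> are \<zeta>,
  \<open>wp\<close> and \<open>wp'\<close> without their principal part at 0. They are holomorphic
  off the nonzero lattice points, so that they can be handled at 0 itself.\<close>

definition zeta_reg :: "complex \<Rightarrow> complex \<Rightarrow> complex" where
  "zeta_reg \<tau> z = (\<Sum>\<^sub>\<infinity>\<omega>\<in>lattice \<tau> - {0}. zeta_terms \<omega> z)"

definition wp_reg :: "complex \<Rightarrow> complex \<Rightarrow> complex" where
  "wp_reg \<tau> z = (\<Sum>\<^sub>\<infinity>\<omega>\<in>lattice \<tau> - {0}. 1 / (z - \<omega>) ^ 2 - 1 / \<omega> ^ 2)"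

definition wp'_reg :: "complex \<Rightarrow> complex \<Rightarrow> complex" where
  "wp'_reg \<tau> z = (\<Sum>\<^sub>\<infinity>\<omega>\<in>lattice \<tau> - {0}. -2 / (z - \<omega>) ^ 3)"

text \<open>Summed over the full lattice with no correcting summand, so that periodicity is a mere
  reindexing; the periodicity of \<open>wp\<close> is deduced from it.\<close>

definition wp' :: "complex \<Rightarrow> complex \<Rightarrow> complex" where
  "wp' \<tau> z = (\<Sum>\<^sub>\<infinity>\<omega>\<in>lattice \<tau>. -2 / (z - \<omega>) ^ 3)"

definition eis_G :: "nat \<Rightarrow> complex \<Rightarrow> complex" where
  "eis_G k \<tau> = (\<Sum>\<^sub>\<infinity>\<omega>\<in>lattice \<tau> - {0}. 1 / \<omega> ^ k)"

text \<open>The exact remainder, divided by z^5, of the expansion of 1/(z - \<omega>)^2 -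
  1/\<omega>^2 at z = 0 after the term 5 z^4/\<omega>^6, summed over \<omega>.\<close>

definition wp_tail :: "complex \<Rightarrow> complex \<Rightarrow> complex" where
  "wp_tail \<tau> z = (\<Sum>\<^sub>\<infinity>\<omega>\<in>lattice \<tau> - {0}. (6 * \<omega> - 5 * z) / (\<omega> ^ 6 * (z - \<omega>) ^ 2))"

lemma wp_eq: "wp \<tau> z = 1 / z ^ 2 + wp_reg \<tau> z"
  by (simp add: wp_def wp_reg_def)

lemma zeta_terms_eq:
  "z \<noteq> \<omega> \<Longrightarrow> \<omega> \<noteq> 0 \<Longrightarrow> zeta_terms \<omega> z = z ^ 2 / (\<omega> ^ 2 * (z - \<omega>))"
  by (simp add: zeta_terms_def divide_simps power2_eq_square) (simp add: algebra_simps)?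

text \<open>Far from the disc of radius \<open>R\<close>, i.e. for \<open>\<bar>\<omega>\<bar> > 2R\<close>, one has
  \<open>\<bar>z - \<omega>\<bar> \<ge> \<bar>\<omega>\<bar>/2\<close>, which gives all the bounds below.\<close>

context
  fixes R :: real and z \<omega> :: complex
  assumes R: "R \<ge> 1" "norm z < R" "norm \<omega> > 2 * R"
begin

private lemma far: "norm (z - \<omega>) \<ge> norm \<omega> / 2" "norm \<omega> > 0" "\<omega> \<noteq> 0" "z \<noteq> \<omega>"
  using R norm_triangle_ineq3[of z \<omega>] by auto

lemma zeta_terms_bound: "norm (zeta_terms \<omega> z) \<le> 2 * R ^ 2 * (1 / norm \<omega> ^ 3)"
proof -
  have "norm (zeta_terms \<omega> z) = norm z ^ 2 / (norm \<omega> ^ 2 * norm (z - \<omega>))"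
    using far by (subst zeta_terms_eq) (auto simp: norm_divide norm_mult norm_power)
  also have "\<dots> \<le> R ^ 2 / (norm \<omega> ^ 2 * (norm \<omega> / 2))"
    using R far by (intro frac_le power_mono mult_left_mono) auto
  also have "\<dots> = 2 * R ^ 2 * (1 / norm \<omega> ^ 3)"
    using far by (simp add: power2_eq_square power3_eq_cube)
  finally show ?thesis .
qed

lemma wp_terms_bound: "norm (1 / (z - \<omega>) ^ 2 - 1 / \<omega> ^ 2) \<le> 12 * R * (1 / norm \<omega> ^ 3)"
proof -
  have "1 / (z - \<omega>) ^ 2 - 1 / \<omega> ^ 2 = z * (2 * \<omega> - z) / (\<omega> ^ 2 * (z - \<omega>) ^ 2)"
    using far by (simp add: divide_simps) (simp add: power2_eq_square algebra_simps)
  also have "norm \<dots> = norm z * norm (2 * \<omega> - z) / (norm \<omega> ^ 2 * norm (z - \<omega>) ^ 2)"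
    by (simp add: norm_divide norm_mult norm_power)
  also have "\<dots> \<le> R * (3 * norm \<omega>) / (norm \<omega> ^ 2 * (norm \<omega> / 2) ^ 2)"
  proof (intro frac_le mult_mono mult_left_mono power_mono)
    show "norm (2 * \<omega> - z) \<le> 3 * norm \<omega>"
      using norm_triangle_ineq4[of "2 * \<omega>" z] R by (simp add: norm_mult)
  qed (use R far in auto)
  also have "\<dots> = 12 * R * (1 / norm \<omega> ^ 3)"
    using far by (simp add: power2_eq_square power3_eq_cube field_simps)
  finally show ?thesis .
qed

lemma wp_tail_bound:
  "norm ((6 * \<omega> - 5 * z) / (\<omega> ^ 6 * (z - \<omega>) ^ 2)) \<le> 44 * (1 / norm \<omega> ^ 3)"
proof -
  have "norm ((6 * \<omega> - 5 * z) / (\<omega> ^ 6 * (z - \<omega>) ^ 2)) =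
      norm (6 * \<omega> - 5 * z) / (norm \<omega> ^ 6 * norm (z - \<omega>) ^ 2)"
    by (simp add: norm_divide norm_mult norm_power)
  also have "\<dots> \<le> 11 * norm \<omega> / (norm \<omega> ^ 6 * (norm \<omega> / 2) ^ 2)"
  proof (intro frac_le mult_mono mult_left_mono power_mono)
    show "norm (6 * \<omega> - 5 * z) \<le> 11 * norm \<omega>"
      using norm_triangle_ineq4[of "6 * \<omega>" "5 * z"] R by (simp add: norm_mult)
  qed (use R far in auto)
  also have "\<dots> = 44 * (1 / norm \<omega> ^ 3) * (1 / norm \<omega> ^ 4)"
    using far by (simp add: eval_nat_numeral field_simps)
  also have "\<dots> \<le> 44 * (1 / norm \<omega> ^ 3) * 1"
    using R far by (intro mult_left_mono) auto
  finally show ?thesis by simp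
qed

end

lemma summable_on_far:
  assumes "Im \<tau> > 0"
  shows "(\<lambda>\<omega>. c * (1 / norm \<omega> ^ 3)) summable_on ((lattice \<tau> - {0}) - {\<omega> \<in> lattice \<tau>. norm \<omega> \<le> r})"
  by (intro summable_on_cmult_right summable_on_subset[OF lattice_summable[OF assms]]) auto

text \<open>All series are treated at once on the disc of radius \<open>R\<close> = |z| + 1 without
  the nonzero lattice points. The exceptional set consists of the finitely many lattice points of
  modulus at most 2\<open>R\<close>, where the bounds for distant \<omega> do not apply; all
  majorants are multiples of 1/|\<omega>|^3.\<close>

lemma
  assumes \<tau>: "Im \<tau> > 0" and z: "z \<notin> lattice \<tau> - {0}"
  shows zeta_reg_summable: "(\<lambda>\<omega>. zeta_terms \<omega> z) summable_on (lattice \<tau> - {0})"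
    and zeta_reg_deriv: "(zeta_reg \<tau> has_field_derivative - wp_reg \<tau> z) (at z)"
    and wp_reg_summable: "(\<lambda>\<omega>. 1 / (z - \<omega>) ^ 2 - 1 / \<omega> ^ 2) summable_on (lattice \<tau> - {0})"
    and wp_reg_deriv: "(wp_reg \<tau> has_field_derivative wp'_reg \<tau> z) (at z)"
    and wp'_reg_summable: "(\<lambda>\<omega>. -2 / (z - \<omega>) ^ 3) summable_on (lattice \<tau> - {0})"
    and wp_tail_summable: "(\<lambda>\<omega>. (6 * \<omega> - 5 * z) / (\<omega> ^ 6 * (z - \<omega>) ^ 2)) summable_on (lattice \<tau> - {0})"
    and wp_tail_diff: "wp_tail \<tau> field_differentiable (at z)"
proof -
  define R where "R = norm z + 1"
  define D where "D = ball 0 R \<inter> - (lattice \<tau> - {0})"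
  define B where "B = {\<omega> \<in> lattice \<tau>. norm \<omega> \<le> 2 * R}"
  have R: "R \<ge> 1" by (simp add: R_def)
  have D: "open D" unfolding D_def
    by (intro open_Int open_Compl_lattice_subset[OF \<tau>]) auto
  have zD: "z \<in> D" using z unfolding D_def R_def by auto
  have B: "finite B" unfolding B_def by (rule finite_lattice_ball[OF \<tau>])
  have neq: "w \<noteq> \<omega>" "\<omega> \<noteq> 0" if "\<omega> \<in> lattice \<tau> - {0}" "w \<in> D" for \<omega> w
    using that by (auto simp: D_def)
  have far: "norm w < R" "norm \<omega> > 2 * R" if "\<omega> \<in> (lattice \<tau> - {0}) - B" "w \<in> D" for \<omega> w
    using that by (auto simp: D_def B_def)
  have d1: "(zeta_terms \<omega> has_field_derivative - (1 / (w - \<omega>) ^ 2 - 1 / \<omega> ^ 2)) (at w)"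
    if "\<omega> \<in> lattice \<tau> - {0}" "w \<in> D" for \<omega> w
    unfolding zeta_terms_def[abs_def] using neq[OF that]
    by (auto intro!: derivative_eq_intros simp: field_simps power2_eq_square)
  have b1: "norm (zeta_terms \<omega> w) \<le> 2 * R ^ 2 * (1 / norm \<omega> ^ 3)"
    if "\<omega> \<in> (lattice \<tau> - {0}) - B" "w \<in> D" for \<omega> w
    by (rule zeta_terms_bound[OF R far[OF that]])
  note 1 = has_field_derivative_infsum[OF D zD B d1 b1
      summable_on_far[OF \<tau>, of _ "2 * R", folded B_def]]
  show "(\<lambda>\<omega>. zeta_terms \<omega> z) summable_on (lattice \<tau> - {0})" by (rule 1(1))
  show "(zeta_reg \<tau> has_field_derivative - wp_reg \<tau> z) (at z)"
    using 1(3) by (simp add: zeta_reg_def[abs_def] wp_reg_def infsum_uminus del: minus_diff_eq)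
  have d2: "((\<lambda>w. 1 / (w - \<omega>) ^ 2 - 1 / \<omega> ^ 2) has_field_derivative -2 / (w - \<omega>) ^ 3) (at w)"
    if "\<omega> \<in> lattice \<tau> - {0}" "w \<in> D" for \<omega> w
    using neq[OF that]
    by (auto intro!: derivative_eq_intros) (simp add: divide_simps eval_nat_numeral)
  have b2: "norm (1 / (w - \<omega>) ^ 2 - 1 / \<omega> ^ 2) \<le> 12 * R * (1 / norm \<omega> ^ 3)"
    if "\<omega> \<in> (lattice \<tau> - {0}) - B" "w \<in> D" for \<omega> w
    by (rule wp_terms_bound[OF R far[OF that]])
  note 2 = has_field_derivative_infsum[OF D zD B d2 b2
      summable_on_far[OF \<tau>, of _ "2 * R", folded B_def]]
  show "(\<lambda>\<omega>. 1 / (z - \<omega>) ^ 2 - 1 / \<omega> ^ 2) summable_on (lattice \<tau> - {0})" by (rule 2(1))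
  show "(wp_reg \<tau> has_field_derivative wp'_reg \<tau> z) (at z)"
    using 2(3) by (simp add: wp_reg_def[abs_def] wp'_reg_def)
  show "(\<lambda>\<omega>. -2 / (z - \<omega>) ^ 3) summable_on (lattice \<tau> - {0})" by (rule 2(2))
  have d3: "((\<lambda>w. (6 * \<omega> - 5 * w) / (\<omega> ^ 6 * (w - \<omega>) ^ 2)) has_field_derivative
      deriv (\<lambda>w. (6 * \<omega> - 5 * w) / (\<omega> ^ 6 * (w - \<omega>) ^ 2)) w) (at w)"
    if "\<omega> \<in> lattice \<tau> - {0}" "w \<in> D" for \<omega> w
    using neq[OF that] unfolding DERIV_deriv_iff_field_differentiable
    by (intro derivative_intros) auto
  have b3: "norm ((6 * \<omega> - 5 * w) / (\<omega> ^ 6 * (w - \<omega>) ^ 2)) \<le> 44 * (1 / norm \<omega> ^ 3)"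
    if "\<omega> \<in> (lattice \<tau> - {0}) - B" "w \<in> D" for \<omega> w
    by (rule wp_tail_bound[OF R far[OF that]])
  note 3 = has_field_derivative_infsum[OF D zD B d3 b3
      summable_on_far[OF \<tau>, of _ "2 * R", folded B_def]]
  show "(\<lambda>\<omega>. (6 * \<omega> - 5 * z) / (\<omega> ^ 6 * (z - \<omega>) ^ 2)) summable_on (lattice \<tau> - {0})"
    by (rule 3(1))
  show "wp_tail \<tau> field_differentiable (at z)"
    using 3(3) by (auto simp: wp_tail_def[abs_def] field_differentiable_def)
qed

lemma holomorphic_on_derivI:
  "(\<And>z. z \<in> S \<Longrightarrow> (f has_field_derivative f' z) (at z)) \<Longrightarrow> f holomorphic_on S"
  unfolding holomorphic_on_def field_differentiable_def
  using has_field_derivative_at_within by blast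

lemma holomorphic_zeta_reg: "Im \<tau> > 0 \<Longrightarrow> zeta_reg \<tau> holomorphic_on - (lattice \<tau> - {0})"
  by (rule holomorphic_on_derivI[OF zeta_reg_deriv]) auto

lemma holomorphic_wp_tail: "Im \<tau> > 0 \<Longrightarrow> wp_tail \<tau> holomorphic_on - (lattice \<tau> - {0})"
  unfolding holomorphic_on_def
  by (intro ballI field_differentiable_at_within[OF wp_tail_diff]) auto

lemma eis_G_summable:
  assumes "Im \<tau> > 0" "k \<ge> 3"
  shows "(\<lambda>\<omega>. 1 / \<omega> ^ k) summable_on (lattice \<tau> - {0})"
proof -
  obtain r where r: "r > 0" "ball 0 r \<inter> lattice \<tau> = {0}"
    using lattice_isolated[OF assms(1)] .
  show ?thesis
  proof (rule abs_summable_summable, rule summable_on_comparison_test)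
    show "(\<lambda>\<omega>. (1 / r ^ (k - 3)) * (1 / norm \<omega> ^ 3)) summable_on (lattice \<tau> - {0})"
      by (intro summable_on_cmult_right lattice_summable assms)
    fix \<omega> assume \<omega>: "\<omega> \<in> lattice \<tau> - {0}"
    have n: "norm \<omega> \<ge> r"
    proof (rule ccontr)
      assume "\<not> norm \<omega> \<ge> r"
      with \<omega> have "\<omega> \<in> ball 0 r \<inter> lattice \<tau>" by auto
      with r(2) \<omega> show False by auto
    qed
    have "norm (1 / \<omega> ^ k) = 1 / norm \<omega> ^ (k - 3) * (1 / norm \<omega> ^ 3)"
      using power_add[of "norm \<omega>" "k - 3" 3] assms(2) by (simp add: norm_divide norm_power)
    also have "\<dots> \<le> (1 / r ^ (k - 3)) * (1 / norm \<omega> ^ 3)"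
      using n r power_mono[of r "norm \<omega>" "k - 3"] zero_less_power[of r "k - 3"]
      by (intro mult_right_mono frac_le) auto
    finally show "norm (1 / \<omega> ^ k) \<le> (1 / r ^ (k - 3)) * (1 / norm \<omega> ^ 3)" .
  qed auto
qed

lemma bij_betw_uminus_lattice: "bij_betw uminus (lattice \<tau> - {0}) (lattice \<tau> - {0})"
  by (rule bij_betw_byWitness[where f' = uminus]) auto

lemma eis_G_odd:
  assumes "Im \<tau> > 0" "odd k"
  shows "eis_G k \<tau> = 0"
proof -
  have "eis_G k \<tau> = (\<Sum>\<^sub>\<infinity>\<omega>\<in>lattice \<tau> - {0}. 1 / (- \<omega>) ^ k)"
    unfolding eis_G_def
    by (rule infsum_reindex_bij_betw[OF bij_betw_uminus_lattice, symmetric])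
  also have "\<dots> = (\<Sum>\<^sub>\<infinity>\<omega>\<in>lattice \<tau> - {0}. - (1 / \<omega> ^ k))"
    using assms(2) by simp
  also have "\<dots> = - eis_G k \<tau>" by (simp add: eis_G_def infsum_uminus)
  finally show ?thesis by simp
qed

lemma eis_g2_eq: "eis_g2 \<tau> = 60 * eis_G 4 \<tau>"
  and eis_g3_eq: "eis_g3 \<tau> = 140 * eis_G 6 \<tau>"
  by (simp_all add: eis_g2_def eis_g3_def eis_G_def)

text \<open>Each term is expanded to fourth order with exact remainder, and the odd Eisenstein sums
  cancel under \<omega> to -\<omega>. Keeping the remainder as the single holomorphic function
  \<open>wp_tail\<close> avoids power series later.\<close>

lemma wp_reg_expansion:
  assumes \<tau>: "Im \<tau> > 0" and z: "z \<notin> lattice \<tau> - {0}"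
  shows "wp_reg \<tau> z = 3 * eis_G 4 \<tau> * z ^ 2 + 5 * eis_G 6 \<tau> * z ^ 4 + z ^ 5 * wp_tail \<tau> z"
proof -
  have "((\<lambda>\<omega>. 2 * z * (1 / \<omega> ^ 3) + 3 * z ^ 2 * (1 / \<omega> ^ 4) + 4 * z ^ 3 * (1 / \<omega> ^ 5)
      + 5 * z ^ 4 * (1 / \<omega> ^ 6) + z ^ 5 * ((6 * \<omega> - 5 * z) / (\<omega> ^ 6 * (z - \<omega>) ^ 2)))
    has_sum (2 * z * eis_G 3 \<tau> + 3 * z ^ 2 * eis_G 4 \<tau> + 4 * z ^ 3 * eis_G 5 \<tau>
      + 5 * z ^ 4 * eis_G 6 \<tau> + z ^ 5 * wp_tail \<tau> z)) (lattice \<tau> - {0})"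
    unfolding eis_G_def wp_tail_def
    by (intro has_sum_add has_sum_cmult_right has_sum_infsum eis_G_summable wp_tail_summable
        assms) auto
  also have "?this \<longleftrightarrow> ((\<lambda>\<omega>. 1 / (z - \<omega>) ^ 2 - 1 / \<omega> ^ 2) has_sum
    (2 * z * eis_G 3 \<tau> + 3 * z ^ 2 * eis_G 4 \<tau> + 4 * z ^ 3 * eis_G 5 \<tau>
      + 5 * z ^ 4 * eis_G 6 \<tau> + z ^ 5 * wp_tail \<tau> z)) (lattice \<tau> - {0})"
  proof (rule has_sum_cong)
    fix \<omega> assume "\<omega> \<in> lattice \<tau> - {0}"
    then have *: "\<omega> \<noteq> 0" "z - \<omega> \<noteq> 0" using z by auto
    show "2 * z * (1 / \<omega> ^ 3) + 3 * z ^ 2 * (1 / \<omega> ^ 4) + 4 * z ^ 3 * (1 / \<omega> ^ 5)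
      + 5 * z ^ 4 * (1 / \<omega> ^ 6) + z ^ 5 * ((6 * \<omega> - 5 * z) / (\<omega> ^ 6 * (z - \<omega>) ^ 2))
      = 1 / (z - \<omega>) ^ 2 - 1 / \<omega> ^ 2"
    proof (cases "z = 0")
      case False
      with * show ?thesis
        by (simp add: divide_simps) (simp add: power2_eq_square eval_nat_numeral algebra_simps)
    qed simp
  qed
  finally have "wp_reg \<tau> z = 2 * z * eis_G 3 \<tau> + 3 * z ^ 2 * eis_G 4 \<tau> + 4 * z ^ 3 * eis_G 5 \<tau>
      + 5 * z ^ 4 * eis_G 6 \<tau> + z ^ 5 * wp_tail \<tau> z"
    unfolding wp_reg_def by (rule infsumI)
  moreover have "eis_G 3 \<tau> = 0" "eis_G 5 \<tau> = 0" by (rule eis_G_odd[OF \<tau>]; simp)+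
  ultimately show ?thesis by (simp only: mult_zero_right mult_zero_left add_0_left add_0_right mult_ac)
qed

lemma wp'_eq:
  assumes \<tau>: "Im \<tau> > 0" and z: "z \<notin> lattice \<tau>"
  shows "wp' \<tau> z = -2 / z ^ 3 + wp'_reg \<tau> z"
proof -
  have "((\<lambda>\<omega>. -2 / (z - \<omega>) ^ 3) has_sum (wp'_reg \<tau> z + -2 / (z - 0) ^ 3)) (insert 0 (lattice \<tau> - {0}))"
    unfolding wp'_reg_def
    by (subst add.commute, rule has_sum_insert)
      (use wp'_reg_summable[OF \<tau>, of z] z in auto)
  then show ?thesis
    unfolding wp'_def by (simp add: insert_absorb infsumI add.commute)
qed

lemma wp_deriv:
  assumes \<tau>: "Im \<tau> > 0" and z: "z \<notin> lattice \<tau>"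
  shows "(wp \<tau> has_field_derivative wp' \<tau> z) (at z)"
proof -
  have "z \<noteq> 0" using z by auto
  then have "((\<lambda>z. 1 / z ^ 2 + wp_reg \<tau> z) has_field_derivative -2 / z ^ 3 + wp'_reg \<tau> z) (at z)"
    using z by (auto intro!: derivative_eq_intros wp_reg_deriv[OF \<tau>])
      (simp add: divide_simps eval_nat_numeral)
  then show ?thesis using z by (simp add: wp_eq[abs_def] wp'_eq[OF \<tau>])
qed

lemma holomorphic_wp: "Im \<tau> > 0 \<Longrightarrow> wp \<tau> holomorphic_on - lattice \<tau>"
  by (rule holomorphic_on_derivI[OF wp_deriv]) simp_all

lemma deriv_wp: "Im \<tau> > 0 \<Longrightarrow> z \<notin> lattice \<tau> \<Longrightarrow> deriv (wp \<tau>) z = wp' \<tau> z"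
  by (rule DERIV_imp_deriv[OF wp_deriv])

lemma holomorphic_wp': "Im \<tau> > 0 \<Longrightarrow> wp' \<tau> holomorphic_on - lattice \<tau>"
proof -
  assume \<tau>: "Im \<tau> > 0"
  have "deriv (wp \<tau>) holomorphic_on - lattice \<tau>"
    by (rule holomorphic_deriv[OF holomorphic_wp[OF \<tau>] open_Compl_lattice_subset[OF \<tau> order_refl]])
  then show ?thesis
    by (rule holomorphic_transform) (use deriv_wp[OF \<tau>] in auto)
qed

text \<open>Given by the second-order differential equation instead of a lattice sum;
  \<open>wp'_deriv\<close> shows that it is the derivative of \<open>wp'\<close>.\<close>

definition wp'' :: "complex \<Rightarrow> complex \<Rightarrow> complex" where
  "wp'' \<tau> z = 6 * wp \<tau> z ^ 2 - eis_g2 \<tau> / 2"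

lemma wp_uminus: "wp \<tau> (- z) = wp \<tau> z"
proof -
  have "(\<Sum>\<^sub>\<infinity>\<omega>\<in>lattice \<tau> - {0}. 1 / (- z - \<omega>) ^ 2 - 1 / \<omega> ^ 2) =
        (\<Sum>\<^sub>\<infinity>\<omega>\<in>lattice \<tau> - {0}. 1 / (- z - - \<omega>) ^ 2 - 1 / (- \<omega>) ^ 2)"
    by (rule infsum_reindex_bij_betw[OF bij_betw_uminus_lattice, symmetric])
  also have "\<dots> = (\<Sum>\<^sub>\<infinity>\<omega>\<in>lattice \<tau> - {0}. 1 / (z - \<omega>) ^ 2 - 1 / \<omega> ^ 2)"
    by (intro infsum_cong) (simp add: power2_commute)
  finally show ?thesis by (simp add: wp_def)
qed

lemma zeta_reg_uminus: "zeta_reg \<tau> (- z) = - zeta_reg \<tau> z"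
proof -
  have "zeta_reg \<tau> (- z) = (\<Sum>\<^sub>\<infinity>\<omega>\<in>lattice \<tau> - {0}. zeta_terms (- \<omega>) (- z))"
    unfolding zeta_reg_def
    by (rule infsum_reindex_bij_betw[OF bij_betw_uminus_lattice, symmetric])
  also have "\<dots> = (\<Sum>\<^sub>\<infinity>\<omega>\<in>lattice \<tau> - {0}. - zeta_terms \<omega> z)"
  proof (rule infsum_cong)
    fix \<omega>
    have "1 / (- z - - \<omega>) = - (1 / (z - \<omega>))"
      by (metis minus_diff_eq minus_diff_minus minus_divide_right)
    then show "zeta_terms (- \<omega>) (- z) = - zeta_terms \<omega> z"
      by (simp add: zeta_terms_def)
  qed
  also have "\<dots> = - zeta_reg \<tau> z" by (simp add: zeta_reg_def infsum_uminus)
  finally show ?thesis .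
qed

lemma wp'_period:
  assumes "\<omega> \<in> lattice \<tau>"
  shows "wp' \<tau> (z + \<omega>) = wp' \<tau> z"
proof -
  have "bij_betw (\<lambda>x. x + \<omega>) (lattice \<tau>) (lattice \<tau>)"
    by (rule bij_betw_byWitness[where f' = "\<lambda>x. x - \<omega>"]) (use assms in auto)
  from infsum_reindex_bij_betw[OF this, of "\<lambda>\<xi>. -2 / (z + \<omega> - \<xi>) ^ 3"]
  show ?thesis by (simp add: wp'_def)
qed

lemma constant_on_Compl_lattice:
  assumes "Im \<tau> > 0" "\<And>z. z \<notin> lattice \<tau> \<Longrightarrow> (f has_field_derivative 0) (at z)"
  obtains c where "\<And>z. z \<notin> lattice \<tau> \<Longrightarrow> f z = c"
proof -
  have "\<exists>c. \<forall>z\<in>- lattice \<tau>. f z = c"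
    using has_field_derivative_0_imp_constant_on[of "- lattice \<tau>" f]
      connected_Compl_lattice open_Compl_lattice_subset[OF assms(1) order_refl] assms(2)
    by (auto simp: constant_on_def)
  then show ?thesis using that by auto
qed

lemma half_not_lattice:
  assumes "Im \<tau> > 0"
  shows "1 / 2 \<notin> lattice \<tau>" "\<tau> / 2 \<notin> lattice \<tau>"
proof -
  have *: "x \<in> \<int> \<and> y \<in> \<int>" if l: "of_real x + of_real y * \<tau> \<in> lattice \<tau>" for x y
  proof -
    from l obtain m n :: int where "of_real x + of_real y * \<tau> = of_real m + of_real n * \<tau>"
      by (auto simp: lattice_def)
    then have "x = of_int m" "y = of_int n"
      using lattice_coords_eq_iff[OF assms, of x y "of_int m" "of_int n"] by auto
    then show ?thesis by simp
  qed
  have half: "(1/2 :: real) \<notin> \<int>"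
  proof
    assume "(1/2 :: real) \<in> \<int>"
    then obtain k :: int where "1/2 = real_of_int k" by (auto elim: Ints_cases)
    then have "2 * k = 1" by linarith
    then show False by presburger
  qed
  show "1 / 2 \<notin> lattice \<tau>" using *[of "1/2" 0] half by auto
  show "\<tau> / 2 \<notin> lattice \<tau>" using *[of 0 "1/2"] half by auto
qed

lemma DERIV_shift_complex:
  "(f has_field_derivative D) (at (z + w)) \<Longrightarrow> ((\<lambda>z. f (z + w)) has_field_derivative D) (at (z :: complex))"
proof -
  assume "(f has_field_derivative D) (at (z + w))"
  moreover have "((\<lambda>z. z + w) has_field_derivative 1) (at z)"
    by (auto intro!: derivative_eq_intros)
  ultimately show ?thesis using DERIV_chain2[of f D "\<lambda>z. z + w" z 1 UNIV] by simp
qed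

text \<open>Since \<open>wp'\<close> is periodic, the difference is constant on the connected
  complement of the lattice. Evenness of \<open>wp\<close> at -\<omega>/2 makes the constant 0,
  which is why \<omega>/2 must lie off the lattice; this holds for the generators 1 and
  \<tau>.\<close>

lemma wp_period_aux:
  assumes \<tau>: "Im \<tau> > 0" and \<omega>: "\<omega> \<in> lattice \<tau>" "\<omega> / 2 \<notin> lattice \<tau>" and z: "z \<notin> lattice \<tau>"
  shows "wp \<tau> (z + \<omega>) = wp \<tau> z"
proof -
  have "((\<lambda>z. wp \<tau> (z + \<omega>) - wp \<tau> z) has_field_derivative 0) (at z)" if "z \<notin> lattice \<tau>" for z
  proof -
    have "((\<lambda>z. wp \<tau> (z + \<omega>) - wp \<tau> z) has_field_derivative wp' \<tau> (z + \<omega>) - wp' \<tau> z) (at z)"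
      by (intro derivative_intros DERIV_shift_complex wp_deriv \<tau>)
        (use that lattice_add_iff[OF \<omega>(1)] in auto)
    then show ?thesis by (simp add: wp'_period[OF \<omega>(1)])
  qed
  from constant_on_Compl_lattice[OF \<tau> this] obtain c
    where c: "\<And>z. z \<notin> lattice \<tau> \<Longrightarrow> wp \<tau> (z + \<omega>) - wp \<tau> z = c" by blast
  have "c = 0" using c[of "- (\<omega> / 2)"] \<omega>(2) wp_uminus[of \<tau> "\<omega> / 2"] by simp
  then show ?thesis using c[OF z] by simp
qed

lemma lattice_periodic:
  assumes "\<And>z. z \<notin> lattice \<tau> \<Longrightarrow> f (z + 1) = f z" "\<And>z. z \<notin> lattice \<tau> \<Longrightarrow> f (z + \<tau>) = f z"
    and "z \<notin> lattice \<tau>" "\<omega> \<in> lattice \<tau>"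
  shows "f (z + \<omega>) = f z"
proof -
  have nat: "f (z + of_nat k * p) = f z"
    if p: "p \<in> lattice \<tau>" "\<And>z. z \<notin> lattice \<tau> \<Longrightarrow> f (z + p) = f z" and z: "z \<notin> lattice \<tau>" for k p z
  proof (induction k)
    case (Suc k)
    have "z + of_nat k * p \<notin> lattice \<tau>"
    proof (induction k)
      case (Suc k)
      have "z + of_nat (Suc k) * p = (z + of_nat k * p) + p" by (simp add: algebra_simps)
      with Suc lattice_add_iff[OF p(1)] show ?case by metis
    qed (use z in auto)
    from p(2)[OF this] Suc show ?case by (simp add: algebra_simps)
  qed auto
  have int: "f (z + of_int k * p) = f z"
    if p: "p \<in> lattice \<tau>" "\<And>z. z \<notin> lattice \<tau> \<Longrightarrow> f (z + p) = f z" and z: "z \<notin> lattice \<tau>" for k p z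
  proof (cases k)
    case (nonneg n)
    then show ?thesis using nat[OF p z, of n] by simp
  next
    case (neg n)
    have m: "- p \<in> lattice \<tau>" using p(1) by auto
    have "f (z + of_nat (Suc n) * (- p)) = f z"
    proof (rule nat[OF m _ z])
      fix z assume z: "z \<notin> lattice \<tau>"
      then have "z + - p \<notin> lattice \<tau>" using lattice_add_iff[OF m] by blast
      from p(2)[OF this] show "f (z + - p) = f z" by simp
    qed
    moreover have "of_int k * p = of_nat (Suc n) * (- p)" 
      unfolding neg of_int_minus of_int_of_nat_eq by (simp add: algebra_simps)
    ultimately show ?thesis by simp
  qed
  have mult: "of_int k * p \<in> lattice \<tau>" if "p \<in> {1, \<tau>}" for k p
  proof -
    have "of_int k = of_int k + of_int 0 * \<tau>" "of_int k * \<tau> = of_int 0 + of_int k * \<tau>" by simp_all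
    then have "of_int k \<in> lattice \<tau>" "of_int k * \<tau> \<in> lattice \<tau>" unfolding lattice_def by blast+
    with that show ?thesis by auto
  qed
  obtain m n where \<omega>: "\<omega> = of_int m * 1 + of_int n * \<tau>" using assms(4) by (auto simp: lattice_def)
  have "z + of_int m * 1 \<notin> lattice \<tau>"
    using assms(3) lattice_add_iff[OF mult[of 1 m], of z] by auto
  from int[of \<tau>, OF _ assms(2) this, of n] int[of 1, OF _ assms(1,3), of m]
  show ?thesis by (simp add: \<omega> add.assoc)
qed

lemma wp_period:
  assumes "Im \<tau> > 0" "\<omega> \<in> lattice \<tau>" "z \<notin> lattice \<tau>"
  shows "wp \<tau> (z + \<omega>) = wp \<tau> z"
  by (rule lattice_periodic[where \<tau> = \<tau>])
    (use assms half_not_lattice[OF assms(1)] wp_period_aux[OF assms(1)] in auto)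


section \<open>Liouville's theorem for doubly periodic functions\<close>

lemma open_Compl_lattice: "Im \<tau> > 0 \<Longrightarrow> open (- lattice \<tau>)"
  by (rule open_Compl_lattice_subset) auto

lemma eventually_not_lattice:
  assumes "Im \<tau> > 0" shows "eventually (\<lambda>z. z \<notin> lattice \<tau>) (at z)"
proof -
  have "\<not> z islimpt lattice \<tau>"
  proof
    assume "z islimpt lattice \<tau>"
    then have "z \<in> closure (lattice \<tau> - {z})" by (simp add: islimpt_in_closure)
    moreover have "closed (lattice \<tau> - {z})" by (rule closed_lattice_subset[OF assms]) auto
    ultimately show False by simp
  qed
  then show ?thesis by (simp add: islimpt_conv_frequently_at frequently_def)
qed

lemma holomorphic_on_isCont:
  "f holomorphic_on S \<Longrightarrow> open S \<Longrightarrow> z \<in> S \<Longrightarrow> isCont f z"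
  using continuous_on_eq_continuous_at holomorphic_on_imp_continuous_on by blast

lemma lattice_reduce:
  assumes "Im \<tau> > 0"
  obtains x y \<omega> where "z = of_real x + of_real y * \<tau> + \<omega>" "\<omega> \<in> lattice \<tau>"
    "- 1/2 \<le> x" "x < 1/2" "- 1/2 \<le> y" "y < (1/2 :: real)"
proof -
  define y0 where "y0 = Im z / Im \<tau>"
  define x0 where "x0 = Re z - y0 * Re \<tau>"
  define m n where "m = \<lfloor>x0 + 1/2\<rfloor>" and "n = \<lfloor>y0 + 1/2\<rfloor>"
  have "z = of_real x0 + of_real y0 * \<tau>"
    using assms by (simp add: complex_eq_iff x0_def y0_def)
  then have "z = of_real (x0 - of_int m) + of_real (y0 - of_int n) * \<tau> + (of_int m + of_int n * \<tau>)"
    by (simp add: algebra_simps)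
  then show ?thesis
    by (rule that) (auto simp: lattice_def m_def n_def; linarith)+
qed

definition parallelogram :: "complex \<Rightarrow> complex set" where
  "parallelogram \<tau> = (\<lambda>(x, y). of_real x + of_real y * \<tau>) ` ({-1/2..1/2} \<times> {-1/2..1/2})"

lemma compact_parallelogram: "compact (parallelogram \<tau>)"
  unfolding parallelogram_def case_prod_unfold
  by (intro compact_continuous_image continuous_intros compact_Times) auto

lemma parallelogram_reduce:
  assumes "Im \<tau> > 0"
  obtains w \<omega> where "z = w + \<omega>" "w \<in> parallelogram \<tau>" "\<omega> \<in> lattice \<tau>"
proof -
  obtain x y \<omega> where "z = of_real x + of_real y * \<tau> + \<omega>" "\<omega> \<in> lattice \<tau>"
    "- 1/2 \<le> x" "x < 1/2" "- 1/2 \<le> y" "y < (1/2 :: real)"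
    using lattice_reduce[OF assms] .
  then show ?thesis
    by (intro that[of "of_real x + of_real y * \<tau>" \<omega>])
      (auto simp: parallelogram_def intro!: image_eqI[of _ _ "(x, y)"])
qed

lemma periodic_entire_const:
  assumes \<tau>: "Im \<tau> > 0" and f: "f holomorphic_on UNIV"
    and per: "\<And>z \<omega>. \<omega> \<in> lattice \<tau> \<Longrightarrow> f (z + \<omega>) = f z"
  obtains c where "\<And>z. f z = c"
proof -
  have "range f \<subseteq> f ` parallelogram \<tau>"
  proof safe
    fix z
    obtain w \<omega> where "z = w + \<omega>" "w \<in> parallelogram \<tau>" "\<omega> \<in> lattice \<tau>"
      using parallelogram_reduce[OF \<tau>] .
    then show "f z \<in> f ` parallelogram \<tau>" by (auto simp: per)
  qed
  moreover have "bounded (f ` parallelogram \<tau>)"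
    by (intro compact_imp_bounded compact_continuous_image compact_parallelogram
        holomorphic_on_imp_continuous_on holomorphic_on_subset[OF f]) auto
  ultimately have "bounded (range f)" by (rule bounded_subset[rotated])
  with Liouville_theorem[OF f] show ?thesis using that by (auto simp: constant_on_def)
qed

text \<open>Give \<open>f\<close> the value \<open>c\<close> at all lattice points. The limit makes
  the singularity at 0 removable, periodicity carries this to every lattice point, and an entire
  doubly periodic function is constant.\<close>

lemma elliptic_const:
  assumes \<tau>: "Im \<tau> > 0" and f: "f holomorphic_on - lattice \<tau>"
    and per: "\<And>z \<omega>. z \<notin> lattice \<tau> \<Longrightarrow> \<omega> \<in> lattice \<tau> \<Longrightarrow> f (z + \<omega>) = f z"
    and lim: "(f \<longlongrightarrow> c) (at 0)" and z: "z \<notin> lattice \<tau>"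
  shows "f z = c"
proof -
  define g where "g z = (if z \<in> lattice \<tau> then c else f z)" for z
  have gper: "g (z + \<omega>) = g z" if "\<omega> \<in> lattice \<tau>" for z \<omega>
    using that per by (auto simp: g_def lattice_add_iff)
  have g1: "g holomorphic_on - lattice \<tau>"
    by (rule holomorphic_transform[OF f]) (auto simp: g_def)
  obtain r where r: "r > 0" "ball 0 r \<inter> lattice \<tau> = {0}" using lattice_isolated[OF \<tau>] .
  have glim: "(g \<longlongrightarrow> g 0) (at 0)"
  proof -
    have "(g \<longlongrightarrow> c) (at 0)"
      by (rule Lim_transform_eventually[OF lim])
        (use eventually_not_lattice[OF \<tau>, of 0] in \<open>auto simp: g_def elim!: eventually_mono\<close>)
    then show ?thesis by (simp add: g_def)
  qed
  have "isCont g w" if "w \<in> ball 0 r" for w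
  proof (cases "w = 0")
    case True
    show ?thesis unfolding True isCont_def by (rule glim)
  next
    case False
    then have "w \<in> - lattice \<tau>" using r(2) that by blast
    then show ?thesis
      by (rule holomorphic_on_isCont[OF g1 open_Compl_lattice[OF \<tau>]])
  qed
  then have "continuous_on (ball 0 r) g" by (simp add: continuous_at_imp_continuous_on)
  moreover have "g holomorphic_on ball 0 r - {0}"
    by (rule holomorphic_on_subset[OF g1]) (use r in auto)
  ultimately have g0: "g holomorphic_on ball 0 r"
    using no_isolated_singularity[of "ball 0 r" g "{0}"] by auto
  have "g field_differentiable at w" for w
  proof (cases "w \<in> lattice \<tau>")
    case True
    have "g field_differentiable at 0"
      using g0 r(1) holomorphic_on_imp_differentiable_at[of g "ball 0 r" 0] by simp
    then obtain D where "(g has_field_derivative D) (at (w + - w))"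
      by (auto simp: field_differentiable_def)
    then have "((\<lambda>z. g (z + - w)) has_field_derivative D) (at w)"
      by (rule DERIV_shift_complex)
    moreover have "(\<lambda>z. g (z + - w)) = g"
      using gper[of "- w"] True by auto
    ultimately show ?thesis by (auto simp: field_differentiable_def)
  next
    case False
    then show ?thesis
      by (intro holomorphic_on_imp_differentiable_at[OF g1 open_Compl_lattice[OF \<tau>]]) auto
  qed
  then have "g holomorphic_on UNIV" by (simp add: holomorphic_on_def)
  then obtain k where k: "\<And>z. g z = k" using periodic_entire_const[OF \<tau> _ gper] by metis
  have "g z = g 0" using k by simp
  then show ?thesis using z by (simp add: g_def)
qed

section \<open>The differential equations of the Weierstrass function\<close>

context
  fixes \<tau> :: complex
  assumes \<tau>: "Im \<tau> > 0"
begin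

private definition "a = 3 * eis_G 4 \<tau>"
text \<open>With these coefficients \<open>wp\<close> = 1/z^2 + a z^2 + b z^4 + z^5 T near 0, and g2
  = 20 a, g3 = 28 b.\<close>

private definition "b = 5 * eis_G 6 \<tau>"
private abbreviation (input) "T \<equiv> wp_tail \<tau>"
private abbreviation (input) "T1 \<equiv> deriv (wp_tail \<tau>)"
private abbreviation (input) "T2 \<equiv> deriv (deriv (wp_tail \<tau>))"

private lemma open': "open (- (lattice \<tau> - {0}))"
  by (rule open_Compl_lattice_subset[OF \<tau>]) auto

private lemma T: "(T has_field_derivative T1 z) (at z)" "(T1 has_field_derivative T2 z) (at z)"
  "isCont T2 z"
  if "z \<notin> lattice \<tau> - {0}" for z
proof -
  have z: "z \<in> - (lattice \<tau> - {0})" using that by auto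
  have h: "T holomorphic_on - (lattice \<tau> - {0})" by (rule holomorphic_wp_tail[OF \<tau>])
  note h1 = holomorphic_deriv[OF h open']
  note h2 = holomorphic_deriv[OF h1 open']
  show "(T has_field_derivative T1 z) (at z)" "(T1 has_field_derivative T2 z) (at z)"
    using holomorphic_derivI[OF h open' z] holomorphic_derivI[OF h1 open' z] by auto
  show "isCont T2 z"
    by (rule holomorphic_on_isCont[OF h2 open' z])
qed

private lemma wp_loc: "wp \<tau> z = 1 / z ^ 2 + (a * z ^ 2 + b * z ^ 4 + z ^ 5 * T z)"
  if "z \<notin> lattice \<tau> - {0}" for z
  using wp_reg_expansion[OF \<tau> that] by (simp add: wp_eq a_def b_def)

private lemma wp'_loc:
  "wp' \<tau> z = -2 / z ^ 3 + (2 * a * z + 4 * b * z ^ 3 + 5 * z ^ 4 * T z + z ^ 5 * T1 z)"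
  if z: "z \<notin> lattice \<tau>" for z
proof -
  have z': "z \<notin> lattice \<tau> - {0}" "z \<noteq> 0" using z by auto
  have "((\<lambda>z. 1 / z ^ 2 + (a * z ^ 2 + b * z ^ 4 + z ^ 5 * T z)) has_field_derivative
      (-2 / z ^ 3 + (2 * a * z + 4 * b * z ^ 3 + 5 * z ^ 4 * T z + z ^ 5 * T1 z))) (at z)"
    using z' by (auto intro!: derivative_eq_intros T) (simp add: divide_simps eval_nat_numeral)
  then have "(wp \<tau> has_field_derivative
      (-2 / z ^ 3 + (2 * a * z + 4 * b * z ^ 3 + 5 * z ^ 4 * T z + z ^ 5 * T1 z))) (at z)"
    by (rule has_field_derivative_transform_within_open[OF _ open_Compl_lattice[OF \<tau>]])
      (use z in \<open>auto intro: wp_loc[symmetric]\<close>)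
  with wp_deriv[OF \<tau> z] show ?thesis by (rule DERIV_unique)
qed

private lemma wp''_loc: "deriv (wp' \<tau>) z = 6 / z ^ 4 + (2 * a + 12 * b * z ^ 2 + 20 * z ^ 3 * T z +
      10 * z ^ 4 * T1 z + z ^ 5 * T2 z)"
  if z: "z \<notin> lattice \<tau>" for z
proof -
  have z': "z \<notin> lattice \<tau> - {0}" "z \<noteq> 0" using z by auto
  have "((\<lambda>z. -2 / z ^ 3 + (2 * a * z + 4 * b * z ^ 3 + 5 * z ^ 4 * T z + z ^ 5 * T1 z))
     has_field_derivative (6 / z ^ 4 + (2 * a + 12 * b * z ^ 2 + 20 * z ^ 3 * T z +
      10 * z ^ 4 * T1 z + z ^ 5 * T2 z))) (at z)"
    using z' by (auto intro!: derivative_eq_intros T) (simp add: divide_simps eval_nat_numeral algebra_simps)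
  then have "(wp' \<tau> has_field_derivative (6 / z ^ 4 + (2 * a + 12 * b * z ^ 2 + 20 * z ^ 3 * T z +
      10 * z ^ 4 * T1 z + z ^ 5 * T2 z))) (at z)"
    by (rule has_field_derivative_transform_within_open[OF _ open_Compl_lattice[OF \<tau>]])
      (use z in \<open>simp_all add: wp'_loc\<close>)
  then show ?thesis by (rule DERIV_imp_deriv)
qed

text \<open>Both differential equations are settled by writing an elliptic combination near 0 as an
  expression \<open>E\<close> in which the poles have been cancelled by hand; only continuity of
  \<open>E\<close> at 0 and the value \<open>E 0\<close> then matter.\<close>

private lemma lim0:
  assumes "\<And>z. z \<notin> lattice \<tau> \<Longrightarrow> E z = f z" "isCont E 0"
  shows "(f \<longlongrightarrow> E 0) (at 0)"
proof (rule Lim_transform_eventually)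
  show "(E \<longlongrightarrow> E 0) (at 0)" using assms(2) by (simp add: isCont_def)
  show "eventually (\<lambda>z. E z = f z) (at 0)"
    using eventually_not_lattice[OF \<tau>] by eventually_elim (rule assms(1))
qed

private lemma cont0: "isCont T 0" "isCont T1 0" "isCont T2 0"
  using T[of 0] by (auto intro: DERIV_isCont)

text \<open>The difference of the two sides is elliptic, and its Laurent expansion at 0 has neither
  a principal part nor a constant term, so it vanishes by \<open>elliptic_const\<close>.\<close>

lemma wp'_deriv:
  assumes z: "z \<notin> lattice \<tau>"
  shows "(wp' \<tau> has_field_derivative wp'' \<tau> z) (at z)"
proof -
  define f where "f z = deriv (wp' \<tau>) z - wp'' \<tau> z" for z
  have h: "deriv (wp' \<tau>) holomorphic_on - lattice \<tau>"
    by (rule holomorphic_deriv[OF holomorphic_wp'[OF \<tau>] open_Compl_lattice[OF \<tau>]])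
  have hol: "f holomorphic_on - lattice \<tau>"
    unfolding f_def wp''_def by (intro holomorphic_intros h holomorphic_wp \<tau>)
  have dper: "deriv (wp' \<tau>) (z + \<omega>) = deriv (wp' \<tau>) z"
    if "z \<notin> lattice \<tau>" "\<omega> \<in> lattice \<tau>" for z \<omega>
  proof -
    have "z + \<omega> \<in> - lattice \<tau>" using that lattice_add_iff by blast
    then have "(wp' \<tau> has_field_derivative deriv (wp' \<tau>) (z + \<omega>)) (at (z + \<omega>))"
      using holomorphic_derivI[OF holomorphic_wp'[OF \<tau>] open_Compl_lattice[OF \<tau>]] by blast
    then have "((\<lambda>z. wp' \<tau> (z + \<omega>)) has_field_derivative deriv (wp' \<tau>) (z + \<omega>)) (at z)"
      by (rule DERIV_shift_complex)
    then show ?thesis using wp'_period[OF that(2)] by (simp add: DERIV_imp_deriv)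
  qed
  have per: "f (z + \<omega>) = f z" if "z \<notin> lattice \<tau>" "\<omega> \<in> lattice \<tau>" for z \<omega>
    using that by (simp add: f_def wp''_def dper wp_period[OF \<tau>])
  \<comment> \<open>The poles 6/z^4 cancel, the constants 2a - 12a + g2/2 add up to 0 since g2 = 20
    a, and the z^2 terms in b cancel as well.\<close>
  define E where "E z = 8 * z ^ 3 * T z + 10 * z ^ 4 * T1 z + z ^ 5 * T2 z
      - 6 * (a * z ^ 2 + b * z ^ 4 + z ^ 5 * T z) ^ 2" for z
  have "E z = f z" if z: "z \<notin> lattice \<tau>" for z
  proof -
    have z': "z \<notin> lattice \<tau> - {0}" "z \<noteq> 0" using z by auto
    have "eis_g2 \<tau> = 20 * a" by (simp add: eis_g2_eq a_def)
    then show ?thesis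
      unfolding E_def f_def wp''_loc[OF z] wp_loc[OF z'(1)] wp''_def
      using z'(2) by (simp add: field_simps eval_nat_numeral)
  qed
  moreover have "isCont E 0" unfolding E_def by (intro continuous_intros cont0)
  ultimately have "(f \<longlongrightarrow> E 0) (at 0)" by (rule lim0)
  from elliptic_const[OF \<tau> hol per this z] have "deriv (wp' \<tau>) z = wp'' \<tau> z"
    by (simp add: f_def E_def)
  then show ?thesis
    using holomorphic_derivI[OF holomorphic_wp'[OF \<tau>] open_Compl_lattice[OF \<tau>], of z] z by auto
qed

text \<open>Again by \<open>elliptic_const\<close>: all poles cancel in \<open>wp'\<close>^2 - 4
  \<open>wp\<close>^3 + g2 \<open>wp\<close>, and what is left at 0 is -28 b = -g3.\<close>

lemma wp'_square:
  assumes z: "z \<notin> lattice \<tau>"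
  shows "wp' \<tau> z ^ 2 = 4 * wp \<tau> z ^ 3 - eis_g2 \<tau> * wp \<tau> z - eis_g3 \<tau>"
proof -
  define f where "f z = wp' \<tau> z ^ 2 - 4 * wp \<tau> z ^ 3 + eis_g2 \<tau> * wp \<tau> z" for z
  have hol: "f holomorphic_on - lattice \<tau>"
    unfolding f_def by (intro holomorphic_intros holomorphic_wp holomorphic_wp' \<tau>)
  have per: "f (z + \<omega>) = f z" if "z \<notin> lattice \<tau>" "\<omega> \<in> lattice \<tau>" for z \<omega>
    using that by (simp add: f_def wp_period[OF \<tau>] wp'_period)
  define E where "E z = - 28 * b - 32 * z * T z - 4 * z ^ 2 * T1 z
      + (2 * a * z + 4 * b * z ^ 3 + 5 * z ^ 4 * T z + z ^ 5 * T1 z) ^ 2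
      - 12 * z ^ 2 * (a + b * z ^ 2 + z ^ 3 * T z) ^ 2
      - 4 * (a * z ^ 2 + b * z ^ 4 + z ^ 5 * T z) ^ 3
      + 20 * a * (a * z ^ 2 + b * z ^ 4 + z ^ 5 * T z)" for z
  have "E z = f z" if z: "z \<notin> lattice \<tau>" for z
  proof -
    have z': "z \<notin> lattice \<tau> - {0}" "z \<noteq> 0" using z by auto
    have g2: "eis_g2 \<tau> = 20 * a" by (simp add: eis_g2_eq a_def)
    \<comment> \<open>With 1/z as an independent letter, the claim is a polynomial identity modulo i
      z = 1.\<close>
    define i where "i = 1 / z"
    have i: "i * z = 1" using z' by (simp add: i_def)
    have "wp \<tau> z = i ^ 2 + (a * z ^ 2 + b * z ^ 4 + z ^ 5 * T z)"
      using wp_loc[OF z'(1)] by (simp add: i_def power_divide)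
    moreover have "wp' \<tau> z = -2 * i ^ 3 + (2 * a * z + 4 * b * z ^ 3 + 5 * z ^ 4 * T z + z ^ 5 * T1 z)"
      using wp'_loc[OF z] by (simp add: i_def power_divide)
    ultimately show ?thesis
      unfolding E_def f_def g2 using i by algebra
  qed
  moreover have "isCont E 0" unfolding E_def by (intro continuous_intros cont0)
  ultimately have "(f \<longlongrightarrow> E 0) (at 0)" by (rule lim0)
  from elliptic_const[OF \<tau> hol per this z] have "f z = - 28 * b"
    by (simp add: E_def)
  also have "- 28 * b = - eis_g3 \<tau>" by (simp add: eis_g3_eq b_def)
  finally show ?thesis unfolding f_def by algebra
qed

lemma wp''_deriv:
  assumes z: "z \<notin> lattice \<tau>"
  shows "(wp'' \<tau> has_field_derivative 12 * wp \<tau> z * wp' \<tau> z) (at z)"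
  unfolding wp''_def[abs_def] using assms
  by (auto intro!: derivative_eq_intros wp_deriv \<tau>)

text \<open>The zeros of \<open>wp'\<close> are simple: as wp''' = 12 wp wp' is a multiple of
  \<open>wp'\<close>, the Leibniz rule shows inductively that a double zero kills every derivative.
  Then \<open>wp'\<close> vanishes identically, against its pole at 0.\<close>

lemma wp''_nonzero:
  assumes h: "h \<notin> lattice \<tau>" "wp' \<tau> h = 0"
  shows "wp'' \<tau> h \<noteq> 0"
proof
  assume wp''0: "wp'' \<tau> h = 0"
  let ?U = "- lattice \<tau>"
  have U: "open ?U" "connected ?U" "h \<in> ?U"
    using open_Compl_lattice[OF \<tau>] connected_Compl_lattice h by auto
  have d1: "deriv (wp' \<tau>) z = wp'' \<tau> z" if "z \<in> ?U" for z
    by (rule DERIV_imp_deriv[OF wp'_deriv]) (use that in auto)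
  have d2: "deriv (deriv (wp' \<tau>)) z = (12 * wp \<tau> z) * wp' \<tau> z" if "z \<in> ?U" for z
  proof -
    have "(deriv (wp' \<tau>) has_field_derivative (12 * wp \<tau> z * wp' \<tau> z)) (at z)"
      by (rule has_field_derivative_transform_within_open[OF wp''_deriv U(1)])
        (use that d1 in auto)
    then show ?thesis by (rule DERIV_imp_deriv)
  qed
  have zero: "(deriv ^^ n) (wp' \<tau>) h = 0" for n
  proof (induction n rule: less_induct)
    case (less n)
    consider "n = 0" | "n = 1" | k where "n = Suc (Suc k)"
      by (metis One_nat_def old.nat.exhaust)
    then show ?case
    proof cases
      case 3
      have "(deriv ^^ n) (wp' \<tau>) h = (deriv ^^ k) (deriv (deriv (wp' \<tau>))) h"
        by (simp add: 3 funpow_Suc_right del: funpow.simps)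
      also have "\<dots> = (deriv ^^ k) (\<lambda>z. (12 * wp \<tau> z) * wp' \<tau> z) h"
        by (rule higher_deriv_cong_ev)
          (use eventually_nhds_in_open[OF U(1,3)] d2 in \<open>auto elim!: eventually_mono\<close>)
      also have "\<dots> = (\<Sum>i = 0..k. of_nat (k choose i) * (deriv ^^ i) (\<lambda>z. 12 * wp \<tau> z) h *
            (deriv ^^ (k - i)) (wp' \<tau>) h)"
        by (rule higher_deriv_mult[OF _ _ U(1,3)])
          (intro holomorphic_intros holomorphic_wp holomorphic_wp' \<tau>)+
      also have "\<dots> = 0" using less by (intro sum.neutral) (auto simp: 3)
      finally show ?thesis .
    qed (use h wp''0 d1[of h] in auto)
  qed
  have w0: "wp' \<tau> z = 0" if "z \<in> ?U" for z
    by (rule holomorphic_fun_eq_0_on_connected[OF holomorphic_wp'[OF \<tau>] U(1,2) zero U(3) that])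
  \<comment> \<open>This is z^3 \<open>wp'\<close>, extended to 0 with value -2; it detects the
    pole.\<close>
  define E where "E z = -2 + z ^ 3 * (2 * a * z + 4 * b * z ^ 3 + 5 * z ^ 4 * T z + z ^ 5 * T1 z)" for z
  have "E z = 0" if "z \<notin> lattice \<tau>" for z
  proof -
    have "E z = z ^ 3 * wp' \<tau> z"
      unfolding E_def wp'_loc[OF that] using that by (auto simp: field_simps)
    then show ?thesis using w0 that by simp
  qed
  moreover have "isCont E 0" unfolding E_def by (intro continuous_intros cont0)
  ultimately have "((\<lambda>_. 0) \<longlongrightarrow> E 0) (at (0::complex))" by (rule lim0)
  then have "E 0 = 0" by (simp add: tendsto_const_iff)
  then show False by (simp add: E_def)
qed

text \<open>Normal forms at the pole, here and in the next two lemmas: a function holomorphic near 0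
  with known nonzero value there, over a power of z. All growth estimates at the puncture are read
  off from them.\<close>

lemma wp'_near_0:
  obtains A where "A holomorphic_on - (lattice \<tau> - {0})" "A 0 = -2"
    "\<And>z. z \<notin> lattice \<tau> \<Longrightarrow> wp' \<tau> z = A z / z ^ 3"
proof -
  have hT: "T holomorphic_on - (lattice \<tau> - {0})" by (rule holomorphic_wp_tail[OF \<tau>])
  define A where "A z = -2 + z ^ 3 * (2 * a * z + 4 * b * z ^ 3 + 5 * z ^ 4 * T z + z ^ 5 * T1 z)" for z
  show ?thesis
  proof (rule that[of A])
    show "A holomorphic_on - (lattice \<tau> - {0})"
      unfolding A_def by (intro holomorphic_intros hT holomorphic_deriv open')
    show "wp' \<tau> z = A z / z ^ 3" if "z \<notin> lattice \<tau>" for z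
    proof -
      have "z \<noteq> 0" using that by auto
      then show ?thesis
        unfolding A_def wp'_loc[OF that] by (simp add: field_simps)
    qed
  qed (simp add: A_def)
qed

lemma wp_near_0:
  obtains A where "A holomorphic_on - (lattice \<tau> - {0})" "A 0 = 1"
    "\<And>z. z \<notin> lattice \<tau> \<Longrightarrow> wp \<tau> z = A z / z ^ 2"
proof -
  have hT: "T holomorphic_on - (lattice \<tau> - {0})" by (rule holomorphic_wp_tail[OF \<tau>])
  define A where "A z = 1 + z ^ 2 * (a * z ^ 2 + b * z ^ 4 + z ^ 5 * T z)" for z
  show ?thesis
  proof (rule that[of A])
    show "A holomorphic_on - (lattice \<tau> - {0})"
      unfolding A_def by (intro holomorphic_intros hT)
    show "wp \<tau> z = A z / z ^ 2" if "z \<notin> lattice \<tau>" for z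
    proof -
      have z': "z \<notin> lattice \<tau> - {0}" "z \<noteq> 0" using that by auto
      show ?thesis
        unfolding A_def wp_loc[OF z'(1)] using z' by (auto simp: field_simps)
    qed
  qed (simp add: A_def)
qed

lemma wp''_near_0:
  obtains A where "A holomorphic_on - (lattice \<tau> - {0})" "A 0 = 6"
    "\<And>z. z \<notin> lattice \<tau> \<Longrightarrow> wp'' \<tau> z = A z / z ^ 4"
proof -
  obtain A where A: "A holomorphic_on - (lattice \<tau> - {0})" "A 0 = 1"
    "\<And>z. z \<notin> lattice \<tau> \<Longrightarrow> wp \<tau> z = A z / z ^ 2" by (rule wp_near_0) blast
  show ?thesis
  proof (rule that[of "\<lambda>z. 6 * A z ^ 2 - eis_g2 \<tau> / 2 * z ^ 4"])
    show "(\<lambda>z. 6 * A z ^ 2 - eis_g2 \<tau> / 2 * z ^ 4) holomorphic_on - (lattice \<tau> - {0})"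
      by (intro holomorphic_intros A)
    show "wp'' \<tau> z = (6 * A z ^ 2 - eis_g2 \<tau> / 2 * z ^ 4) / z ^ 4" if "z \<notin> lattice \<tau>" for z
    proof -
      have "z \<noteq> 0" using that by auto
      then show ?thesis
        unfolding wp''_def A(3)[OF that] by (simp add: field_simps)
    qed
  qed (simp add: A)
qed

end

lemma filterlim_wp':
  assumes "Im \<tau> > 0" shows "filterlim (wp' \<tau>) at_infinity (at 0)"
proof -
  obtain A where A: "A holomorphic_on - (lattice \<tau> - {0})" "A 0 = -2"
    "\<And>z. z \<notin> lattice \<tau> \<Longrightarrow> wp' \<tau> z = A z / z ^ 3" by (rule wp'_near_0[OF assms]) blast
  have op: "open (- (lattice \<tau> - {0}))" by (rule open_Compl_lattice_subset[OF assms]) auto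
  have "isCont A 0"
    by (rule holomorphic_on_isCont[OF A(1) op]) auto
  then have lim: "(A \<longlongrightarrow> -2) (at 0)" using A(2) by (simp add: isCont_def)
  have "filterlim (\<lambda>z::complex. z ^ 3) (at 0) (at 0)"
    unfolding filterlim_at by (auto intro!: tendsto_eq_intros simp: eventually_at_filter)
  from filterlim_divide_at_infinity[OF lim this] have "filterlim (\<lambda>z. A z / z ^ 3) at_infinity (at 0)"
    by simp
  then show ?thesis
    by (rule filterlim_cong[THEN iffD1, rotated -1])
      (use eventually_not_lattice[OF assms, of 0] A(3) in \<open>auto elim!: eventually_mono\<close>)
qed


section \<open>The zeta function and its quasi-periods\<close>

definition wzeta :: "complex \<Rightarrow> complex \<Rightarrow> complex" where
  "wzeta \<tau> z = 1 / z + zeta_reg \<tau> z"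

lemma wzeta_deriv:
  assumes "Im \<tau> > 0" "z \<notin> lattice \<tau>"
  shows "(wzeta \<tau> has_field_derivative - wp \<tau> z) (at z)"
proof -
  have "z \<noteq> 0" "z \<notin> lattice \<tau> - {0}" using assms by auto
  then show ?thesis
    unfolding wzeta_def[abs_def] wp_eq
    by (auto intro!: derivative_eq_intros zeta_reg_deriv[OF assms(1)])
      (simp add: power2_eq_square divide_simps)
qed

lemma zeta_reg_0: "zeta_reg \<tau> 0 = 0"
  by (simp add: zeta_reg_def zeta_terms_def infsum_0)

lemma is_weierstrass_zeta_wzeta:
  assumes "Im \<tau> > 0" shows "is_weierstrass_zeta \<tau> (wzeta \<tau>)"
proof -
  have "isCont (zeta_reg \<tau>) 0"
    by (rule DERIV_isCont[OF zeta_reg_deriv[OF assms]]) auto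
  then have "(zeta_reg \<tau> \<longlongrightarrow> 0) (at 0)" by (simp add: isCont_def zeta_reg_0)
  then show ?thesis
    using wzeta_deriv[OF assms] by (simp add: is_weierstrass_zeta_def) (simp add: wzeta_def)
qed

text \<open>Two functions with the defining properties differ by a constant on the connected
  complement of the lattice, and the normalisation at 0 makes it 0. Hence the chosen function agrees
  with the explicit series at all points that matter.\<close>

lemma weierstrass_zeta_eq:
  assumes \<tau>: "Im \<tau> > 0" and z: "z \<notin> lattice \<tau>"
  shows "weierstrass_zeta \<tau> z = wzeta \<tau> z"
proof -
  have W: "is_weierstrass_zeta \<tau> (weierstrass_zeta \<tau>)"
    unfolding weierstrass_zeta_def by (rule someI[of "is_weierstrass_zeta \<tau>", OF is_weierstrass_zeta_wzeta[OF \<tau>]])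
  have "((\<lambda>z. weierstrass_zeta \<tau> z - wzeta \<tau> z) has_field_derivative 0) (at z)" if "z \<notin> lattice \<tau>" for z
  proof -
    have "(weierstrass_zeta \<tau> has_field_derivative - wp \<tau> z) (at z)"
      using W that unfolding is_weierstrass_zeta_def by blast
    from DERIV_diff[OF this wzeta_deriv[OF \<tau> that]] show ?thesis by simp
  qed
  from constant_on_Compl_lattice[OF \<tau> this] obtain c
    where c: "\<And>z. z \<notin> lattice \<tau> \<Longrightarrow> weierstrass_zeta \<tau> z - wzeta \<tau> z = c" by blast
  have "((\<lambda>z. (weierstrass_zeta \<tau> z - 1 / z) - (wzeta \<tau> z - 1 / z)) \<longlongrightarrow> 0 - 0) (at 0)"
    using W is_weierstrass_zeta_wzeta[OF \<tau>] unfolding is_weierstrass_zeta_def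
    by (intro tendsto_diff) blast+
  moreover have "eventually (\<lambda>z. (weierstrass_zeta \<tau> z - 1 / z) - (wzeta \<tau> z - 1 / z) = c) (at 0)"
    using eventually_not_lattice[OF \<tau>, of 0] by eventually_elim (use c in auto)
  ultimately have "((\<lambda>z. c) \<longlongrightarrow> 0 - 0) (at (0 :: complex))"
    by (rule Lim_transform_eventually)
  then have "c = 0" by (simp add: tendsto_const_iff)
  with c[OF z] show ?thesis by simp
qed

lemma wzeta_uminus: "wzeta \<tau> (- z) = - wzeta \<tau> z"
  by (simp add: wzeta_def zeta_reg_uminus)

text \<open>The increment is constant since its derivative vanishes by periodicity of
  \<open>wp\<close>; evaluating it at -\<omega>/2 and using that \<zeta> is odd gives its
  value.\<close>

lemma wzeta_quasi_period:
  assumes \<tau>: "Im \<tau> > 0" and \<omega>: "\<omega> \<in> lattice \<tau>" "\<omega> / 2 \<notin> lattice \<tau>" and z: "z \<notin> lattice \<tau>"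
  shows "wzeta \<tau> (z + \<omega>) = wzeta \<tau> z + 2 * wzeta \<tau> (\<omega> / 2)"
proof -
  have "((\<lambda>z. wzeta \<tau> (z + \<omega>) - wzeta \<tau> z) has_field_derivative 0) (at z)"
    if z: "z \<notin> lattice \<tau>" for z
  proof -
    have "z + \<omega> \<notin> lattice \<tau>" using z lattice_add_iff[OF \<omega>(1)] by blast
    from DERIV_diff[OF DERIV_shift_complex[OF wzeta_deriv[OF \<tau> this]] wzeta_deriv[OF \<tau> z]]
    show ?thesis by (simp add: wp_period[OF \<tau> \<omega>(1) z])
  qed
  from constant_on_Compl_lattice[OF \<tau> this] obtain c
    where c: "\<And>z. z \<notin> lattice \<tau> \<Longrightarrow> wzeta \<tau> (z + \<omega>) - wzeta \<tau> z = c" by blast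
  have "c = 2 * wzeta \<tau> (\<omega> / 2)"
    using c[of "- (\<omega> / 2)"] \<omega>(2) wzeta_uminus[of \<tau> "\<omega> / 2"] by simp
  with c[OF z] show ?thesis by (simp add: algebra_simps)
qed

lemma eta_eq:
  assumes \<tau>: "Im \<tau> > 0"
  shows "eta1 \<tau> = 2 * wzeta \<tau> (1 / 2)" and "eta2 \<tau> = 2 * wzeta \<tau> (\<tau> / 2)"
proof -
  have eq: "weierstrass_zeta \<tau> (z + \<omega>) - weierstrass_zeta \<tau> z = 2 * wzeta \<tau> (\<omega> / 2)"
    if \<omega>: "\<omega> \<in> lattice \<tau>" "\<omega> / 2 \<notin> lattice \<tau>" and z: "z \<notin> lattice \<tau>" for z \<omega>
  proof -
    have "z + \<omega> \<notin> lattice \<tau>" using z lattice_add_iff[OF \<omega>(1)] by blast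
    then show ?thesis
      using weierstrass_zeta_eq[OF \<tau>] wzeta_quasi_period[OF \<tau> \<omega> z] z by simp
  qed
  have THE: "(THE c. \<forall>z. z \<notin> lattice \<tau> \<longrightarrow> weierstrass_zeta \<tau> (z + \<omega>) - weierstrass_zeta \<tau> z = c)
      = 2 * wzeta \<tau> (\<omega> / 2)" if \<omega>: "\<omega> \<in> lattice \<tau>" "\<omega> / 2 \<notin> lattice \<tau>" for \<omega>
    by (rule the_equality) (use eq[OF \<omega>] half_not_lattice(1)[OF \<tau>] in auto)
  show "eta1 \<tau> = 2 * wzeta \<tau> (1 / 2)" "eta2 \<tau> = 2 * wzeta \<tau> (\<tau> / 2)"
    unfolding eta1_def eta2_def by (rule THE; use half_not_lattice[OF \<tau>] in auto)+
qed

lemma wzeta_period: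
  assumes \<tau>: "Im \<tau> > 0" and z: "z \<notin> lattice \<tau>"
  shows "wzeta \<tau> (z + 1) = wzeta \<tau> z + eta1 \<tau>" "wzeta \<tau> (z + \<tau>) = wzeta \<tau> z + eta2 \<tau>"
  using wzeta_quasi_period[OF \<tau> _ _ z] half_not_lattice[OF \<tau>] by (auto simp: eta_eq[OF \<tau>])

lemma wp_continuous: "Im \<tau> > 0 \<Longrightarrow> continuous_on (- lattice \<tau>) (wp \<tau>)"
  by (rule holomorphic_on_imp_continuous_on[OF holomorphic_wp])

lemma wzeta_continuous: "Im \<tau> > 0 \<Longrightarrow> continuous_on (- lattice \<tau>) (wzeta \<tau>)"
  by (intro holomorphic_on_imp_continuous_on holomorphic_on_derivI[OF wzeta_deriv]) auto

lemma contour_integral_linepath_shift: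
  "contour_integral (linepath (a + w) (b + w)) f = contour_integral (linepath a b) (\<lambda>z. f (z + w))"
proof -
  have "linepath (a + w) (b + w) x = linepath a b x + w" for x
    by (simp add: linepath_def algebra_simps)
  then show ?thesis by (simp add: contour_integral_integral)
qed

text \<open>Integrate \<open>\<zeta>\<close> over the boundary of a period parallelogram around \<open>0\<close>, cut into two triangles
  of which the first contains \<open>0\<close> in its interior and the second contains no pole.\<close>

lemma legendre_relation:
  assumes \<tau>: "Im \<tau> > 0"
  shows "eta1 \<tau> * \<tau> - eta2 \<tau> = 2 * pi * \<i>"
proof -
  \<comment> \<open>The parallelogram is shifted so that 0 is the centroid of the triangle a, b, c.
    In lattice coordinates it is [-2/3, 1/3] x [-1/3, 2/3], so no edge, including the diagonal,
    meets the lattice.\<close>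
  define a b c d where "a = - (2/3) - \<tau> / 3" and "b = 1/3 - \<tau> / 3" and "c = 1/3 + 2 * \<tau> / 3"
    and "d = - (2/3) + 2 * \<tau> / 3"
  note defs = a_def b_def c_def d_def
  have T1: "u *\<^sub>R a + v *\<^sub>R b + w *\<^sub>R c = of_real (1/3 - u) + of_real (w - 1/3) * \<tau>"
    if "u + v + w = 1" for u v w
  proof -
    have v: "v = 1 - u - w" using that by simp
    show ?thesis unfolding v defs by (simp add: scaleR_conv_of_real field_simps)
  qed
  have T2: "u *\<^sub>R a + v *\<^sub>R c + w *\<^sub>R d = of_real (v - 2/3) + of_real (2/3 - u) * \<tau>"
    if "u + v + w = 1" for u v w
  proof -
    have w: "w = 1 - u - v" using that by simp
    show ?thesis unfolding w defs by (simp add: scaleR_conv_of_real field_simps)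
  qed
  have small: "x = 0 \<and> y = 0" if "of_real x + of_real y * \<tau> \<in> lattice \<tau>"
    "\<bar>x\<bar> < 1" "\<bar>y\<bar> < 1" for x y
  proof -
    from that obtain m n :: int where "of_real x + of_real y * \<tau> = of_real m + of_real n * \<tau>"
      by (auto simp: lattice_def)
    then have "x = m" "y = n" using lattice_coords_eq_iff[OF \<tau>] by blast+
    with that show ?thesis by auto
  qed
  have L1: "u = 1/3 \<and> v = 1/3 \<and> w = 1/3" if "u \<ge> 0" "v \<ge> 0" "w \<ge> 0" "u + v + w = 1"
    "u *\<^sub>R a + v *\<^sub>R b + w *\<^sub>R c \<in> lattice \<tau>" for u v w
  proof -
    have "1/3 - u = 0 \<and> w - 1/3 = 0"
      by (rule small) (use that T1[OF that(4)] in auto)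
    then show ?thesis using that(4) by auto
  qed
  have H2: "convex hull {a, c, d} \<subseteq> - lattice \<tau>"
  proof
    fix z assume "z \<in> convex hull {a, c, d}"
    then obtain u v w where uvw: "u \<ge> 0" "v \<ge> 0" "w \<ge> 0" "u + v + w = 1"
      "z = u *\<^sub>R a + v *\<^sub>R c + w *\<^sub>R d" by (auto simp: convex_hull_3)
    show "z \<in> - lattice \<tau>"
    proof
      assume z: "z \<in> lattice \<tau>"
      have "v - 2/3 = 0 \<and> 2/3 - u = 0"
        by (rule small) (use uvw z T2[OF uvw(4)] in auto)
      then show False using uvw by auto
    qed
  qed
  have H1: "convex hull {a, b, c} \<subseteq> - (lattice \<tau> - {0})"
  proof
    fix z assume "z \<in> convex hull {a, b, c}"
    then obtain u v w where uvw: "u \<ge> 0" "v \<ge> 0" "w \<ge> 0" "u + v + w = 1"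
      "z = u *\<^sub>R a + v *\<^sub>R b + w *\<^sub>R c" by (auto simp: convex_hull_3)
    show "z \<in> - (lattice \<tau> - {0})"
    proof (cases "z \<in> lattice \<tau>")
      case True
      then have "1/3 - u = 0" "w - 1/3 = 0" using L1[OF uvw(1-4)] uvw(5) by auto
      then have "z = 0" unfolding uvw(5) T1[OF uvw(4)] by (simp only:) simp
      then show ?thesis by simp
    qed simp
  qed
  have int0: "0 \<in> interior (convex hull {a, b, c})"
  proof (rule interiorI)
    \<comment> \<open>The open triangle in lattice coordinates x, y: the conditions say that the
      barycentric coordinates 1/3 - x, 1/3 + x - y and y + 1/3 are positive.\<close>
    define U where "U = {z. Re z - Im z / Im \<tau> * Re \<tau> < 1/3} \<inter> {z. - (1/3) < Im z / Im \<tau>}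
      \<inter> {z. Im z / Im \<tau> < Re z - Im z / Im \<tau> * Re \<tau> + 1/3}"
    show "open U" unfolding U_def
      by (intro open_Int open_Collect_less continuous_intros) (use \<tau> in auto)
    show "0 \<in> U" by (simp add: U_def)
    show "U \<subseteq> convex hull {a, b, c}"
    proof
      fix z assume z: "z \<in> U"
      define y x where "y = Im z / Im \<tau>" and "x = Re z - Im z / Im \<tau> * Re \<tau>"
      have "z = of_real x + of_real y * \<tau>" using \<tau> by (simp add: x_def y_def complex_eq_iff)
      also have "\<dots> = (1/3 - x) *\<^sub>R a + (1/3 + x - y) *\<^sub>R b + (y + 1/3) *\<^sub>R c"
        by (subst T1) auto
      finally have zeq: "z = \<dots>" .
      have "x < 1/3" "- (1/3) < y" "y < x + 1/3" using z by (auto simp: U_def x_def y_def)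
      then show "z \<in> convex hull {a, b, c}"
        unfolding convex_hull_3 mem_Collect_eq
        by (intro exI[of _ "1/3 - x"] exI[of _ "1/3 + x - y"] exI[of _ "y + 1/3"] conjI zeq) auto
    qed
  qed
  have segs: "closed_segment a b \<subseteq> - lattice \<tau>" "closed_segment b c \<subseteq> - lattice \<tau>"
    "closed_segment c a \<subseteq> - lattice \<tau>" "closed_segment c d \<subseteq> - lattice \<tau>" "closed_segment d a \<subseteq> - lattice \<tau>"
  proof -
    show "closed_segment a b \<subseteq> - lattice \<tau>"
      unfolding closed_segment_def using L1[of "1 - u" u 0 for u] by auto
    show "closed_segment b c \<subseteq> - lattice \<tau>"
      unfolding closed_segment_def using L1[of 0 "1 - u" u for u] by auto
    show "closed_segment c a \<subseteq> - lattice \<tau>"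
      unfolding closed_segment_def using L1[of u 0 "1 - u" for u] by (auto simp: add.commute)
    show "closed_segment c d \<subseteq> - lattice \<tau>" "closed_segment d a \<subseteq> - lattice \<tau>"
      using H2 by (meson closed_segment_subset_convex_hull hull_inc insertI1 insertI2 order_trans)+
  qed
  define f where "f = wzeta \<tau>"
  define I where "I = (\<lambda>p q. contour_integral (linepath p q) f)"
  have ci: "f contour_integrable_on linepath p q" if "closed_segment p q \<subseteq> - lattice \<tau>" for p q
    unfolding f_def
    by (intro contour_integrable_continuous_linepath continuous_on_subset[OF wzeta_continuous[OF \<tau>] that])
  have hI: "(f has_contour_integral I p q) (linepath p q)" if "closed_segment p q \<subseteq> - lattice \<tau>" for p q
    unfolding I_def by (rule has_contour_integral_integral[OF ci[OF that]])
  have join: "(f has_contour_integral I p q + (I q r + I r p)) (linepath p q +++ linepath q r +++ linepath r p)"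
    if "closed_segment p q \<subseteq> - lattice \<tau>" "closed_segment q r \<subseteq> - lattice \<tau>"
      "closed_segment r p \<subseteq> - lattice \<tau>" for p q r
    by (intro has_contour_integral_join hI that) auto
  have ca: "closed_segment a c \<subseteq> - lattice \<tau>" using segs(3) by (simp add: closed_segment_commute)
  let ?t = "linepath a b +++ linepath b c +++ linepath c a"
  have 1: "I a b + (I b c + I c a) = 2 * pi * \<i>"
  proof -
    have "0 \<notin> path_image ?t" using segs by (auto simp: path_image_join)
    then have "((\<lambda>w. 1 / (w - 0)) has_contour_integral 2 * pi * \<i> * winding_number ?t 0) ?t"
      by (intro has_contour_integral_winding_number) auto
    moreover have "winding_number ?t 0 = 1"
      using winding_number_triangle[OF int0] \<tau> by (simp add: defs)
    moreover have "(zeta_reg \<tau> has_contour_integral 0) ?t"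
      by (rule Cauchy_theorem_triangle, rule holomorphic_on_subset[OF holomorphic_zeta_reg[OF \<tau>] H1])
    ultimately have "((\<lambda>w. 1 / (w - 0) + zeta_reg \<tau> w) has_contour_integral 2 * pi * \<i> * 1 + 0) ?t"
      by (metis has_contour_integral_add)
    then have "(f has_contour_integral 2 * pi * \<i>) ?t"
      by (simp add: f_def wzeta_def[abs_def])
    then show ?thesis
      using has_contour_integral_unique join[OF segs(1-3)] by blast
  qed
  have 2: "I a c + (I c d + I d a) = 0"
  proof -
    have "wzeta \<tau> holomorphic_on - lattice \<tau>"
      by (rule holomorphic_on_derivI[OF wzeta_deriv[OF \<tau>]]) auto
    then have "(f has_contour_integral 0) (linepath a c +++ linepath c d +++ linepath d a)"
      unfolding f_def by (intro Cauchy_theorem_triangle holomorphic_on_subset[OF _ H2])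
    then show ?thesis
      using has_contour_integral_unique join[OF ca segs(4,5)] by blast
  qed
  have rev: "I q p = - I p q" if "closed_segment p q \<subseteq> - lattice \<tau>" for p q
    unfolding I_def f_def
    by (rule contour_integral_reverse_linepath, rule continuous_on_subset[OF wzeta_continuous[OF \<tau>]])
      (use that closed_segment_commute in auto)
  have shift: "I (p + w) (q + w) = I p q + e * (q - p)"
    if s: "closed_segment p q \<subseteq> - lattice \<tau>" and "\<And>z. z \<notin> lattice \<tau> \<Longrightarrow> f (z + w) = f z + e" for p q w e
  proof -
    have "I (p + w) (q + w) = contour_integral (linepath p q) (\<lambda>z. f z + e)"
      unfolding I_def contour_integral_linepath_shift
      by (rule contour_integral_eq) (use that in auto)
    also have "\<dots> = I p q + e * (q - p)"
      unfolding I_def 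
      by (subst contour_integral_add[OF ci[OF s]]) (auto intro: contour_integrable_continuous_linepath)
    finally show ?thesis .
  qed
  \<comment> \<open>Opposite sides differ by a period, so their integrals differ by the quasi-period
    times the side vector: by eta2 times 1 for the shift by \<tau>, and by eta1 times \<tau> for the
    shift by 1.\<close>
  have "I d c = I a b + eta2 \<tau>"
    using shift[OF segs(1), of \<tau> "eta2 \<tau>"] wzeta_period(2)[OF \<tau>] by (simp add: defs f_def field_simps)
  moreover have "I b c = I a d + eta1 \<tau> * \<tau>"
    using shift[of a d 1 "eta1 \<tau>"] segs(5) wzeta_period(1)[OF \<tau>]
    by (simp add: defs f_def field_simps closed_segment_commute)
  moreover have "I a d = - I d a" "I d c = - I c d" "I a c = - I c a" using rev segs by blast+
  ultimately show ?thesis using 1 2 by algebra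
qed

section \<open>Continuous dependence of the lattice sums on \<tau>\<close>

lemma lattice_const_le_5:
  assumes "Im \<tau> \<ge> 1/2" "norm \<tau> \<le> 1"
  shows "lattice_const \<tau> \<le> 5"
proof -
  have "(1 + norm \<tau>) / Im \<tau> \<le> 2 / (1/2)"
    by (intro frac_le) (use assms in auto)
  then show ?thesis by (simp add: lattice_const_def)
qed

text \<open>Any set would do that contains the arc from pi/3 to pi/2 of the unit circle and on which
  \<open>lattice_const\<close> is bounded; here the bound is 1 + (1 + 1)/(1/2) = 5.\<close>

definition modular_region :: "complex set" where
  "modular_region = {\<tau>. Im \<tau> \<ge> 1/2 \<and> norm \<tau> \<le> 1}"

lemma modular_region_coords_le:
  assumes "\<tau> \<in> modular_region"
  shows "(\<bar>x\<bar> + \<bar>y\<bar>) / 5 \<le> norm (of_real x + of_real y * \<tau>)"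
proof -
  have "\<bar>x\<bar> + \<bar>y\<bar> \<le> lattice_const \<tau> * norm (of_real x + of_real y * \<tau>)"
    using assms by (intro lattice_coords_le) (auto simp: modular_region_def)
  also have "\<dots> \<le> 5 * norm (of_real x + of_real y * \<tau>)"
    using assms lattice_const_le_5 by (intro mult_right_mono) (auto simp: modular_region_def)
  finally show ?thesis by simp
qed

text \<open>The index set varies with \<tau>, so the sum is first reindexed by integer pairs. Then a
  majorant independent of \<tau> gives a uniform limit of continuous finite sums; the factor 8 comes
  from s \<ge> (s + 1)/2 for s \<ge> 1, which matches \<open>summable_on_int_pairs\<close>.\<close>

lemma continuous_on_lattice_sum:
  fixes f :: "complex \<Rightarrow> complex \<Rightarrow> complex"
  assumes cont: "\<And>m n. (m, n) \<noteq> (0, 0) \<Longrightarrow>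
      continuous_on modular_region (\<lambda>\<tau>. f (of_int m + of_int n * \<tau>) \<tau>)"
    and bound: "\<And>m n \<tau>. \<tau> \<in> modular_region \<Longrightarrow> \<bar>real_of_int m\<bar> + \<bar>real_of_int n\<bar> \<ge> 1 \<Longrightarrow>
      norm (f (of_int m + of_int n * \<tau>) \<tau>) \<le> K / (\<bar>real_of_int m\<bar> + \<bar>real_of_int n\<bar>) ^ 3"
    and K: "K \<ge> 0"
  shows "continuous_on modular_region (\<lambda>\<tau>. \<Sum>\<^sub>\<infinity>\<omega>\<in>lattice \<tau> - {0}. f \<omega> \<tau>)"
proof -
  let ?X = "UNIV - {(0 :: int, 0 :: int)}"
  have lim: "uniform_limit modular_region (\<lambda>Z \<tau>. \<Sum>x\<in>Z. f (lattice_pt \<tau> x) \<tau>)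
     (\<lambda>\<tau>. \<Sum>\<^sub>\<infinity>x\<in>?X. f (lattice_pt \<tau> x) \<tau>) (finite_subsets_at_top ?X)"
  proof (rule Weierstrass_m_test_general)
    show "(\<lambda>x. (8 * K) * (case x of (m, n) \<Rightarrow>
        1 / (\<bar>real_of_int m\<bar> + \<bar>real_of_int n\<bar> + 1) ^ 3)) summable_on ?X"
      by (intro summable_on_cmult_right summable_on_subset[OF summable_on_int_pairs]) auto
    fix x \<tau> assume x: "x \<in> ?X" and \<tau>: "\<tau> \<in> modular_region"
    obtain m n where mn: "x = (m, n)" by force
    define s where "s = \<bar>real_of_int m\<bar> + \<bar>real_of_int n\<bar>"
    have "\<bar>m\<bar> + \<bar>n\<bar> \<ge> 1" using x by (auto simp: mn)
    then have s: "s \<ge> 1" by (auto simp: s_def)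
    have "norm (f (lattice_pt \<tau> x) \<tau>) \<le> K / s ^ 3"
      using bound[OF \<tau>, of m n] s by (simp add: mn s_def)
    also have "\<dots> \<le> K / ((s + 1) / 2) ^ 3"
      using s K by (intro divide_left_mono power_mono mult_pos_pos) auto
    also have "\<dots> = 8 * K * (1 / (s + 1) ^ 3)" using s by (simp add: field_simps)
    finally show "norm (f (lattice_pt \<tau> x) \<tau>) \<le> (8 * K) * (case x of (m, n) \<Rightarrow>
        1 / (\<bar>real_of_int m\<bar> + \<bar>real_of_int n\<bar> + 1) ^ 3)" by (simp add: mn s_def)
  qed
  have "continuous_on modular_region (\<lambda>\<tau>. \<Sum>\<^sub>\<infinity>x\<in>?X. f (lattice_pt \<tau> x) \<tau>)"
  proof (rule uniform_limit_theorem[OF _ lim finite_subsets_at_top_neq_bot])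
    show "eventually (\<lambda>Z. continuous_on modular_region (\<lambda>\<tau>. \<Sum>x\<in>Z. f (lattice_pt \<tau> x) \<tau>))
        (finite_subsets_at_top ?X)"
    proof (rule eventually_finite_subsets_at_top_weakI, rule continuous_on_sum)
      fix Z x assume "Z \<subseteq> ?X" "x \<in> Z"
      then have "x \<in> ?X" by blast
      then show "continuous_on modular_region (\<lambda>\<tau>. f (lattice_pt \<tau> x) \<tau>)"
        using cont[of "fst x" "snd x"] by (cases x) auto
    qed
  qed
  also have "?this \<longleftrightarrow> ?thesis"
  proof (rule continuous_on_cong[OF refl])
    fix \<tau> assume "\<tau> \<in> modular_region"
    then have "Im \<tau> > 0" by (auto simp: modular_region_def)
    from infsum_reindex_bij_betw[OF bij_betw_lattice_pt(2)[OF this], of "\<lambda>\<omega>. f \<omega> \<tau>"]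
    show "(\<Sum>\<^sub>\<infinity>x\<in>?X. f (lattice_pt \<tau> x) \<tau>) = (\<Sum>\<^sub>\<infinity>\<omega>\<in>lattice \<tau> - {0}. f \<omega> \<tau>)"
      by simp
  qed
  finally show ?thesis .
qed

lemma modular_region_nonzero:
  assumes "\<tau> \<in> modular_region" "(x, y) \<noteq> (0, 0)"
  shows "of_real x + of_real y * \<tau> \<noteq> 0"
  using modular_region_coords_le[OF assms(1), of x y] assms(2) by (auto simp: abs_le_zero_iff)

lemma continuous_on_eis_G:
  assumes "k \<ge> 3"
  shows "continuous_on modular_region (eis_G k)"
  unfolding eis_G_def[abs_def]
proof (rule continuous_on_lattice_sum[where K = "5 ^ k"])
  fix m n :: int assume mn: "(m, n) \<noteq> (0, 0)"
  have "of_int m + of_int n * \<tau> \<noteq> 0" if "\<tau> \<in> modular_region" for \<tau>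
    using modular_region_nonzero[OF that, of "of_int m" "of_int n"] mn by simp
  then show "continuous_on modular_region (\<lambda>\<tau>. 1 / (of_int m + of_int n * \<tau>) ^ k)"
    by (intro continuous_intros) auto
next
  fix m n :: int and \<tau> assume \<tau>: "\<tau> \<in> modular_region"
  define s where "s = \<bar>real_of_int m\<bar> + \<bar>real_of_int n\<bar>"
  assume "\<bar>real_of_int m\<bar> + \<bar>real_of_int n\<bar> \<ge> 1"
  then have s: "s \<ge> 1" by (simp add: s_def)
  have le: "s / 5 \<le> norm (of_int m + of_int n * \<tau>)"
    using modular_region_coords_le[OF \<tau>, of "of_int m" "of_int n"] by (simp add: s_def)
  have "norm (1 / (of_int m + of_int n * \<tau>) ^ k) = 1 / norm (of_int m + of_int n * \<tau>) ^ k"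
    by (simp add: norm_divide norm_power)
  also have "\<dots> \<le> 1 / (s / 5) ^ k" using le s by (intro frac_le power_mono) auto
  also have "\<dots> = 5 ^ k / s ^ k" by (simp add: power_divide)
  also have "\<dots> \<le> 5 ^ k / s ^ 3" using s assms by (intro frac_le power_increasing) auto
  finally show "norm (1 / (of_int m + of_int n * \<tau>) ^ k) \<le> 5 ^ k / (\<bar>real_of_int m\<bar> + \<bar>real_of_int n\<bar>) ^ 3"
    by (simp add: s_def)
qed auto

text \<open>Needed at the half-periods 1/2 and \<tau>/2, whose values give eta1 and eta2. For such a
  point z one has |z| \<le> 1, |\<omega>| \<ge> s/5 and |z - \<omega>| \<ge> s/10, and the closed
  form z^2/(\<omega>^2 (z - \<omega>)) of the term yields 5^2 * 10 = 250.\<close>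

lemma continuous_on_zeta_reg:
  assumes xy: "\<bar>x\<bar> + \<bar>y\<bar> \<le> 1/2"
  shows "continuous_on modular_region (\<lambda>\<tau>. zeta_reg \<tau> (of_real x + of_real y * \<tau>))"
  unfolding zeta_reg_def
proof (rule continuous_on_lattice_sum[where K = 250])
  fix m n :: int assume mn: "(m, n) \<noteq> (0, 0)"
  have "\<bar>m\<bar> + \<bar>n\<bar> \<ge> 1" using mn by auto
  then have ge: "\<bar>real_of_int m\<bar> + \<bar>real_of_int n\<bar> \<ge> 1" by linarith
  have 1: "of_int m + of_int n * \<tau> \<noteq> 0" if "\<tau> \<in> modular_region" for \<tau>
    using modular_region_nonzero[OF that, of "of_int m" "of_int n"] mn by simp
  have 2: "of_real x + of_real y * \<tau> - (of_int m + of_int n * \<tau>) \<noteq> 0" if "\<tau> \<in> modular_region" for \<tau>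
  proof -
    have "(x - m, y - n) \<noteq> (0, 0)" using ge xy by auto
    from modular_region_nonzero[OF that this] show ?thesis by (simp add: algebra_simps)
  qed
  show "continuous_on modular_region (\<lambda>\<tau>. zeta_terms (of_int m + of_int n * \<tau>) (of_real x + of_real y * \<tau>))"
    unfolding zeta_terms_def by (intro continuous_intros) (use 1 2 in auto)
next
  fix m n :: int and \<tau> assume \<tau>: "\<tau> \<in> modular_region"
  define s where "s = \<bar>real_of_int m\<bar> + \<bar>real_of_int n\<bar>"
  define \<omega> z where "\<omega> = of_int m + of_int n * \<tau>" and "z = of_real x + of_real y * \<tau>"
  assume "\<bar>real_of_int m\<bar> + \<bar>real_of_int n\<bar> \<ge> 1"
  then have s: "s \<ge> 1" by (simp add: s_def)
  have 1: "s / 5 \<le> norm \<omega>"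
    using modular_region_coords_le[OF \<tau>, of "of_int m" "of_int n"] by (simp add: s_def \<omega>_def)
  have "\<bar>real_of_int m\<bar> \<le> \<bar>x - m\<bar> + \<bar>x\<bar>" "\<bar>real_of_int n\<bar> \<le> \<bar>y - n\<bar> + \<bar>y\<bar>" by linarith+
  then have "s \<le> (\<bar>x - m\<bar> + \<bar>y - n\<bar>) + 1/2" using xy unfolding s_def by linarith
  then have "s / 2 \<le> \<bar>x - m\<bar> + \<bar>y - n\<bar>" using s by linarith
  then have "s / 2 / 5 \<le> (\<bar>x - m\<bar> + \<bar>y - n\<bar>) / 5" by (rule divide_right_mono) simp
  also have "\<dots> \<le> norm (z - \<omega>)"
    using modular_region_coords_le[OF \<tau>, of "x - m" "y - n"] by (simp add: z_def \<omega>_def algebra_simps)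
  finally have 2: "s / 10 \<le> norm (z - \<omega>)" by simp
  have "norm z \<le> \<bar>x\<bar> + \<bar>y\<bar> * norm \<tau>" unfolding z_def
    by (rule order_trans[OF norm_triangle_ineq]) (simp add: norm_mult)
  also have "\<dots> \<le> \<bar>x\<bar> + \<bar>y\<bar> * 1"
    using \<tau> by (intro add_left_mono mult_left_mono) (auto simp: modular_region_def)
  finally have z: "norm z \<le> 1" using xy by simp
  have ne: "z \<noteq> \<omega>" "\<omega> \<noteq> 0" using 1 2 s by auto
  have "norm (zeta_terms \<omega> z) = norm z ^ 2 / (norm \<omega> ^ 2 * norm (z - \<omega>))"
    using ne by (simp add: zeta_terms_eq norm_divide norm_mult norm_power)
  also have "\<dots> \<le> 1 ^ 2 / ((s / 5) ^ 2 * (s / 10))"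
    using 1 2 s z by (intro frac_le power_mono mult_mono) auto
  also have "\<dots> = 250 / s ^ 3" using s by (simp add: field_simps eval_nat_numeral)
  finally show "norm (zeta_terms (of_int m + of_int n * \<tau>) (of_real x + of_real y * \<tau>))
      \<le> 250 / (\<bar>real_of_int m\<bar> + \<bar>real_of_int n\<bar>) ^ 3"
    by (simp add: s_def \<omega>_def z_def)
qed auto

lemma cis_modular_region:
  assumes "\<alpha> \<in> {pi / 3..pi / 2}" shows "cis \<alpha> \<in> modular_region"
proof -
  have "sin (pi / 6) \<le> sin \<alpha>"
    using assms by (intro sin_monotone_2pi_le) auto
  then show ?thesis by (simp add: modular_region_def sin_30)
qed

lemma continuous_on_P: "continuous_on {pi / 3..pi / 2} P"
proof -
  have comp: "continuous_on {pi / 3..pi / 2} (\<lambda>\<alpha>. f (cis \<alpha>))" if "continuous_on modular_region f"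
    for f :: "complex \<Rightarrow> complex"
    by (rule continuous_on_compose2[OF that]) (use cis_modular_region in \<open>auto intro!: continuous_intros\<close>)
  have pos: "Im (cis \<alpha>) > 0" if "\<alpha> \<in> {pi / 3..pi / 2}" for \<alpha>
    using cis_modular_region[OF that] by (simp add: modular_region_def)
  have e1: "continuous_on {pi / 3..pi / 2} (\<lambda>\<alpha>. eta1 (cis \<alpha>))"
  proof -
    have "continuous_on {pi / 3..pi / 2} (\<lambda>\<alpha>. 2 * (2 + zeta_reg (cis \<alpha>) (1/2)))"
      using comp[OF continuous_on_zeta_reg[of "1/2" 0]] by (auto intro!: continuous_intros)
    then show ?thesis
      by (rule continuous_on_eq) (use eta_eq(1)[OF pos] in \<open>simp add: wzeta_def\<close>)
  qed
  have e2: "continuous_on {pi / 3..pi / 2} (\<lambda>\<alpha>. eta2 (cis \<alpha>))"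
  proof -
    have "continuous_on {pi / 3..pi / 2} (\<lambda>\<alpha>. 2 * (2 / cis \<alpha> + zeta_reg (cis \<alpha>) (cis \<alpha> / 2)))"
      using comp[OF continuous_on_zeta_reg[of 0 "1/2"]] by (auto intro!: continuous_intros)
    then show ?thesis
      by (rule continuous_on_eq) (use eta_eq(2)[OF pos] in \<open>simp add: wzeta_def\<close>)
  qed
  have g: "continuous_on {pi / 3..pi / 2} (\<lambda>\<alpha>. eis_g2 (cis \<alpha>))"
    "continuous_on {pi / 3..pi / 2} (\<lambda>\<alpha>. eis_g3 (cis \<alpha>))"
    unfolding eis_g2_eq eis_g3_eq
    by (intro continuous_intros comp continuous_on_eis_G; simp)+
  show ?thesis
    unfolding P_def p1_def p2_def by (intro continuous_intros e1 e2 g)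
qed

section \<open>Lattices with complex multiplication\<close>

text \<open>The half-period 1/2 is a zero of \<open>wp'\<close>, because \<open>wp'\<close> is odd
  and periodic. If g2 = g3 = 0, the cubic equation forces \<open>wp\<close> = 0 there, so
  \<open>wp''\<close> vanishes too and contradicts \<open>wp''_nonzero\<close>.\<close>

lemma eis_discriminant:
  assumes \<tau>: "Im \<tau> > 0"
  shows "eis_g2 \<tau> \<noteq> 0 \<or> eis_g3 \<tau> \<noteq> 0"
proof (rule ccontr)
  assume "\<not> ?thesis"
  then have g: "eis_g2 \<tau> = 0" "eis_g3 \<tau> = 0" by auto
  note h = half_not_lattice(1)[OF \<tau>]
  have odd: "wp' \<tau> (- (1/2)) = - wp' \<tau> (1/2)"
  proof -
    have "(wp \<tau> has_field_derivative wp' \<tau> (- (1/2))) (at (- (1/2)))"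
      using h by (intro wp_deriv[OF \<tau>]) simp
    then have "((\<lambda>z. wp \<tau> (- z)) has_field_derivative wp' \<tau> (- (1/2)) * - 1) (at (1/2))"
      by (intro DERIV_chain2[where f = "wp \<tau>"]) (auto intro!: derivative_eq_intros)
    then have "(wp \<tau> has_field_derivative - wp' \<tau> (- (1/2))) (at (1/2))"
      by (simp add: wp_uminus)
    with wp_deriv[OF \<tau> h] show ?thesis using DERIV_unique by force
  qed
  have "wp' \<tau> (1/2) = 0"
    using wp'_period[of 1 \<tau> "- (1/2)"] odd by simp
  moreover from this have "wp \<tau> (1/2) = 0"
    using wp'_square[OF \<tau> h] g by simp
  then have "wp'' \<tau> (1/2) = 0" by (simp add: wp''_def g)
  ultimately show False using wp''_nonzero[OF \<tau> h] by blast
qed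

context
  fixes \<tau> u :: complex
  assumes \<tau>: "Im \<tau> > 0" and u: "u \<in> lattice \<tau>" "u * \<tau> \<in> lattice \<tau>"
    "inverse u \<in> lattice \<tau>" "inverse u * \<tau> \<in> lattice \<tau>" "u \<noteq> 0"
begin

private lemma of_int_mult_lattice: "x \<in> lattice \<tau> \<Longrightarrow> of_int k * x \<in> lattice \<tau>"
proof -
  assume "x \<in> lattice \<tau>"
  then obtain m n where "x = of_int m + of_int n * \<tau>" by (auto simp: lattice_def)
  then have "of_int k * x = of_int (k * m) + of_int (k * n) * \<tau>" by (simp add: algebra_simps)
  then show ?thesis unfolding lattice_def by blast
qed

private lemma mult_lattice:
  assumes "v \<in> lattice \<tau>" "v * \<tau> \<in> lattice \<tau>" "x \<in> lattice \<tau>"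
  shows "v * x \<in> lattice \<tau>"
proof -
  obtain m n where "x = of_int m + of_int n * \<tau>" using assms(3) by (auto simp: lattice_def)
  then have "v * x = of_int m * v + of_int n * (v * \<tau>)" by (simp add: algebra_simps)
  then show ?thesis using assms of_int_mult_lattice by auto
qed

lemma bij_betw_cm: "bij_betw (\<lambda>x. u * x) (lattice \<tau> - {0}) (lattice \<tau> - {0})"
proof (rule bij_betw_byWitness[where f' = "\<lambda>x. inverse u * x"])
  show "\<forall>x\<in>lattice \<tau> - {0}. inverse u * (u * x) = x" "\<forall>x\<in>lattice \<tau> - {0}. u * (inverse u * x) = x"
    using u(5) by (auto simp flip: mult.assoc)
  show "(\<lambda>x. u * x) ` (lattice \<tau> - {0}) \<subseteq> lattice \<tau> - {0}"
    using mult_lattice[OF u(1,2)] u(5) by auto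
  show "(\<lambda>x. inverse u * x) ` (lattice \<tau> - {0}) \<subseteq> lattice \<tau> - {0}"
  proof (rule image_subsetI)
    fix x assume x: "x \<in> lattice \<tau> - {0}"
    then have "inverse u * x \<in> lattice \<tau>" by (intro mult_lattice[OF u(3,4)]) blast
    moreover have "inverse u * x \<noteq> 0" using x u(5) by simp
    ultimately show "inverse u * x \<in> lattice \<tau> - {0}" by blast
  qed
qed

text \<open>Multiplication by u permutes the nonzero lattice points, while the Eisenstein sum is
  homogeneous of degree -k, so it equals itself divided by u^k.\<close>

lemma eis_G_cm:
  assumes "u ^ k \<noteq> 1"
  shows "eis_G k \<tau> = 0"
proof -
  have "eis_G k \<tau> = (\<Sum>\<^sub>\<infinity>\<omega>\<in>lattice \<tau> - {0}. 1 / (u * \<omega>) ^ k)"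
    unfolding eis_G_def by (rule infsum_reindex_bij_betw[OF bij_betw_cm, symmetric])
  also have "\<dots> = (\<Sum>\<^sub>\<infinity>\<omega>\<in>lattice \<tau> - {0}. 1 / u ^ k * (1 / \<omega> ^ k))"
    by (simp add: power_mult_distrib)
  also have "\<dots> = 1 / u ^ k * eis_G k \<tau>"
    unfolding eis_G_def by (rule infsum_cmult_right')
  finally have "eis_G k \<tau> * (u ^ k - 1) = 0" using u(5) by (simp add: field_simps)
  then show ?thesis using assms by simp
qed

text \<open>The same reindexing for \<zeta>, which is homogeneous of degree -1 in the point and the
  lattice together. At a half-period it relates the two quasi-periods.\<close>

lemma wzeta_cm: "wzeta \<tau> (u * z) = wzeta \<tau> z / u"
proof -
  have "zeta_reg \<tau> (u * z) = (\<Sum>\<^sub>\<infinity>\<omega>\<in>lattice \<tau> - {0}. zeta_terms (u * \<omega>) (u * z))"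
    unfolding zeta_reg_def by (rule infsum_reindex_bij_betw[OF bij_betw_cm, symmetric])
  also have "\<dots> = (\<Sum>\<^sub>\<infinity>\<omega>\<in>lattice \<tau> - {0}. 1 / u * zeta_terms \<omega> z)"
  proof (rule infsum_cong)
    fix \<omega> assume "\<omega> \<in> lattice \<tau> - {0}"
    have "1 / (u * z - u * \<omega>) = 1 / u * (1 / (z - \<omega>))"
      by (simp flip: right_diff_distrib)
    moreover have "u * z / (u * \<omega>) ^ 2 = 1 / u * (z / \<omega> ^ 2)"
      using u(5) by (simp add: power2_eq_square)
    ultimately show "zeta_terms (u * \<omega>) (u * z) = 1 / u * zeta_terms \<omega> z"
      by (simp add: zeta_terms_def ring_distribs)
  qed
  also have "\<dots> = 1 / u * zeta_reg \<tau> z"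
    unfolding zeta_reg_def by (rule infsum_cmult_right')
  finally show ?thesis
    by (simp add: wzeta_def ring_distribs add_divide_distrib)
qed

end

section \<open>The signs of \<open>P\<close> at the square and the hexagonal lattice\<close>

lemma P_pi_half: "P (pi / 2) < 0"
proof -
  have \<tau>: "Im \<i> > 0" by simp
  have mem: "- \<i> \<in> lattice \<i>" "- 1 \<in> lattice \<i>" by simp_all
  have g3: "eis_g3 \<i> = 0"
  proof -
    have "\<i> ^ 6 = (-1 :: complex)" by (simp add: eval_nat_numeral)
    then have "\<i> ^ 6 \<noteq> (1 :: complex)" by simp
    then have "eis_G 6 \<i> = 0"
      by (intro eis_G_cm[where u = \<i>]) (use mem in auto)
    then show ?thesis by (simp add: eis_g3_eq)
  qed
  then have g2: "eis_g2 \<i> \<noteq> 0" using eis_discriminant[OF \<tau>] by blast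
  have "wzeta \<i> (\<i> * (1/2)) = wzeta \<i> (1/2) / \<i>"
    by (rule wzeta_cm) (use mem in auto)
  then have e2: "eta2 \<i> = - \<i> * eta1 \<i>"
    by (simp add: eta_eq[OF \<tau>])
  \<comment> \<open>With eta2 = -\<i> eta1, vanishing of eta1 would make the left side of the
    Legendre relation 0.\<close>
  have e1: "eta1 \<i> \<noteq> 0"
    using legendre_relation[OF \<tau>] e2 by auto
  define c where "c = 2 * eis_g2 \<i> * eta1 \<i>"
  have "P (pi / 2) = Im (cnj c * (- \<i> * c))"
    by (simp add: P_def p1_def p2_def g3 e2 cis_pi_half c_def mult_ac)
  also have "\<dots> = - ((norm c)\<^sup>2)"
    unfolding cmod_power2 by (simp add: power2_eq_square)
  also have "\<dots> < 0" using g2 e1 by (simp add: c_def)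
  finally show ?thesis .
qed

lemma P_pi_third: "P (pi / 3) > 0"
proof -
  define \<rho> where "\<rho> = cis (pi / 3)"
  have \<rho>: "\<rho> = Complex (1/2) (sqrt 3 / 2)"
    by (simp add: \<rho>_def complex_eq_iff cos_60 sin_60)
  have \<tau>: "Im \<rho> > 0" by (simp add: \<rho>)
  \<comment> \<open>The minimal equation of \<rho>; it shows that \<rho>^2 and 1/\<rho> = 1 - \<rho>
    lie in the lattice, so that \<rho> acts on it invertibly.\<close>
  have sq: "\<rho> * \<rho> = \<rho> - 1" by (simp add: \<rho> complex_eq_iff)
  have inv: "inverse \<rho> = 1 - \<rho>"
    by (rule inverse_unique) (use sq in \<open>simp add: algebra_simps\<close>)
  have n0: "\<rho> \<noteq> 0" using \<tau> by auto
  have g2: "eis_g2 \<rho> = 0"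
  proof -
    have "\<rho> ^ 4 = - \<rho>"
    proof -
      have "\<rho> ^ 4 = (\<rho> * \<rho>) * (\<rho> * \<rho>)" by (simp add: eval_nat_numeral)
      then show ?thesis unfolding sq using sq by (simp add: algebra_simps)
    qed
    then have "\<rho> ^ 4 \<noteq> 1" by (simp add: \<rho> complex_eq_iff)
    then have "eis_G 4 \<rho> = 0"
    proof (rule eis_G_cm[OF \<tau>, where u = \<rho>, rotated -1])
      show "\<rho> * \<rho> \<in> lattice \<rho>" "inverse \<rho> \<in> lattice \<rho>" unfolding sq inv by auto
    qed (use n0 in auto)
    then show ?thesis by (simp add: eis_g2_eq)
  qed
  then have g3: "eis_g3 \<rho> \<noteq> 0" using eis_discriminant[OF \<tau>] by blast
  define c where "c = 3 * eis_g3 \<rho>"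
  have "P (pi / 3) = Im (cnj (- c) * (- (c * \<rho>)))"
    by (simp only: P_def p1_def p2_def g2 c_def flip: \<rho>_def) simp
  also have "\<dots> = (norm c)\<^sup>2 * Im \<rho>"
    unfolding cmod_power2 by (simp add: power2_eq_square algebra_simps)
  also have "\<dots> > 0" using g3 \<tau> by (simp add: c_def)
  finally show ?thesis .
qed

lemma P_zero: "\<exists>\<alpha>\<^sub>0\<in>{pi / 3<..<pi / 2}. P \<alpha>\<^sub>0 = 0"
proof -
  have "\<exists>x\<ge>pi / 3. x \<le> pi / 2 \<and> P x = 0"
    by (rule IVT2') (use continuous_on_P P_pi_half P_pi_third in auto)
  then obtain x where x: "pi / 3 \<le> x" "x \<le> pi / 2" "P x = 0" by blast
  have "x \<noteq> pi / 3" "x \<noteq> pi / 2" using x(3) P_pi_half P_pi_third by (metis less_irrefl)+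
  with x show ?thesis by force
qed


section \<open>Quotients by a lattice\<close>

lemma cls_eq_iff: "cls \<tau> z = cls \<tau> w \<longleftrightarrow> z - w \<in> lattice \<tau>"
proof
  assume "cls \<tau> z = cls \<tau> w"
  moreover have "z \<in> cls \<tau> z" by (simp add: cls_def)
  ultimately show "z - w \<in> lattice \<tau>" by (simp add: cls_def)
next
  assume *: "z - w \<in> lattice \<tau>"
  have "x - z \<in> lattice \<tau> \<longleftrightarrow> x - w \<in> lattice \<tau>" for x
    using lattice_add_iff[OF *, of "x - z"] by simp
  then show "cls \<tau> z = cls \<tau> w" by (simp add: cls_def)
qed

lemma cls_add [simp]: "\<omega> \<in> lattice \<tau> \<Longrightarrow> cls \<tau> (z + \<omega>) = cls \<tau> z"
  by (simp add: cls_eq_iff)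

lemma cls_eqE:
  assumes "cls \<tau> z = cls \<tau> w" obtains \<omega> where "\<omega> \<in> lattice \<tau>" "w = z + \<omega>"
  using assms that[of "w - z"] by (metis add.commute cls_eq_iff diff_add_cancel)

definition cls_rep :: "complex set \<Rightarrow> complex" where
  "cls_rep p = (SOME z. z \<in> p)"

lemma cls_rep: "cls \<tau> (cls_rep (cls \<tau> z)) = cls \<tau> z"
proof -
  have "z \<in> cls \<tau> z" by (simp add: cls_def)
  then have "cls_rep (cls \<tau> z) \<in> cls \<tau> z" unfolding cls_rep_def by (rule someI)
  then have "cls_rep (cls \<tau> z) - z \<in> lattice \<tau>" by (subst (asm) (2) cls_def) simp
  then show ?thesis by (simp add: cls_eq_iff)
qed

lemma cls_vimage_image: "cls \<tau> -` (cls \<tau> ` W) = (\<Union>\<omega>\<in>lattice \<tau>. (\<lambda>z. z + \<omega>) ` W)"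
proof (intro equalityI subsetI)
  fix z assume "z \<in> cls \<tau> -` (cls \<tau> ` W)"
  then obtain w where w: "w \<in> W" "cls \<tau> w = cls \<tau> z" by auto
  then obtain \<omega> where "\<omega> \<in> lattice \<tau>" "z = w + \<omega>" by (elim cls_eqE)
  with w show "z \<in> (\<Union>\<omega>\<in>lattice \<tau>. (\<lambda>z. z + \<omega>) ` W)" by blast
qed auto

lemma open_cls_vimage_image: "open W \<Longrightarrow> open (cls \<tau> -` (cls \<tau> ` W))"
  unfolding cls_vimage_image
  by (intro open_UN ballI) (simp add: add.commute open_translation)

definition coord_x :: "complex \<Rightarrow> complex \<Rightarrow> real" where
  "coord_x \<tau> z = Re z - Im z / Im \<tau> * Re \<tau>"

definition coord_y :: "complex \<Rightarrow> complex \<Rightarrow> real" where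
  "coord_y \<tau> z = Im z / Im \<tau>"

lemma coord_eq: "Im \<tau> > 0 \<Longrightarrow> of_real (coord_x \<tau> z) + of_real (coord_y \<tau> z) * \<tau> = z"
  by (simp add: coord_x_def coord_y_def complex_eq_iff)

lemma coord_of [simp]:
  assumes "Im \<tau> > 0"
  shows "coord_x \<tau> (of_real x + of_real y * \<tau>) = x" "coord_y \<tau> (of_real x + of_real y * \<tau>) = y"
  using assms by (simp_all add: coord_x_def coord_y_def)

text \<open>The embedding of the torus as a product of two circles.\<close>

definition torus_emb :: "complex \<Rightarrow> complex \<Rightarrow> complex \<times> complex" where
  "torus_emb \<tau> z = (exp (2 * pi * \<i> * of_real (coord_x \<tau> z)), exp (2 * pi * \<i> * of_real (coord_y \<tau> z)))"

lemma exp_2pi_eq_iff: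
  "exp (2 * pi * \<i> * of_real x) = exp (2 * pi * \<i> * of_real y) \<longleftrightarrow> x - y \<in> \<int>"
proof
  assume "exp (2 * pi * \<i> * of_real x) = exp (2 * pi * \<i> * of_real y)"
  then obtain n :: int where "2 * pi * \<i> * of_real x = 2 * pi * \<i> * of_real y + of_int (2 * n) * pi * \<i>"
    unfolding exp_eq by blast
  then have "2 * pi * x = 2 * pi * y + 2 * n * pi" by (simp add: complex_eq_iff)
  then have "2 * pi * (x - y - n) = 0" by (simp add: algebra_simps)
  then have "x - y = of_int n" by simp
  then show "x - y \<in> \<int>" by simp
next
  assume "x - y \<in> \<int>"
  then obtain n :: int where "x - y = of_int n" by (elim Ints_cases)
  then have x: "x = y + of_int n" by simp
  show "exp (2 * pi * \<i> * of_real x) = exp (2 * pi * \<i> * of_real y)"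
    unfolding exp_eq x by (intro exI[of _ n]) (simp add: algebra_simps)
qed

lemma torus_emb_eq_iff:
  assumes \<tau>: "Im \<tau> > 0"
  shows "torus_emb \<tau> z = torus_emb \<tau> w \<longleftrightarrow> z - w \<in> lattice \<tau>"
proof -
  define x y where "x = coord_x \<tau> z - coord_x \<tau> w" and "y = coord_y \<tau> z - coord_y \<tau> w"
  have eq: "z - w = of_real x + of_real y * \<tau>"
    using coord_eq[OF \<tau>, of z] coord_eq[OF \<tau>, of w] by (simp add: x_def y_def algebra_simps)
  have "torus_emb \<tau> z = torus_emb \<tau> w \<longleftrightarrow> x \<in> \<int> \<and> y \<in> \<int>"
    unfolding torus_emb_def prod.inject exp_2pi_eq_iff x_def y_def ..
  also have "\<dots> \<longleftrightarrow> z - w \<in> lattice \<tau>"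
  proof
    assume "x \<in> \<int> \<and> y \<in> \<int>"
    then obtain m n :: int where "x = of_int m" "y = of_int n" by (auto elim!: Ints_cases)
    then show "z - w \<in> lattice \<tau>" unfolding eq lattice_def by auto
  next
    assume "z - w \<in> lattice \<tau>"
    then obtain m n :: int where "of_real x + of_real y * \<tau> = of_real m + of_real n * \<tau>"
      unfolding eq by (auto simp: lattice_def)
    then have "x = m" "y = n" using lattice_coords_eq_iff[OF \<tau>] by blast+
    then show "x \<in> \<int> \<and> y \<in> \<int>" by simp
  qed
  finally show ?thesis .
qed

lemma continuous_torus_emb [continuous_intros]:
  "Im \<tau> > 0 \<Longrightarrow> continuous_on A (torus_emb \<tau>)"
  unfolding torus_emb_def coord_x_def coord_y_def by (intro continuous_intros) auto

text \<open>Common shape of the charts of the torus and of the punctured torus: local inverses of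
  the projection. Only the values of the coordinate on the chart domain are prescribed, so that
  restricting a chart leaves its coordinate map untouched.\<close>

definition lattice_chart :: "complex \<Rightarrow> complex set chart \<Rightarrow> complex set \<Rightarrow> bool" where
  "lattice_chart \<tau> c W \<longleftrightarrow> open W \<and> inj_on (cls \<tau>) W \<and> fst c = cls \<tau> ` W \<and>
     (\<forall>z\<in>W. snd c (cls \<tau> z) = z)"

lemma lattice_chartD:
  assumes "lattice_chart \<tau> c W"
  shows "open W" "inj_on (cls \<tau>) W" "fst c = cls \<tau> ` W" "z \<in> W \<Longrightarrow> snd c (cls \<tau> z) = z"
    "chart_img c = W" "z \<in> W \<Longrightarrow> param c z = cls \<tau> z" "inj_on (snd c) (fst c)"
proof -
  show 1: "open W" "inj_on (cls \<tau>) W" "fst c = cls \<tau> ` W" "\<And>z. z \<in> W \<Longrightarrow> snd c (cls \<tau> z) = z"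
    using assms unfolding lattice_chart_def by blast+
  have "snd c ` cls \<tau> ` W = (\<lambda>z. z) ` W" unfolding image_image by (rule image_cong) (use 1 in auto)
  then show "chart_img c = W" by (simp add: chart_img_def 1(3))
  show inj: "inj_on (snd c) (fst c)"
    unfolding 1(3) by (rule inj_on_inverseI[where g = "cls \<tau>"]) (use 1(4) in force)
  show "param c z = cls \<tau> z" if "z \<in> W"
    unfolding param_def using inv_into_f_f[OF inj, of "cls \<tau> z"] 1(3) 1(4)[OF that] that by simp
qed

text \<open>Near any representative z, the chart is the translation by one fixed lattice vector,
  even if z itself is far from \<open>W\<close>.\<close>

lemma lattice_chart_local:
  assumes "lattice_chart \<tau> c W" "cls \<tau> z \<in> fst c"
  obtains \<omega> where "\<omega> \<in> lattice \<tau>" "z + \<omega> \<in> W"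
    "\<And>z'. z' + \<omega> \<in> W \<Longrightarrow> cls \<tau> z' \<in> fst c \<and> snd c (cls \<tau> z') = z' + \<omega>"
proof -
  note c = lattice_chartD[OF assms(1)]
  obtain w where w: "w \<in> W" "cls \<tau> w = cls \<tau> z" using assms(2) c(3) by auto
  then obtain \<omega> where \<omega>: "\<omega> \<in> lattice \<tau>" "w = z + \<omega>" by (metis cls_eqE)
  show ?thesis
  proof (rule that[of \<omega>])
    fix z' assume z': "z' + \<omega> \<in> W"
    have eq: "cls \<tau> z' = cls \<tau> (z' + \<omega>)" using \<omega>(1) by simp
    show "cls \<tau> z' \<in> fst c \<and> snd c (cls \<tau> z') = z' + \<omega>"
      unfolding eq using c(3) c(4)[OF z'] z' by blast
  qed (use \<omega> w in auto)
qed

lemma deriv_comp_param: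
  assumes "lattice_chart \<tau> c W" "z \<in> W"
  shows "deriv (F \<circ> param c) z = deriv (\<lambda>z. F (cls \<tau> z)) z"
  using lattice_chartD[OF assms(1)] assms(2)
  by (intro deriv_cong_ev refl eventually_mono[OF eventually_nhds_in_open[of W]]) auto

lemma dcoef_cls:
  assumes "lattice_chart \<tau> c W" "z \<in> W"
  shows "dcoef c F (cls \<tau> z) = deriv (\<lambda>z. F (cls \<tau> z)) z"
  using lattice_chartD(4)[OF assms] by (simp add: dcoef_def deriv_comp_param[OF assms])

text \<open>Transition maps are locally translations. Hence all tensors on these surfaces have
  chart-independent coefficients, namely those in the global coordinate z of the plane.\<close>

lemma transition_local:
  assumes c: "lattice_chart \<tau> c W" and d: "lattice_chart \<tau> d W'" and z: "z \<in> W" "cls \<tau> z \<in> fst d"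
  shows "(transition c d has_field_derivative 1) (at z)"
    and "(transition c d has_field_derivative 1) (at z within A)"
proof -
  obtain \<omega> where \<omega>: "\<omega> \<in> lattice \<tau>" "z + \<omega> \<in> W'"
    "\<And>z'. z' + \<omega> \<in> W' \<Longrightarrow> cls \<tau> z' \<in> fst d \<and> snd d (cls \<tau> z') = z' + \<omega>"
    using lattice_chart_local[OF d z(2)] by blast
  have op: "open ((\<lambda>z. z + \<omega>) -` W' \<inter> W)"
    using lattice_chartD(1)[OF c] lattice_chartD(1)[OF d]
    by (intro open_Int open_vimage continuous_intros)
  have "((\<lambda>z. z + \<omega>) has_field_derivative 1) (at z)" by (auto intro!: derivative_eq_intros)
  then show D: "(transition c d has_field_derivative 1) (at z)"
  proof (rule has_field_derivative_transform_within_open[OF _ op])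
    show "z \<in> (\<lambda>z. z + \<omega>) -` W' \<inter> W" using \<omega> z by auto
    fix x assume "x \<in> (\<lambda>z. z + \<omega>) -` W' \<inter> W"
    then show "x + \<omega> = transition c d x"
      using \<omega>(3)[of x] lattice_chartD(6)[OF c, of x] by (simp add: transition_def)
  qed
  then show "(transition c d has_field_derivative 1) (at z within A)"
    by (rule has_field_derivative_at_within)
qed

text \<open>Treats the torus (\<Omega> the whole plane) and the punctured torus (\<Omega> the
  complement of the lattice) together: a surface covered by a connected, lattice-invariant open
  set.\<close>

locale lattice_quotient =
  fixes \<tau> :: complex and S :: "complex set surface" and \<Omega> :: "complex set"
  assumes tau: "Im \<tau> > 0"
    and Omega: "open \<Omega>" "connected \<Omega>" "\<Omega> \<noteq> {}" "\<And>z \<omega>. z \<in> \<Omega> \<Longrightarrow> \<omega> \<in> lattice \<tau> \<Longrightarrow> z + \<omega> \<in> \<Omega>"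
    and openin_iff: "\<And>U. openin (stop S) U \<longleftrightarrow> U \<subseteq> cls \<tau> ` \<Omega> \<and> open (cls \<tau> -` U)"
    and chart: "\<And>c. c \<in> charts S \<Longrightarrow> \<exists>W. W \<subseteq> \<Omega> \<and> lattice_chart \<tau> c W"
    and cover: "\<And>z. z \<in> \<Omega> \<Longrightarrow> \<exists>c\<in>charts S. cls \<tau> z \<in> fst c"
begin

lemma cls_in_image_iff: "cls \<tau> z \<in> cls \<tau> ` \<Omega> \<longleftrightarrow> z \<in> \<Omega>"
proof
  assume "cls \<tau> z \<in> cls \<tau> ` \<Omega>"
  then obtain w where "w \<in> \<Omega>" "cls \<tau> w = cls \<tau> z" by auto
  then show "z \<in> \<Omega>" using Omega(4) by (metis cls_eqE)
qed auto

lemma vimage_Omega: "cls \<tau> -` (cls \<tau> ` \<Omega>) = \<Omega>"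
  using cls_in_image_iff by auto

lemma topspace_eq: "topspace (stop S) = cls \<tau> ` \<Omega>"
proof
  show "topspace (stop S) \<subseteq> cls \<tau> ` \<Omega>" using openin_iff[of "topspace (stop S)"] by simp
  have "openin (stop S) (cls \<tau> ` \<Omega>)" by (simp add: openin_iff vimage_Omega Omega(1))
  then show "cls \<tau> ` \<Omega> \<subseteq> topspace (stop S)" by (rule openin_subset)
qed

lemma openin_image:
  assumes "open W" "W \<subseteq> \<Omega>" shows "openin (stop S) (cls \<tau> ` W)"
  using assms by (auto simp: openin_iff intro: open_cls_vimage_image)

lemma continuous_map_cls: "continuous_map (top_of_set \<Omega>) (stop S) (cls \<tau>)"
proof (rule continuous_map[THEN iffD2], intro conjI allI impI)
  show "cls \<tau> ` topspace (top_of_set \<Omega>) \<subseteq> topspace (stop S)" by (simp add: topspace_eq)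
  fix U assume U: "openin (stop S) U"
  have "{x \<in> topspace (top_of_set \<Omega>). cls \<tau> x \<in> U} = \<Omega> \<inter> cls \<tau> -` U" by auto
  then show "openin (top_of_set \<Omega>) {x \<in> topspace (top_of_set \<Omega>). cls \<tau> x \<in> U}"
    using U by (simp add: openin_iff openin_open_Int)
qed

lemma continuous_map_from:
  fixes f :: "complex set \<Rightarrow> 'b :: topological_space"
  assumes f: "continuous_on \<Omega> (\<lambda>z. f (cls \<tau> z))"
  shows "continuous_map (stop S) euclidean f"
proof (rule continuous_map[THEN iffD2], intro conjI allI impI)
  fix U :: "'b set" assume "openin euclidean U"
  then have U: "open U" by simp
  have eq: "cls \<tau> -` {x \<in> topspace (stop S). f x \<in> U} = \<Omega> \<inter> (\<lambda>z. f (cls \<tau> z)) -` U"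
    by (auto simp: topspace_eq cls_in_image_iff)
  have "open (\<Omega> \<inter> (\<lambda>z. f (cls \<tau> z)) -` U)"
    using f U Omega(1) by (simp add: continuous_on_open_vimage Int_commute)
  then show "openin (stop S) {x \<in> topspace (stop S). f x \<in> U}"
    unfolding openin_iff eq by (auto simp: topspace_eq)
qed auto

definition emb :: "complex set \<Rightarrow> complex \<times> complex" where
  "emb p = torus_emb \<tau> (cls_rep p)"

lemma emb_cls: "emb (cls \<tau> z) = torus_emb \<tau> z"
  unfolding emb_def torus_emb_eq_iff[OF tau] using cls_rep by (simp add: cls_eq_iff)

lemma continuous_map_emb: "continuous_map (stop S) euclidean emb"
  by (rule continuous_map_from) (simp add: emb_cls continuous_torus_emb tau)

text \<open>The two circle coordinates give a continuous injection into a Hausdorff space.\<close>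

lemma Hausdorff: "Hausdorff_space (stop S)"
proof (rule Hausdorff_space_injective_preimage[OF _ continuous_map_emb])
  show "inj_on emb (topspace (stop S))"
    by (auto simp: inj_on_def topspace_eq emb_cls torus_emb_eq_iff[OF tau] cls_eq_iff)
qed (simp add: Hausdorff_space_euclidean)

lemma homeomorphic_chart:
  assumes "c \<in> charts S"
  shows "homeomorphic_map (subtopology (stop S) (fst c)) (top_of_set (chart_img c)) (snd c)"
proof -
  obtain W where W: "W \<subseteq> \<Omega>" "lattice_chart \<tau> c W" using chart[OF assms] by blast
  note c = lattice_chartD[OF W(2)]
  have top: "topspace (subtopology (stop S) (fst c)) = cls \<tau> ` W"
    using W(1) c(3) by (auto simp: topspace_eq)
  have "homeomorphic_maps (subtopology (stop S) (fst c)) (top_of_set W) (snd c) (cls \<tau>)"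
    unfolding homeomorphic_maps_def
  proof (intro conjI ballI)
    show "continuous_map (subtopology (stop S) (fst c)) (top_of_set W) (snd c)"
    proof (rule continuous_map[THEN iffD2], intro conjI allI impI)
      show "snd c ` topspace (subtopology (stop S) (fst c)) \<subseteq> topspace (top_of_set W)"
        unfolding top using c(4) by auto
      fix U assume "openin (top_of_set W) U"
      then have U: "open U" "U \<subseteq> W" using c(1) by (auto simp: openin_open_eq)
      have "{x \<in> topspace (subtopology (stop S) (fst c)). snd c x \<in> U} = cls \<tau> ` U"
        unfolding top using c(4) U(2) by force
      moreover have "openin (subtopology (stop S) (fst c)) (cls \<tau> ` U)"
        unfolding openin_subtopology using openin_image[OF U(1)] U(2) W(1) c(3) by blast
      ultimately show "openin (subtopology (stop S) (fst c)) {x \<in> topspace (subtopology (stop S) (fst c)). snd c x \<in> U}"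
        by simp
    qed
    show "continuous_map (top_of_set W) (subtopology (stop S) (fst c)) (cls \<tau>)"
      using continuous_map_from_subtopology_mono[OF continuous_map_cls W(1)] c(3)
      by (auto simp: continuous_map_in_subtopology)
    fix x assume "x \<in> topspace (subtopology (stop S) (fst c))"
    then obtain w where "w \<in> W" "x = cls \<tau> w" unfolding top by blast
    then show "cls \<tau> (snd c x) = x" using c(4) by simp
  qed (use c(4) in simp)
  then show ?thesis unfolding c(5) homeomorphic_map_maps by blast
qed

lemma holomorphic_transition:
  assumes "c \<in> charts S" "lattice_chart \<tau> d W'"
  shows "transition c d holomorphic_on snd c ` (fst c \<inter> fst d)"
proof -
  obtain W where W: "W \<subseteq> \<Omega>" "lattice_chart \<tau> c W" using chart[OF assms(1)] by blast
  note c = lattice_chartD[OF W(2)]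
  have "transition c d field_differentiable (at z within snd c ` (fst c \<inter> fst d))"
    if z: "z \<in> snd c ` (fst c \<inter> fst d)" for z
  proof -
    obtain w where "w \<in> W" "cls \<tau> w \<in> fst d" "z = snd c (cls \<tau> w)" using z c(3) by auto
    then have "z \<in> W" "cls \<tau> z \<in> fst d" using c(4) by auto
    from transition_local(2)[OF W(2) assms(2) this] show ?thesis
      by (auto simp: field_differentiable_def)
  qed
  then show ?thesis by (simp add: holomorphic_on_def)
qed

lemma riemann_surface: "riemann_surface S"
  unfolding riemann_surface_def
proof (intro conjI ballI)
  show "topspace (stop S) \<noteq> {}" using Omega(3) by (simp add: topspace_eq)
  have "connectedin (stop S) (cls \<tau> ` \<Omega>)"
    by (rule connectedin_continuous_map_image[OF continuous_map_cls])
      (use Omega(2) in \<open>simp add: connectedin_subtopology\<close>)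
  then show "connected_space (stop S)"
    by (metis connectedin_topspace topspace_eq)
  show "Hausdorff_space (stop S)" by (rule Hausdorff)
  show "(\<Union>c\<in>charts S. fst c) = topspace (stop S)"
  proof
    show "(\<Union>c\<in>charts S. fst c) \<subseteq> topspace (stop S)"
    proof (intro UN_least)
      fix c assume "c \<in> charts S"
      from chart[OF this] obtain W where "W \<subseteq> \<Omega>" "lattice_chart \<tau> c W" by blast
      then show "fst c \<subseteq> topspace (stop S)" using lattice_chartD(3) by (auto simp: topspace_eq)
    qed
    show "topspace (stop S) \<subseteq> (\<Union>c\<in>charts S. fst c)" using cover by (auto simp: topspace_eq)
  qed
next
  fix c assume c: "c \<in> charts S"
  from chart[OF this] obtain W where W: "W \<subseteq> \<Omega>" "lattice_chart \<tau> c W" by blast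
  note cd = lattice_chartD[OF W(2)]
  show "openin (stop S) (fst c)" unfolding cd(3) by (rule openin_image[OF cd(1) W(1)])
  show "open (chart_img c)" using cd by simp
  show "homeomorphic_map (subtopology (stop S) (fst c)) (top_of_set (chart_img c)) (snd c)"
    by (rule homeomorphic_chart[OF c])
  fix d assume "d \<in> charts S"
  from chart[OF this] obtain W' where "lattice_chart \<tau> d W'" by blast
  then show "transition c d holomorphic_on snd c ` (fst c \<inter> fst d)"
    by (rule holomorphic_transition[OF c])
qed

lemma holomorphic_fun_from:
  assumes "(\<lambda>z. F (cls \<tau> z)) holomorphic_on \<Omega>"
  shows "holomorphic_fun S F"
  unfolding holomorphic_fun_def
proof
  fix c assume "c \<in> charts S"
  from chart[OF this] obtain W where W: "W \<subseteq> \<Omega>" "lattice_chart \<tau> c W" by blast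
  note c = lattice_chartD[OF W(2)]
  show "(F \<circ> param c) holomorphic_on chart_img c"
    unfolding c(5) by (rule holomorphic_transform[OF holomorphic_on_subset[OF assms W(1)]])
      (use c(6) in auto)
qed

text \<open>Lifts a path to the plane without covering space theory: on [0, 1] both circle
  coordinates have continuous logarithms, which serve as lattice coordinates of the lift. In a chart
  the lift differs from the path by a constant lattice vector, so it inherits differentiability off
  a finite set.\<close>

lemma pC1_path_lift:
  assumes "pC1_path S \<gamma>"
  obtains g K where "continuous_on {0..1} g" "\<And>t. t \<in> {0..1} \<Longrightarrow> g t \<in> \<Omega> \<and> cls \<tau> (g t) = \<gamma> t"
    "finite K" "\<And>t. t \<in> {0<..<1} - K \<Longrightarrow> g differentiable (at t)"
proof -
  have \<gamma>: "pathin (stop S) \<gamma>" using assms by (simp add: pC1_path_def)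
  then have \<gamma>_in: "\<gamma> t \<in> cls \<tau> ` \<Omega>" if "t \<in> {0..1}" for t
    using that continuous_map_image_subset_topspace[OF \<gamma>[unfolded pathin_def]]
    by (auto simp: topspace_eq image_subset_iff)
  have cont: "continuous_on {0..1} (\<lambda>t. emb (\<gamma> t))"
    using continuous_map_compose[OF \<gamma>[unfolded pathin_def] continuous_map_emb]
    by (simp add: o_def)
  have nz: "fst (emb p) \<noteq> 0" "snd (emb p) \<noteq> 0" "norm (fst (emb p)) = 1" "norm (snd (emb p)) = 1" for p
    by (simp_all add: emb_def torus_emb_def)
  have log: "\<exists>u. continuous_on {0..1} u \<and> (\<forall>t\<in>{0..1}. f t = exp (2 * pi * \<i> * of_real (u t)))"
    if f: "continuous_on {0..1} f" "\<And>t. norm (f t) = 1" for f :: "real \<Rightarrow> complex"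
  proof -
    have "contractible {0..1::real}" by (rule convex_imp_contractible) simp
    moreover have "f t \<noteq> 0" for t using f(2)[of t] by auto
    ultimately obtain h where h: "continuous_on {0..1} h" "\<And>t. t \<in> {0..1} \<Longrightarrow> f t = exp (h t)"
      using continuous_logarithm_on_contractible[OF f(1)] by blast
    have "f t = exp (2 * pi * \<i> * of_real (Im (h t) / (2 * pi)))" if t: "t \<in> {0..1}" for t
    proof -
      have "Re (h t) = 0" using f(2)[of t] h(2)[OF t] by simp
      then have "h t = 2 * pi * \<i> * of_real (Im (h t) / (2 * pi))" by (simp add: complex_eq_iff)
      with h(2)[OF t] show ?thesis by simp
    qed
    moreover have "continuous_on {0..1} (\<lambda>t. Im (h t) / (2 * pi))"
      by (intro continuous_intros h) auto
    ultimately show ?thesis by blast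
  qed
  obtain u where u: "continuous_on {0..1} u" "\<And>t. t \<in> {0..1} \<Longrightarrow> fst (emb (\<gamma> t)) = exp (2 * pi * \<i> * of_real (u t))"
    using log[OF continuous_on_fst[OF cont] nz(3)] by blast
  obtain v where v: "continuous_on {0..1} v" "\<And>t. t \<in> {0..1} \<Longrightarrow> snd (emb (\<gamma> t)) = exp (2 * pi * \<i> * of_real (v t))"
    using log[OF continuous_on_snd[OF cont] nz(4)] by blast
  define g where "g t = of_real (u t) + of_real (v t) * \<tau>" for t
  have g: "continuous_on {0..1} g" unfolding g_def by (intro continuous_intros u v)
  have gcls: "g t \<in> \<Omega> \<and> cls \<tau> (g t) = \<gamma> t" if t: "t \<in> {0..1}" for t
  proof -
    obtain z where z: "z \<in> \<Omega>" "\<gamma> t = cls \<tau> z" using \<gamma>_in[OF t] by auto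
    have "torus_emb \<tau> (g t) = emb (\<gamma> t)"
      using u(2)[OF t] v(2)[OF t] by (simp add: torus_emb_def g_def tau prod_eq_iff)
    then have "cls \<tau> (g t) = \<gamma> t" by (simp add: z emb_cls torus_emb_eq_iff[OF tau] cls_eq_iff)
    moreover from this have "g t \<in> \<Omega>" using z cls_in_image_iff by (metis imageI)
    ultimately show ?thesis by simp
  qed
  \<comment> \<open>The claim on a subinterval, arranged for bisection: it is additive over adjacent
    intervals and holds on short ones. The guard confines it to [0, 1], as the short intervals
    around a point may stick out.\<close>
  define Q where "Q a b \<longleftrightarrow> (0 \<le> a \<and> b \<le> 1 \<longrightarrow> (\<exists>K. finite K \<and> (\<forall>t\<in>{a<..<b} - K. g differentiable (at t))))"
    for a b :: real
  have "0 \<le> (1 :: real)" by simp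
  then have "Q 0 1"
  proof (induction rule: Bolzano)
    case (trans a b c)
    show ?case unfolding Q_def
    proof
      assume ac: "0 \<le> a \<and> c \<le> 1"
      then obtain K L where K: "finite K" "\<forall>t\<in>{a<..<b} - K. g differentiable (at t)"
        and L: "finite L" "\<forall>t\<in>{b<..<c} - L. g differentiable (at t)"
        using trans unfolding Q_def by auto
      have "g differentiable (at t)" if "t \<in> {a<..<c} - (K \<union> L \<union> {b})" for t
        by (cases "t < b") (use that K(2) L(2) in auto)
      then show "\<exists>K. finite K \<and> (\<forall>t\<in>{a<..<c} - K. g differentiable (at t))"
        using K(1) L(1) by (intro exI[of _ "K \<union> L \<union> {b}"]) auto
    qed
  next
    case (local x)
    then have x: "x \<in> {0..1}" by simp
    obtain c where c: "c \<in> charts S" "cls \<tau> (g x) \<in> fst c" using cover gcls[OF x] by blast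
    obtain W where W: "W \<subseteq> \<Omega>" "lattice_chart \<tau> c W" using chart[OF c(1)] by blast
    obtain \<omega> where \<omega>: "\<omega> \<in> lattice \<tau>" "g x + \<omega> \<in> W"
      "\<And>z'. z' + \<omega> \<in> W \<Longrightarrow> cls \<tau> z' \<in> fst c \<and> snd c (cls \<tau> z') = z' + \<omega>"
      using lattice_chart_local[OF W(2) c(2)] by blast
    have "open ((\<lambda>z. z + \<omega>) -` W)"
      using lattice_chartD(1)[OF W(2)] by (intro open_vimage continuous_intros)
    then obtain e where e: "e > 0" "ball (g x) e \<subseteq> (\<lambda>z. z + \<omega>) -` W"
      using \<omega>(2) openE by blast
    obtain d where d: "d > 0" "\<And>t. t \<in> {0..1} \<Longrightarrow> dist t x < d \<Longrightarrow> dist (g t) (g x) < e"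
      using g x e(1) unfolding continuous_on_iff by blast
    have near: "\<gamma> t \<in> fst c \<and> snd c (\<gamma> t) = g t + \<omega>" if "t \<in> {0..1}" "dist t x < d" for t
    proof -
      have "g t + \<omega> \<in> W" using d(2)[OF that] e(2) by (auto simp: dist_commute)
      from \<omega>(3)[OF this] show ?thesis using gcls[OF that(1)] by simp
    qed
    show ?case
    proof (intro exI[of _ d] conjI allI impI d(1))
      fix a b assume ab: "a \<le> x \<and> x \<le> b \<and> b - a < d"
      show "Q a b" unfolding Q_def
      proof
        assume ab': "0 \<le> a \<and> b \<le> 1"
        show "\<exists>K. finite K \<and> (\<forall>t\<in>{a<..<b} - K. g differentiable (at t))"
        proof (cases "a < b")
          case True
          have nr: "\<gamma> t \<in> fst c \<and> snd c (\<gamma> t) = g t + \<omega>" if "t \<in> {a..b}" for t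
            using near[of t] ab ab' that by (auto simp: dist_real_def)
          then have "(snd c \<circ> \<gamma>) piecewise_C1_differentiable_on {a..b}"
            using assms c(1) True ab' unfolding pC1_path_def by blast
          then obtain K where K: "finite K" "\<And>t. t \<in> {a..b} - K \<Longrightarrow> (snd c \<circ> \<gamma>) differentiable (at t)"
            unfolding piecewise_C1_differentiable_on_def C1_differentiable_on_eq by blast
          have "g differentiable (at t)" if t: "t \<in> {a<..<b} - K" for t
          proof -
            have "(snd c \<circ> \<gamma>) differentiable (at t)" using K(2) t by auto
            then obtain D where D: "((snd c \<circ> \<gamma>) has_derivative D) (at t)" by (auto simp: differentiable_def)
            have "((\<lambda>t. (snd c \<circ> \<gamma>) t - \<omega>) has_derivative D) (at t)"
              using has_derivative_diff[OF D has_derivative_const[of \<omega>]] by simp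
            then have "(g has_derivative D) (at t)"
              by (rule has_derivative_transform_within_open[where s = "{a<..<b}"]) (use t nr in auto)
            then show ?thesis by (auto simp: differentiable_def)
          qed
          then show ?thesis using K(1) by blast
        qed (auto intro: exI[of _ "{}"])
      qed
    qed
  qed
  then obtain K where "finite K" "\<And>t. t \<in> {0<..<1} - K \<Longrightarrow> g differentiable (at t)"
    unfolding Q_def by auto
  then show ?thesis using that[OF g gcls] by blast
qed

text \<open>In a chart the image of the segment is the segment plus a lattice vector that is locally
  constant in the parameter, hence constant on the interval.\<close>

lemma pC1_path_segment:
  assumes "closed_segment z w \<subseteq> \<Omega>"
  shows "pC1_path S (\<lambda>t. cls \<tau> (linepath z w t))"
  unfolding pC1_path_def
proof (intro conjI ballI allI impI)
  let ?g = "linepath z w"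
  have in\<Omega>: "?g t \<in> \<Omega>" if "t \<in> {0..1}" for t
    using assms that linepath_in_path[of t z w] by auto
  show "pathin (stop S) (\<lambda>t. cls \<tau> (?g t))"
    unfolding pathin_def
    by (rule continuous_map_compose[OF _ continuous_map_cls, unfolded o_def])
      (use in\<Omega> in \<open>auto simp: continuous_map_in_subtopology intro: continuous_on_linepath\<close>)
  fix c a b assume c: "c \<in> charts S" and ab: "0 \<le> a \<and> a < b \<and> b \<le> 1 \<and> (\<lambda>t. cls \<tau> (?g t)) ` {a..b} \<subseteq> fst c"
  obtain W where W: "W \<subseteq> \<Omega>" "lattice_chart \<tau> c W" using chart[OF c] by blast
  define k where "k t = snd c (cls \<tau> (?g t)) - ?g t" for t
  have "k constant_on {a..b}"
  proof (rule locally_constant_imp_constant)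
    fix x assume x: "x \<in> {a..b}"
    obtain \<omega> where \<omega>: "\<omega> \<in> lattice \<tau>" "?g x + \<omega> \<in> W"
      "\<And>z'. z' + \<omega> \<in> W \<Longrightarrow> cls \<tau> z' \<in> fst c \<and> snd c (cls \<tau> z') = z' + \<omega>"
      using lattice_chart_local[OF W(2), of "?g x"] ab x by (metis image_subset_iff)
    have op: "open ((\<lambda>t. ?g t + \<omega>) -` W)"
      using lattice_chartD(1)[OF W(2)]
      by (intro open_vimage continuous_intros continuous_on_linepath)
    have k: "k t = \<omega>" if "?g t + \<omega> \<in> W" for t using \<omega>(3)[OF that] by (simp add: k_def)
    show "\<exists>T. openin (top_of_set {a..b}) T \<and> x \<in> T \<and> (\<forall>t\<in>T. k t = k x)"
      by (intro exI[of _ "{a..b} \<inter> (\<lambda>t. ?g t + \<omega>) -` W"] conjI openin_open_Int op)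
        (use x \<omega>(2) k in auto)
  qed simp
  then obtain \<omega> where \<omega>: "\<And>t. t \<in> {a..b} \<Longrightarrow> k t = \<omega>" by (auto simp: constant_on_def)
  then have eq: "(snd c \<circ> (\<lambda>t. cls \<tau> (?g t))) t = ?g t + \<omega>" if "t \<in> {a..b}" for t
    using that by (simp add: k_def algebra_simps)
  show "(snd c \<circ> (\<lambda>t. cls \<tau> (?g t))) piecewise_C1_differentiable_on {a..b}"
    unfolding piecewise_C1_differentiable_on_def
  \<comment> \<open>The formula in the chart is known only on the closed interval, so a two-sided
    derivative is available only in the interior; the endpoints become exceptional points.\<close>
  proof (intro conjI exI[of _ "{a, b}"])
    show "continuous_on {a..b} (snd c \<circ> (\<lambda>t. cls \<tau> (?g t)))"
      by (rule continuous_on_eq[where f = "\<lambda>t. ?g t + \<omega>"])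
        (use eq in \<open>auto intro!: continuous_intros continuous_on_linepath\<close>)
    show "(snd c \<circ> (\<lambda>t. cls \<tau> (?g t))) C1_differentiable_on ({a..b} - {a, b})"
      unfolding C1_differentiable_on_def
    proof (intro exI[of _ "\<lambda>_. w - z"] conjI ballI)
      fix t assume t: "t \<in> {a..b} - {a, b}"
      have "((\<lambda>t. ?g t + \<omega>) has_vector_derivative w - z) (at t)"
        unfolding linepath_def by (auto intro!: derivative_eq_intros simp: algebra_simps)
      then show "((snd c \<circ> (\<lambda>t. cls \<tau> (?g t))) has_vector_derivative w - z) (at t)"
        by (rule has_vector_derivative_transform_within_open[where S = "{a<..<b}"])
          (use t eq in auto)
    qed auto
  qed auto
qed

end


section \<open>The torus and the punctured torus as lattice quotients\<close>

lemma openin_torus: "openin (stop (torus \<tau>)) U \<longleftrightarrow> U \<subseteq> range (cls \<tau>) \<and> open (cls \<tau> -` U)"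
proof -
  have "istopology (\<lambda>U. U \<subseteq> range (cls \<tau>) \<and> open (cls \<tau> -` U))"
    unfolding istopology_def
  proof (intro conjI allI impI)
    fix K assume "\<forall>U\<in>K. U \<subseteq> range (cls \<tau>) \<and> open (cls \<tau> -` U)"
    then show "\<Union> K \<subseteq> range (cls \<tau>)" "open (cls \<tau> -` \<Union> K)"
      by (auto simp: vimage_Union)
  qed (auto intro: open_Int)
  then show ?thesis by (simp add: torus_def topology_inverse')
qed

lemma lattice_quotient_torus:
  assumes \<tau>: "Im \<tau> > 0" shows "lattice_quotient \<tau> (torus \<tau>) UNIV"
proof
  fix c assume "c \<in> charts (torus \<tau>)"
  then obtain V where V: "c = (cls \<tau> ` V, inv_into V (cls \<tau>))" "open V" "inj_on (cls \<tau>) V"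
    by (auto simp: torus_def)
  then show "\<exists>W. W \<subseteq> UNIV \<and> lattice_chart \<tau> c W"
    by (intro exI[of _ V]) (auto simp: lattice_chart_def)
next
  fix z :: complex
  obtain r where r: "r > 0" "ball 0 r \<inter> lattice \<tau> = {0}"
    using lattice_isolated[OF \<tau>] by blast
  define V where "V = ball z (r / 2)"
  have "inj_on (cls \<tau>) V"
  proof (rule inj_onI)
    fix x y assume xy: "x \<in> V" "y \<in> V" "cls \<tau> x = cls \<tau> y"
    have "dist x y < r" using xy dist_triangle_half_r[of z x r y] by (simp add: V_def)
    then have "x - y \<in> ball 0 r \<inter> lattice \<tau>" using xy(3) by (simp add: cls_eq_iff dist_norm norm_minus_commute)
    then show "x = y" unfolding r(2) by simp
  qed
  moreover have "open V" by (simp add: V_def)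
  ultimately have "(cls \<tau> ` V, inv_into V (cls \<tau>)) \<in> charts (torus \<tau>)"
    by (auto simp: torus_def)
  moreover have "z \<in> V" using r by (simp add: V_def)
  ultimately show "\<exists>c\<in>charts (torus \<tau>). cls \<tau> z \<in> fst c" by force
qed (auto simp: \<tau> openin_torus connected_UNIV)

lemma cls_eq_0_iff: "cls \<tau> z = cls \<tau> 0 \<longleftrightarrow> z \<in> lattice \<tau>"
  by (simp add: cls_eq_iff)

abbreviation punctured_torus :: "complex \<Rightarrow> complex set surface" where
  "punctured_torus \<tau> \<equiv> puncture (torus \<tau>) {cls \<tau> 0}"

lemma lattice_quotient_puncture:
  assumes \<tau>: "Im \<tau> > 0"
  shows "lattice_quotient \<tau> (punctured_torus \<tau>) (- lattice \<tau>)"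
proof -
  interpret T: lattice_quotient \<tau> "torus \<tau>" UNIV by (rule lattice_quotient_torus[OF \<tau>])
  have img: "cls \<tau> ` (V \<inter> - lattice \<tau>) = cls \<tau> ` V - {cls \<tau> 0}" for V
    using cls_eq_0_iff by auto
  have vim: "cls \<tau> -` (A - {cls \<tau> 0}) = cls \<tau> -` A \<inter> - lattice \<tau>" for A
    using cls_eq_0_iff by auto
  show ?thesis
  proof
    fix U
    show "openin (stop (punctured_torus \<tau>)) U \<longleftrightarrow> U \<subseteq> cls \<tau> ` (- lattice \<tau>) \<and> open (cls \<tau> -` U)"
    proof
      assume "openin (stop (punctured_torus \<tau>)) U"
      then obtain A where A: "openin (stop (torus \<tau>)) A" "U = A \<inter> (topspace (stop (torus \<tau>)) - {cls \<tau> 0})"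
        by (auto simp: puncture_def openin_subtopology)
      have "U = A - {cls \<tau> 0}" using A openin_subset by blast
      moreover have "A \<subseteq> range (cls \<tau>)" "open (cls \<tau> -` A)" using A(1) by (auto simp: openin_torus)
      ultimately show "U \<subseteq> cls \<tau> ` (- lattice \<tau>) \<and> open (cls \<tau> -` U)"
        using img[of UNIV] vim[of A] open_Compl_lattice[OF \<tau>] by (auto intro: open_Int)
    next
      assume U: "U \<subseteq> cls \<tau> ` (- lattice \<tau>) \<and> open (cls \<tau> -` U)"
      then have "openin (stop (torus \<tau>)) U" by (auto simp: openin_torus)
      moreover have "U \<subseteq> topspace (stop (torus \<tau>)) - {cls \<tau> 0}"
        using U img[of UNIV] by (auto simp: T.topspace_eq)
      ultimately show "openin (stop (punctured_torus \<tau>)) U"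
        unfolding puncture_def by (auto simp: openin_subtopology)
    qed
  next
    fix c assume "c \<in> charts (punctured_torus \<tau>)"
    then obtain V where V: "c = (cls \<tau> ` V - {cls \<tau> 0}, inv_into V (cls \<tau>))" "open V" "inj_on (cls \<tau>) V"
      by (auto simp: puncture_def torus_def)
    have "lattice_chart \<tau> c (V \<inter> - lattice \<tau>)"
      unfolding lattice_chart_def
    proof (intro conjI ballI)
      show "open (V \<inter> - lattice \<tau>)" by (rule open_Int[OF V(2) open_Compl_lattice[OF \<tau>]])
      show "inj_on (cls \<tau>) (V \<inter> - lattice \<tau>)" by (rule inj_on_subset[OF V(3)]) blast
      show "fst c = cls \<tau> ` (V \<inter> - lattice \<tau>)" unfolding img by (simp add: V(1))
      fix z assume "z \<in> V \<inter> - lattice \<tau>"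
      then show "snd c (cls \<tau> z) = z" using inv_into_f_f[OF V(3), of z] by (simp add: V(1))
    qed
    then show "\<exists>W. W \<subseteq> - lattice \<tau> \<and> lattice_chart \<tau> c W"
      by (intro exI[of _ "V \<inter> - lattice \<tau>"] conjI Int_lower2)
  next
    fix z assume z: "z \<in> - lattice \<tau>"
    obtain c where c: "c \<in> charts (torus \<tau>)" "cls \<tau> z \<in> fst c" using T.cover[of z] by blast
    then have "(fst c - {cls \<tau> 0}, snd c) \<in> charts (punctured_torus \<tau>)"
      by (auto simp: puncture_def intro!: image_eqI[of _ _ c] split: prod.splits)
    then show "\<exists>c\<in>charts (punctured_torus \<tau>). cls \<tau> z \<in> fst c"
      using c(2) z cls_eq_0_iff by (intro bexI) auto
  next
    show "- lattice \<tau> \<noteq> {}" using half_not_lattice(1)[OF \<tau>] by blast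
    show "z + \<omega> \<in> - lattice \<tau>" if "z \<in> - lattice \<tau>" "\<omega> \<in> lattice \<tau>" for z \<omega>
      using that lattice_add_iff by blast
  qed (use \<tau> open_Compl_lattice connected_Compl_lattice in auto)
qed

context lattice_quotient
begin

text \<open>Used for the compactification: the surface is literally the torus minus a point, so the
  biholomorphism is the identity. Its inverse is only known to be the identity on the carrier, hence
  the form of the assumption.\<close>

lemma holomorphic_map_ident:
  assumes "\<And>p. p \<in> topspace (stop S) \<Longrightarrow> h p = p"
  shows "holomorphic_map S S h"
  unfolding holomorphic_map_def
proof (intro conjI ballI)
  have "continuous_map (stop S) (stop S) id" by simp
  then show "continuous_map (stop S) (stop S) h"
    by (rule continuous_map_eq) (use assms in auto)
  fix c d assume c: "c \<in> charts S" and d: "d \<in> charts S"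
  obtain W where W: "W \<subseteq> \<Omega>" "lattice_chart \<tau> c W" using chart[OF c] by blast
  obtain W' where W': "lattice_chart \<tau> d W'" using chart[OF d] by blast
  note cd = lattice_chartD[OF W(2)]
  have h: "h p = p" if "p \<in> fst c" for p
    using that assms W(1) cd(3) by (auto simp: topspace_eq)
  then have eq: "fst c \<inter> h -` fst d = fst c \<inter> fst d" by auto
  show "(snd d \<circ> h \<circ> param c) holomorphic_on snd c ` (fst c \<inter> h -` fst d)"
    unfolding eq
  proof (rule holomorphic_transform[OF holomorphic_transition[OF c W']])
    fix z assume "z \<in> snd c ` (fst c \<inter> fst d)"
    then have "z \<in> W" using cd(3,4) by auto
    then have "param c z \<in> fst c" using cd(3,6) by auto
    then show "transition c d z = (snd d \<circ> h \<circ> param c) z" by (simp add: transition_def h)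
  qed
qed

lemma form_chart_indep:
  assumes \<omega>: "holomorphic_form S \<omega>" and c: "c \<in> charts S" "p \<in> fst c" and d: "d \<in> charts S" "p \<in> fst d"
  shows "\<omega> c p = \<omega> d p"
proof -
  obtain W where W: "lattice_chart \<tau> c W" using chart[OF c(1)] by blast
  obtain W' where W': "lattice_chart \<tau> d W'" using chart[OF d(1)] by blast
  obtain w where w: "w \<in> W" "p = cls \<tau> w" using c(2) lattice_chartD(3)[OF W] by auto
  have "deriv (transition c d) w = 1"
    by (rule DERIV_imp_deriv, rule transition_local(1)[OF W W' w(1)]) (use d w in auto)
  moreover have "snd c p = w" using w lattice_chartD(4)[OF W] by auto
  moreover have "\<omega> c p = \<omega> d p * deriv (transition c d) (snd c p)"
    using \<omega> c d unfolding holomorphic_form_def by blast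
  ultimately show ?thesis by simp
qed

text \<open>The coefficient of a form is the same in all charts at a point, so it pulls back to a
  holomorphic function on \<Omega>; the form is that function times dz.\<close>

lemma holomorphic_form_lift:
  assumes "holomorphic_form S \<omega>"
  shows "(\<lambda>z. \<omega> (chart_at S (cls \<tau> z)) (cls \<tau> z)) holomorphic_on \<Omega>" (is "?f holomorphic_on _")
proof -
  have "?f field_differentiable (at z)" if z: "z \<in> \<Omega>" for z
  proof -
    obtain d where d: "d \<in> charts S" "cls \<tau> z \<in> fst d" using cover[OF z] by blast
    obtain W where W: "W \<subseteq> \<Omega>" "lattice_chart \<tau> d W" using chart[OF d(1)] by blast
    note cd = lattice_chartD[OF W(2)]
    obtain \<xi> where \<xi>: "\<xi> \<in> lattice \<tau>" "z + \<xi> \<in> W"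
      "\<And>z'. z' + \<xi> \<in> W \<Longrightarrow> cls \<tau> z' \<in> fst d \<and> snd d (cls \<tau> z') = z' + \<xi>"
      using lattice_chart_local[OF W(2) d(2)] by blast
    have "(\<omega> d \<circ> param d) holomorphic_on W"
      using assms d(1) cd(5) unfolding holomorphic_form_def by metis
    then obtain D where "((\<omega> d \<circ> param d) has_field_derivative D) (at (z + \<xi>))"
      using holomorphic_derivI[OF _ cd(1) \<xi>(2)] by blast
    then have "((\<lambda>z. (\<omega> d \<circ> param d) (z + \<xi>)) has_field_derivative D) (at z)"
      by (rule DERIV_shift_complex)
    moreover have "open ((\<lambda>z. z + \<xi>) -` W)"
      using cd(1) by (intro open_vimage continuous_intros)
    ultimately have "(?f has_field_derivative D) (at z)"
    proof (rule has_field_derivative_transform_within_open)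
      fix w assume "w \<in> (\<lambda>z. z + \<xi>) -` W"
      then have w: "w + \<xi> \<in> W" by simp
      have "cls \<tau> w \<in> fst d" using \<xi>(3)[OF w] by blast
      then have "chart_at S (cls \<tau> w) \<in> charts S \<and> cls \<tau> w \<in> fst (chart_at S (cls \<tau> w))"
        unfolding chart_at_def using someI[of "\<lambda>c. c \<in> charts S \<and> cls \<tau> w \<in> fst c" d] d(1) by blast
      with form_chart_indep[OF assms] d(1) \<open>cls \<tau> w \<in> fst d\<close>
      have "?f w = \<omega> d (cls \<tau> w)" by blast
      moreover have "param d (w + \<xi>) = cls \<tau> w" using cd(6)[OF w] \<xi>(1) by simp
      ultimately show "(\<omega> d \<circ> param d) (w + \<xi>) = ?f w" by simp
    qed (use \<xi>(2) in auto)
    then show ?thesis by (auto simp: field_differentiable_def)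
  qed
  then show ?thesis by (simp add: holomorphic_on_def field_differentiable_at_within)
qed

lemma chart_at:
  assumes "z \<in> \<Omega>"
  shows "chart_at S (cls \<tau> z) \<in> charts S" "cls \<tau> z \<in> fst (chart_at S (cls \<tau> z))"
proof -
  obtain d where d: "d \<in> charts S" "cls \<tau> z \<in> fst d" using cover[OF assms] by blast
  then have "chart_at S (cls \<tau> z) \<in> charts S \<and> cls \<tau> z \<in> fst (chart_at S (cls \<tau> z))"
    unfolding chart_at_def using someI[of "\<lambda>c. c \<in> charts S \<and> cls \<tau> z \<in> fst c" d] by blast
  then show "chart_at S (cls \<tau> z) \<in> charts S" "cls \<tau> z \<in> fst (chart_at S (cls \<tau> z))" by auto
qed

end

section \<open>Compactness of the torus, its genus, and meromorphic extension over the
  puncture\<close>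

lemma compact_space_torus:
  assumes \<tau>: "Im \<tau> > 0" shows "compact_space (stop (torus \<tau>))"
proof -
  interpret T: lattice_quotient \<tau> "torus \<tau>" UNIV by (rule lattice_quotient_torus[OF \<tau>])
  have "cls \<tau> z \<in> cls \<tau> ` parallelogram \<tau>" for z
  proof -
    obtain w \<omega> where "z = w + \<omega>" "w \<in> parallelogram \<tau>" "\<omega> \<in> lattice \<tau>"
      using parallelogram_reduce[OF \<tau>] by blast
    then show ?thesis by simp
  qed
  then have "topspace (stop (torus \<tau>)) = cls \<tau> ` parallelogram \<tau>"
    by (auto simp: T.topspace_eq)
  moreover have "compactin (stop (torus \<tau>)) (cls \<tau> ` parallelogram \<tau>)"
    by (rule image_compactin[OF _ T.continuous_map_cls])
      (simp add: compact_parallelogram)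
  ultimately show ?thesis by (simp add: compact_space_def)
qed

text \<open>The coefficient function of a holomorphic form is entire and doubly periodic, so by
  Liouville the form is a multiple of dz, which has coefficient 1 in every chart.\<close>

lemma has_genus_torus:
  assumes \<tau>: "Im \<tau> > 0" shows "has_genus (torus \<tau>) 1"
proof -
  interpret T: lattice_quotient \<tau> "torus \<tau>" UNIV by (rule lattice_quotient_torus[OF \<tau>])
  let ?S = "torus \<tau>"
  let ?B = "\<lambda>(i :: nat) (c :: complex set chart) (p :: complex set). 1 :: complex"
  have "holomorphic_form ?S (?B i)" for i
    unfolding holomorphic_form_def
  proof (intro conjI ballI)
    fix c d p assume c: "c \<in> charts ?S" and d: "d \<in> charts ?S" and p: "p \<in> fst c \<inter> fst d"
    obtain W where W: "lattice_chart \<tau> c W" using T.chart[OF c] by blast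
    obtain W' where W': "lattice_chart \<tau> d W'" using T.chart[OF d] by blast
    obtain w where w: "w \<in> W" "p = cls \<tau> w" using p lattice_chartD(3)[OF W] by auto
    have "deriv (transition c d) w = 1"
      by (rule DERIV_imp_deriv, rule transition_local(1)[OF W W' w(1)]) (use p w in auto)
    then show "1 = 1 * deriv (transition c d) (snd c p)"
      using w lattice_chartD(4)[OF W] by auto
  qed (auto simp: o_def)
  moreover have "\<exists>!a :: nat \<Rightarrow> complex. (\<forall>i\<ge>1. a i = 0) \<and>
      (\<forall>c\<in>charts ?S. \<forall>p\<in>fst c. \<omega> c p = (\<Sum>i<1. a i * ?B i c p))" if \<omega>: "holomorphic_form ?S \<omega>" for \<omega>
  proof -
    let ?f = "\<lambda>z. \<omega> (chart_at ?S (cls \<tau> z)) (cls \<tau> z)"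
    have "?f (z + \<xi>) = ?f z" if "\<xi> \<in> lattice \<tau>" for z \<xi> using that by simp
    with periodic_entire_const[OF \<tau> T.holomorphic_form_lift[OF \<omega>]] obtain k where k: "\<And>z. ?f z = k"
      by metis
    have eq: "\<omega> c p = k" if c: "c \<in> charts ?S" "p \<in> fst c" for c p
    proof -
      obtain W where W: "lattice_chart \<tau> c W" using T.chart[OF c(1)] by blast
      obtain z where z: "p = cls \<tau> z" using c(2) lattice_chartD(3)[OF W] by auto
      have "\<omega> c p = ?f z"
        unfolding z by (rule T.form_chart_indep[OF \<omega>]) (use c z T.chart_at in auto)
      then show ?thesis using k by simp
    qed
    obtain c where c: "c \<in> charts ?S" "cls \<tau> 0 \<in> fst c" using T.cover[of 0] by blast
    show ?thesis
    proof (rule ex1I[of _ "\<lambda>i. if i = 0 then k else 0"])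
      fix a :: "nat \<Rightarrow> complex"
      assume a: "(\<forall>i\<ge>1. a i = 0) \<and> (\<forall>c\<in>charts ?S. \<forall>p\<in>fst c. \<omega> c p = (\<Sum>i<1. a i * ?B i c p))"
      then have "\<omega> c (cls \<tau> 0) = a 0" using c by (simp only: lessThan_Suc One_nat_def) simp
      then have "a 0 = k" using eq[OF c] by simp
      then show "a = (\<lambda>i. if i = 0 then k else 0)" using a by (auto simp: fun_eq_iff)
    qed (use eq in auto)
  qed
  ultimately show ?thesis
    unfolding has_genus_def using T.riemann_surface compact_space_torus[OF \<tau>]
    by (intro conjI exI[of _ ?B]) blast+
qed

text \<open>Off the lattice \<open>H\<close> is \<open>f\<close> in the chart, and every lattice
  point carries a translate of the pole at 0; the value of \<open>H\<close> at the class of 0 is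
  immaterial.\<close>

lemma meromorphic_on_torus_chart:
  assumes \<tau>: "Im \<tau> > 0" and c: "c \<in> charts (torus \<tau>)"
    and f: "f holomorphic_on - lattice \<tau>" "is_pole f 0"
    and H: "\<And>z. z \<notin> lattice \<tau> \<Longrightarrow> H (cls \<tau> z) = f z"
  shows "(H \<circ> param c) meromorphic_on chart_img c"
proof -
  interpret T: lattice_quotient \<tau> "torus \<tau>" UNIV by (rule lattice_quotient_torus[OF \<tau>])
  obtain W where W: "lattice_chart \<tau> c W" using T.chart[OF c] by blast
  note cd = lattice_chartD[OF W]
  have Hc: "(H \<circ> param c) z = f z" if "z \<in> W" "z \<notin> lattice \<tau>" for z
    using cd(6)[OF that(1)] H[OF that(2)] by simp
  show ?thesis
    unfolding meromorphic_on_altdef cd(5)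
  proof
    fix z assume z: "z \<in> W"
    have near: "eventually (\<lambda>w. f w = (H \<circ> param c) w) (at z)"
      using eventually_not_lattice[OF \<tau>, of z] eventually_at_in_open'[OF cd(1) z]
      by eventually_elim (use Hc in auto)
    have op: "open (- (lattice \<tau> - {z}))" by (rule open_Compl_lattice_subset[OF \<tau>]) auto
    have "isolated_singularity_at f z"
      by (rule isolated_singularity_at_holomorphic[OF _ op])
        (use holomorphic_on_subset[OF f(1)] in auto)
    moreover have "not_essential f z"
    proof (cases "z \<in> lattice \<tau>")
      case False
      then show ?thesis
        by (intro not_essential_holomorphic[OF f(1) _ open_Compl_lattice[OF \<tau>]]) auto
    next
      case True
      have per: "f (z + w) = f w" if w: "w \<notin> lattice \<tau>" for w
      proof -
        have "z + w \<notin> lattice \<tau>" using w lattice_add_iff[OF True, of w] by (simp add: add.commute)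
        then have "f (z + w) = H (cls \<tau> (w + z))" using H by (simp add: add.commute)
        then show ?thesis using H[OF w] True by simp
      qed
      have "eventually (\<lambda>w. f (z + w) = f w) (at 0)"
        using eventually_not_lattice[OF \<tau>, of 0] by eventually_elim (rule per)
      then have "is_pole (\<lambda>w. f (z + w)) 0"
        using f(2) is_pole_cong[of "\<lambda>w. f (z + w)" f 0 0] by blast
      then have "is_pole f z" using is_pole_shift_0 by blast
      then show ?thesis by (auto simp: not_essential_def)
    qed
    ultimately show "isolated_singularity_at (H \<circ> param c) z \<and> not_essential (H \<circ> param c) z"
      using isolated_singularity_at_cong[OF near refl] not_essential_cong[OF near refl] by blast
  qed
qed

lemma front_has_genus_1:
  assumes \<tau>: "Im \<tau> > 0"
    and f: "f holomorphic_on - lattice \<tau>" "is_pole f 0" "\<And>z. z \<notin> lattice \<tau> \<Longrightarrow> F (cls \<tau> z) = f z"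
    and g: "g holomorphic_on - lattice \<tau>" "is_pole g 0" "\<And>z. z \<notin> lattice \<tau> \<Longrightarrow> G (cls \<tau> z) = g z"
  shows "front_has_genus (punctured_torus \<tau>) F G 1"
proof -
  interpret Q: lattice_quotient \<tau> "punctured_torus \<tau>" "- lattice \<tau>" by (rule lattice_quotient_puncture[OF \<tau>])
  interpret T: lattice_quotient \<tau> "torus \<tau>" UNIV by (rule lattice_quotient_torus[OF \<tau>])
  let ?X = "topspace (stop (punctured_torus \<tau>))"
  have inv: "inv_into ?X id p = p" if "p \<in> ?X" for p
    using inv_into_f_f[of id ?X p] that by simp
  have "biholomorphic_map (punctured_torus \<tau>) (punctured_torus \<tau>) id"
    unfolding biholomorphic_map_def
    by (intro conjI Q.holomorphic_map_ident inv) auto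
  moreover have "((F \<circ> inv_into ?X id) \<circ> param c) meromorphic_on chart_img c \<and>
      ((G \<circ> inv_into ?X id) \<circ> param c) meromorphic_on chart_img c" if c: "c \<in> charts (torus \<tau>)" for c
    using inv f(3) g(3)
    by (intro conjI meromorphic_on_torus_chart[OF \<tau> c f(1,2)] meromorphic_on_torus_chart[OF \<tau> c g(1,2)])
      (auto simp: Q.topspace_eq)
  ultimately show ?thesis
    unfolding front_has_genus_def
    using has_genus_torus[OF \<tau>] T.topspace_eq
    by (intro exI[of _ "torus \<tau>"] exI[of _ "{cls \<tau> 0}"] exI[of _ id]) auto
qed


section \<open>The Weierstrass data\<close>

text \<open>The data are a \<open>wp'\<close> and \<open>wp\<close>, evaluated at a representative
  of the class. The factor a is chosen in the end so that the periods become imaginary.\<close>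

definition front_F :: "complex \<Rightarrow> complex \<Rightarrow> complex set \<Rightarrow> complex" where
  "front_F \<tau> a p = a * wp' \<tau> (cls_rep p)"

definition front_G :: "complex \<Rightarrow> complex set \<Rightarrow> complex" where
  "front_G \<tau> p = wp \<tau> (cls_rep p)"

lemma cls_rep_add:
  obtains \<omega> where "\<omega> \<in> lattice \<tau>" "cls_rep (cls \<tau> z) = z + \<omega>"
  using cls_eqE[OF cls_rep[of \<tau> z, symmetric]] by blast

lemma front_F_cls: "front_F \<tau> a (cls \<tau> z) = a * wp' \<tau> z"
  by (rule cls_rep_add[of \<tau> z]) (simp add: front_F_def wp'_period)

lemma front_G_cls: "Im \<tau> > 0 \<Longrightarrow> z \<notin> lattice \<tau> \<Longrightarrow> front_G \<tau> (cls \<tau> z) = wp \<tau> z"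
  by (rule cls_rep_add[of \<tau> z]) (simp add: front_G_def wp_period)

text \<open>A primitive of \<open>\<wp>'\<^sup>2\<close>; its periods are \<open>p\<^sub>1/5\<close> and \<open>p\<^sub>2/5\<close>.\<close>

definition wp'_sq_prim :: "complex \<Rightarrow> complex \<Rightarrow> complex" where
  "wp'_sq_prim \<tau> z = 2 / 5 * wp \<tau> z * wp' \<tau> z + 2 / 5 * eis_g2 \<tau> * wzeta \<tau> z - 3 / 5 * eis_g3 \<tau> * z"

lemma wp'_sq_prim_deriv:
  assumes \<tau>: "Im \<tau> > 0" and z: "z \<notin> lattice \<tau>"
  shows "(wp'_sq_prim \<tau> has_field_derivative wp' \<tau> z ^ 2) (at z)"
proof -
  have "(wp'_sq_prim \<tau> has_field_derivative
      (2 / 5 * (wp' \<tau> z * wp' \<tau> z + wp \<tau> z * wp'' \<tau> z) + 2 / 5 * eis_g2 \<tau> * - wp \<tau> z - 3 / 5 * eis_g3 \<tau>)) (at z)"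
    unfolding wp'_sq_prim_def[abs_def]
    by (auto intro!: derivative_eq_intros wp_deriv[OF \<tau> z] wp'_deriv[OF \<tau> z] wzeta_deriv[OF \<tau> z]
        simp: algebra_simps)
  also have "2 / 5 * (wp' \<tau> z * wp' \<tau> z + wp \<tau> z * wp'' \<tau> z) + 2 / 5 * eis_g2 \<tau> * - wp \<tau> z - 3 / 5 * eis_g3 \<tau>
      = wp' \<tau> z ^ 2"
  proof -
    \<comment> \<open>Multiplied by 5, the claim reads 2 wp'^2 + 3 (4 wp^3 - g2 wp - g3) = 5 wp'^2
      once \<open>wp''\<close> is expanded, and the bracket is wp'^2 by
      \<open>wp'_square\<close>.\<close>
    have "5 * (2 / 5 * (wp' \<tau> z * wp' \<tau> z + wp \<tau> z * wp'' \<tau> z) + 2 / 5 * eis_g2 \<tau> * - wp \<tau> z - 3 / 5 * eis_g3 \<tau>)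
      = 2 * wp' \<tau> z ^ 2 + 2 * wp \<tau> z * wp'' \<tau> z - 2 * eis_g2 \<tau> * wp \<tau> z - 3 * eis_g3 \<tau>"
      by (simp add: power2_eq_square algebra_simps)
    also have "\<dots> = 2 * wp' \<tau> z ^ 2 + 3 * (4 * wp \<tau> z ^ 3 - eis_g2 \<tau> * wp \<tau> z - eis_g3 \<tau>)"
      by (simp add: wp''_def power2_eq_square power3_eq_cube algebra_simps)
    also have "\<dots> = 5 * wp' \<tau> z ^ 2" using wp'_square[OF \<tau> z] by simp
    finally show ?thesis by (simp only: mult_cancel_left) simp
  qed
  finally show ?thesis .
qed

lemma wp'_sq_prim_period:
  assumes \<tau>: "Im \<tau> > 0" and z: "z \<notin> lattice \<tau>"
  shows "wp'_sq_prim \<tau> (z + 1) = wp'_sq_prim \<tau> z + (2 * eis_g2 \<tau> * eta1 \<tau> - 3 * eis_g3 \<tau>) / 5"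
    and "wp'_sq_prim \<tau> (z + \<tau>) = wp'_sq_prim \<tau> z + (2 * eis_g2 \<tau> * eta2 \<tau> - 3 * eis_g3 \<tau> * \<tau>) / 5"
  unfolding wp'_sq_prim_def wp_period[OF \<tau> lattice_1 z] wp_period[OF \<tau> lattice_tau z]
    wp'_period[OF lattice_1] wp'_period[OF lattice_tau] wzeta_period[OF \<tau> z]
  by (simp_all add: field_simps)

section \<open>Period condition and existence of the front\<close>

context
  fixes \<tau> a :: complex
  assumes \<tau>: "Im \<tau> > 0" and a: "a \<noteq> 0"
begin

interpretation Q: lattice_quotient \<tau> "punctured_torus \<tau>" "- lattice \<tau>"
  by (rule lattice_quotient_puncture[OF \<tau>])

lemma dcoef_front:
  assumes "c \<in> charts (punctured_torus \<tau>)" "z \<notin> lattice \<tau>" "cls \<tau> z \<in> fst c"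
  shows "dcoef c (front_F \<tau> a) (cls \<tau> z) = a * wp'' \<tau> z" "dcoef c (front_G \<tau>) (cls \<tau> z) = wp' \<tau> z"
proof -
  obtain W where W: "W \<subseteq> - lattice \<tau>" "lattice_chart \<tau> c W" using Q.chart[OF assms(1)] by blast
  obtain w where w: "w \<in> W" "cls \<tau> w = cls \<tau> z" using assms(3) lattice_chartD(3)[OF W(2)] by force
  have wl: "w \<notin> lattice \<tau>" using w W(1) by blast
  obtain \<omega> where \<omega>: "\<omega> \<in> lattice \<tau>" "z = w + \<omega>" using cls_eqE[OF w(2)] by blast
  have "((\<lambda>z. front_F \<tau> a (cls \<tau> z)) has_field_derivative a * wp'' \<tau> w) (at w)"
    unfolding front_F_cls by (rule DERIV_cmult[OF wp'_deriv[OF \<tau> wl]])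
  moreover have "((\<lambda>z. front_G \<tau> (cls \<tau> z)) has_field_derivative wp' \<tau> w) (at w)"
    by (rule has_field_derivative_transform_within_open[OF wp_deriv[OF \<tau> wl] open_Compl_lattice[OF \<tau>]])
      (use wl front_G_cls[OF \<tau>] in auto)
  ultimately have "dcoef c (front_F \<tau> a) (cls \<tau> w) = a * wp'' \<tau> w" "dcoef c (front_G \<tau>) (cls \<tau> w) = wp' \<tau> w"
    unfolding dcoef_cls[OF W(2) w(1)] by (simp_all add: DERIV_imp_deriv)
  moreover have "wp'' \<tau> z = wp'' \<tau> w" "wp' \<tau> z = wp' \<tau> w"
    unfolding \<omega>(2) wp''_def wp_period[OF \<tau> \<omega>(1) wl] wp'_period[OF \<omega>(1)] by simp_all
  ultimately show "dcoef c (front_F \<tau> a) (cls \<tau> z) = a * wp'' \<tau> z" "dcoef c (front_G \<tau>) (cls \<tau> z) = wp' \<tau> z"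
    by (simp_all only: w(2))
qed

text \<open>The fundamental theorem of calculus for the primitive along a lift g of the path, which
  tolerates the finitely many points where g is not differentiable.\<close>

lemma line_integral_front:
  assumes g: "continuous_on {0..1} g" "\<And>t. t \<in> {0..1} \<Longrightarrow> g t \<in> - lattice \<tau> \<and> cls \<tau> (g t) = \<gamma> t"
    and K: "finite K" "\<And>t. t \<in> {0<..<1} - K \<Longrightarrow> g differentiable (at t)"
  shows "line_integral (front_F \<tau> a) (front_G \<tau>) \<gamma> = a * (wp'_sq_prim \<tau> (g 1) - wp'_sq_prim \<tau> (g 0))"
proof -
  let ?H = "\<lambda>z. a * wp'_sq_prim \<tau> z"
  let ?f = "\<lambda>t. front_F \<tau> a (\<gamma> t) * vector_derivative (front_G \<tau> \<circ> \<gamma>) (at t within {0..1})"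
  have "(?f has_integral ((?H \<circ> g) 1 - (?H \<circ> g) 0)) {0..1}"
  proof (rule fundamental_theorem_of_calculus_interior_strong[OF K(1)])
    have "continuous_on (- lattice \<tau>) (wp'_sq_prim \<tau>)"
      by (intro holomorphic_on_imp_continuous_on holomorphic_on_derivI[OF wp'_sq_prim_deriv[OF \<tau>]]) auto
    then have "continuous_on (g ` {0..1}) ?H"
      by (intro continuous_intros) (rule continuous_on_subset, use g(2) in auto)
    then show "continuous_on {0..1} (?H \<circ> g)" by (rule continuous_on_compose[OF g(1)])
    fix t assume t: "t \<in> {0<..<1} - K"
    then have t': "t \<in> {0..1}" by auto
    have gt: "g t \<notin> lattice \<tau>" using g(2)[OF t'] by auto
    obtain D where D: "(g has_vector_derivative D) (at t)"
      using K(2)[OF t] vector_derivative_works by blast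
    have "(wp \<tau> \<circ> g has_vector_derivative D * wp' \<tau> (g t)) (at t)"
      by (rule field_vector_diff_chain_at[OF D wp_deriv[OF \<tau> gt]])
    then have "(front_G \<tau> \<circ> \<gamma> has_vector_derivative D * wp' \<tau> (g t)) (at t)"
    proof (rule has_vector_derivative_transform_within_open[where S = "{0<..<1}"])
      fix s :: real assume "s \<in> {0<..<1}"
      then have "g s \<notin> lattice \<tau>" "cls \<tau> (g s) = \<gamma> s" using g(2)[of s] by auto
      then show "(wp \<tau> \<circ> g) s = (front_G \<tau> \<circ> \<gamma>) s"
        using front_G_cls[OF \<tau>, of "g s"] by simp
    qed (use t in auto)
    then have v: "vector_derivative (front_G \<tau> \<circ> \<gamma>) (at t within {0..1}) = D * wp' \<tau> (g t)"
      by (rule vector_derivative_at_within_ivl) (use t in auto)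
    have "?f t = D * (a * wp' \<tau> (g t) ^ 2)"
      using g(2)[OF t'] front_F_cls[of \<tau> a "g t"] by (simp add: v power2_eq_square)
    moreover have "(?H \<circ> g has_vector_derivative D * (a * wp' \<tau> (g t) ^ 2)) (at t)"
      by (rule field_vector_diff_chain_at[OF D DERIV_cmult[OF wp'_sq_prim_deriv[OF \<tau> gt]]])
    ultimately show "(?H \<circ> g has_vector_derivative ?f t) (at t)" by simp
  qed auto
  then show ?thesis
    unfolding line_integral_def by (simp add: integral_unique algebra_simps)
qed

text \<open>The assumptions make the real part of the primitive doubly periodic, so it descends to a
  function \<open>H\<close> on the surface. The real part of each line integral is then a difference
  of values of \<open>H\<close>: it vanishes on closed curves, and \<psi> is written down with
  \<open>H\<close>.\<close>

lemma improper_affine_front_ex: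
  assumes p: "Re (a * (2 * eis_g2 \<tau> * eta1 \<tau> - 3 * eis_g3 \<tau>)) = 0"
    "Re (a * (2 * eis_g2 \<tau> * eta2 \<tau> - 3 * eis_g3 \<tau> * \<tau>)) = 0"
  shows "\<exists>\<psi>. improper_affine_front (punctured_torus \<tau>) (front_F \<tau> a) (front_G \<tau>) \<psi>"
proof -
  let ?S = "punctured_torus \<tau>"
  let ?F = "front_F \<tau> a" and ?G = "front_G \<tau>"
  define h where "h z = Re (a * wp'_sq_prim \<tau> z)" for z
  have per: "h (z + \<omega>) = h z" if z: "z \<notin> lattice \<tau>" and \<omega>: "\<omega> \<in> lattice \<tau>" for z \<omega>
  proof (rule lattice_periodic[OF _ _ z \<omega>])
    fix z assume z: "z \<notin> lattice \<tau>"
    have "h (z + 1) = h z + Re (a * (2 * eis_g2 \<tau> * eta1 \<tau> - 3 * eis_g3 \<tau>)) / 5"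
      "h (z + \<tau>) = h z + Re (a * (2 * eis_g2 \<tau> * eta2 \<tau> - 3 * eis_g3 \<tau> * \<tau>)) / 5"
      unfolding h_def wp'_sq_prim_period[OF \<tau> z] ring_distribs
      by (simp_all add: field_simps)
    then show "h (z + 1) = h z" "h (z + \<tau>) = h z" using p by simp_all
  qed
  define H where "H q = h (cls_rep q)" for q
  have H: "H (cls \<tau> z) = h z" if "z \<notin> lattice \<tau>" for z
    by (rule cls_rep_add[of \<tau> z]) (simp add: H_def per[OF that])
  have line: "Re (line_integral ?F ?G \<gamma>) = H (\<gamma> 1) - H (\<gamma> 0)" if \<gamma>: "pC1_path ?S \<gamma>" for \<gamma>
  proof -
    obtain g K where g: "continuous_on {0..1} g" "\<And>t. t \<in> {0..1} \<Longrightarrow> g t \<in> - lattice \<tau> \<and> cls \<tau> (g t) = \<gamma> t"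
      and K: "finite K" "\<And>t. t \<in> {0<..<1} - K \<Longrightarrow> g differentiable (at t)"
      by (rule Q.pC1_path_lift[OF \<gamma>]) blast
    have "g 1 \<notin> lattice \<tau>" "g 0 \<notin> lattice \<tau>" "cls \<tau> (g 1) = \<gamma> 1" "cls \<tau> (g 0) = \<gamma> 0"
      using g(2)[of 0] g(2)[of 1] by auto
    then have "H (\<gamma> 1) = h (g 1)" "H (\<gamma> 0) = h (g 0)" using H by metis+
    moreover have "Re (line_integral ?F ?G \<gamma>) = h (g 1) - h (g 0)"
      using line_integral_front[OF g K] by (simp add: h_def ring_distribs)
    ultimately show ?thesis by simp
  qed
  define \<psi> where "\<psi> q = (?G q + cnj (?F q), ((cmod (?G q))\<^sup>2 - (cmod (?F q))\<^sup>2) / 2 + (Re (?G q * ?F q) - 2 * H q))" for q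
  have "improper_affine_front ?S ?F ?G \<psi>"
    unfolding improper_affine_front_def
  proof (intro conjI ballI allI impI)
    show "riemann_surface ?S" by (rule Q.riemann_surface)
    show "holomorphic_fun ?S ?F"
      by (rule Q.holomorphic_fun_from) (unfold front_F_cls, intro holomorphic_intros holomorphic_wp' \<tau>)
    show "holomorphic_fun ?S ?G"
      by (rule Q.holomorphic_fun_from, rule holomorphic_transform[OF holomorphic_wp[OF \<tau>]])
        (use front_G_cls[OF \<tau>] in auto)
    fix c q assume c: "c \<in> charts ?S" and q: "q \<in> fst c"
    obtain W where W: "W \<subseteq> - lattice \<tau>" "lattice_chart \<tau> c W" using Q.chart[OF c] by blast
    obtain z where z: "z \<in> W" "q = cls \<tau> z" using q lattice_chartD(3)[OF W(2)] by blast
    have zl: "z \<notin> lattice \<tau>" using z W(1) by blast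
    have "wp'' \<tau> z \<noteq> 0 \<or> wp' \<tau> z \<noteq> 0" using wp''_nonzero[OF \<tau> zl] by blast
    then show "(dcoef c ?F q, dcoef c ?G q) \<noteq> (0, 0)"
      using dcoef_front[OF c zl q[unfolded z(2)]] a z(2) by simp
  next
    fix \<gamma> assume "pC1_path ?S \<gamma> \<and> \<gamma> 0 = \<gamma> 1"
    then show "Re (line_integral ?F ?G \<gamma>) = 0" using line[of \<gamma>] by simp
  next
    have half: "1 / 2 \<in> - lattice \<tau>" using half_not_lattice(1)[OF \<tau>] by simp
    show "\<exists>p\<^sub>0\<in>topspace (stop ?S). \<exists>k :: real. \<forall>\<gamma>. pC1_path ?S \<gamma> \<and> \<gamma> 0 = p\<^sub>0 \<longrightarrow>
        (let p = \<gamma> 1 in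
         \<psi> p = (?G p + cnj (?F p),
                ((cmod (?G p))\<^sup>2 - (cmod (?F p))\<^sup>2) / 2
                  + Re (?G p * ?F p - 2 * line_integral ?F ?G \<gamma>) + k))"
    \<comment> \<open>The third coordinate of \<psi> contains -2 \<open>H\<close> itself while the
      integral starts at the base point, so the additive constant restores -2 \<open>H\<close> at
      the base point.\<close>
    proof (intro bexI[of _ "cls \<tau> (1/2)"] exI[of _ "- 2 * H (cls \<tau> (1/2))"] allI impI)
      fix \<gamma> assume "pC1_path ?S \<gamma> \<and> \<gamma> 0 = cls \<tau> (1/2)"
      then show "let p = \<gamma> 1 in
         \<psi> p = (?G p + cnj (?F p),
                ((cmod (?G p))\<^sup>2 - (cmod (?F p))\<^sup>2) / 2
                  + Re (?G p * ?F p - 2 * line_integral ?F ?G \<gamma>) + - 2 * H (cls \<tau> (1/2)))"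
        using line[of \<gamma>] unfolding Let_def \<psi>_def minus_complex.sel by simp
    qed (use half in \<open>auto simp: Q.topspace_eq\<close>)
  qed
  then show ?thesis by blast
qed

end

section \<open>Smooth functions\<close>

text \<open>For p = 1 this is the standard flat function exp(-1/x). The polynomial factor in 1/x
  makes the family closed under differentiation, with p replaced by x^2 (p - p').\<close>

definition bump_poly :: "real poly \<Rightarrow> real \<Rightarrow> real" where
  "bump_poly p x = (if x > 0 then poly p (1 / x) * exp (- (1 / x)) else 0)"

lemma poly_exp_tendsto_0: "((\<lambda>x. x ^ n * poly p x * exp (- x)) \<longlongrightarrow> 0) (at_top :: real filter)"
proof (induction p arbitrary: n)
  case (pCons c p)
  have "((\<lambda>x. c * (x ^ n / exp x) + x ^ Suc n * poly p x * exp (- x)) \<longlongrightarrow> c * 0 + 0) (at_top :: real filter)"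
    by (intro tendsto_intros tendsto_power_div_exp_0 pCons.IH)
  moreover have "(\<lambda>x. c * (x ^ n / exp x) + x ^ Suc n * poly p x * exp (- x)) =
      (\<lambda>x. x ^ n * poly (pCons c p) x * exp (- x))"
    by (auto simp: fun_eq_iff exp_minus divide_inverse algebra_simps)
  ultimately show ?case by simp
qed simp

lemma bump_poly_deriv:
  "(bump_poly p has_real_derivative bump_poly ([:0, 0, 1:] * (p - pderiv p)) x) (at x)"
proof -
  consider "x > 0" | "x < 0" | "x = 0" by linarith
  then show ?thesis
  proof cases
    case 1
    have "((\<lambda>x. poly p (1 / x) * exp (- (1 / x))) has_real_derivative
        poly p (1 / x) * (exp (- (1 / x)) * (1 / x ^ 2)) + (poly (pderiv p) (1 / x) * (- 1 / x ^ 2)) * exp (- (1 / x))) (at x)"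
    proof (intro DERIV_mult')
      have d: "((\<lambda>x. 1 / x) has_real_derivative - 1 / x ^ 2) (at x)"
        using 1 by (auto intro!: derivative_eq_intros simp: power2_eq_square)
      show "((\<lambda>x. poly p (1 / x)) has_real_derivative poly (pderiv p) (1 / x) * (- 1 / x ^ 2)) (at x)"
        by (rule DERIV_chain2[OF poly_DERIV d])
      have "((\<lambda>x. - (1 / x)) has_real_derivative - (- 1 / x ^ 2)) (at x)" by (rule DERIV_minus[OF d])
      then show "((\<lambda>x. exp (- (1 / x))) has_real_derivative exp (- (1 / x)) * (1 / x ^ 2)) (at x)"
        using DERIV_chain2[OF DERIV_exp] by fastforce
    qed
    also have "poly p (1 / x) * (exp (- (1 / x)) * (1 / x ^ 2)) + (poly (pderiv p) (1 / x) * (- 1 / x ^ 2)) * exp (- (1 / x))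
        = bump_poly ([:0, 0, 1:] * (p - pderiv p)) x"
      using 1 by (simp add: bump_poly_def power2_eq_square field_simps)
    finally show ?thesis
      by (rule has_field_derivative_transform_within_open[where S = "{0<..}"])
        (use 1 in \<open>auto simp: bump_poly_def\<close>)
  next
    case 2
    have "((\<lambda>x. 0) has_real_derivative 0) (at x)" by simp
    then have "(bump_poly p has_real_derivative 0) (at x)"
      by (rule has_field_derivative_transform_within_open[where S = "{..<0}"])
        (use 2 in \<open>auto simp: bump_poly_def\<close>)
    then show ?thesis using 2 by (simp add: bump_poly_def)
  next
    case 3
    have R: "((\<lambda>h. bump_poly p h / h) \<longlongrightarrow> 0) (at_right 0)"
    proof -
      have "((\<lambda>h. inverse h ^ 1 * poly p (inverse h) * exp (- inverse h)) \<longlongrightarrow> 0) (at_right (0::real))"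
        by (rule filterlim_compose[OF poly_exp_tendsto_0 filterlim_inverse_at_top_right])
      then show ?thesis
        by (rule Lim_transform_eventually)
          (auto simp: eventually_at_filter bump_poly_def divide_inverse mult_ac)
    qed
    have "((\<lambda>h. bump_poly p h / h) \<longlongrightarrow> 0) (at_left 0)"
      by (rule Lim_transform_eventually[OF tendsto_const])
        (auto simp: eventually_at_filter bump_poly_def)
    with R have "((\<lambda>h. bump_poly p h / h) \<longlongrightarrow> 0) (at 0)" by (simp add: filterlim_split_at)
    moreover have z: "bump_poly q 0 = 0" for q by (simp add: bump_poly_def)
    ultimately show ?thesis unfolding 3 z DERIV_def by simp
  qed
qed

text \<open>A class closed under directional derivatives that contains everything needed for the
  metrics: real parts of holomorphic functions, sums, products and the cutoff. Closure
  (\<open>smooth_fun_derivative\<close>) gives every order of differentiability by one induction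
  (\<open>smooth_fun_Ck\<close>).\<close>

inductive smooth_fun :: "complex set \<Rightarrow> (complex \<Rightarrow> real) \<Rightarrow> bool" for U where
  Re: "h holomorphic_on U \<Longrightarrow> smooth_fun U (\<lambda>z. Re (h z))"
| add: "smooth_fun U f \<Longrightarrow> smooth_fun U g \<Longrightarrow> smooth_fun U (\<lambda>z. f z + g z)"
| mult: "smooth_fun U f \<Longrightarrow> smooth_fun U g \<Longrightarrow> smooth_fun U (\<lambda>z. f z * g z)"
| bump: "smooth_fun U f \<Longrightarrow> smooth_fun U (\<lambda>z. bump_poly p (f z))"
| cong: "smooth_fun U f \<Longrightarrow> (\<And>z. z \<in> U \<Longrightarrow> g z = f z) \<Longrightarrow> smooth_fun U g"

lemma smooth_fun_subset: "smooth_fun U f \<Longrightarrow> V \<subseteq> U \<Longrightarrow> smooth_fun V f"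
proof (induction rule: smooth_fun.induct)
  case (cong f g)
  show ?case by (rule smooth_fun.cong[OF cong.IH]) (use cong in auto)
qed (auto intro: smooth_fun.intros holomorphic_on_subset)

lemma smooth_fun_const: "smooth_fun U (\<lambda>_. c)"
  using smooth_fun.Re[of "\<lambda>_. of_real c" U] by simp

lemma smooth_fun_Im: "h holomorphic_on U \<Longrightarrow> smooth_fun U (\<lambda>z. Im (h z))"
proof -
  assume "h holomorphic_on U"
  then have "(\<lambda>z. - \<i> * h z) holomorphic_on U" by (intro holomorphic_intros)
  from smooth_fun.Re[OF this] show ?thesis by simp
qed

lemma smooth_fun_Re_mult_cnj:
  assumes "f holomorphic_on U" "g holomorphic_on U"
  shows "smooth_fun U (\<lambda>z. Re (f z * cnj (g z)))"
proof (rule smooth_fun.cong)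
  show "smooth_fun U (\<lambda>z. Re (f z) * Re (g z) + Im (f z) * Im (g z))"
    by (intro smooth_fun.add smooth_fun.mult smooth_fun.Re smooth_fun_Im assms)
qed auto

lemma smooth_fun_derivative:
  assumes U: "open U" and "smooth_fun U f"
  shows "\<exists>D. (\<forall>z\<in>U. (f has_derivative D z) (at z)) \<and> (\<forall>v. smooth_fun U (\<lambda>z. D z v))"
  using assms(2)
proof (induction rule: smooth_fun.induct)
  case (Re h)
  have "((\<lambda>z. Re (h z)) has_derivative (\<lambda>v. Re (deriv h z * v))) (at z)" if "z \<in> U" for z
    using holomorphic_derivI[OF Re U that] unfolding has_field_derivative_def
    by (rule has_derivative_Re)
  moreover have "smooth_fun U (\<lambda>z. Re (deriv h z * v))" for v
    by (intro smooth_fun.Re holomorphic_intros holomorphic_deriv Re U)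
  ultimately show ?case by (intro exI[of _ "\<lambda>z v. Re (deriv h z * v)"]) auto
next
  case (add f g)
  then obtain D E where D: "\<forall>z\<in>U. (f has_derivative D z) (at z)" "\<forall>v. smooth_fun U (\<lambda>z. D z v)"
    and E: "\<forall>z\<in>U. (g has_derivative E z) (at z)" "\<forall>v. smooth_fun U (\<lambda>z. E z v)" by blast
  show ?case
    by (intro exI[of _ "\<lambda>z v. D z v + E z v"] conjI ballI allI has_derivative_add smooth_fun.add)
      (use D E in auto)
next
  case (mult f g)
  then obtain D E where D: "\<forall>z\<in>U. (f has_derivative D z) (at z)" "\<forall>v. smooth_fun U (\<lambda>z. D z v)"
    and E: "\<forall>z\<in>U. (g has_derivative E z) (at z)" "\<forall>v. smooth_fun U (\<lambda>z. E z v)" by blast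
  show ?case
    by (intro exI[of _ "\<lambda>z v. f z * E z v + D z v * g z"] conjI ballI allI has_derivative_mult
        smooth_fun.add smooth_fun.mult mult.hyps) (use D E in auto)
next
  case (bump f p)
  then obtain D where D: "\<forall>z\<in>U. (f has_derivative D z) (at z)" "\<forall>v. smooth_fun U (\<lambda>z. D z v)" by blast
  let ?q = "[:0, 0, 1:] * (p - pderiv p)"
  have "((\<lambda>z. bump_poly p (f z)) has_derivative (\<lambda>v. bump_poly ?q (f z) * D z v)) (at z)" if "z \<in> U" for z
    using diff_chain_at[OF D(1)[rule_format, OF that] bump_poly_deriv[of p "f z", unfolded has_field_derivative_def]]
    by (simp add: o_def)
  moreover have "smooth_fun U (\<lambda>z. bump_poly ?q (f z) * D z v)" for v
    by (intro smooth_fun.mult smooth_fun.bump bump.hyps D(2)[rule_format])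
  ultimately show ?case by (intro exI[of _ "\<lambda>z v. bump_poly ?q (f z) * D z v"]) auto
next
  case (cong f g)
  then obtain D where D: "\<forall>z\<in>U. (f has_derivative D z) (at z)" "\<forall>v. smooth_fun U (\<lambda>z. D z v)" by blast
  have "(g has_derivative D z) (at z)" if "z \<in> U" for z
    by (rule has_derivative_transform_within_open[OF D(1)[rule_format, OF that] U that]) (simp add: cong.hyps)
  with D(2) show ?case by blast
qed

lemma smooth_fun_Ck:
  assumes U: "open U" shows "smooth_fun U f \<Longrightarrow> Ck_on k f U"
proof (induction k arbitrary: f)
  case 0
  then obtain D where "\<forall>z\<in>U. (f has_derivative D z) (at z)"
    using smooth_fun_derivative[OF U] by blast
  then have "continuous_on U f"
    by (intro continuous_at_imp_continuous_on ballI) (metis has_derivative_continuous)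
  then show ?case by simp
next
  case (Suc k)
  obtain D where D: "\<forall>z\<in>U. (f has_derivative D z) (at z)" "\<forall>v. smooth_fun U (\<lambda>z. D z v)"
    using smooth_fun_derivative[OF U Suc.prems] by blast
  have "Ck_on k (\<lambda>z. frechet_derivative f (at z) v) U" for v
  proof (rule Suc.IH, rule smooth_fun.cong)
    show "smooth_fun U (\<lambda>z. D z v)" using D(2) by blast
    show "frechet_derivative f (at z) v = D z v" if "z \<in> U" for z
      using frechet_derivative_at[OF D(1)[rule_format, OF that]] by simp
  qed
  moreover have "\<forall>z\<in>U. f differentiable (at z)" using D(1) by (auto simp: differentiable_def)
  ultimately show ?case by simp
qed

context lattice_quotient
begin

text \<open>As transition maps have derivative 1, a form on the surface is described by one field
  \<open>X\<close> on \<Omega> in the coordinate z; it suffices to check algebra and smoothness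
  there.\<close>

lemma symmetric_formI:
  assumes T: "\<And>c z v w. c \<in> charts S \<Longrightarrow> z \<in> \<Omega> \<Longrightarrow> cls \<tau> z \<in> fst c \<Longrightarrow> T c (cls \<tau> z) v w = X z v w"
    and bil: "\<And>z. z \<in> \<Omega> \<Longrightarrow> bilinear (X z)" and sym: "\<And>z v w. z \<in> \<Omega> \<Longrightarrow> X z v w = X z w v"
    and smooth: "\<And>v w. smooth_fun \<Omega> (\<lambda>z. X z v w)"
  shows "symmetric_form S T"
  unfolding symmetric_form_def
proof (intro conjI ballI allI)
  fix c assume c: "c \<in> charts S"
  obtain W where W: "W \<subseteq> \<Omega>" "lattice_chart \<tau> c W" using chart[OF c] by blast
  note cd = lattice_chartD[OF W(2)]
  have TX: "T c (cls \<tau> z) = X z" if "z \<in> W" for z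
    using T[OF c, of z] that W(1) cd(3) by (auto simp: fun_eq_iff)
  {
    fix p assume "p \<in> fst c"
    then obtain z where z: "z \<in> W" "p = cls \<tau> z" using cd(3) by blast
    then have "z \<in> \<Omega>" using W(1) by blast
    then show "bilinear (T c p)" "T c p v w = T c p w v" for v w
      using bil[of z] sym[of z v w] TX[OF z(1)] z(2) by simp_all
  }
  fix v w k
  show "Ck_on k (\<lambda>z. T c (param c z) v w) (chart_img c)"
    unfolding cd(5)
  proof (rule smooth_fun_Ck[OF cd(1)], rule smooth_fun.cong)
    show "smooth_fun W (\<lambda>z. X z v w)" by (rule smooth_fun_subset[OF smooth W(1)])
    show "T c (param c z) v w = X z v w" if "z \<in> W" for z
      using TX[OF that] cd(6)[OF that] by simp
  qed
next
  fix c d p v w assume c: "c \<in> charts S" and d: "d \<in> charts S" and p: "p \<in> fst c \<inter> fst d"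
  obtain W where W: "W \<subseteq> \<Omega>" "lattice_chart \<tau> c W" using chart[OF c] by blast
  obtain W' where W': "lattice_chart \<tau> d W'" using chart[OF d] by blast
  obtain z where z: "z \<in> W" "p = cls \<tau> z" using p lattice_chartD(3)[OF W(2)] by blast
  have "z \<in> \<Omega>" using z W(1) by blast
  have "deriv (transition c d) z = 1"
    by (rule DERIV_imp_deriv, rule transition_local(1)[OF W(2) W' z(1)]) (use p z in auto)
  then show "T c p v w = T d p (deriv (transition c d) (snd c p) * v) (deriv (transition c d) (snd c p) * w)"
    using T[OF c \<open>z \<in> \<Omega>\<close>] T[OF d \<open>z \<in> \<Omega>\<close>] p z lattice_chartD(4)[OF W(2) z(1)] by simp
qed

lemma riemannian_metricI:
  assumes T: "\<And>c z v w. c \<in> charts S \<Longrightarrow> z \<in> \<Omega> \<Longrightarrow> cls \<tau> z \<in> fst c \<Longrightarrow> T c (cls \<tau> z) v w = X z v w"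
    and "\<And>z. z \<in> \<Omega> \<Longrightarrow> bilinear (X z)" "\<And>z v w. z \<in> \<Omega> \<Longrightarrow> X z v w = X z w v"
    and "\<And>v w. smooth_fun \<Omega> (\<lambda>z. X z v w)" and pos: "\<And>z v. z \<in> \<Omega> \<Longrightarrow> v \<noteq> 0 \<Longrightarrow> X z v v > 0"
  shows "riemannian_metric S T"
  unfolding riemannian_metric_def
proof (intro conjI ballI allI impI)
  show "symmetric_form S T" by (rule symmetric_formI[OF assms(1-4)])
  fix c p and v :: complex assume c: "c \<in> charts S" and p: "p \<in> fst c" and v: "v \<noteq> 0"
  obtain W where W: "W \<subseteq> \<Omega>" "lattice_chart \<tau> c W" using chart[OF c] by blast
  obtain z where z: "z \<in> W" "p = cls \<tau> z" using p lattice_chartD(3)[OF W(2)] by blast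
  have "z \<in> \<Omega>" using z W(1) by blast
  then show "T c p v v > 0" using T[OF c \<open>z \<in> \<Omega>\<close>] pos[OF \<open>z \<in> \<Omega>\<close> v] p z(2) by simp
qed

end


section \<open>Completeness\<close>

text \<open>The derivative is known to be integrable only in the gauge sense. If the right side is
  infinite there is nothing to show; if it is finite, the derivative is Lebesgue integrable and the
  usual norm bound applies.\<close>

lemma norm_diff_le_nn_integral_derivative:
  fixes \<phi> :: "real \<Rightarrow> complex"
  assumes "continuous_on {0..1} \<phi>" "finite K"
    and d: "\<And>t. t \<in> {0<..<1} - K \<Longrightarrow> (\<phi> has_vector_derivative \<phi>' t) (at t)"
  shows "ennreal (norm (\<phi> 1 - \<phi> 0)) \<le> (\<integral>\<^sup>+t\<in>{0..1}. ennreal (norm (\<phi>' t)) \<partial>lborel)"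
proof -
  let ?f = "\<lambda>t. indicator {0..1} t *\<^sub>R \<phi>' t"
  have int: "(\<phi>' has_integral (\<phi> 1 - \<phi> 0)) {0..1}"
    by (rule fundamental_theorem_of_calculus_interior_strong[OF assms(2) _ d assms(1)]) auto
  have meas: "?f \<in> borel_measurable lebesgue"
    by (rule has_integral_implies_lebesgue_measurable[OF int])
  have eq: "(\<integral>\<^sup>+t. ennreal (norm (?f t)) \<partial>lebesgue) = (\<integral>\<^sup>+t\<in>{0..1}. ennreal (norm (\<phi>' t)) \<partial>lborel)"
    unfolding nn_integral_completion by (intro nn_integral_cong) (auto simp: indicator_def)
  show ?thesis
  proof (cases "(\<integral>\<^sup>+t\<in>{0..1}. ennreal (norm (\<phi>' t)) \<partial>lborel) = \<infinity>")
    case False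
    then have "(\<integral>\<^sup>+t. ennreal (norm (?f t)) \<partial>lebesgue) < \<infinity>"
      unfolding eq by (simp add: top.not_eq_extremum)
    then have i: "integrable lebesgue ?f" using meas by (intro integrableI_bounded)
    then have "(LINT t:{0..1}|lebesgue. \<phi>' t) = \<phi> 1 - \<phi> 0"
      using set_lebesgue_integral_eq_integral(2)[of "{0..1}" \<phi>'] int
      by (simp add: set_integrable_def integral_unique)
    then have "ennreal (norm (\<phi> 1 - \<phi> 0)) \<le> (\<integral>\<^sup>+t. ennreal (norm (?f t)) \<partial>lebesgue)"
      using integral_norm_bound_ennreal[OF i] by (simp add: set_lebesgue_integral_def)
    then show ?thesis unfolding eq .
  qed simp
qed

context lattice_quotient
begin

context
  fixes T :: "complex set field2" and X :: "complex \<Rightarrow> complex \<Rightarrow> complex \<Rightarrow> real"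
  assumes T: "\<And>c z v w. c \<in> charts S \<Longrightarrow> z \<in> \<Omega> \<Longrightarrow> cls \<tau> z \<in> fst c \<Longrightarrow> T c (cls \<tau> z) v w = X z v w"
begin

text \<open>\<open>speed\<close> uses an arbitrary chart at each point, but around t every chart
  coordinate of the path is the lift plus a constant, so its velocity is that of the lift.\<close>

lemma speed_eq:
  assumes D: "(g has_vector_derivative D) (at t)" and t: "0 < t" "t < 1"
    and g: "\<And>s. s \<in> {0<..<1} \<Longrightarrow> g s \<in> \<Omega> \<and> cls \<tau> (g s) = \<gamma> s"
  shows "speed S T \<gamma> t = sqrt (X (g t) D D)"
proof -
  define c where "c = chart_at S (\<gamma> t)"
  have gt: "g t \<in> \<Omega>" "cls \<tau> (g t) = \<gamma> t" using g[of t] t by auto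
  have c: "c \<in> charts S" "cls \<tau> (g t) \<in> fst c"
    using chart_at[OF gt(1)] unfolding gt(2) c_def by auto
  obtain W where W: "W \<subseteq> \<Omega>" "lattice_chart \<tau> c W" using chart[OF c(1)] by blast
  obtain \<omega> where \<omega>: "\<omega> \<in> lattice \<tau>" "g t + \<omega> \<in> W"
    "\<And>z'. z' + \<omega> \<in> W \<Longrightarrow> cls \<tau> z' \<in> fst c \<and> snd c (cls \<tau> z') = z' + \<omega>"
    using lattice_chart_local[OF W(2) c(2)] by blast
  have "isCont (\<lambda>s. g s + \<omega>) t"
    using has_vector_derivative_continuous[OF D] by (intro continuous_intros)
  then have "((\<lambda>s. g s + \<omega>) \<longlongrightarrow> g t + \<omega>) (at t)" by (simp add: isCont_def)
  then have ev: "eventually (\<lambda>s. g s + \<omega> \<in> W) (at t)"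
    by (rule topological_tendstoD[OF _ lattice_chartD(1)[OF W(2)] \<omega>(2)])
  have near: "(snd c \<circ> \<gamma>) s = g s + \<omega>" if "s \<in> {0<..<1}" "g s + \<omega> \<in> W" for s
    using \<omega>(3)[OF that(2)] g[OF that(1)] by simp
  have ev2: "eventually (\<lambda>s. g s + \<omega> = (snd c \<circ> \<gamma>) s) (at t)"
  proof -
    have "eventually (\<lambda>s. s \<in> {0<..<1}) (at t)"
      by (rule eventually_at_in_open') (use t in auto)
    with ev show ?thesis by eventually_elim (rule near[symmetric])
  qed
  have "((\<lambda>s. g s + \<omega>) has_vector_derivative D) (at t)"
    using has_vector_derivative_add[OF D has_vector_derivative_const[of \<omega>]] by simp
  then have "(snd c \<circ> \<gamma> has_vector_derivative D) (at t)"
    unfolding has_vector_derivative_def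
    by (rule has_derivative_transform_eventually[OF _ ev2]) (use near[of t] t \<omega>(2) in auto)
  then have "vector_derivative (snd c \<circ> \<gamma>) (at t) = D" by (rule vector_derivative_at)
  moreover have "T c (\<gamma> t) D D = X (g t) D D"
    using T[OF c(1) gt(1) c(2)] gt(2) by simp
  ultimately show ?thesis unfolding speed_def Let_def c_def[symmetric] by simp
qed

text \<open>A function whose differential is bounded by the metric changes by at most the length.
  Only its differences need be lattice-invariant, which admits both a periodic \<open>H\<close> and
  a multiple of the coordinate z; invariance moves the lift to the prescribed starting
  point.\<close>

lemma path_len_ge:
  assumes \<gamma>: "pC1_path S \<gamma>" and z: "z \<in> \<Omega>" "cls \<tau> z = \<gamma> 0"
    and H: "\<And>z. z \<in> \<Omega> \<Longrightarrow> (H has_field_derivative H' z) (at z)"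
    and bound: "\<And>z v. z \<in> \<Omega> \<Longrightarrow> norm (H' z * v) \<le> sqrt (X z v v)"
    and per: "\<And>z w \<omega>. z \<in> \<Omega> \<Longrightarrow> w \<in> \<Omega> \<Longrightarrow> \<omega> \<in> lattice \<tau> \<Longrightarrow> H (w + \<omega>) - H (z + \<omega>) = H w - H z"
  obtains w where "w \<in> \<Omega>" "cls \<tau> w = \<gamma> 1" "ennreal (norm (H w - H z)) \<le> path_len S T \<gamma>"
proof -
  obtain g K where g: "continuous_on {0..1} g" "\<And>t. t \<in> {0..1} \<Longrightarrow> g t \<in> \<Omega> \<and> cls \<tau> (g t) = \<gamma> t"
    and K: "finite K" "\<And>t. t \<in> {0<..<1} - K \<Longrightarrow> g differentiable (at t)"
    by (rule pC1_path_lift[OF \<gamma>]) blast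
  have g0: "g 0 \<in> \<Omega>" "cls \<tau> (g 0) = cls \<tau> z" and g1: "g 1 \<in> \<Omega>" "cls \<tau> (g 1) = \<gamma> 1"
    using g(2)[of 0] g(2)[of 1] z by auto
  obtain \<omega> where \<omega>: "\<omega> \<in> lattice \<tau>" "z = g 0 + \<omega>" using cls_eqE[OF g0(2)] by blast
  define D where "D t = vector_derivative g (at t)" for t
  have D: "(g has_vector_derivative D t) (at t)" if "t \<in> {0<..<1} - K" for t
    unfolding D_def using K(2)[OF that] vector_derivative_works by blast
  have "continuous_on \<Omega> H"
    by (intro holomorphic_on_imp_continuous_on holomorphic_on_derivI[OF H])
  then have "continuous_on (g ` {0..1}) H" by (rule continuous_on_subset) (use g(2) in auto)
  then have "continuous_on {0..1} (H \<circ> g)" by (rule continuous_on_compose[OF g(1)])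
  moreover have "(H \<circ> g has_vector_derivative D t * H' (g t)) (at t)" if t: "t \<in> {0<..<1} - K" for t
    by (rule field_vector_diff_chain_at[OF D[OF t] H]) (use g(2)[of t] t in auto)
  ultimately have "ennreal (norm ((H \<circ> g) 1 - (H \<circ> g) 0)) \<le> (\<integral>\<^sup>+t\<in>{0..1}. ennreal (norm (D t * H' (g t))) \<partial>lborel)"
    by (rule norm_diff_le_nn_integral_derivative[OF _ K(1)])
  also have "\<dots> \<le> path_len S T \<gamma>"
    unfolding path_len_def
  proof (rule nn_integral_mono_AE)
    have "AE t in lborel. t \<notin> insert 0 (insert 1 K)"
      using K(1) by (intro AE_not_in finite_imp_null_set_lborel) auto
    then show "AE t in lborel. ennreal (norm (D t * H' (g t))) * indicator {0..1} t
        \<le> ennreal (speed S T \<gamma> t) * indicator {0..1} t"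
    proof eventually_elim
      case (elim t)
      show ?case
      proof (cases "t \<in> {0..1}")
        case True
        then have t: "t \<in> {0<..<1} - K" using elim by auto
        have "speed S T \<gamma> t = sqrt (X (g t) (D t) (D t))"
          by (rule speed_eq[OF D[OF t]]) (use t g(2) in auto)
        moreover have "norm (D t * H' (g t)) \<le> sqrt (X (g t) (D t) (D t))"
          using bound[of "g t" "D t"] g(2)[OF True] by (simp add: mult.commute)
        ultimately show ?thesis by (intro mult_right_mono ennreal_leI) auto
      qed simp
    qed
  qed
  finally have "ennreal (norm (H (g 1) - H (g 0))) \<le> path_len S T \<gamma>" by simp
  moreover have "H (g 1 + \<omega>) - H z = H (g 1) - H (g 0)"
    using per[OF g0(1) g1(1) \<omega>(1)] \<omega>(2) by simp
  ultimately show ?thesis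
    using that[of "g 1 + \<omega>"] Omega(4)[OF g1(1) \<omega>(1)] g1(2) \<omega>(1) by simp
qed

lemma rdist_segment_le:
  assumes seg: "closed_segment w z \<subseteq> \<Omega>" and C: "\<And>u v. u \<in> closed_segment w z \<Longrightarrow> X u v v \<le> (C * norm v)\<^sup>2" "C \<ge> 0"
  shows "rdist S T (cls \<tau> w) (cls \<tau> z) \<le> ennreal (C * norm (z - w))"
proof -
  let ?\<gamma> = "\<lambda>t. cls \<tau> (linepath w z t)"
  have "rdist S T (cls \<tau> w) (cls \<tau> z) \<le> path_len S T ?\<gamma>"
    unfolding rdist_def
    by (intro Inf_lower CollectI exI[of _ ?\<gamma>] conjI refl pC1_path_segment[OF seg])
      (simp_all add: linepath_def)
  also have "\<dots> \<le> (\<integral>\<^sup>+t. ennreal (C * norm (z - w)) * indicator {0..1::real} t \<partial>lborel)"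
    unfolding path_len_def
  proof (rule nn_integral_mono_AE)
    have "AE t in lborel. (t :: real) \<notin> {0, 1}"
      by (intro AE_not_in finite_imp_null_set_lborel) auto
    then show "AE t in lborel. ennreal (speed S T ?\<gamma> t) * indicator {0..1} t
        \<le> ennreal (C * norm (z - w)) * indicator {0..1} t"
    proof eventually_elim
      case (elim t)
      show ?case
      proof (cases "t \<in> {0..1}")
        case True
        then have t: "0 < t" "t < 1" using elim by auto
        have "speed S T ?\<gamma> t = sqrt (X (linepath w z t) (z - w) (z - w))"
        proof (rule speed_eq[OF _ t])
          show "(linepath w z has_vector_derivative z - w) (at t)"
            by (rule has_vector_derivative_linepath_within)
          show "linepath w z s \<in> \<Omega> \<and> cls \<tau> (linepath w z s) = ?\<gamma> s" if "s \<in> {0<..<1}" for s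
            using linepath_in_path[of s w z] seg that by auto
        qed
        also have "\<dots> \<le> C * norm (z - w)"
          by (rule real_le_lsqrt) (use C linepath_in_path[of t w z] True in auto)
        finally show ?thesis by (intro mult_right_mono ennreal_leI) auto
      qed simp
    qed
  qed
  also have "\<dots> = ennreal (C * norm (z - w))"
    by (subst nn_integral_cmult_indicator) auto
  finally show ?thesis .
qed

text \<open>The function \<open>H\<close> is Lipschitz and blows up at the ends, so that Cauchy sequences stay in a
  compact set; the lower bound \<open>b\<close> lets them converge in the flat torus.\<close>

lemma complete_metricI:
  assumes riem: "riemannian_metric S T"
    and b: "b > 0" "\<And>z v. z \<in> \<Omega> \<Longrightarrow> b * norm v \<le> sqrt (X z v v)"
    and loc: "\<And>z. z \<in> \<Omega> \<Longrightarrow> \<exists>\<delta>>0. \<exists>C\<ge>0. ball z \<delta> \<subseteq> \<Omega> \<and> (\<forall>u\<in>ball z \<delta>. \<forall>v. X u v v \<le> (C * norm v)\<^sup>2)"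
    and H: "\<And>z. z \<in> \<Omega> \<Longrightarrow> (H has_field_derivative H' z) (at z)"
    and bound: "\<And>z v. z \<in> \<Omega> \<Longrightarrow> norm (H' z * v) \<le> sqrt (X z v v)"
    and per: "\<And>z \<omega>. z \<in> \<Omega> \<Longrightarrow> \<omega> \<in> lattice \<tau> \<Longrightarrow> H (z + \<omega>) = H z"
    and proper: "\<And>\<zeta> z. (\<And>n. \<zeta> n \<in> \<Omega>) \<Longrightarrow> \<zeta> \<longlonglongrightarrow> z \<Longrightarrow> z \<notin> \<Omega> \<Longrightarrow>
        filterlim (\<lambda>n. H (\<zeta> n)) at_infinity sequentially"
  shows "complete_metric S T"
  unfolding complete_metric_def
proof (intro conjI riem allI impI)
  fix s :: "nat \<Rightarrow> complex set"
  assume s: "range s \<subseteq> topspace (stop S) \<and> (\<forall>e>0. \<exists>N. \<forall>m\<ge>N. \<forall>n\<ge>N. rdist S T (s m) (s n) < e)"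
  have cauchy: "\<exists>N. \<forall>m\<ge>N. \<forall>n\<ge>N. rdist S T (s m) (s n) < e" if "e > 0" for e
    using s that by blast
  have path: "\<exists>\<gamma>. pC1_path S \<gamma> \<and> \<gamma> 0 = p \<and> \<gamma> 1 = q \<and> path_len S T \<gamma> < e" if "rdist S T p q < e" for p q e
    using that unfolding rdist_def Inf_less_iff by blast
  have "\<exists>z. z \<in> \<Omega> \<and> z \<in> parallelogram \<tau> \<and> cls \<tau> z = s n" for n
  proof -
    have "s n \<in> cls \<tau> ` \<Omega>" using s topspace_eq by blast
    then obtain z where z: "z \<in> \<Omega>" "s n = cls \<tau> z" by blast
    obtain w \<omega> where w: "z = w + \<omega>" "w \<in> parallelogram \<tau>" "\<omega> \<in> lattice \<tau>"
      using parallelogram_reduce[OF tau] by blast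
    have "w = z + - \<omega>" using w(1) by simp
    then have "w \<in> \<Omega>" using Omega(4)[OF z(1) lattice_uminus[OF w(3)]] by simp
    then show ?thesis using w z by auto
  qed
  then obtain \<zeta> where \<zeta>: "\<And>n. \<zeta> n \<in> \<Omega>" "\<And>n. \<zeta> n \<in> parallelogram \<tau>" "\<And>n. cls \<tau> (\<zeta> n) = s n" by metis
  obtain z r where z: "strict_mono r" "(\<zeta> \<circ> r) \<longlonglongrightarrow> z"
    using compact_parallelogram[of \<tau>, unfolded compact_def] \<zeta>(2) by blast
  \<comment> \<open>Otherwise \<open>H\<close> would tend to infinity along the subsequence, whereas
    the Cauchy condition with distance 1 keeps \<open>H\<close> within 1 of its value at index
    \<open>N\<close>.\<close>
  have "z \<in> \<Omega>"
  proof (rule ccontr)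
    assume "z \<notin> \<Omega>"
    then have inf: "filterlim (\<lambda>n. H ((\<zeta> \<circ> r) n)) at_infinity sequentially"
      by (intro proper[OF _ z(2)]) (use \<zeta>(1) in auto)
    obtain N where N: "\<And>n. n \<ge> N \<Longrightarrow> rdist S T (s N) (s n) < ennreal 1"
      using cauchy[of "ennreal 1"] by auto
    have "norm (H (\<zeta> n)) \<le> norm (H (\<zeta> N)) + 1" if n: "n \<ge> N" for n
    proof -
      obtain \<gamma> where \<gamma>: "pC1_path S \<gamma>" "\<gamma> 0 = s N" "\<gamma> 1 = s n" "path_len S T \<gamma> < ennreal 1"
        using path[OF N[OF n]] by blast
      have "cls \<tau> (\<zeta> N) = \<gamma> 0" by (simp add: \<gamma> \<zeta>)
      then obtain w where w: "w \<in> \<Omega>" "cls \<tau> w = \<gamma> 1" "ennreal (norm (H w - H (\<zeta> N))) \<le> path_len S T \<gamma>"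
        by (rule path_len_ge[OF \<gamma>(1) \<zeta>(1) _ H bound]) (auto simp: per)
      have "cls \<tau> w = cls \<tau> (\<zeta> n)" using w(2) \<gamma>(3) \<zeta>(3) by simp
      then obtain \<omega> where "\<omega> \<in> lattice \<tau>" "\<zeta> n = w + \<omega>" by (rule cls_eqE)
      then have "H (\<zeta> n) = H w" using per[OF w(1)] by simp
      moreover have "norm (H w - H (\<zeta> N)) < 1"
        using le_less_trans[OF w(3) \<gamma>(4)] by (subst (asm) ennreal_less_iff) auto
      ultimately show ?thesis using norm_triangle_ineq2[of "H w" "H (\<zeta> N)"] by simp
    qed
    moreover have "eventually (\<lambda>n. norm (H (\<zeta> N)) + 2 \<le> norm (H ((\<zeta> \<circ> r) n))) sequentially"
    proof -
      have "norm (H (\<zeta> N)) + 2 > 0" using norm_ge_zero[of "H (\<zeta> N)"] by linarith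
      then show ?thesis using inf unfolding filterlim_at_infinity[OF order_refl] by blast
    qed
    then obtain k where "\<And>n. n \<ge> k \<Longrightarrow> norm (H (\<zeta> N)) + 2 \<le> norm (H (\<zeta> (r n)))"
      unfolding eventually_sequentially by auto
    then have "norm (H (\<zeta> N)) + 2 \<le> norm (H (\<zeta> (r (max k N))))" by simp
    moreover have "r (max k N) \<ge> N"
      using seq_suble[OF z(1), of "max k N"] by simp
    ultimately show False by force
  qed
  obtain \<delta> C where \<delta>: "\<delta> > 0" "ball z \<delta> \<subseteq> \<Omega>" and C: "C \<ge> 0" "\<And>u v. u \<in> ball z \<delta> \<Longrightarrow> X u v v \<le> (C * norm v)\<^sup>2"
    using loc[OF \<open>z \<in> \<Omega>\<close>] by blast
  \<comment> \<open>One term of the subsequence is close to z in the plane; by the lower bound b the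
    later terms of the whole sequence have representatives near it. A straight segment to z then has
    small length, since \<open>X\<close> is bounded above near z.\<close>
  have conv: "\<exists>N. \<forall>n\<ge>N. rdist S T (s n) (cls \<tau> z) < a" if a: "a > 0" for a
  proof -
    obtain e where e: "e > 0" "ennreal e < a"
    proof -
      obtain x where x: "0 < x" "x < a" using dense[OF a] by blast
      then have "x < top" using less_trans[OF x(2)] top.extremum_strict by (metis not_less_iff_gr_or_eq top.not_eq_extremum)
      then obtain e where "x = ennreal e" "e \<ge> 0" by (cases x) auto
      with x show ?thesis by (intro that[of e]) (auto simp: ennreal_zero_less_divide)
    qed
    define \<eta> where "\<eta> = min \<delta> (e / (C + 1))"
    have \<eta>: "\<eta> > 0" "\<eta> \<le> \<delta>" "C * \<eta> \<le> e"
    proof -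
      show "\<eta> > 0" "\<eta> \<le> \<delta>" using \<delta>(1) e(1) C(1) by (auto simp: \<eta>_def)
      have "C * \<eta> \<le> C * (e / (C + 1))" using C(1) by (intro mult_left_mono) (auto simp: \<eta>_def)
      also have "\<dots> \<le> e" using C(1) e(1) by (simp add: field_simps)
      finally show "C * \<eta> \<le> e" .
    qed
    obtain N where N: "\<And>m n. m \<ge> N \<Longrightarrow> n \<ge> N \<Longrightarrow> rdist S T (s m) (s n) < ennreal (b * (\<eta> / 2))"
      using cauchy[of "ennreal (b * (\<eta> / 2))"] b(1) \<eta>(1) by auto
    obtain k where k: "\<And>n. n \<ge> k \<Longrightarrow> dist ((\<zeta> \<circ> r) n) z < \<eta> / 2"
      using z(2) \<eta>(1) unfolding lim_sequentially by (meson half_gt_zero)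
    define m where "m = r (max k N)"
    have m: "m \<ge> N" "dist (\<zeta> m) z < \<eta> / 2"
      using seq_suble[OF z(1), of "max k N"] k[of "max k N"] by (auto simp: m_def)
    have "rdist S T (s n) (cls \<tau> z) < a" if n: "n \<ge> N" for n
    proof -
      obtain \<gamma> where \<gamma>: "pC1_path S \<gamma>" "\<gamma> 0 = s m" "\<gamma> 1 = s n" "path_len S T \<gamma> < ennreal (b * (\<eta> / 2))"
        using path[OF N[OF m(1) n]] by blast
      have "cls \<tau> (\<zeta> m) = \<gamma> 0" by (simp add: \<gamma> \<zeta>)
      moreover have "((\<lambda>z. of_real b * z) has_field_derivative of_real b) (at z)" for z :: complex
        using DERIV_cmult_Id by blast
      moreover have "norm (of_real b * v) \<le> sqrt (X z v v)" if "z \<in> \<Omega>" for z v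
        using b(2)[OF that, of v] b(1) by (simp add: norm_mult)
      ultimately obtain w where w: "w \<in> \<Omega>" "cls \<tau> w = \<gamma> 1"
          "ennreal (norm (of_real b * w - of_real b * \<zeta> m)) \<le> path_len S T \<gamma>"
        by (rule path_len_ge[OF \<gamma>(1) \<zeta>(1), where H = "\<lambda>z. of_real b * z" and H' = "\<lambda>_. of_real b"])
          (auto simp: algebra_simps)
      have "norm (of_real b * w - of_real b * \<zeta> m) = b * dist w (\<zeta> m)"
        using b(1) by (simp add: dist_norm norm_mult flip: right_diff_distrib)
      then have "ennreal (b * dist w (\<zeta> m)) < ennreal (b * (\<eta> / 2))"
        using le_less_trans[OF w(3) \<gamma>(4)] by simp
      then have "b * dist w (\<zeta> m) < b * (\<eta> / 2)" using b(1) by (subst (asm) ennreal_less_iff) auto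
      then have "dist w (\<zeta> m) < \<eta> / 2" using b(1) by simp
      then have wz: "dist w z < \<eta>" using m(2) dist_triangle[of w z "\<zeta> m"] by simp
      have seg: "closed_segment w z \<subseteq> ball z \<delta>"
        by (rule closed_segment_subset) (use wz \<eta>(2) \<delta>(1) in \<open>auto simp: dist_commute\<close>)
      have "rdist S T (cls \<tau> w) (cls \<tau> z) \<le> ennreal (C * norm (z - w))"
        by (rule rdist_segment_le) (use seg \<delta>(2) C in auto)
      also have "\<dots> \<le> ennreal e"
      proof (rule ennreal_leI)
        have "C * norm (z - w) \<le> C * \<eta>"
          using wz C(1) by (intro mult_left_mono) (auto simp: dist_norm norm_minus_commute)
        with \<eta>(3) show "C * norm (z - w) \<le> e" by simp
      qed
      also have "ennreal e < a" by (rule e(2))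
      finally show ?thesis using w(2) \<gamma>(3) by simp
    qed
    then show ?thesis by blast
  qed
  show "\<exists>p\<in>topspace (stop S). (\<lambda>n. rdist S T (s n) p) \<longlonglongrightarrow> 0"
  proof (rule bexI[of _ "cls \<tau> z"])
    show "(\<lambda>n. rdist S T (s n) (cls \<tau> z)) \<longlonglongrightarrow> 0"
    proof (rule order_tendstoI)
      fix a :: ennreal assume "0 < a"
      from conv[OF this] show "eventually (\<lambda>n. rdist S T (s n) (cls \<tau> z) < a) sequentially"
        by (simp add: eventually_sequentially)
    qed simp
    show "cls \<tau> z \<in> topspace (stop S)" using \<open>z \<in> \<Omega>\<close> by (simp add: topspace_eq)
  qed
qed

end

end

section \<open>Estimates for the flat form and completeness of the front\<close>

lemma filterlim_pole:
  assumes \<tau>: "Im \<tau> > 0" and A: "A holomorphic_on - (lattice \<tau> - {0})" "A 0 \<noteq> 0"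
    and f: "\<And>z. z \<notin> lattice \<tau> \<Longrightarrow> f z = A z / z ^ n" and n: "n > 0"
  shows "filterlim f at_infinity (at 0)"
proof -
  have op: "open (- (lattice \<tau> - {0}))" by (rule open_Compl_lattice_subset[OF \<tau>]) auto
  have "isCont A 0" by (rule holomorphic_on_isCont[OF A(1) op]) auto
  then have lim: "(A \<longlongrightarrow> A 0) (at 0)" by (simp add: isCont_def)
  have "filterlim (\<lambda>z::complex. z ^ n) (at 0) (at 0)"
    unfolding filterlim_at using n by (auto intro!: tendsto_eq_intros simp: eventually_at_filter)
  from filterlim_divide_at_infinity[OF lim this A(2)]
  show ?thesis
    by (rule filterlim_cong[THEN iffD1, rotated -1])
      (use eventually_not_lattice[OF \<tau>, of 0] f in \<open>auto elim!: eventually_mono\<close>)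
qed

lemma filterlim_wp:
  assumes "Im \<tau> > 0" shows "filterlim (wp \<tau>) at_infinity (at 0)"
proof -
  obtain A where A: "A holomorphic_on - (lattice \<tau> - {0})" "A 0 = 1"
    "\<And>z. z \<notin> lattice \<tau> \<Longrightarrow> wp \<tau> z = A z / z ^ 2" by (rule wp_near_0[OF assms]) blast
  show ?thesis by (rule filterlim_pole[OF assms A(1) _ A(3)]) (simp_all add: A(2))
qed

lemma parallelogram_lattice:
  assumes \<tau>: "Im \<tau> > 0" and z: "z \<in> parallelogram \<tau>" "z \<in> lattice \<tau>"
  shows "z = 0"
proof -
  obtain x y where xy: "z = of_real x + of_real y * \<tau>" "\<bar>x\<bar> \<le> 1/2" "\<bar>y\<bar> \<le> 1/2"
    using z(1) by (auto simp: parallelogram_def)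
  obtain m n :: int where "z = of_real m + of_real n * \<tau>" using z(2) by (auto simp: lattice_def)
  then have "x = m" "y = n" using xy(1) lattice_coords_eq_iff[OF \<tau>] by metis+
  with xy have "m = 0" "n = 0" by linarith+
  with \<open>x = m\<close> \<open>y = n\<close> xy(1) show ?thesis by simp
qed

lemma compact_parallelogram_diff_ball:
  assumes "Im \<tau> > 0" "r > 0"
  shows "compact (parallelogram \<tau> - ball 0 r)" "parallelogram \<tau> - ball 0 r \<subseteq> - lattice \<tau>"
proof -
  show "compact (parallelogram \<tau> - ball 0 r)" by (intro compact_diff compact_parallelogram) auto
  show "parallelogram \<tau> - ball 0 r \<subseteq> - lattice \<tau>"
  proof
    fix x assume x: "x \<in> parallelogram \<tau> - ball 0 r"
    then have "x \<noteq> 0" using assms(2) by auto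
    then show "x \<in> - lattice \<tau>" using parallelogram_lattice[OF assms(1)] x by blast
  qed
qed

text \<open>The polarized flat form for dF = f dz and dG = g dz.\<close>

definition flat_coeff :: "complex \<Rightarrow> complex \<Rightarrow> complex \<Rightarrow> complex \<Rightarrow> real" where
  "flat_coeff f g v w = Re ((f * v) * cnj (f * w)) + Re ((g * v) * cnj (g * w)) + 2 * Re ((f * v) * (g * w))"

lemma Re_mult_cnj_same: "Re (z * cnj z) = (norm z)\<^sup>2"
  unfolding cmod_power2 by (simp add: power2_eq_square)

text \<open>The cross term is at least -2 |f g| |v|^2. The bound degenerates where |f| = |g|, which
  is why a compactly supported form has to be added.\<close>

lemma flat_coeff_ge: "((norm f - norm g) * norm v)\<^sup>2 \<le> flat_coeff f g v v"
proof -
  have "- (norm (f * v) * norm (g * v)) \<le> Re ((f * v) * (g * v))"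
    using abs_Re_le_cmod[of "(f * v) * (g * v)"] by (simp only: norm_mult abs_le_iff) linarith
  then have "norm (f * v) ^ 2 + norm (g * v) ^ 2 - 2 * (norm (f * v) * norm (g * v)) \<le> flat_coeff f g v v"
    unfolding flat_coeff_def Re_mult_cnj_same by linarith
  moreover have "((norm f - norm g) * norm v)\<^sup>2 =
      norm (f * v) ^ 2 + norm (g * v) ^ 2 - 2 * (norm (f * v) * norm (g * v))"
    by (simp add: norm_mult power2_eq_square algebra_simps)
  ultimately show ?thesis by simp
qed

lemma flat_coeff_le: "flat_coeff f g v v \<le> ((norm f + norm g) * norm v)\<^sup>2"
proof -
  have "Re ((f * v) * (g * v)) \<le> norm (f * v) * norm (g * v)"
    using complex_Re_le_cmod[of "(f * v) * (g * v)"] by (simp only: norm_mult)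
  then have "flat_coeff f g v v \<le> norm (f * v) ^ 2 + norm (g * v) ^ 2 + 2 * (norm (f * v) * norm (g * v))"
    unfolding flat_coeff_def Re_mult_cnj_same by linarith
  also have "\<dots> = ((norm f + norm g) * norm v)\<^sup>2"
    by (simp add: norm_mult power2_eq_square algebra_simps)
  finally show ?thesis .
qed

lemma bilinear_Re_mult_cnj: "bilinear (\<lambda>v w. Re ((f * v) * cnj (g * w)))"
  unfolding bilinear_def by (auto intro!: linearI simp: algebra_simps)

lemma bilinear_Re_mult: "bilinear (\<lambda>v w. Re ((f * v) * (g * w)))"
  unfolding bilinear_def by (auto intro!: linearI simp: algebra_simps)

lemma bilinear_add: "bilinear f \<Longrightarrow> bilinear g \<Longrightarrow> bilinear (\<lambda>v w. f v w + g v w)"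
  unfolding bilinear_def by (auto intro: linear_compose_add)

lemma bilinear_scale: "bilinear f \<Longrightarrow> bilinear (\<lambda>v w. (c :: real) * f v w)"
proof -
  assume b: "bilinear f"
  show "bilinear (\<lambda>v w. c * f v w)"
    unfolding bilinear_def
    by (auto intro!: linearI simp: bilinear_ladd[OF b] bilinear_radd[OF b] bilinear_lmul[OF b]
        bilinear_rmul[OF b] algebra_simps)
qed

lemma bilinear_flat_coeff: "bilinear (flat_coeff f g)"
  unfolding flat_coeff_def[abs_def]
  by (intro bilinear_add bilinear_scale bilinear_Re_mult_cnj bilinear_Re_mult)

lemma flat_coeff_sym: "flat_coeff f g v w = flat_coeff f g w v"
  by (simp add: flat_coeff_def algebra_simps)

lemma wp''_period:
  "Im \<tau> > 0 \<Longrightarrow> z \<notin> lattice \<tau> \<Longrightarrow> \<omega> \<in> lattice \<tau> \<Longrightarrow> wp'' \<tau> (z + \<omega>) = wp'' \<tau> z"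
  by (simp add: wp''_def wp_period)

lemma holomorphic_wp'': "Im \<tau> > 0 \<Longrightarrow> wp'' \<tau> holomorphic_on - lattice \<tau>"
  unfolding wp''_def by (intro holomorphic_intros holomorphic_wp)

context
  fixes \<tau> a :: complex
  assumes \<tau>: "Im \<tau> > 0" and a: "a \<noteq> 0"
begin

interpretation Q: lattice_quotient \<tau> "punctured_torus \<tau>" "- lattice \<tau>"
  by (rule lattice_quotient_puncture[OF \<tau>])

text \<open>A dichotomy: near the lattice the pole of a \<open>wp''\<close> (order 4) beats that of
  \<open>wp'\<close> (order 3) and gives the second alternative; the rest of the parallelogram is
  compact and gives the first. Periodicity extends this to the plane.\<close>

lemma front_estimate:
  obtains R C where "\<And>z. z \<notin> lattice \<tau> \<Longrightarrow>
    (norm (wp \<tau> z))\<^sup>2 \<le> R \<and> norm (a * wp'' \<tau> z) \<le> C \<or>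
    2 * norm (wp' \<tau> z) \<le> norm (a * wp'' \<tau> z) \<and> 1 \<le> norm (a * wp'' \<tau> z)"
proof -
  obtain A where A: "A holomorphic_on - (lattice \<tau> - {0})" "A 0 = -2"
    "\<And>z. z \<notin> lattice \<tau> \<Longrightarrow> wp' \<tau> z = A z / z ^ 3" by (rule wp'_near_0[OF \<tau>]) blast
  obtain B where B: "B holomorphic_on - (lattice \<tau> - {0})" "B 0 = 6"
    "\<And>z. z \<notin> lattice \<tau> \<Longrightarrow> wp'' \<tau> z = B z / z ^ 4" by (rule wp''_near_0[OF \<tau>]) blast
  have op: "open (- (lattice \<tau> - {0}))" by (rule open_Compl_lattice_subset[OF \<tau>]) auto
  have "isCont A 0" "isCont B 0"
    by (rule holomorphic_on_isCont[OF A(1) op] holomorphic_on_isCont[OF B(1) op]; simp)+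
  then have lim: "(A \<longlongrightarrow> -2) (at 0)" "(B \<longlongrightarrow> 6) (at 0)" using A(2) B(2) by (simp_all add: isCont_def)
  have "((\<lambda>z. norm a * norm (B z) - 2 * (norm (A z) * norm z)) \<longlongrightarrow>
      norm a * norm (6 :: complex) - 2 * (norm (-2 :: complex) * norm (0 :: complex))) (at 0)"
    by (intro tendsto_intros lim)
  then have "eventually (\<lambda>z. norm a * norm (B z) - 2 * (norm (A z) * norm z) > 0) (at 0)"
    by (rule order_tendstoD) (use a in simp)
  then have 1: "eventually (\<lambda>z. 2 * norm (wp' \<tau> z) \<le> norm (a * wp'' \<tau> z)) (at 0)"
    using eventually_not_lattice[OF \<tau>, of 0]
  proof eventually_elim
    case (elim z)
    then have z: "norm z > 0" by auto
    have "2 * norm (wp' \<tau> z) = 2 * (norm (A z) * norm z) / norm z ^ 4"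
      using z unfolding A(3)[OF elim(2)] norm_divide norm_power by (simp add: eval_nat_numeral)
    also have "\<dots> \<le> norm a * norm (B z) / norm z ^ 4"
      using elim(1) by (intro divide_right_mono) auto
    also have "\<dots> = norm (a * wp'' \<tau> z)"
      unfolding B(3)[OF elim(2)] by (simp add: norm_divide norm_power norm_mult)
    finally show ?case .
  qed
  have "filterlim (wp'' \<tau>) at_infinity (at 0)"
    by (rule filterlim_pole[OF \<tau> B(1) _ B(3)]) (simp_all add: B(2))
  then have "eventually (\<lambda>z. norm (wp'' \<tau> z) \<ge> 1 / norm a) (at 0)"
    unfolding filterlim_at_infinity[OF order_refl] using a by simp
  with 1 have "eventually (\<lambda>z. 2 * norm (wp' \<tau> z) \<le> norm (a * wp'' \<tau> z) \<and> 1 \<le> norm (a * wp'' \<tau> z)) (at 0)"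
    by eventually_elim (use a in \<open>simp add: norm_mult field_simps\<close>)
  then obtain r where r: "r > 0" "\<And>z. z \<noteq> 0 \<Longrightarrow> dist z 0 < r \<Longrightarrow>
      2 * norm (wp' \<tau> z) \<le> norm (a * wp'' \<tau> z) \<and> 1 \<le> norm (a * wp'' \<tau> z)"
    unfolding eventually_at by blast
  let ?K = "parallelogram \<tau> - ball 0 r"
  note K = compact_parallelogram_diff_ball[OF \<tau> r(1)]
  have "bounded (wp \<tau> ` ?K)" "bounded ((\<lambda>z. a * wp'' \<tau> z) ` ?K)"
    by (intro compact_imp_bounded compact_continuous_image K continuous_on_subset[OF _ K(2)] wp_continuous \<tau>
        continuous_intros holomorphic_on_imp_continuous_on holomorphic_wp'' \<tau>)+
  then obtain M C where M: "\<And>z. z \<in> ?K \<Longrightarrow> norm (wp \<tau> z) \<le> M" and C: "\<And>z. z \<in> ?K \<Longrightarrow> norm (a * wp'' \<tau> z) \<le> C"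
    unfolding bounded_iff by blast
  show ?thesis
  proof (rule that[of "M\<^sup>2" C])
    fix z assume z: "z \<notin> lattice \<tau>"
    obtain w \<omega> where w: "z = w + \<omega>" "w \<in> parallelogram \<tau>" "\<omega> \<in> lattice \<tau>"
      using parallelogram_reduce[OF \<tau>] by blast
    have wl: "w \<notin> lattice \<tau>" using z w lattice_add_iff by blast
    then have w0: "w \<noteq> 0" by auto
    have eq: "wp \<tau> z = wp \<tau> w" "wp' \<tau> z = wp' \<tau> w" "wp'' \<tau> z = wp'' \<tau> w"
      unfolding w(1) using wp_period[OF \<tau> w(3) wl] wp'_period[OF w(3)] wp''_period[OF \<tau> wl w(3)] by auto
    show "(norm (wp \<tau> z))\<^sup>2 \<le> M\<^sup>2 \<and> norm (a * wp'' \<tau> z) \<le> C \<or>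
      2 * norm (wp' \<tau> z) \<le> norm (a * wp'' \<tau> z) \<and> 1 \<le> norm (a * wp'' \<tau> z)"
    proof (cases "norm w < r")
      case True
      then show ?thesis using r(2)[OF w0] unfolding eq by simp
    next
      case False
      then have "w \<in> ?K" using w(2) by simp
      then show ?thesis using M[of w] C[of w] unfolding eq by (simp add: power_mono)
    qed
  qed
qed

text \<open>T is a cutoff times |dz|^2, where the cutoff depends on |\<open>wp\<close>| and is
  therefore periodic and smooth. Both |v|^2 and |f v|^2 are then bounded by a multiple of T plus the
  flat form, and the multiple of F with derivative b f serves as the proper Lipschitz
  function.\<close>

lemma complete_front_torus: "complete_front (punctured_torus \<tau>) (front_F \<tau> a) (front_G \<tau>)"
proof -
  obtain R C where RC: "\<And>z. z \<notin> lattice \<tau> \<Longrightarrow>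
    (norm (wp \<tau> z))\<^sup>2 \<le> R \<and> norm (a * wp'' \<tau> z) \<le> C \<or>
    2 * norm (wp' \<tau> z) \<le> norm (a * wp'' \<tau> z) \<and> 1 \<le> norm (a * wp'' \<tau> z)"
    using front_estimate by blast
  let ?S = "punctured_torus \<tau>"
  \<comment> \<open>Vanishes for |\<open>wp\<close>|^2 \<ge> R + 1, thus near the puncture, and is
    at least exp(-1) where |\<open>wp\<close>|^2 \<le> R, that is, in the first alternative of the
    dichotomy.\<close>
  define \<kappa> where "\<kappa> z = bump_poly [:1:] (R + 1 - (norm (wp \<tau> z))\<^sup>2)" for z
  define T where "T = (\<lambda>(c :: complex set chart) p v w. \<kappa> (cls_rep p) * Re (v * cnj w))"
  define f where "f z = a * wp'' \<tau> z" for z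
  define g where "g z = wp' \<tau> z" for z
  define X where "X z v w = \<kappa> z * Re (v * cnj w) + flat_coeff (f z) (g z) v w" for z v w
  have \<kappa>_per: "\<kappa> (z + \<omega>) = \<kappa> z" if "z \<notin> lattice \<tau>" "\<omega> \<in> lattice \<tau>" for z \<omega>
    using that by (simp add: \<kappa>_def wp_period[OF \<tau>])
  have \<kappa>: "0 \<le> \<kappa> z" "\<kappa> z \<le> 1" for z by (simp_all add: \<kappa>_def bump_poly_def)
  have T_eq: "T c (cls \<tau> z) v w = \<kappa> z * Re (v * cnj w)" if "z \<in> - lattice \<tau>" for c z v w
    by (rule cls_rep_add[of \<tau> z]) (use that in \<open>simp add: T_def \<kappa>_per\<close>)
  have smooth_\<kappa>: "smooth_fun (- lattice \<tau>) (\<lambda>z. \<kappa> z * c)" for c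
    unfolding \<kappa>_def
  proof (intro smooth_fun.mult smooth_fun.bump smooth_fun_const)
    have "smooth_fun (- lattice \<tau>) (\<lambda>z. (R + 1) + Re (- wp \<tau> z * cnj (wp \<tau> z)))"
      by (intro smooth_fun.add smooth_fun_const smooth_fun_Re_mult_cnj holomorphic_intros holomorphic_wp \<tau>)
    then show "smooth_fun (- lattice \<tau>) (\<lambda>z. R + 1 - (norm (wp \<tau> z))\<^sup>2)"
      unfolding cmod_power2 by (simp add: power2_eq_square algebra_simps)
  qed
  have smooth_flat: "smooth_fun (- lattice \<tau>) (\<lambda>z. flat_coeff (f z) (g z) v w)" for v w
    unfolding flat_coeff_def f_def g_def
    by (intro smooth_fun.add smooth_fun.mult smooth_fun_const smooth_fun.Re smooth_fun_Re_mult_cnj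
        holomorphic_intros holomorphic_wp'' holomorphic_wp' \<tau>)
  have bil: "bilinear (\<lambda>v w. c * Re (v * cnj w))" for c :: real
    using bilinear_scale[OF bilinear_Re_mult_cnj[of 1 1], of c] by simp
  have sym: "Re (v * cnj w) = Re (w * cnj v)" for v w by (simp add: algebra_simps)
  have symT: "symmetric_form ?S T"
    by (rule Q.symmetric_formI[where X = "\<lambda>z v w. \<kappa> z * Re (v * cnj w)"])
      (use T_eq bil sym smooth_\<kappa> in auto)
  have supp: "compactly_supported ?S T"
  proof -
    have "filterlim (wp \<tau>) at_infinity (at 0)" by (rule filterlim_wp[OF \<tau>])
    moreover have "\<bar>R\<bar> + 2 > 0" by linarith
    ultimately have "eventually (\<lambda>z. norm (wp \<tau> z) \<ge> \<bar>R\<bar> + 2) (at 0)"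
      unfolding filterlim_at_infinity[OF order_refl] by blast
    then obtain r where r: "r > 0" "\<And>z. z \<noteq> 0 \<Longrightarrow> dist z 0 < r \<Longrightarrow> norm (wp \<tau> z) \<ge> \<bar>R\<bar> + 2"
      unfolding eventually_at by blast
    let ?K = "parallelogram \<tau> - ball 0 r"
    note K = compact_parallelogram_diff_ball[OF \<tau> r(1)]
    have cK: "compactin (stop ?S) (cls \<tau> ` ?K)"
      by (rule image_compactin[OF _ Q.continuous_map_cls])
        (use K in \<open>simp add: compactin_subtopology\<close>)
    show ?thesis unfolding compactly_supported_def
    proof (intro exI[of _ "cls \<tau> ` ?K"] conjI cK ballI allI)
      fix c p v w assume c: "c \<in> charts ?S" and p: "p \<in> fst c - cls \<tau> ` ?K"
      obtain W where W: "W \<subseteq> - lattice \<tau>" "lattice_chart \<tau> c W" using Q.chart[OF c] by blast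
      obtain z where z: "z \<in> W" "p = cls \<tau> z" using p lattice_chartD(3)[OF W(2)] by blast
      have zl: "z \<notin> lattice \<tau>" using z W(1) by blast
      obtain u \<omega> where u: "z = u + \<omega>" "u \<in> parallelogram \<tau>" "\<omega> \<in> lattice \<tau>"
        using parallelogram_reduce[OF \<tau>] by blast
      have ul: "u \<notin> lattice \<tau>" using zl u lattice_add_iff by blast
      then have u0: "u \<noteq> 0" by auto
      have pu: "p = cls \<tau> u" using z(2) u by simp
      then have "u \<notin> ?K" using p by blast
      then have "dist u 0 < r" using u(2) by simp
      then have ge: "norm (wp \<tau> u) \<ge> \<bar>R\<bar> + 2" by (rule r(2)[OF u0])
      have "\<bar>R\<bar> + 2 \<le> norm (wp \<tau> u) * 1" using ge by simp
      also have "\<dots> \<le> norm (wp \<tau> u) * norm (wp \<tau> u)" using ge by (intro mult_left_mono) auto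
      finally have "R + 1 - (norm (wp \<tau> u))\<^sup>2 \<le> 0" by (simp add: power2_eq_square)
      then have "\<kappa> u = 0" by (simp add: \<kappa>_def bump_poly_def)
      then show "T c p v w = 0" using T_eq[of u c v w] ul pu by simp
    qed
  qed
  define G where "G = (\<lambda>c p v w. T c p v w + flat_form (front_F \<tau> a) (front_G \<tau>) c p v w)"
  have G_eq: "G c (cls \<tau> z) v w = X z v w" if "c \<in> charts ?S" "z \<in> - lattice \<tau>" "cls \<tau> z \<in> fst c" for c z v w
  proof -
    have "z \<notin> lattice \<tau>" using that(2) by simp
    note d = dcoef_front[OF \<tau> a that(1) this that(3)]
    show ?thesis
      unfolding G_def X_def T_eq[OF that(2)] flat_form_def Let_def d flat_coeff_def f_def g_def
      by (simp only: mult.assoc)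
  qed
  \<comment> \<open>Large enough for both alternatives: the first gives the factors exp 1 and C^2
    exp 1 for |v|^2 and |f v|^2. The second has |f| - |g| \<ge> |f|/2 and |f| \<ge> 1, which gives 4
    for both.\<close>
  define B where "B = (1 + C\<^sup>2) * exp 1 + 4"
  have B: "B > 0" by (simp add: B_def add_pos_pos add_nonneg_pos)
  have est: "(norm v)\<^sup>2 \<le> B * X z v v \<and> (norm (f z * v))\<^sup>2 \<le> B * X z v v" if z: "z \<notin> lattice \<tau>" for z v
  proof -
    have vv: "Re (v * cnj v) = (norm v)\<^sup>2" by (rule Re_mult_cnj_same)
    have fl: "flat_coeff (f z) (g z) v v \<ge> 0" using flat_coeff_ge[of "f z" "g z" v] by (rule order_trans[rotated]) simp
    have X0: "X z v v \<ge> \<kappa> z * (norm v)\<^sup>2" "X z v v \<ge> flat_coeff (f z) (g z) v v"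
      using fl \<kappa>(1)[of z] unfolding X_def vv by simp_all
    have Xn: "X z v v \<ge> 0" using X0(2) fl by linarith
    from RC[OF z] show ?thesis
    proof
      assume c1: "(norm (wp \<tau> z))\<^sup>2 \<le> R \<and> norm (a * wp'' \<tau> z) \<le> C"
      define x where "x = R + 1 - (norm (wp \<tau> z))\<^sup>2"
      have x: "x \<ge> 1" using c1 by (simp add: x_def)
      have "exp (- 1) \<le> \<kappa> z"
        using x by (simp add: \<kappa>_def bump_poly_def flip: x_def)
      then have "exp (- 1) * (norm v)\<^sup>2 \<le> X z v v"
        using X0(1) mult_right_mono[of "exp (- 1)" "\<kappa> z" "(norm v)\<^sup>2"] by simp
      then have v: "(norm v)\<^sup>2 \<le> exp 1 * X z v v" by (simp add: exp_minus field_simps)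
      have "(norm (f z * v))\<^sup>2 \<le> C\<^sup>2 * (norm v)\<^sup>2"
        using c1 unfolding f_def norm_mult[of "a * wp'' \<tau> z"] power_mult_distrib[of "norm (a * wp'' \<tau> z)"]
        by (intro mult_right_mono power_mono) auto
      also have "\<dots> \<le> C\<^sup>2 * (exp 1 * X z v v)" using v by (intro mult_left_mono) auto
      finally have f: "(norm (f z * v))\<^sup>2 \<le> C\<^sup>2 * (exp 1 * X z v v)" .
      have "0 \<le> exp 1 * X z v v" "0 \<le> C\<^sup>2 * (exp 1 * X z v v)" using Xn by simp_all
      moreover have "B * X z v v = exp 1 * X z v v + C\<^sup>2 * (exp 1 * X z v v) + 4 * X z v v"
        by (simp add: B_def algebra_simps)
      ultimately show ?thesis using v f Xn by (intro conjI) linarith+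
    next
      assume c2: "2 * norm (wp' \<tau> z) \<le> norm (a * wp'' \<tau> z) \<and> 1 \<le> norm (a * wp'' \<tau> z)"
      have "norm (f z) / 2 \<le> norm (f z) - norm (g z)" using c2 by (simp add: f_def g_def)
      from mult_right_mono[OF this, of "norm v"]
      have "(norm (f z) * norm v / 2)\<^sup>2 \<le> ((norm (f z) - norm (g z)) * norm v)\<^sup>2"
        by (intro power_mono) auto
      also have "\<dots> \<le> X z v v" using flat_coeff_ge X0(2) by (rule order_trans)
      finally have f: "(norm (f z * v))\<^sup>2 \<le> 4 * X z v v"
        by (simp add: norm_mult power_divide)
      have "norm v \<le> norm (f z * v)"
        using c2 mult_right_mono[of 1 "norm (f z)" "norm v"] by (simp add: f_def norm_mult)
      then have "(norm v)\<^sup>2 \<le> (norm (f z * v))\<^sup>2" by (intro power_mono) auto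
      then have v: "(norm v)\<^sup>2 \<le> 4 * X z v v" using f by linarith
      have "4 * X z v v \<le> B * X z v v"
        using Xn by (intro mult_right_mono) (auto simp: B_def intro!: mult_nonneg_nonneg)
      with v f show ?thesis by linarith
    qed
  qed
  define b where "b = 1 / sqrt B"
  have b: "b > 0" "b\<^sup>2 * B = 1" using B by (simp_all add: b_def power_divide)
  have sqrt_est: "b * norm v \<le> sqrt (X z v v)" "b * norm (f z * v) \<le> sqrt (X z v v)"
    if z: "z \<in> - lattice \<tau>" for z v
  proof -
    have bB: "b\<^sup>2 * (B * X z v v) = X z v v" using b(2) by (simp flip: mult.assoc)
    have "z \<notin> lattice \<tau>" using z by simp
    then have "b\<^sup>2 * (norm v)\<^sup>2 \<le> X z v v" "b\<^sup>2 * (norm (f z * v))\<^sup>2 \<le> X z v v"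
      using est[of z v] mult_left_mono[of "(norm v)\<^sup>2" "B * X z v v" "b\<^sup>2"]
        mult_left_mono[of "(norm (f z * v))\<^sup>2" "B * X z v v" "b\<^sup>2"]
      unfolding bB by simp_all
    then have "(b * norm v)\<^sup>2 \<le> X z v v" "(b * norm (f z * v))\<^sup>2 \<le> X z v v"
      by (simp_all only: power_mult_distrib)
    then show "b * norm v \<le> sqrt (X z v v)" "b * norm (f z * v) \<le> sqrt (X z v v)"
      by - (rule real_le_rsqrt, assumption)+
  qed
  have "complete_metric ?S G"
  proof (rule Q.complete_metricI[where X = X and b = b and H = "\<lambda>z. of_real b * (a * wp' \<tau> z)"
        and H' = "\<lambda>z. of_real b * f z"])
    show "riemannian_metric ?S G"
    proof (rule Q.riemannian_metricI[where X = X])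
      show "bilinear (X z)" for z
        unfolding X_def[abs_def] by (intro bilinear_add bil bilinear_flat_coeff)
      show "X z v w = X z w v" for z v w
        unfolding X_def using sym[of v w] flat_coeff_sym by simp
      show "smooth_fun (- lattice \<tau>) (\<lambda>z. X z v w)" for v w
        unfolding X_def by (intro smooth_fun.add smooth_\<kappa> smooth_flat)
      show "X z v v > 0" if "z \<in> - lattice \<tau>" "v \<noteq> 0" for z v
      proof -
        have "z \<notin> lattice \<tau>" using that(1) by simp
        from est[OF this, of v] have "(norm v)\<^sup>2 \<le> B * X z v v" by blast
        moreover have "0 < (norm v)\<^sup>2" using that(2) by simp
        ultimately have "0 < B * X z v v" by linarith
        then show ?thesis using B by (simp add: zero_less_mult_iff)
      qed
    qed (use G_eq in auto)
    fix z assume z: "z \<in> - lattice \<tau>"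
    show "\<exists>\<delta>>0. \<exists>C\<ge>0. ball z \<delta> \<subseteq> - lattice \<tau> \<and> (\<forall>u\<in>ball z \<delta>. \<forall>v. X u v v \<le> (C * norm v)\<^sup>2)"
    proof -
      obtain \<delta> where \<delta>: "\<delta> > 0" "cball z \<delta> \<subseteq> - lattice \<tau>"
        using open_contains_cball open_Compl_lattice[OF \<tau>] z by blast
      have "bounded (f ` cball z \<delta>)" "bounded (g ` cball z \<delta>)"
        unfolding f_def g_def
        by (intro compact_imp_bounded compact_continuous_image compact_cball continuous_on_subset[OF _ \<delta>(2)]
            continuous_intros holomorphic_on_imp_continuous_on holomorphic_wp'' holomorphic_wp' \<tau>)+
      then obtain M N where M: "\<And>u. u \<in> cball z \<delta> \<Longrightarrow> norm (f u) \<le> M" and N: "\<And>u. u \<in> cball z \<delta> \<Longrightarrow> norm (g u) \<le> N"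
        unfolding bounded_iff by blast
      have MN: "M \<ge> 0" "N \<ge> 0"
        using M[of z] N[of z] \<delta>(1) norm_ge_zero order_trans by (metis centre_in_cball less_imp_le)+
      have "X u v v \<le> ((1 + M + N) * norm v)\<^sup>2" if u: "u \<in> ball z \<delta>" for u v
      proof -
        have "flat_coeff (f u) (g u) v v \<le> ((norm (f u) + norm (g u)) * norm v)\<^sup>2"
          by (rule flat_coeff_le)
        also have "\<dots> \<le> ((M + N) * norm v)\<^sup>2"
          using M[of u] N[of u] u by (intro power_mono mult_right_mono add_mono) auto
        finally have "X u v v \<le> 1 * (norm v)\<^sup>2 + ((M + N) * norm v)\<^sup>2"
          unfolding X_def Re_mult_cnj_same using mult_right_mono[OF \<kappa>(2)[of u], of "(norm v)\<^sup>2"]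
          by simp
        also have "\<dots> \<le> ((1 + M + N) * norm v)\<^sup>2"
          using MN by (simp add: power2_eq_square algebra_simps)
        finally show ?thesis .
      qed
      moreover have "ball z \<delta> \<subseteq> - lattice \<tau>" using ball_subset_cball \<delta>(2) by (rule order_trans)
      moreover have "0 \<le> 1 + M + N" using MN by simp
      ultimately show ?thesis using \<delta>(1) by blast
    qed
    show "((\<lambda>z. of_real b * (a * wp' \<tau> z)) has_field_derivative of_real b * f z) (at z)"
      unfolding f_def by (intro DERIV_cmult wp'_deriv[OF \<tau>]) (use z in auto)
    show "norm (of_real b * f z * v) \<le> sqrt (X z v v)" for v
      using sqrt_est(2)[OF z, of v] b(1) by (simp add: norm_mult mult.assoc)
    show "of_real b * (a * wp' \<tau> (z + \<omega>)) = of_real b * (a * wp' \<tau> z)" if "\<omega> \<in> lattice \<tau>" for \<omega>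
      by (simp add: wp'_period[OF that])
  next
    fix \<zeta> :: "nat \<Rightarrow> complex" and z assume \<zeta>: "\<And>n. \<zeta> n \<in> - lattice \<tau>" "\<zeta> \<longlonglongrightarrow> z" and "z \<notin> - lattice \<tau>"
    then have z: "z \<in> lattice \<tau>" by simp
    have "filterlim (\<lambda>n. \<zeta> n - z) (at 0) sequentially"
      unfolding filterlim_at using \<zeta>(1) z LIM_zero[OF \<zeta>(2)] by (auto intro!: always_eventually)
    from filterlim_compose[OF filterlim_wp'[OF \<tau>] this]
    have "filterlim (\<lambda>n. wp' \<tau> (\<zeta> n - z)) at_infinity sequentially" .
    moreover have "wp' \<tau> (\<zeta> n - z) = wp' \<tau> (\<zeta> n)" for n
      using wp'_period[OF lattice_uminus[OF z], of "\<zeta> n"] by simp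
    ultimately have "filterlim (\<lambda>n. wp' \<tau> (\<zeta> n)) at_infinity sequentially" by simp
    moreover have "((\<lambda>n. of_real b * a) \<longlongrightarrow> of_real b * a) sequentially" by simp
    moreover have "of_real b * a \<noteq> 0" using a b(1) by simp
    ultimately have "filterlim (\<lambda>n. (of_real b * a) * wp' \<tau> (\<zeta> n)) at_infinity sequentially"
      using tendsto_mult_filterlim_at_infinity by blast
    then show "filterlim (\<lambda>n. of_real b * (a * wp' \<tau> (\<zeta> n))) at_infinity sequentially"
      by (simp add: mult.assoc)
  qed (use G_eq b(1) sqrt_est(1) in auto)
  then show ?thesis
    unfolding complete_front_def G_def using symT supp by blast
qed

end


section \<open>The total curvature\<close>

text \<open>The classical K = -(Laplacian of log \<Lambda>)/(2 \<Lambda>). The assumptions present p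
  and q as the partial derivatives of log \<Lambda>, so that the Christoffel symbols are
  \<plusminus>p/2 and \<plusminus>q/2, and their quadratic terms cancel in the curvature.\<close>

lemma gauss_curv_plane_conformal:
  assumes U: "open U" "z \<in> U" and m: "\<And>u v w. u \<in> U \<Longrightarrow> m u v w = \<Lambda> u * Re (v * cnj w)"
    and pos: "\<And>u. u \<in> U \<Longrightarrow> \<Lambda> u > 0"
    and d: "\<And>u. u \<in> U \<Longrightarrow> (\<Lambda> has_derivative d\<Lambda> u) (at u)"
    and pq: "\<And>u. u \<in> U \<Longrightarrow> d\<Lambda> u 1 = p u * \<Lambda> u" "\<And>u. u \<in> U \<Longrightarrow> d\<Lambda> u \<i> = q u * \<Lambda> u"
    and p': "(p has_derivative p') (at z)" and q': "(q has_derivative q') (at z)"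
  shows "gauss_curv_plane m z = - (p' 1 + q' \<i>) / (2 * \<Lambda> z)" and "metric_det m z = (\<Lambda> z)\<^sup>2"
proof -
  have ne: "(1 :: complex) \<noteq> \<i>" "\<i> \<noteq> (1 :: complex)" by (simp_all add: complex_eq_iff)
  have pd: "pderiv_dir e (\<lambda>u. m u j l) u = d\<Lambda> u e * Re (j * cnj l)" if u: "u \<in> U" for u e j l
  proof -
    have "((\<lambda>u. \<Lambda> u * Re (j * cnj l)) has_derivative (\<lambda>e. d\<Lambda> u e * Re (j * cnj l))) (at u)"
      by (rule has_derivative_mult_left[OF d[OF u]])
    then have "((\<lambda>u. m u j l) has_derivative (\<lambda>e. d\<Lambda> u e * Re (j * cnj l))) (at u)"
      by (rule has_derivative_transform_within_open[OF _ U(1) u]) (simp add: m)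
    from frechet_derivative_at[OF this] show ?thesis
      by (simp add: pderiv_dir_def fun_eq_iff)
  qed
  have det: "metric_det m u = (\<Lambda> u)\<^sup>2" if "u \<in> U" for u
    using m[OF that] by (simp add: metric_det_def power2_eq_square)
  then show "metric_det m z = (\<Lambda> z)\<^sup>2" using U by simp
  have chr: "christoffel m 1 \<i> \<i> u = - p u / 2" "christoffel m \<i> \<i> \<i> u = q u / 2"
    "christoffel m 1 1 1 u = p u / 2" "christoffel m 1 1 \<i> u = q u / 2"
    "christoffel m \<i> 1 \<i> u = p u / 2" "christoffel m 1 \<i> 1 u = q u / 2" if u: "u \<in> U" for u
    using pos[OF u] ne
    by (simp_all add: christoffel_def pd[OF u] metric_inv_def det[OF u] m[OF u] pq[OF u] power2_eq_square)
  have P1: "pderiv_dir 1 (christoffel m 1 \<i> \<i>) z = - p' 1 / 2"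
  proof -
    have "((\<lambda>u. - p u / 2) has_derivative (\<lambda>e. - p' e / 2)) (at z)"
      using p' by (auto intro!: derivative_eq_intros)
    then have "(christoffel m 1 \<i> \<i> has_derivative (\<lambda>e. - p' e / 2)) (at z)"
      by (rule has_derivative_transform_within_open[OF _ U]) (simp add: chr)
    from frechet_derivative_at[OF this] show ?thesis by (simp add: pderiv_dir_def fun_eq_iff)
  qed
  have P2: "pderiv_dir \<i> (christoffel m 1 1 \<i>) z = q' \<i> / 2"
  proof -
    have "((\<lambda>u. q u / 2) has_derivative (\<lambda>e. q' e / 2)) (at z)"
      using q' by (auto intro!: derivative_eq_intros)
    then have "(christoffel m 1 1 \<i> has_derivative (\<lambda>e. q' e / 2)) (at z)"
      by (rule has_derivative_transform_within_open[OF _ U]) (simp add: chr)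
    from frechet_derivative_at[OF this] show ?thesis by (simp add: pderiv_dir_def fun_eq_iff)
  qed
  have "riem m 1 z = - p' 1 / 2 - q' \<i> / 2"
    using ne by (simp add: riem_def P1 P2 chr[OF U(2)])
  then show "gauss_curv_plane m z = - (p' 1 + q' \<i>) / (2 * \<Lambda> z)"
    using ne pos[OF U(2)]
    by (simp add: gauss_curv_plane_def det[OF U(2)] m[OF U(2)] power2_eq_square field_simps)
qed

text \<open>\<open>log_dz\<close> is the \<open>z\<close>-derivative of \<open>log (\<bar>f\<bar>\<^sup>2 + \<bar>g\<bar>\<^sup>2)\<close>, where \<open>f1\<close>, \<open>f2\<close> stand for the first two
  derivatives of \<open>f\<close>; \<open>log_dz_deriv\<close> is its real differential.\<close>

definition log_dz :: "(complex \<Rightarrow> complex) \<Rightarrow> (complex \<Rightarrow> complex) \<Rightarrow> (complex \<Rightarrow> complex) \<Rightarrow>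
    (complex \<Rightarrow> complex) \<Rightarrow> complex \<Rightarrow> complex" where
  "log_dz f f1 g g1 z = (f1 z * cnj (f z) + g1 z * cnj (g z)) / (f z * cnj (f z) + g z * cnj (g z))"

definition log_dz_deriv :: "(complex \<Rightarrow> complex) \<Rightarrow> (complex \<Rightarrow> complex) \<Rightarrow> (complex \<Rightarrow> complex) \<Rightarrow>
    (complex \<Rightarrow> complex) \<Rightarrow> (complex \<Rightarrow> complex) \<Rightarrow> (complex \<Rightarrow> complex) \<Rightarrow> complex \<Rightarrow> complex \<Rightarrow> complex" where
  "log_dz_deriv f f1 f2 g g1 g2 z v =
     (((f1 z * cnj (f1 z * v) + f2 z * v * cnj (f z)) + (g1 z * cnj (g1 z * v) + g2 z * v * cnj (g z))) *
        (f z * cnj (f z) + g z * cnj (g z)) -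
      (f1 z * cnj (f z) + g1 z * cnj (g z)) *
        ((f z * cnj (f1 z * v) + f1 z * v * cnj (f z)) + (g z * cnj (g1 z * v) + g1 z * v * cnj (g z)))) /
     ((f z * cnj (f z) + g z * cnj (g z)) * (f z * cnj (f z) + g z * cnj (g z)))"

lemma sum_mult_cnj_eq: "f * cnj f + g * cnj g = of_real ((norm f)\<^sup>2 + (norm g)\<^sup>2)"
  by (simp only: of_real_add complex_norm_square)

lemma sum_mult_cnj_nonzero: "f \<noteq> 0 \<or> g \<noteq> 0 \<Longrightarrow> f * cnj f + g * cnj g \<noteq> 0"
  unfolding sum_mult_cnj_eq of_real_eq_0_iff by (simp add: add_nonneg_eq_0_iff)

lemma has_derivative_log_dz:
  assumes f: "(f has_field_derivative f1 z) (at z)" "(f1 has_field_derivative f2 z) (at z)"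
    and g: "(g has_field_derivative g1 z) (at z)" "(g1 has_field_derivative g2 z) (at z)"
    and nz: "f z \<noteq> 0 \<or> g z \<noteq> 0"
  shows "(log_dz f f1 g g1 has_derivative log_dz_deriv f f1 f2 g g1 g2 z) (at z)"
proof -
  note d = f[unfolded has_field_derivative_def] g[unfolded has_field_derivative_def]
  note c = bounded_linear.has_derivative[OF bounded_linear_cnj]
  show ?thesis
    unfolding log_dz_def[abs_def] log_dz_deriv_def[abs_def]
    by (rule has_derivative_divide'
        [OF has_derivative_add[OF has_derivative_mult[OF d(2) c[OF d(1)]] has_derivative_mult[OF d(4) c[OF d(3)]]]
          has_derivative_add[OF has_derivative_mult[OF d(1) c[OF d(1)]] has_derivative_mult[OF d(3) c[OF d(3)]]]
          sum_mult_cnj_nonzero[OF nz]])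
qed

lemma isCont_log_dz_deriv:
  assumes "isCont f z" "isCont f1 z" "isCont f2 z" "isCont g z" "isCont g1 z" "isCont g2 z"
    and "f z \<noteq> 0 \<or> g z \<noteq> 0"
  shows "isCont (\<lambda>z. log_dz_deriv f f1 f2 g g1 g2 z v) z"
proof -
  have "(f z * cnj (f z) + g z * cnj (g z)) * (f z * cnj (f z) + g z * cnj (g z)) \<noteq> 0"
    using sum_mult_cnj_nonzero[OF assms(7)] by simp
  then show ?thesis
    unfolding log_dz_deriv_def by (intro continuous_intros assms(1-6))
qed

section \<open>Lebesgue measure in lattice coordinates and the period cell\<close>

definition half_square :: "(real \<times> real) set" where
  "half_square = {-1/2..<1/2} \<times> {-1/2..<1/2} - {(0, 0)}"

lemma half_square_borel [measurable]: "half_square \<in> sets borel"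
proof -
  have "{-1/2..<1/2 :: real} \<times> {-1/2..<1/2 :: real} \<in> sets (borel \<Otimes>\<^sub>M borel)"
    by (rule pair_measureI) simp_all
  then show ?thesis
    unfolding half_square_def borel_prod by (rule sets.Diff) simp
qed

lemma half_indicator_integral: "(LINT t|lborel. indicator {-1/2..<1/2 :: real} t *\<^sub>R (c :: complex)) = c"
proof -
  have "integrable lborel (indicator {-1/2..<1/2 :: real} :: real \<Rightarrow> real)"
    by (simp add: integrable_indicator_iff)
  then have "(LINT t|lborel. indicator {-1/2..<1/2 :: real} t *\<^sub>R c) =
      (LINT t|lborel. indicator {-1/2..<1/2 :: real} t) *\<^sub>R c"
    by (intro integral_scaleR_left)
  then show ?thesis by simp
qed

abbreviation coord_pt :: "complex \<Rightarrow> real \<times> real \<Rightarrow> complex" where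
  "coord_pt \<tau> \<equiv> \<lambda>(x, y). of_real x + of_real y * \<tau>"

lemma coord_pt_half_square:
  assumes \<tau>: "Im \<tau> > 0" and p: "p \<in> half_square"
  shows "coord_pt \<tau> p \<in> parallelogram \<tau>" "coord_pt \<tau> p \<noteq> 0" "coord_pt \<tau> p \<notin> lattice \<tau>"
proof -
  show 1: "coord_pt \<tau> p \<in> parallelogram \<tau>"
    using p by (auto simp: parallelogram_def half_square_def intro!: imageI)
  show 2: "coord_pt \<tau> p \<noteq> 0"
    using p lattice_coords_eq_iff[OF \<tau>, of "fst p" "snd p" 0 0] by (cases p) (auto simp: half_square_def)
  show "coord_pt \<tau> p \<notin> lattice \<tau>" using parallelogram_lattice[OF \<tau> 1] 2 by blast
qed

lemma continuous_coord_pt: "continuous_on A (coord_pt \<tau>)"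
  unfolding case_prod_unfold by (intro continuous_intros)


text \<open>Lattice coordinates have Jacobian Im \<tau>. On a box this is Fubini: each horizontal
  slice of the preimage is a shifted interval of the width of the box, and the admissible heights
  are scaled by 1/Im \<tau>.\<close>

lemma lborel_complex_lattice:
  assumes \<tau>: "Im \<tau> > 0"
  shows "(lborel :: complex measure) =
    density (distr lborel borel (coord_pt \<tau>)) (\<lambda>_. ennreal (Im \<tau>))"
proof (rule lborel_eqI)
  define c where "c = Im \<tau>"
  have c: "c > 0" using \<tau> by (simp add: c_def)
  have lp: "coord_pt \<tau> \<in> borel_measurable lborel"
    unfolding case_prod_unfold by (simp add: borel_measurable_continuous_onI continuous_intros)
  fix l u :: complex assume lu: "\<And>b. b \<in> Basis \<Longrightarrow> l \<bullet> b \<le> u \<bullet> b"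
  have le: "Re l \<le> Re u" "Im l \<le> Im u" using lu[of 1] lu[of \<i>] by (simp_all add: Basis_complex_def)
  have A: "coord_pt \<tau> -` box l u \<in> sets (lborel \<Otimes>\<^sub>M lborel)"
    unfolding lborel_prod using measurable_sets[OF lp, of "box l u"] by simp
  have "emeasure (distr lborel borel (coord_pt \<tau>)) (box l u) = emeasure (lborel \<Otimes>\<^sub>M lborel) (coord_pt \<tau> -` box l u)"
    using lp by (subst emeasure_distr) (simp_all add: lborel_prod)
  also have "\<dots> = (\<integral>\<^sup>+y. emeasure lborel ((\<lambda>x. (x, y)) -` coord_pt \<tau> -` box l u) \<partial>lborel)"
    by (rule lborel_pair.emeasure_pair_measure_alt2[OF A])
  also have "\<dots> = (\<integral>\<^sup>+y. ennreal (Re u - Re l) * indicator {Im l / c<..<Im u / c} y \<partial>lborel)"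
  proof (rule nn_integral_cong)
    fix y :: real
    have "(\<lambda>x. (x, y)) -` coord_pt \<tau> -` box l u =
        (if y \<in> {Im l / c<..<Im u / c} then {Re l - y * Re \<tau><..<Re u - y * Re \<tau>} else {})"
      using c by (auto simp: in_box_complex_iff c_def field_simps)
    then show "emeasure lborel ((\<lambda>x. (x, y)) -` coord_pt \<tau> -` box l u) =
        ennreal (Re u - Re l) * indicator {Im l / c<..<Im u / c} y"
      using le by (simp add: indicator_def)
  qed
  also have "\<dots> = ennreal (Re u - Re l) * ennreal (Im u / c - Im l / c)"
    using le c by (subst nn_integral_cmult_indicator) (auto simp: divide_right_mono)
  finally have 1: "emeasure (distr lborel borel (coord_pt \<tau>)) (box l u) = ennreal ((Re u - Re l) * ((Im u - Im l) / c))"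
    using le c by (simp add: ennreal_mult diff_divide_distrib divide_right_mono)
  have "emeasure (density (distr lborel borel (coord_pt \<tau>)) (\<lambda>_. ennreal c)) (box l u)
      = ennreal c * emeasure (distr lborel borel (coord_pt \<tau>)) (box l u)"
    by (subst emeasure_density) (auto simp: nn_integral_cmult_indicator)
  also have "\<dots> = ennreal ((Re u - Re l) * (Im u - Im l))"
    unfolding 1 using le c by (simp flip: ennreal_mult)
  also have "(Re u - Re l) * (Im u - Im l) = (\<Prod>b\<in>Basis. (u - l) \<bullet> b)"
    by (simp add: Basis_complex_def complex_eq_iff)
  finally show "emeasure (density (distr lborel borel (coord_pt \<tau>)) (\<lambda>_. ennreal (Im \<tau>))) (box l u)
      = ennreal (\<Prod>b\<in>Basis. (u - l) \<bullet> b)" by (simp add: c_def)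
qed simp

text \<open>A half-open period parallelogram, punctured at the lattice point.\<close>

definition period_cell :: "complex \<Rightarrow> complex set" where
  "period_cell \<tau> = (\<lambda>z. (coord_x \<tau> z, coord_y \<tau> z)) -` half_square"

lemma period_cell_borel: "Im \<tau> > 0 \<Longrightarrow> period_cell \<tau> \<in> sets borel"
proof -
  assume \<tau>: "Im \<tau> > 0"
  have "continuous_on UNIV (\<lambda>z. (coord_x \<tau> z, coord_y \<tau> z))"
    unfolding coord_x_def coord_y_def by (intro continuous_intros) (use \<tau> in auto)
  from measurable_sets_borel[OF borel_measurable_continuous_onI[OF this] half_square_borel]
  show ?thesis unfolding period_cell_def by simp
qed

lemma coord_pt_period_cell:
  "Im \<tau> > 0 \<Longrightarrow> of_real x + of_real y * \<tau> \<in> period_cell \<tau> \<longleftrightarrow> (x, y) \<in> half_square"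
  by (simp add: period_cell_def)

lemma period_cell_not_lattice:
  assumes \<tau>: "Im \<tau> > 0" and z: "z \<in> period_cell \<tau>" shows "z \<notin> lattice \<tau>"
  using coord_pt_half_square(3)[OF \<tau>, of "(coord_x \<tau> z, coord_y \<tau> z)"] z coord_eq[OF \<tau>, of z]
  by (simp add: period_cell_def)

lemma period_cell_unique:
  assumes \<tau>: "Im \<tau> > 0" and z: "z \<notin> lattice \<tau>"
  obtains \<omega>\<^sub>0 where "\<omega>\<^sub>0 \<in> lattice \<tau>" "\<And>\<omega>. \<omega> \<in> lattice \<tau> \<Longrightarrow> z - \<omega> \<in> period_cell \<tau> \<longleftrightarrow> \<omega> = \<omega>\<^sub>0"
proof -
  obtain x y \<omega>\<^sub>0 where z_eq: "z = of_real x + of_real y * \<tau> + \<omega>\<^sub>0" "\<omega>\<^sub>0 \<in> lattice \<tau>"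
    and xy: "- 1/2 \<le> x" "x < 1/2" "- 1/2 \<le> y" "y < (1/2 :: real)"
    by (rule lattice_reduce[OF \<tau>]) blast
  have "(x, y) \<noteq> (0, 0)" using z z_eq by auto
  then have xy': "(x, y) \<in> half_square" using xy by (simp add: half_square_def)
  have "z - \<omega> \<in> period_cell \<tau> \<longleftrightarrow> \<omega> = \<omega>\<^sub>0" if \<omega>: "\<omega> \<in> lattice \<tau>" for \<omega>
  proof
    assume zw: "z - \<omega> \<in> period_cell \<tau>"
    obtain m n :: int where mn: "\<omega>\<^sub>0 - \<omega> = of_int m + of_int n * \<tau>"
      using lattice_diff[OF z_eq(2) \<omega>] by (auto simp: lattice_def)
    have "z - \<omega> = of_real x + of_real y * \<tau> + (\<omega>\<^sub>0 - \<omega>)" by (simp add: z_eq)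
    also have "\<dots> = of_real (x + m) + of_real (y + n) * \<tau>" unfolding mn by (simp add: algebra_simps)
    finally have "(x + m, y + n) \<in> half_square" using zw coord_pt_period_cell[OF \<tau>] by metis
    then have "-1/2 \<le> x + m" "x + m < 1/2" "-1/2 \<le> y + n" "y + n < 1/2" by (auto simp: half_square_def)
    then have "m = 0" "n = 0" using xy by linarith+
    with mn show "\<omega> = \<omega>\<^sub>0" by simp
  next
    assume "\<omega> = \<omega>\<^sub>0"
    then show "z - \<omega> \<in> period_cell \<tau>" using xy' coord_pt_period_cell[OF \<tau>, of x y] by (simp add: z_eq)
  qed
  with z_eq(2) show ?thesis using that by blast
qed

lemma nn_integral_count_space_unique:
  fixes k :: ennreal
  assumes "w \<in> I" "\<And>i. i \<in> I \<Longrightarrow> R i \<longleftrightarrow> i = w"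
  shows "(\<integral>\<^sup>+i. (if R i then k else 0) \<partial>count_space I) = k"
proof -
  have "(\<integral>\<^sup>+i. (if R i then k else 0) \<partial>count_space I) = (\<integral>\<^sup>+i. k * indicator {w} i \<partial>count_space I)"
    by (rule nn_integral_cong) (use assms in \<open>auto simp: indicator_def\<close>)
  also have "\<dots> = k" using assms(1) by (subst nn_integral_cmult_indicator) auto
  finally show ?thesis .
qed

text \<open>Unfolding: sum over the lattice translates of the period cell, translate each piece back into the
  cell and use that every point of the cell has exactly one translate in \<open>V\<close> or none.\<close>

lemma nn_integral_period_cell:
  assumes \<tau>: "Im \<tau> > 0" and \<phi>: "\<phi> \<in> borel_measurable borel"
    and per: "\<And>z \<omega>. \<omega> \<in> lattice \<tau> \<Longrightarrow> \<phi> (z + \<omega>) = (\<phi> z :: ennreal)"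
    and V: "V \<in> sets borel" "inj_on (cls \<tau>) V" "V \<subseteq> - lattice \<tau>"
  shows "(\<integral>\<^sup>+z. \<phi> z * indicator V z \<partial>lborel) =
    (\<integral>\<^sup>+z. \<phi> z * indicator (cls \<tau> -` (cls \<tau> ` V) \<inter> period_cell \<tau>) z \<partial>lborel)"
proof -
  let ?Q = "period_cell \<tau>" and ?L = "lattice \<tau>"
  note Q = period_cell_borel[OF \<tau>]
  define F where "F \<omega> z = (if z - \<omega> \<in> ?Q then \<phi> z * indicator V z else 0)" for \<omega> z
  define G where "G \<omega> z = (if z + \<omega> \<in> V then \<phi> z * indicator ?Q z else 0)" for \<omega> z
  have F_meas: "F \<omega> \<in> borel_measurable lborel" for \<omega>
  proof -
    have "(\<lambda>z. z - \<omega>) -` ?Q \<in> sets borel"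
      using measurable_sets_borel[OF borel_measurable_continuous_onI Q, of "\<lambda>z. z - \<omega>"]
      by (simp add: continuous_intros)
    then have "{z \<in> space lborel. z - \<omega> \<in> ?Q} \<in> sets lborel" by (simp add: vimage_def)
    then show ?thesis unfolding F_def using \<phi> V(1)
      by (intro measurable_If borel_measurable_times_ennreal borel_measurable_indicator) auto
  qed
  have G_meas: "G \<omega> \<in> borel_measurable lborel" for \<omega>
  proof -
    have "(\<lambda>z. z + \<omega>) -` V \<in> sets borel"
      using measurable_sets_borel[OF borel_measurable_continuous_onI V(1), of "\<lambda>z. z + \<omega>"]
      by (simp add: continuous_intros)
    then have "{z \<in> space lborel. z + \<omega> \<in> V} \<in> sets lborel" by (simp add: vimage_def)
    then show ?thesis unfolding G_def using \<phi> Q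
      by (intro measurable_If borel_measurable_times_ennreal borel_measurable_indicator) auto
  qed
  have FG: "(\<integral>\<^sup>+z. F \<omega> z \<partial>lborel) = (\<integral>\<^sup>+z. G \<omega> z \<partial>lborel)" if \<omega>: "\<omega> \<in> ?L" for \<omega>
  proof -
    have "(\<integral>\<^sup>+z. F \<omega> z \<partial>lborel) = (\<integral>\<^sup>+z. F \<omega> z \<partial>distr lborel borel ((+) \<omega>))"
      by (simp only: lborel_distr_plus)
    also have "\<dots> = (\<integral>\<^sup>+z. F \<omega> (\<omega> + z) \<partial>lborel)"
      by (rule nn_integral_distr) (use F_meas in auto)
    also have "\<dots> = (\<integral>\<^sup>+z. G \<omega> z \<partial>lborel)"
    proof (rule nn_integral_cong)
      fix z show "F \<omega> (\<omega> + z) = G \<omega> z"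
        using per[OF \<omega>, of z] by (simp add: F_def G_def indicator_def add.commute)
    qed
    finally show ?thesis .
  qed
  have "(\<integral>\<^sup>+z. \<phi> z * indicator V z \<partial>lborel) = (\<integral>\<^sup>+z. \<integral>\<^sup>+\<omega>. F \<omega> z \<partial>count_space ?L \<partial>lborel)"
  proof (rule nn_integral_cong)
    fix z
    show "\<phi> z * indicator V z = (\<integral>\<^sup>+\<omega>. F \<omega> z \<partial>count_space ?L)"
    proof (cases "z \<in> V")
      case True
      then have "z \<notin> ?L" using V(3) by blast
      then obtain \<omega>\<^sub>0 where "\<omega>\<^sub>0 \<in> ?L" "\<And>\<omega>. \<omega> \<in> ?L \<Longrightarrow> z - \<omega> \<in> ?Q \<longleftrightarrow> \<omega> = \<omega>\<^sub>0"
        by (rule period_cell_unique[OF \<tau>]) blast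
      from nn_integral_count_space_unique[OF this] show ?thesis by (simp add: F_def)
    qed (simp add: F_def cong: if_cong)
  qed
  also have "\<dots> = (\<integral>\<^sup>+\<omega>. \<integral>\<^sup>+z. F \<omega> z \<partial>lborel \<partial>count_space ?L)"
    by (rule nn_integral_count_space_nn_integral[OF countable_lattice F_meas])
  also have "\<dots> = (\<integral>\<^sup>+\<omega>. \<integral>\<^sup>+z. G \<omega> z \<partial>lborel \<partial>count_space ?L)"
    by (rule nn_integral_cong) (simp add: FG)
  also have "\<dots> = (\<integral>\<^sup>+z. \<integral>\<^sup>+\<omega>. G \<omega> z \<partial>count_space ?L \<partial>lborel)"
    by (rule nn_integral_count_space_nn_integral[OF countable_lattice G_meas, symmetric])
  also have "\<dots> = (\<integral>\<^sup>+z. \<phi> z * indicator (cls \<tau> -` (cls \<tau> ` V) \<inter> ?Q) z \<partial>lborel)"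
  proof (rule nn_integral_cong)
    fix z
    show "(\<integral>\<^sup>+\<omega>. G \<omega> z \<partial>count_space ?L) = \<phi> z * indicator (cls \<tau> -` (cls \<tau> ` V) \<inter> ?Q) z"
    proof (cases "\<exists>\<omega>\<in>?L. z + \<omega> \<in> V")
      case True
      then obtain \<omega>\<^sub>0 where \<omega>\<^sub>0: "\<omega>\<^sub>0 \<in> ?L" "z + \<omega>\<^sub>0 \<in> V" by blast
      have "z + \<omega> \<in> V \<longleftrightarrow> \<omega> = \<omega>\<^sub>0" if "\<omega> \<in> ?L" for \<omega>
      proof
        assume "z + \<omega> \<in> V"
        moreover have "cls \<tau> (z + \<omega>) = cls \<tau> (z + \<omega>\<^sub>0)" using that \<omega>\<^sub>0(1) by simp
        ultimately have "z + \<omega> = z + \<omega>\<^sub>0" using V(2) \<omega>\<^sub>0(2) by (metis inj_onD)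
        then show "\<omega> = \<omega>\<^sub>0" by simp
      qed (use \<omega>\<^sub>0 in simp)
      from nn_integral_count_space_unique[OF \<omega>\<^sub>0(1) this]
      have "(\<integral>\<^sup>+\<omega>. G \<omega> z \<partial>count_space ?L) = \<phi> z * indicator ?Q z" unfolding G_def .
      moreover have "z \<in> cls \<tau> -` (cls \<tau> ` V)"
        using \<omega>\<^sub>0 cls_add[OF \<omega>\<^sub>0(1), of z] by (metis imageI vimageI)
      ultimately show ?thesis by (simp add: indicator_def)
    next
      case False
      then have "(\<integral>\<^sup>+\<omega>. G \<omega> z \<partial>count_space ?L) = (\<integral>\<^sup>+\<omega>. 0 \<partial>count_space ?L)"
        by (intro nn_integral_cong) (auto simp: G_def)
      moreover have "z \<notin> cls \<tau> -` (cls \<tau> ` V)"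
      proof
        assume "z \<in> cls \<tau> -` (cls \<tau> ` V)"
        then obtain w where w: "w \<in> V" "cls \<tau> z = cls \<tau> w" by auto
        then obtain \<omega> where "\<omega> \<in> ?L" "w = z + \<omega>" by (metis cls_eqE)
        with w False show False by blast
      qed
      ultimately show ?thesis by simp
    qed
  qed
  finally show ?thesis .
qed

section \<open>The curvature integral over a period parallelogram\<close>

context
  fixes \<tau> a :: complex
  assumes \<tau>: "Im \<tau> > 0" and a: "a \<noteq> 0"
begin

private abbreviation (input) "f \<equiv> \<lambda>z. a * wp'' \<tau> z"
private abbreviation (input) "f1 \<equiv> \<lambda>z. a * (12 * wp \<tau> z * wp' \<tau> z)"
private abbreviation (input) "f2 \<equiv> \<lambda>z. a * (12 * (wp \<tau> z * wp'' \<tau> z + wp' \<tau> z * wp' \<tau> z))"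
private abbreviation (input) "g \<equiv> wp' \<tau>"
private abbreviation (input) "g1 \<equiv> wp'' \<tau>"
private abbreviation (input) "g2 \<equiv> \<lambda>z. 12 * wp \<tau> z * wp' \<tau> z"

lemma front_data_derivs:
  assumes z: "z \<notin> lattice \<tau>"
  shows "(f has_field_derivative f1 z) (at z)" "(f1 has_field_derivative f2 z) (at z)"
    "(g has_field_derivative g1 z) (at z)" "(g1 has_field_derivative g2 z) (at z)"
    "(g2 has_field_derivative f2 z / a) (at z)" "f z \<noteq> 0 \<or> g z \<noteq> 0"
proof -
  show "(f has_field_derivative f1 z) (at z)" by (rule DERIV_cmult[OF wp''_deriv[OF \<tau> z]])
  show "(g has_field_derivative g1 z) (at z)" by (rule wp'_deriv[OF \<tau> z])
  show "(g1 has_field_derivative g2 z) (at z)" by (rule wp''_deriv[OF \<tau> z])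
  have "((\<lambda>z. 12 * (wp \<tau> z * wp' \<tau> z)) has_field_derivative
      12 * (wp \<tau> z * wp'' \<tau> z + wp' \<tau> z * wp' \<tau> z)) (at z)"
    by (rule DERIV_cmult[OF DERIV_mult'[OF wp_deriv[OF \<tau> z] wp'_deriv[OF \<tau> z]]])
  then have *: "((\<lambda>z. 12 * wp \<tau> z * wp' \<tau> z) has_field_derivative
      12 * (wp \<tau> z * wp'' \<tau> z + wp' \<tau> z * wp' \<tau> z)) (at z)"
    by (simp only: mult.assoc)
  show "(f1 has_field_derivative f2 z) (at z)" by (rule DERIV_cmult[OF *])
  show "(g2 has_field_derivative f2 z / a) (at z)" using * a by simp
  show "f z \<noteq> 0 \<or> g z \<noteq> 0" using wp''_nonzero[OF \<tau> z] a by auto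
qed

text \<open>The first summand is periodic but behaves like -4/z at the puncture. Adding 4 \<zeta>,
  which is holomorphic off the lattice, removes the pole without changing the derivative in the
  conjugate variable; the price is the quasi-periods.\<close>

definition curv_h :: "complex \<Rightarrow> complex" where
  "curv_h z = log_dz f f1 g g1 z + 4 * wzeta \<tau> z"

definition curv_J :: "complex \<Rightarrow> complex \<Rightarrow> complex" where
  "curv_J z v = log_dz_deriv f f1 f2 g g1 g2 z v + 4 * (- wp \<tau> z * v)"

lemma curv_h_deriv:
  assumes z: "z \<notin> lattice \<tau>"
  shows "(curv_h has_derivative curv_J z) (at z)"
  unfolding curv_h_def[abs_def] curv_J_def[abs_def]
proof (rule has_derivative_add)
  show "(log_dz f f1 g g1 has_derivative log_dz_deriv f f1 f2 g g1 g2 z) (at z)"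
    by (rule has_derivative_log_dz[of f f1 z f2 g g1 g2]) (rule front_data_derivs[OF z])+
  show "((\<lambda>z. 4 * wzeta \<tau> z) has_derivative (\<lambda>v. 4 * (- wp \<tau> z * v))) (at z)"
    by (rule has_derivative_mult_right[OF wzeta_deriv[OF \<tau> z, unfolded has_field_derivative_def]])
qed

lemma continuous_on_curv_J: "continuous_on (- lattice \<tau>) (\<lambda>z. curv_J z v)"
proof (rule continuous_at_imp_continuous_on, rule ballI)
  fix z assume "z \<in> - lattice \<tau>"
  then have z: "z \<notin> lattice \<tau>" by simp
  note d = front_data_derivs[OF z]
  have c: "isCont (wp \<tau>) z" "isCont g z" "isCont g1 z"
    using DERIV_isCont[OF wp_deriv[OF \<tau> z]] DERIV_isCont[OF d(3)] DERIV_isCont[OF d(4)] by auto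
  have "isCont (\<lambda>z. log_dz_deriv f f1 f2 g g1 g2 z v) z"
    by (rule isCont_log_dz_deriv[of z f f1 f2 g g1 g2]) (intro continuous_intros c d(6))+
  then show "isCont (\<lambda>z. curv_J z v) z"
    unfolding curv_J_def by (intro continuous_intros c(1))
qed

lemma curv_h_period:
  assumes z: "z \<notin> lattice \<tau>"
  shows "curv_h (z + 1) = curv_h z + 4 * eta1 \<tau>" "curv_h (z + \<tau>) = curv_h z + 4 * eta2 \<tau>"
proof -
  have per: "log_dz f f1 g g1 (z + \<omega>) = log_dz f f1 g g1 z" if "\<omega> \<in> lattice \<tau>" for \<omega>
    unfolding log_dz_def wp''_period[OF \<tau> z that] wp'_period[OF that] wp_period[OF \<tau> that z] ..
  show "curv_h (z + 1) = curv_h z + 4 * eta1 \<tau>" "curv_h (z + \<tau>) = curv_h z + 4 * eta2 \<tau>"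
    unfolding curv_h_def per[OF lattice_1] per[OF lattice_tau] wzeta_period[OF \<tau> z] by simp_all
qed

text \<open>At the pole, \<open>A = z\<^sup>4 f\<close> and \<open>B = z\<^sup>4 g\<close> are holomorphic and \<open>A(0) \<noteq> 0\<close>; replacing \<open>(f, g)\<close> by
  \<open>(A, B)\<close> changes \<open>log_dz\<close> by \<open>4/z\<close>, which is the principal part of \<open>4\<zeta>\<close>.\<close>

lemma curv_J_bounded_near_0: "\<exists>C. eventually (\<lambda>z. norm (curv_J z v) \<le> C) (at 0)"
proof -
  obtain A0 where A0: "A0 holomorphic_on - (lattice \<tau> - {0})" "A0 0 = 6"
    "\<And>z. z \<notin> lattice \<tau> \<Longrightarrow> wp'' \<tau> z = A0 z / z ^ 4" by (rule wp''_near_0[OF \<tau>]) blast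
  obtain B0 where B0: "B0 holomorphic_on - (lattice \<tau> - {0})" "B0 0 = -2"
    "\<And>z. z \<notin> lattice \<tau> \<Longrightarrow> wp' \<tau> z = B0 z / z ^ 3" by (rule wp'_near_0[OF \<tau>]) blast
  define A where "A z = a * A0 z" for z
  define B where "B z = z * B0 z" for z
  let ?V = "- (lattice \<tau> - {0})"
  have V: "open ?V" by (rule open_Compl_lattice_subset[OF \<tau>]) auto
  have V0: "0 \<in> ?V" by simp
  have hA: "A holomorphic_on ?V" "deriv A holomorphic_on ?V" "deriv (deriv A) holomorphic_on ?V"
    and hB: "B holomorphic_on ?V" "deriv B holomorphic_on ?V" "deriv (deriv B) holomorphic_on ?V"
    unfolding A_def[abs_def] B_def[abs_def]
    by (intro holomorphic_deriv holomorphic_intros A0(1) B0(1) V)+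
  have A_0: "A 0 \<noteq> 0" using a by (simp add: A_def A0(2))
  note cA = holomorphic_on_isCont[OF hA(1) V V0] holomorphic_on_isCont[OF hA(2) V V0] holomorphic_on_isCont[OF hA(3) V V0]
  note cB = holomorphic_on_isCont[OF hB(1) V V0] holomorphic_on_isCont[OF hB(2) V V0] holomorphic_on_isCont[OF hB(3) V V0]
  define J where "J z = log_dz_deriv A (deriv A) (deriv (deriv A)) B (deriv B) (deriv (deriv B)) z v
      + 4 * (- wp_reg \<tau> z * v)" for z
  have "isCont J 0"
    unfolding J_def
    by (intro continuous_intros isCont_log_dz_deriv cA cB DERIV_isCont[OF wp_reg_deriv[OF \<tau>]])
      (use A_0 in auto)
  then have limJ: "(J \<longlongrightarrow> J 0) (at 0)" by (simp add: isCont_def)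
  have fA: "f z = A z / z ^ 4" "g z = B z / z ^ 4" if "z \<notin> lattice \<tau>" for z
  proof -
    have "z \<noteq> 0" using that by auto
    then show "f z = A z / z ^ 4" "g z = B z / z ^ 4"
      unfolding A0(3)[OF that] B0(3)[OF that] A_def B_def by (simp_all add: eval_nat_numeral)
  qed
  have quot: "((\<lambda>z. H z / z ^ 4) has_field_derivative deriv H z / z ^ 4 - 4 / z * (H z / z ^ 4)) (at z)"
    if "H holomorphic_on ?V" "z \<notin> lattice \<tau>" for H z
  proof -
    have "z \<noteq> 0" "z \<in> ?V" using that(2) by auto
    with holomorphic_derivI[OF that(1) V, of z] show ?thesis
      by (auto intro!: derivative_eq_intros) (simp add: divide_simps eval_nat_numeral, simp add: algebra_simps)
  qed
  have f1A: "f1 z = deriv A z / z ^ 4 - 4 / z * f z" "g1 z = deriv B z / z ^ 4 - 4 / z * g z"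
    if z: "z \<notin> lattice \<tau>" for z
  proof -
    have "(f has_field_derivative deriv A z / z ^ 4 - 4 / z * (A z / z ^ 4)) (at z)"
      by (rule has_field_derivative_transform_within_open[OF quot[OF hA(1) z] open_Compl_lattice[OF \<tau>]])
        (use z fA in auto)
    then show "f1 z = deriv A z / z ^ 4 - 4 / z * f z"
      unfolding fA(1)[OF z] using front_data_derivs(1)[OF z] DERIV_unique by blast
    have "(g has_field_derivative deriv B z / z ^ 4 - 4 / z * (B z / z ^ 4)) (at z)"
      by (rule has_field_derivative_transform_within_open[OF quot[OF hB(1) z] open_Compl_lattice[OF \<tau>]])
        (use z fA in auto)
    then show "g1 z = deriv B z / z ^ 4 - 4 / z * g z"
      unfolding fA(2)[OF z] using front_data_derivs(3)[OF z] DERIV_unique by blast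
  qed
  have log_eq: "curv_h z = log_dz A (deriv A) B (deriv B) z + 4 * zeta_reg \<tau> z"
    if z: "z \<notin> lattice \<tau>" for z
  proof -
    have z0: "z \<noteq> 0" using z by auto
    define N where "N = f z * cnj (f z) + g z * cnj (g z)"
    have N: "N \<noteq> 0" unfolding N_def by (rule sum_mult_cnj_nonzero[OF front_data_derivs(6)[OF z]])
    define w where "w = z ^ 4 * cnj (z ^ 4)"
    have w: "w \<noteq> 0" using z0 by (simp add: w_def)
    have AB: "A z = f z * z ^ 4" "B z = g z * z ^ 4" using fA[OF z] z0 by simp_all
    have dAB: "deriv A z = (f1 z + 4 / z * f z) * z ^ 4" "deriv B z = (g1 z + 4 / z * g z) * z ^ 4"
      using f1A[OF z] z0 by simp_all
    have num: "deriv A z * cnj (A z) + deriv B z * cnj (B z)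
        = ((f1 z * cnj (f z) + g1 z * cnj (g z)) + 4 / z * N) * w"
      unfolding dAB unfolding AB N_def w_def complex_cnj_mult by (simp only: ring_distribs mult_ac add_ac)
    have den: "A z * cnj (A z) + B z * cnj (B z) = N * w"
      unfolding AB N_def w_def complex_cnj_mult by (simp only: ring_distribs mult_ac add_ac)
    have "log_dz A (deriv A) B (deriv B) z = log_dz f f1 g g1 z + 4 / z"
    proof -
      define X where "X = f1 z * cnj (f z) + g1 z * cnj (g z)"
      have "(X + 4 / z * N) * w / (N * w) = X / N + 4 / z"
        using N w by (simp add: add_divide_distrib)
      then show ?thesis unfolding log_dz_def num den X_def N_def .
    qed
    then show ?thesis by (simp add: curv_h_def wzeta_def algebra_simps)
  qed
  have "eventually (\<lambda>z. A z \<noteq> 0) (at 0)"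
  proof -
    have "(A \<longlongrightarrow> A 0) (at 0)" using cA(1) by (simp add: isCont_def)
    then show ?thesis by (rule tendsto_imp_eventually_ne[OF _ A_0])
  qed
  then have "eventually (\<lambda>z. curv_J z v = J z) (at 0)"
    using eventually_not_lattice[OF \<tau>, of 0]
  proof eventually_elim
    case (elim z)
    then have zV: "z \<in> ?V" and zl: "z \<in> - lattice \<tau>" by auto
    have zr: "z \<notin> lattice \<tau> - {0}" using zV by blast
    have "((\<lambda>z. log_dz A (deriv A) B (deriv B) z + 4 * zeta_reg \<tau> z) has_derivative
        (\<lambda>v. log_dz_deriv A (deriv A) (deriv (deriv A)) B (deriv B) (deriv (deriv B)) z v
          + 4 * (- wp_reg \<tau> z * v))) (at z)"
    proof (rule has_derivative_add[OF has_derivative_log_dz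
          has_derivative_mult_right[OF zeta_reg_deriv[OF \<tau> zr, unfolded has_field_derivative_def]]])
      show "(A has_field_derivative deriv A z) (at z)" "(deriv A has_field_derivative deriv (deriv A) z) (at z)"
        "(B has_field_derivative deriv B z) (at z)" "(deriv B has_field_derivative deriv (deriv B) z) (at z)"
        using holomorphic_derivI[OF hA(1) V zV] holomorphic_derivI[OF hA(2) V zV]
          holomorphic_derivI[OF hB(1) V zV] holomorphic_derivI[OF hB(2) V zV] by auto
    qed (use elim in auto)
    then have "(curv_h has_derivative
        (\<lambda>v. log_dz_deriv A (deriv A) (deriv (deriv A)) B (deriv B) (deriv (deriv B)) z v
          + 4 * (- wp_reg \<tau> z * v))) (at z)"
      by (rule has_derivative_transform_within_open[OF _ open_Compl_lattice[OF \<tau>] zl])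
        (use log_eq in auto)
    from has_derivative_unique[OF curv_h_deriv[OF elim(2)] this]
    show ?case by (simp add: J_def)
  qed
  moreover have "eventually (\<lambda>z. dist (J z) (J 0) < 1) (at 0)"
    using limJ by (rule tendstoD) simp
  ultimately have "eventually (\<lambda>z. norm (curv_J z v) \<le> norm (J 0) + 1) (at 0)"
  proof eventually_elim
    case (elim z)
    then show ?case using norm_triangle_ineq2[of "J z" "J 0"] by (simp add: dist_norm)
  qed
  then show ?thesis by blast
qed

lemma curv_J_bounded:
  obtains C where "\<And>z. z \<in> parallelogram \<tau> \<Longrightarrow> z \<noteq> 0 \<Longrightarrow> norm (curv_J z v) \<le> C"
proof -
  obtain C where "eventually (\<lambda>z. norm (curv_J z v) \<le> C) (at 0)"
    using curv_J_bounded_near_0 by blast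
  then obtain r where r: "r > 0" "\<And>z. z \<noteq> 0 \<Longrightarrow> dist z 0 < r \<Longrightarrow> norm (curv_J z v) \<le> C"
    unfolding eventually_at by blast
  note K = compact_parallelogram_diff_ball[OF \<tau> r(1)]
  have "bounded ((\<lambda>z. curv_J z v) ` (parallelogram \<tau> - ball 0 r))"
    by (intro compact_imp_bounded compact_continuous_image K continuous_on_subset[OF continuous_on_curv_J K(2)])
  then obtain D where D: "\<And>z. z \<in> parallelogram \<tau> - ball 0 r \<Longrightarrow> norm (curv_J z v) \<le> D"
    unfolding bounded_iff by blast
  show ?thesis
  proof (rule that[of "max C D"])
    fix z assume z: "z \<in> parallelogram \<tau>" "z \<noteq> 0"
    show "norm (curv_J z v) \<le> max C D"
    proof (cases "norm z < r")
      case True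
      then show ?thesis using r(2)[OF z(2)] by (simp add: le_max_iff_disj)
    next
      case False
      then show ?thesis using D[of z] z(1) by (simp add: le_max_iff_disj)
    qed
  qed
qed

lemma curv_J_integrable: "integrable lborel (\<lambda>p. indicator half_square p *\<^sub>R curv_J (coord_pt \<tau> p) v)"
proof -
  obtain C where C: "\<And>z. z \<in> parallelogram \<tau> \<Longrightarrow> z \<noteq> 0 \<Longrightarrow> norm (curv_J z v) \<le> C"
    using curv_J_bounded by blast
  have "continuous_on half_square (\<lambda>p. curv_J (coord_pt \<tau> p) v)"
    by (rule continuous_on_compose2[OF continuous_on_curv_J continuous_coord_pt]) (use coord_pt_half_square(3)[OF \<tau>] in blast)
  then have "(\<lambda>p. indicator half_square p *\<^sub>R curv_J (coord_pt \<tau> p) v) \<in> borel_measurable borel"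
    by (rule borel_measurable_continuous_on_indicator[OF half_square_borel])
  moreover have "emeasure lborel half_square < \<infinity>"
  proof -
    have "half_square \<subseteq> cbox (-1/2, -1/2) (1/2, 1/2)" by (auto simp: half_square_def cbox_Pair_eq)
    then have "emeasure lborel half_square \<le> emeasure lborel (cbox (-1/2 :: real, -1/2 :: real) (1/2, 1/2))"
      by (rule emeasure_mono) simp
    also have "\<dots> < \<infinity>" by (rule emeasure_lborel_cbox_finite)
    finally show ?thesis .
  qed
  ultimately show ?thesis
    by (intro integrableI_bounded_set[where A = half_square and B = C])
      (use C[OF coord_pt_half_square(1,2)[OF \<tau>]] in auto)
qed

lemma curv_J_line_integral:
  assumes line: "\<And>t. t \<in> {-1/2..1/2} \<Longrightarrow> b + of_real t * v \<notin> lattice \<tau>"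
  shows "(LINT t|lborel. indicator {-1/2..<1/2} t *\<^sub>R curv_J (b + of_real t * v) v)
      = curv_h (b + of_real (1/2) * v) - curv_h (b + of_real (-1/2) * v)"
proof -
  let ?F = "\<lambda>t. curv_h (b + of_real t * v)"
  let ?l = "\<lambda>t. b + of_real t * v"
  have hb: "has_bochner_integral lborel (\<lambda>t. indicator {-1/2..1/2} t *\<^sub>R curv_J (?l t) v) (?F (1/2) - ?F (-1/2))"
  proof (rule has_bochner_integral_FTC_Icc)
    fix t :: real assume t: "-1/2 \<le> t" "t \<le> 1/2"
    have "(?l has_vector_derivative v) (at t within {-1/2..1/2})"
      by (auto intro!: derivative_eq_intros)
    moreover have "(curv_h has_derivative curv_J (?l t)) (at (?l t) within ?l ` {-1/2..1/2})"
      by (rule has_derivative_at_withinI[OF curv_h_deriv[OF line]]) (use t in auto)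
    ultimately show "(?F has_vector_derivative curv_J (?l t) v) (at t within {-1/2..1/2})"
      using vector_derivative_diff_chain_within[of ?l v t "{-1/2..1/2}" curv_h "curv_J (?l t)"]
      by (simp add: o_def)
  next
    show "continuous_on {-1/2..1/2} (\<lambda>t. curv_J (?l t) v)"
      by (rule continuous_on_compose2[OF continuous_on_curv_J])
        (use line in \<open>auto intro!: continuous_intros\<close>)
  qed simp
  have "(LINT t|lborel. indicator {-1/2..<1/2} t *\<^sub>R curv_J (?l t) v)
      = (LINT t|lborel. indicator {-1/2..1/2} t *\<^sub>R curv_J (?l t) v)"
  proof (rule integral_cong_AE)
    have c: "continuous_on {-1/2..1/2} (\<lambda>t. curv_J (?l t) v)"
      by (rule continuous_on_compose2[OF continuous_on_curv_J])
        (use line in \<open>auto intro!: continuous_intros\<close>)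
    then show "(\<lambda>t. indicator {-1/2..<1/2} t *\<^sub>R curv_J (?l t) v) \<in> borel_measurable lborel"
      "(\<lambda>t. indicator {-1/2..1/2} t *\<^sub>R curv_J (?l t) v) \<in> borel_measurable lborel"
      by (auto intro!: borel_measurable_continuous_on_indicator elim: continuous_on_subset)
    show "AE t in lborel. indicator {-1/2..<1/2} t *\<^sub>R curv_J (?l t) v = indicator {-1/2..1/2} t *\<^sub>R curv_J (?l t) v"
      using AE_lborel_singleton[of "1/2 :: real"] by eventually_elim (auto simp: indicator_def)
  qed
  also have "\<dots> = ?F (1/2) - ?F (-1/2)" using hb by (rule has_bochner_integral_integral_eq)
  finally show ?thesis .
qed

lemma coord_pt_line_not_lattice:
  assumes "x \<in> {-1/2..1/2}" "y \<in> {-1/2..1/2}" "x \<noteq> 0 \<or> y \<noteq> 0"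
  shows "of_real x + of_real y * \<tau> \<notin> lattice \<tau>"
proof
  assume "of_real x + of_real y * \<tau> \<in> lattice \<tau>"
  moreover have "of_real x + of_real y * \<tau> \<in> parallelogram \<tau>"
    using assms by (auto simp: parallelogram_def intro!: image_eqI[of _ _ "(x, y)"])
  ultimately have "of_real x + of_real y * \<tau> = 0" using parallelogram_lattice[OF \<tau>] by blast
  then show False using lattice_coords_eq_iff[OF \<tau>, of x y 0 0] assms(3) by simp
qed

text \<open>Integrate first along the period 1: the inner integral is the increment of
  \<open>curv_h\<close> over that period, namely 4 eta1, on every horizontal line except y = 0,
  which runs through the puncture and is negligible. Fubini applies because \<open>curv_J\<close> is
  bounded on the cell.\<close>

lemma curv_J_integral_1:
  "(LINT p|lborel. indicator half_square p *\<^sub>R curv_J (coord_pt \<tau> p) 1) = 4 * eta1 \<tau>"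
proof -
  let ?I = "{-1/2..<1/2 :: real}"
  let ?\<Phi> = "\<lambda>x y. indicator half_square (x, y) *\<^sub>R curv_J (coord_pt \<tau> (x, y)) 1"
  have int: "integrable (lborel \<Otimes>\<^sub>M lborel) (\<lambda>(x, y). ?\<Phi> x y)"
    using curv_J_integrable[of 1] by (simp add: lborel_prod case_prod_unfold)
  have "(LINT p|lborel. indicator half_square p *\<^sub>R curv_J (coord_pt \<tau> p) 1) = (LINT y|lborel. LINT x|lborel. ?\<Phi> x y)"
    using lborel_pair.integral_snd[OF int] by (simp add: lborel_prod case_prod_unfold)
  also have "\<dots> = (LINT y|lborel. indicator ?I y *\<^sub>R (4 * eta1 \<tau>))"
  proof (rule integral_cong_AE)
    show "(\<lambda>y. LINT x|lborel. ?\<Phi> x y) \<in> borel_measurable lborel"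
      using borel_measurable_integrable[OF lborel_pair.integrable_snd[OF int]] by simp
    show "AE y in lborel. (LINT x|lborel. ?\<Phi> x y) = indicator ?I y *\<^sub>R (4 * eta1 \<tau>)"
      using AE_lborel_singleton[of "0 :: real"]
    proof eventually_elim
      case (elim y)
      show ?case
      proof (cases "y \<in> ?I")
        case True
        have line: "of_real y * \<tau> + of_real t * 1 \<notin> lattice \<tau>" if "t \<in> {-1/2..1/2}" for t
          using coord_pt_line_not_lattice[of t y] that True elim by (simp add: add.commute)
        have "?\<Phi> x y = indicator ?I x *\<^sub>R curv_J (of_real y * \<tau> + of_real x * 1) 1" for x
          using True elim by (auto simp: half_square_def indicator_def add.commute)
        then have "(LINT x|lborel. ?\<Phi> x y) =
            curv_h (of_real y * \<tau> + of_real (1/2) * 1) - curv_h (of_real y * \<tau> + of_real (-1/2) * 1)"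
          using curv_J_line_integral[OF line] by simp
        also have "of_real y * \<tau> + of_real (1/2) * 1 = (of_real y * \<tau> + of_real (-1/2) * 1) + 1" by simp
        also have "curv_h \<dots> = curv_h (of_real y * \<tau> + of_real (-1/2) * 1) + 4 * eta1 \<tau>"
          by (rule curv_h_period(1)[OF line]) simp
        finally show ?thesis using True by simp
      next
        case False
        then have z: "indicat_real half_square (x, y) = 0" for x by (auto simp: half_square_def indicator_def)
        show ?thesis unfolding z indicator_simps(2)[OF False] by simp
      qed
    qed
  qed simp
  also have "\<dots> = 4 * eta1 \<tau>" by (rule half_indicator_integral)
  finally show ?thesis .
qed

lemma curv_J_integral_tau:
  "(LINT p|lborel. indicator half_square p *\<^sub>R curv_J (coord_pt \<tau> p) \<tau>) = 4 * eta2 \<tau>"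
proof -
  let ?I = "{-1/2..<1/2 :: real}"
  let ?\<Phi> = "\<lambda>x y. indicator half_square (x, y) *\<^sub>R curv_J (coord_pt \<tau> (x, y)) \<tau>"
  have int: "integrable (lborel \<Otimes>\<^sub>M lborel) (\<lambda>(x, y). ?\<Phi> x y)"
    using curv_J_integrable[of \<tau>] by (simp add: lborel_prod case_prod_unfold)
  have "(LINT p|lborel. indicator half_square p *\<^sub>R curv_J (coord_pt \<tau> p) \<tau>) = (LINT x|lborel. LINT y|lborel. ?\<Phi> x y)"
    using lborel_pair.integral_fst[OF int] by (simp add: lborel_prod case_prod_unfold)
  also have "\<dots> = (LINT x|lborel. indicator ?I x *\<^sub>R (4 * eta2 \<tau>))"
  proof (rule integral_cong_AE)
    show "(\<lambda>x. LINT y|lborel. ?\<Phi> x y) \<in> borel_measurable lborel"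
      using borel_measurable_integrable[OF lborel_pair.integrable_fst[OF int]] by simp
    show "AE x in lborel. (LINT y|lborel. ?\<Phi> x y) = indicator ?I x *\<^sub>R (4 * eta2 \<tau>)"
      using AE_lborel_singleton[of "0 :: real"]
    proof eventually_elim
      case (elim x)
      show ?case
      proof (cases "x \<in> ?I")
        case True
        have line: "of_real x + of_real t * \<tau> \<notin> lattice \<tau>" if "t \<in> {-1/2..1/2}" for t
          using coord_pt_line_not_lattice[of x t] that True elim by simp
        have z: "indicat_real half_square (x, y) = indicat_real ?I y" for y
          using True elim by (auto simp: half_square_def indicator_def)
        have "(LINT y|lborel. ?\<Phi> x y) = (LINT y|lborel. indicator ?I y *\<^sub>R curv_J (of_real x + of_real y * \<tau>) \<tau>)"
          unfolding z prod.case ..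
        also have "\<dots> = curv_h (of_real x + of_real (1/2) * \<tau>) - curv_h (of_real x + of_real (-1/2) * \<tau>)"
          by (rule curv_J_line_integral[OF line])
        also have "of_real x + of_real (1/2) * \<tau> = (of_real x + of_real (-1/2) * \<tau>) + \<tau>"
          by (simp add: field_simps)
        also have "curv_h \<dots> = curv_h (of_real x + of_real (-1/2) * \<tau>) + 4 * eta2 \<tau>"
          by (rule curv_h_period(2)[OF line]) simp
        finally show ?thesis using True by simp
      next
        case False
        then have z: "indicat_real half_square (x, y) = 0" for y by (auto simp: half_square_def indicator_def)
        show ?thesis unfolding z indicator_simps(2)[OF False] by simp
      qed
    qed
  qed simp
  also have "\<dots> = 4 * eta2 \<tau>" by (rule half_indicator_integral)
  finally show ?thesis .
qed

text \<open>Minus twice the real part of the derivative of \<open>curv_h\<close> in the conjugate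
  variable, to which \<zeta> contributes nothing. It is curvature times conformal factor, by
  \<open>gauss_curv_eq\<close>.\<close>

definition curv_K :: "complex \<Rightarrow> real" where
  "curv_K z = - Re (curv_J z 1 + \<i> * curv_J z \<i>)"

text \<open>Rewrites the derivative in the directions 1 and \<i> by those in the period directions 1
  and \<tau>, along which integration is explicit; \<open>curv_J z\<close> is linear over the
  reals.\<close>

lemma curv_K_eq:
  assumes "z \<notin> lattice \<tau>"
  shows "curv_K z = - Re (\<i> * (curv_J z \<tau> - \<tau> * curv_J z 1) / of_real (Im \<tau>))"
proof -
  have lin: "linear (curv_J z)" by (rule has_derivative_linear[OF curv_h_deriv[OF assms]])
  have "\<tau> = Re \<tau> *\<^sub>R 1 + Im \<tau> *\<^sub>R \<i>" by (simp add: complex_eq_iff)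
  then have "curv_J z \<tau> = Re \<tau> *\<^sub>R curv_J z 1 + Im \<tau> *\<^sub>R curv_J z \<i>"
    by (metis lin linear_add linear_scale)
  then have "\<i> * (curv_J z \<tau> - \<tau> * curv_J z 1) = of_real (Im \<tau>) * (curv_J z 1 + \<i> * curv_J z \<i>)"
    by (simp add: complex_eq_iff algebra_simps)
  then show ?thesis using \<tau> by (simp add: curv_K_def)
qed

text \<open>The two directional integrals combine to 4 (eta2 - \<tau> eta1), which is -8 pi \<i> by
  the Legendre relation. The denominator Im \<tau> is compensated later by the Jacobian.\<close>

lemma curv_K_integral_square:
  "has_bochner_integral lborel (\<lambda>p. indicator half_square p *\<^sub>R curv_K (coord_pt \<tau> p)) (- 8 * pi / Im \<tau>)"
proof -
  let ?L = "\<lambda>w z. - Re (\<i> * (w - \<tau> * z) / of_real (Im \<tau>))"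
  have "has_bochner_integral lborel
     (\<lambda>p. - Re (\<i> * (indicator half_square p *\<^sub>R curv_J (coord_pt \<tau> p) \<tau> - \<tau> * (indicator half_square p *\<^sub>R curv_J (coord_pt \<tau> p) 1)) / of_real (Im \<tau>)))
     (- Re (\<i> * (4 * eta2 \<tau> - \<tau> * (4 * eta1 \<tau>)) / of_real (Im \<tau>)))"
    using curv_J_integrable curv_J_integral_1 curv_J_integral_tau
    by (intro has_bochner_integral_minus has_bochner_integral_bounded_linear[OF bounded_linear_Re]
        has_bochner_integral_divide_zero has_bochner_integral_mult_right has_bochner_integral_diff)
      (auto simp: has_bochner_integral_iff)
  also have "\<i> * (4 * eta2 \<tau> - \<tau> * (4 * eta1 \<tau>)) = of_real (8 * pi)"
  proof -
    have e: "eta2 \<tau> = eta1 \<tau> * \<tau> - 2 * pi * \<i>" using legendre_relation[OF \<tau>] by (simp add: algebra_simps)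
    show ?thesis unfolding e by (simp add: algebra_simps)
  qed
  also have "- Re (of_real (8 * pi) / of_real (Im \<tau>)) = - 8 * pi / Im \<tau>"
    by (simp flip: of_real_divide)
  also have "(\<lambda>p. - Re (\<i> * (indicator half_square p *\<^sub>R curv_J (coord_pt \<tau> p) \<tau> - \<tau> * (indicator half_square p *\<^sub>R curv_J (coord_pt \<tau> p) 1)) / of_real (Im \<tau>)))
      = (\<lambda>p. indicator half_square p *\<^sub>R curv_K (coord_pt \<tau> p))"
  proof
    fix p
    show "- Re (\<i> * (indicator half_square p *\<^sub>R curv_J (coord_pt \<tau> p) \<tau> - \<tau> * (indicator half_square p *\<^sub>R curv_J (coord_pt \<tau> p) 1)) / of_real (Im \<tau>))
      = indicator half_square p *\<^sub>R curv_K (coord_pt \<tau> p)"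
      using curv_K_eq[OF coord_pt_half_square(3)[OF \<tau>, of p]] by (cases "p \<in> half_square") (simp_all add: indicator_def)
  qed
  finally show ?thesis .
qed

section \<open>Curvature and area measure on the punctured torus\<close>

interpretation Q: lattice_quotient \<tau> "punctured_torus \<tau>" "- lattice \<tau>"
  by (rule lattice_quotient_puncture[OF \<tau>])

private abbreviation (input) "S \<equiv> punctured_torus \<tau>"
private abbreviation (input) "CF \<equiv> curv_form (front_F \<tau> a) (front_G \<tau>)"

private definition lam :: "complex \<Rightarrow> real" where
  "lam z = 2 * Re (f z * cnj (f z) + g z * cnj (g z))"

private lemma lam_pos: "z \<notin> lattice \<tau> \<Longrightarrow> lam z > 0"
proof -
  assume z: "z \<notin> lattice \<tau>"
  have "f z \<noteq> 0 \<or> g z \<noteq> 0" using wp''_nonzero[OF \<tau> z] a by auto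
  then have "(norm (f z))\<^sup>2 + (norm (g z))\<^sup>2 > 0"
    by (auto intro: add_pos_nonneg add_nonneg_pos)
  then show ?thesis unfolding lam_def sum_mult_cnj_eq by simp
qed

private lemma lam_period: "z \<notin> lattice \<tau> \<Longrightarrow> \<omega> \<in> lattice \<tau> \<Longrightarrow> lam (z + \<omega>) = lam z"
  by (simp only: not_False_eq_True lam_def wp''_period[OF \<tau>] wp'_period)

private lemma continuous_on_lam: "continuous_on (- lattice \<tau>) lam"
  unfolding lam_def
  by (intro continuous_intros holomorphic_on_imp_continuous_on holomorphic_wp'' holomorphic_wp' \<tau>)

private lemma CF_eq:
  assumes "c \<in> charts S" "z \<in> - lattice \<tau>" "cls \<tau> z \<in> fst c"
  shows "CF c (cls \<tau> z) v w = lam z * Re (v * cnj w)"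
proof -
  have "z \<notin> lattice \<tau>" using assms(2) by simp
  note d = dcoef_front[OF \<tau> a assms(1) this assms(3)]
  have "Re ((p * v) * cnj (p * w)) = Re (p * cnj p) * Re (v * cnj w)" for p
    by (simp add: algebra_simps)
  then show ?thesis
    unfolding curv_form_def Let_def d lam_def plus_complex.sel by (simp only: ring_distribs mult.assoc[where 'a = real])
qed

private lemma CF_riemannian: "riemannian_metric S CF"
proof (rule Q.riemannian_metricI[where X = "\<lambda>z v w. lam z * Re (v * cnj w)"])
  show "bilinear (\<lambda>v w. lam z * Re (v * cnj w))" for z
    using bilinear_scale[OF bilinear_Re_mult_cnj[of 1 1], of "lam z"] by simp
  show "lam z * Re (v * cnj w) = lam z * Re (w * cnj v)" for z v w by (simp add: algebra_simps)
  show "smooth_fun (- lattice \<tau>) (\<lambda>z. lam z * Re (v * cnj w))" for v w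
    unfolding lam_def plus_complex.sel
    by (intro smooth_fun.mult smooth_fun.add smooth_fun_const smooth_fun_Re_mult_cnj holomorphic_intros
        holomorphic_wp'' holomorphic_wp' \<tau>)
  show "lam z * Re (v * cnj v) > 0" if "z \<in> - lattice \<tau>" "v \<noteq> 0" for z v
    unfolding Re_mult_cnj_same using lam_pos[of z] that by simp
qed (use CF_eq in auto)

private lemma curv_K_period: "z \<notin> lattice \<tau> \<Longrightarrow> \<omega> \<in> lattice \<tau> \<Longrightarrow> curv_K (z + \<omega>) = curv_K z"
  by (simp only: not_False_eq_True curv_K_def curv_J_def log_dz_deriv_def wp''_period[OF \<tau>] wp'_period wp_period[OF \<tau>])

private lemma local_metric_eq:
  assumes c: "c \<in> charts S" and W: "W \<subseteq> - lattice \<tau>" "lattice_chart \<tau> c W" and u: "u \<in> W"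
  shows "local_metric CF c u v w = lam u * Re (v * cnj w)"
  using CF_eq[OF c, of u v w] lattice_chartD(3,6)[OF W(2)] u W(1) by (auto simp: local_metric_def)

text \<open>In any chart the metric is \<open>lam\<close> |dz|^2, and the partial derivatives of log
  \<open>lam\<close> are 2 Re of \<open>log_dz\<close> times 1 and \<i>. The chart may place the
  point at another representative u; periodicity leads back to z.\<close>

private lemma gauss_curv_eq:
  assumes z: "z \<notin> lattice \<tau>"
  shows "gauss_curv S CF (cls \<tau> z) = curv_K z / lam z"
proof -
  define c where "c = chart_at S (cls \<tau> z)"
  have c: "c \<in> charts S" "cls \<tau> z \<in> fst c" using Q.chart_at[of z] z by (auto simp: c_def)
  obtain W where W: "W \<subseteq> - lattice \<tau>" "lattice_chart \<tau> c W" using Q.chart[OF c(1)] by blast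
  obtain \<omega> where \<omega>: "\<omega> \<in> lattice \<tau>" "z + \<omega> \<in> W"
    "\<And>z'. z' + \<omega> \<in> W \<Longrightarrow> cls \<tau> z' \<in> fst c \<and> snd c (cls \<tau> z') = z' + \<omega>"
    using lattice_chart_local[OF W(2) c(2)] by blast
  define u where "u = z + \<omega>"
  have u: "u \<in> W" "u \<notin> lattice \<tau>" using \<omega>(2) W(1) by (auto simp: u_def)
  let ?D = "log_dz_deriv f f1 f2 g g1 g2"
  note d = front_data_derivs
  have log: "(log_dz f f1 g g1 has_derivative ?D u) (at u)"
    by (rule has_derivative_log_dz[of f f1 u f2 g g1 g2]) (rule d[OF u(2)])+
  have lam': "(lam has_derivative (\<lambda>v. 2 * Re ((f x * cnj (f1 x * v) + f1 x * v * cnj (f x)) +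
      (g x * cnj (g1 x * v) + g1 x * v * cnj (g x))))) (at x)" if x: "x \<in> W" for x
  proof -
    have xl: "x \<notin> lattice \<tau>" using x W(1) by blast
    note c = bounded_linear.has_derivative[OF bounded_linear_cnj]
    note f' = d(1)[OF xl, unfolded has_field_derivative_def] and g' = d(3)[OF xl, unfolded has_field_derivative_def]
    show ?thesis
      unfolding lam_def[abs_def]
      by (rule has_derivative_mult_right[OF has_derivative_Re[OF has_derivative_add
              [OF has_derivative_mult[OF f' c[OF f']] has_derivative_mult[OF g' c[OF g']]]]])
  qed
  have num: "2 * Re ((f x * cnj (f1 x * v) + f1 x * v * cnj (f x)) + (g x * cnj (g1 x * v) + g1 x * v * cnj (g x)))
      = 2 * Re (log_dz f f1 g g1 x * v) * lam x" if x: "x \<in> W" for x v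
  proof -
    have xl: "x \<notin> lattice \<tau>" using x W(1) by blast
    define n where "n = (norm (f x))\<^sup>2 + (norm (g x))\<^sup>2"
    define s where "s = f1 x * cnj (f x) + g1 x * cnj (g x)"
    have N: "f x * cnj (f x) + g x * cnj (g x) = of_real n" by (simp only: n_def sum_mult_cnj_eq)
    have lam: "lam x = 2 * n" unfolding lam_def N by simp
    then have n: "n > 0" using lam_pos[OF xl] by simp
    have l: "log_dz f f1 g g1 x * v * of_real n = s * v" unfolding log_dz_def N s_def using n by simp
    have "2 * Re (log_dz f f1 g g1 x * v) * lam x = 4 * Re (log_dz f f1 g g1 x * v * of_real n)"
      unfolding lam by simp
    also have "\<dots> = 4 * Re (s * v)" unfolding l ..
    also have "\<dots> = 2 * Re ((f x * cnj (f1 x * v) + f1 x * v * cnj (f x)) + (g x * cnj (g1 x * v) + g1 x * v * cnj (g x)))"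
    proof -
      have r: "Re (p * cnj (q * v) + q * v * cnj p) = 2 * Re (q * cnj p * v)" for p q
        by (simp add: algebra_simps)
      show ?thesis
        unfolding s_def ring_distribs plus_complex.sel(1)[of "f x * cnj (f1 x * v) + f1 x * v * cnj (f x)"] r
        by simp
    qed
    finally show ?thesis ..
  qed
  have p': "((\<lambda>x. 2 * Re (log_dz f f1 g g1 x * 1)) has_derivative (\<lambda>v. 2 * Re (?D u v * 1))) (at u)"
    "((\<lambda>x. 2 * Re (log_dz f f1 g g1 x * \<i>)) has_derivative (\<lambda>v. 2 * Re (?D u v * \<i>))) (at u)"
    by (intro has_derivative_mult_right has_derivative_Re has_derivative_mult_left log)+
  have "gauss_curv_plane (local_metric CF c) u = - (2 * Re (?D u 1 * 1) + 2 * Re (?D u \<i> * \<i>)) / (2 * lam u)"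
  proof (rule gauss_curv_plane_conformal(1)[OF lattice_chartD(1)[OF W(2)] u(1) _ _ lam' num num p'])
    show "local_metric CF c x v w = lam x * Re (v * cnj w)" if "x \<in> W" for x v w
      by (rule local_metric_eq[OF c(1) W that])
    show "lam x > 0" if "x \<in> W" for x using lam_pos[of x] that W(1) by blast
  qed
  also have "- (2 * Re (?D u 1 * 1) + 2 * Re (?D u \<i> * \<i>)) / (2 * lam u) = - Re (?D u 1 + \<i> * ?D u \<i>) / lam u"
  proof -
    have "- (2 * Re (p * 1) + 2 * Re (q * \<i>)) = 2 * (- Re (p + \<i> * q))" for p q :: complex by simp
    then show ?thesis by (simp only: mult_divide_mult_cancel_left_if) simp
  qed
  also have "- Re (?D u 1 + \<i> * ?D u \<i>) = curv_K u"
    unfolding curv_K_def curv_J_def by (simp add: algebra_simps)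
  also have "curv_K u / lam u = curv_K z / lam z"
    unfolding u_def using curv_K_period[OF z \<omega>(1)] lam_period[OF z \<omega>(1)] by simp
  finally have "gauss_curv_plane (local_metric CF c) u = curv_K z / lam z" .
  moreover have "snd c (cls \<tau> z) = u" using \<omega>(2,3) by (simp add: u_def)
  ultimately show ?thesis unfolding gauss_curv_def Let_def c_def[symmetric] by simp
qed

private lemma continuous_on_curv_K: "continuous_on (- lattice \<tau>) (curv_K)"
  unfolding curv_K_def by (intro continuous_intros continuous_on_curv_J)

text \<open>\<open>M2\<close> will be the area measure: Lebesgue measure on one period cell,
  weighted by the conformal factor and pushed forward to the Borel sets of the surface.\<close>

private abbreviation (input) "N \<equiv> sigma (topspace (stop S)) {U. openin (stop S) U}"
private abbreviation (input) "M0 \<equiv> restrict_space lborel (period_cell \<tau>)"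
private abbreviation (input) "M1 \<equiv> density M0 (\<lambda>z. ennreal (lam z))"
private abbreviation (input) "M2 \<equiv> distr M1 N (cls \<tau>)"

private lemma cell_sub: "period_cell \<tau> \<subseteq> - lattice \<tau>"
  using period_cell_not_lattice[OF \<tau>] by blast

private lemma N_space: "space N = topspace (stop S)" "sets N = sigma_sets (topspace (stop S)) {U. openin (stop S) U}"
  using openin_subset by (auto intro!: space_measure_of sets_measure_of)

private lemma cls_measurable:
  assumes "X \<subseteq> - lattice \<tau>"
  shows "cls \<tau> \<in> measurable (restrict_space borel X) N"
proof (rule measurable_measure_of)
  show "{U. openin (stop S) U} \<subseteq> Pow (topspace (stop S))" using openin_subset by blast
  show "cls \<tau> \<in> space (restrict_space borel X) \<rightarrow> topspace (stop S)"
    using assms by (auto simp: Q.topspace_eq space_restrict_space)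
  fix U assume "U \<in> {U. openin (stop S) U}"
  then have "open (cls \<tau> -` U)" using Q.openin_iff by blast
  then show "cls \<tau> -` U \<inter> space (restrict_space borel X) \<in> sets (restrict_space borel X)"
    by (auto simp: sets_restrict_space space_restrict_space)
qed

private lemma M0_measurable: "measurable M0 X = measurable (restrict_space borel (period_cell \<tau>)) X"
  by (intro measurable_cong_sets sets_restrict_space_cong) auto

private lemma cls_M1: "cls \<tau> \<in> measurable M1 N"
  unfolding measurable_density_eq1 M0_measurable by (rule cls_measurable[OF cell_sub])

private lemma lam_M0: "lam \<in> borel_measurable M0"
  unfolding M0_measurable
  by (rule borel_measurable_continuous_on_restrict[OF continuous_on_subset[OF continuous_on_lam cell_sub]])

text \<open>A set inside a chart has two lifts, its image V under the coordinate and its part of the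
  period cell. The projection is injective on V, so by unfolding both have the same integral of the
  periodic density \<open>lam\<close>, and \<open>lam\<close> is the square root of the
  determinant.\<close>

private lemma area_measure_M2: "area_measure S CF M2"
  unfolding area_measure_def
proof (intro conjI ballI impI)
  show "space M2 = topspace (stop S)" "sets M2 = sigma_sets (topspace (stop S)) {U. openin (stop S) U}"
    using N_space by simp_all
  fix c A assume c: "c \<in> charts S" and A: "A \<in> sets M2" "A \<subseteq> fst c"
  obtain W where W: "W \<subseteq> - lattice \<tau>" "lattice_chart \<tau> c W" using Q.chart[OF c] by blast
  note cd = lattice_chartD[OF W(2)]
  have AN: "A \<in> sets N" using A(1) by simp
  define V where "V = W \<inter> cls \<tau> -` A"
  have sndA: "snd c ` A = V"
  proof (intro equalityI subsetI)
    fix z assume "z \<in> snd c ` A"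
    then obtain p where p: "p \<in> A" "z = snd c p" by blast
    then obtain w where "w \<in> W" "p = cls \<tau> w" using A(2) cd(3) by blast
    then show "z \<in> V" using p cd(4) by (simp add: V_def)
  next
    fix z assume "z \<in> V"
    then have "z \<in> W" "cls \<tau> z \<in> A" by (auto simp: V_def)
    then show "z \<in> snd c ` A" using cd(4)[of z] by (metis imageI)
  qed
  have clsV: "cls \<tau> ` V = A"
  proof (intro equalityI subsetI)
    fix p assume p: "p \<in> A"
    with A(2) cd(3) obtain w where "w \<in> W" "p = cls \<tau> w" by blast
    with p show "p \<in> cls \<tau> ` V" by (simp add: V_def)
  qed (auto simp: V_def)
  have A_vimage: "cls \<tau> -` A \<inter> - lattice \<tau> \<in> sets borel"
  proof -
    have op: "- lattice \<tau> \<in> sets borel" using open_Compl_lattice[OF \<tau>] by simp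
    have "cls \<tau> -` A \<inter> space (restrict_space borel (- lattice \<tau>)) \<in> sets (restrict_space borel (- lattice \<tau>))"
      by (rule measurable_sets[OF cls_measurable[OF order_refl] AN])
    then show ?thesis using op by (simp only: space_restrict_space space_borel Int_UNIV_right sets_restrict_space_iff)
  qed
  have V: "V \<in> sets borel" "inj_on (cls \<tau>) V" "V \<subseteq> - lattice \<tau>"
  proof -
    have "V = W \<inter> (cls \<tau> -` A \<inter> - lattice \<tau>)" using W(1) by (auto simp: V_def)
    then show "V \<in> sets borel" using A_vimage cd(1) by (simp add: sets.Int)
    show "inj_on (cls \<tau>) V" by (rule inj_on_subset[OF cd(2)]) (simp add: V_def)
    show "V \<subseteq> - lattice \<tau>" using W(1) by (auto simp: V_def)
  qed
  \<comment> \<open>Extended by 0 to the lattice points, so that it is Borel and periodic on the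
    whole plane as the unfolding lemma demands.\<close>
  define \<phi> where "\<phi> z = ennreal (indicator (- lattice \<tau>) z *\<^sub>R lam z)" for z
  have \<phi>: "\<phi> \<in> borel_measurable borel"
    unfolding \<phi>_def using borel_measurable_continuous_on_indicator[OF _ continuous_on_lam] open_Compl_lattice[OF \<tau>]
    by simp
  have per: "\<phi> (z + \<omega>) = \<phi> z" if "\<omega> \<in> lattice \<tau>" for z \<omega>
    using lam_period[of z \<omega>] that lattice_add_iff[OF that, of z] by (cases "z \<in> lattice \<tau>") (auto simp: \<phi>_def indicator_def)
  have \<phi>_eq: "\<phi> z = ennreal (lam z)" if "z \<notin> lattice \<tau>" for z using that by (simp add: \<phi>_def)
  have pre: "cls \<tau> -` A \<inter> space M1 \<in> sets M1" by (rule measurable_sets[OF cls_M1 AN])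
  have sp: "space M1 = period_cell \<tau>" by (simp add: space_restrict_space)
  have "emeasure M2 A = emeasure M1 (cls \<tau> -` A \<inter> period_cell \<tau>)"
    using emeasure_distr[OF cls_M1 AN] unfolding sp .
  also have "\<dots> = (\<integral>\<^sup>+z. ennreal (lam z) * indicator (cls \<tau> -` A \<inter> period_cell \<tau>) z \<partial>M0)"
    by (rule emeasure_density) (use lam_M0 pre sp in auto)
  also have "\<dots> = (\<integral>\<^sup>+z. ennreal (lam z) * indicator (cls \<tau> -` A \<inter> period_cell \<tau>) z * indicator (period_cell \<tau>) z \<partial>lborel)"
    by (rule nn_integral_restrict_space) (use period_cell_borel[OF \<tau>] in simp)
  also have "\<dots> = (\<integral>\<^sup>+z. \<phi> z * indicator (cls \<tau> -` (cls \<tau> ` V) \<inter> period_cell \<tau>) z \<partial>lborel)"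
    unfolding clsV
  proof (rule nn_integral_cong)
    fix z
    show "ennreal (lam z) * indicator (cls \<tau> -` A \<inter> period_cell \<tau>) z * indicator (period_cell \<tau>) z
      = \<phi> z * indicator (cls \<tau> -` A \<inter> period_cell \<tau>) z"
      using \<phi>_eq[of z] cell_sub by (cases "z \<in> period_cell \<tau>") auto
  qed
  also have "\<dots> = (\<integral>\<^sup>+z. \<phi> z * indicator V z \<partial>lborel)"
    by (rule nn_integral_period_cell[OF \<tau> \<phi> per V, symmetric])
  also have "\<dots> = (\<integral>\<^sup>+z\<in>V. ennreal (sqrt (metric_det (local_metric CF c) z)) \<partial>lborel)"
  proof (rule nn_integral_cong)
    fix z
    show "\<phi> z * indicator V z = ennreal (sqrt (metric_det (local_metric CF c) z)) * indicator V z"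
    proof (cases "z \<in> V")
      case True
      then have z: "z \<in> W" "z \<notin> lattice \<tau>" using V(3) by (auto simp: V_def)
      have "metric_det (local_metric CF c) z = (lam z)\<^sup>2"
        by (simp add: metric_det_def local_metric_eq[OF c W z(1)] power2_eq_square)
      then show ?thesis using lam_pos[OF z(2)] \<phi>_eq[OF z(2)] by simp
    qed simp
  qed
  finally show "emeasure M2 A = (\<integral>\<^sup>+z\<in>snd c ` A. ennreal (sqrt (metric_det (local_metric CF c) z)) \<partial>lborel)"
    unfolding sndA .
qed

text \<open>Transfers the integral over the coordinate square to the period cell; the Jacobian Im
  \<tau> cancels the denominator.\<close>

private lemma curv_K_integral: "has_bochner_integral lborel (\<lambda>z. indicator (period_cell \<tau>) z *\<^sub>R curv_K z) (- 8 * pi)"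
proof -
  let ?f = "\<lambda>z. indicator (period_cell \<tau>) z *\<^sub>R curv_K z"
  have lp: "coord_pt \<tau> \<in> borel_measurable lborel"
    unfolding case_prod_unfold by (simp add: borel_measurable_continuous_onI continuous_intros)
  have meas: "?f \<in> borel_measurable borel"
    by (rule borel_measurable_continuous_on_indicator[OF period_cell_borel[OF \<tau>]
          continuous_on_subset[OF continuous_on_curv_K cell_sub]])
  have "?f (coord_pt \<tau> p) = indicator half_square p *\<^sub>R curv_K (coord_pt \<tau> p)" for p
    using coord_pt_period_cell[OF \<tau>, of "fst p" "snd p"] by (cases p) (simp add: indicator_def)
  then have sq: "has_bochner_integral lborel (\<lambda>p. ?f (coord_pt \<tau> p)) (- 8 * pi / Im \<tau>)"
    using curv_K_integral_square by (simp only:)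
  have "has_bochner_integral (distr lborel borel (coord_pt \<tau>)) ?f (- 8 * pi / Im \<tau>)"
    using sq integrable_distr_eq[OF lp meas] integral_distr[OF lp meas] by (simp add: has_bochner_integral_iff)
  from has_bochner_integral_mult_right[OF this, of "Im \<tau>"]
  have "has_bochner_integral (distr lborel borel (coord_pt \<tau>)) (\<lambda>z. Im \<tau> *\<^sub>R ?f z) (- 8 * pi)"
    using \<tau> by simp
  then have "has_bochner_integral (density (distr lborel borel (coord_pt \<tau>)) (\<lambda>_. ennreal (Im \<tau>))) ?f (- 8 * pi)"
    by (intro has_bochner_integral_density) (use meas \<tau> in \<open>simp_all add: less_imp_le\<close>)
  then show ?thesis by (simp only: lborel_complex_lattice[OF \<tau>, symmetric])
qed

lemma has_total_curvature_torus: "has_total_curvature S (front_F \<tau> a) (front_G \<tau>) (- 8 * pi)"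
proof -
  let ?K = "gauss_curv S CF"
  let ?f = "\<lambda>z. curv_K z / lam z"
  have "continuous_on (- lattice \<tau>) ?f"
    by (intro continuous_intros continuous_on_curv_K continuous_on_lam) (use lam_pos in force)
  then have cK: "continuous_on (- lattice \<tau>) (\<lambda>z. ?K (cls \<tau> z))"
    by (rule continuous_on_eq) (use gauss_curv_eq in simp)
  have K_meas: "?K \<in> borel_measurable N"
  proof (rule borel_measurableI)
    fix U :: "real set" assume "open U"
    then have "openin (stop S) {x \<in> topspace (stop S). ?K x \<in> U}"
      using Q.continuous_map_from[OF cK] by (auto simp: continuous_map)
    moreover have "?K -` U \<inter> space N = {x \<in> topspace (stop S). ?K x \<in> U}"
      unfolding N_space(1) by blast
    ultimately show "?K -` U \<inter> space N \<in> sets N" unfolding N_space(2) by auto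
  qed
  have Kc: "(\<lambda>z. ?K (cls \<tau> z)) \<in> borel_measurable M0"
    unfolding M0_measurable
    by (rule borel_measurable_continuous_on_restrict[OF continuous_on_subset[OF cK cell_sub]])
  have nn: "AE z in M0. 0 \<le> lam z"
    by (rule AE_I2) (use lam_pos cell_sub in \<open>force simp: space_restrict_space\<close>)
  have cell: "period_cell \<tau> \<inter> space lborel \<in> sets lborel" using period_cell_borel[OF \<tau>] by simp
  have eq: "(\<lambda>z. indicator (period_cell \<tau>) z *\<^sub>R (lam z *\<^sub>R ?K (cls \<tau> z)))
      = (\<lambda>z. indicator (period_cell \<tau>) z *\<^sub>R curv_K z)"
  proof
    fix z
    show "indicator (period_cell \<tau>) z *\<^sub>R (lam z *\<^sub>R ?K (cls \<tau> z)) = indicator (period_cell \<tau>) z *\<^sub>R curv_K z"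
    proof (cases "z \<in> period_cell \<tau>")
      case True
      then have z: "z \<notin> lattice \<tau>" using cell_sub by blast
      show ?thesis using gauss_curv_eq[OF z] lam_pos[OF z] by simp
    qed simp
  qed
  \<comment> \<open>Undo push-forward, density and restriction in turn; the conformal factor cancels
    against the denominator of the curvature.\<close>
  have "has_bochner_integral M2 ?K (- 8 * pi)"
    unfolding has_bochner_integral_iff integrable_distr_eq[OF cls_M1 K_meas] integral_distr[OF cls_M1 K_meas]
      integrable_density[OF Kc lam_M0 nn] integral_density[OF Kc lam_M0 nn]
      integrable_restrict_space[OF cell] integral_restrict_space[OF cell] eq
    using curv_K_integral by (simp add: has_bochner_integral_iff)
  then show ?thesis
    unfolding has_total_curvature_def has_curvature_integral_def
    using CF_riemannian area_measure_M2 by blast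
qed

end

text \<open>The assumption says that p and q lie on one real line through 0. Multiplying by \<i>
  times the conjugate of a nonzero one of them turns this line into the imaginary axis; if both
  vanish, any a works.\<close>

lemma period_multiplier:
  fixes p q :: complex
  assumes "Im (cnj p * q) = 0"
  obtains a where "a \<noteq> 0" "Re (a * p) = 0" "Re (a * q) = 0"
proof (cases "p = 0")
  case False
  have "Re (\<i> * cnj p * p) = 0" "Re (\<i> * cnj p * q) = - Im (cnj p * q)" by simp_all
  then show ?thesis using that[of "\<i> * cnj p"] False assms by simp
next
  case True
  show ?thesis
  proof (cases "q = 0")
    case False
    have "Re (\<i> * cnj q * q) = 0" by simp
    then show ?thesis using that[of "\<i> * cnj q"] False True by simp
  qed (use that[of 1] True in simp)
qed

theorem theorem4p12:
  shows "\<exists>\<alpha>\<^sub>0 :: real. \<alpha>\<^sub>0 \<in> {pi / 3 <..< pi / 2} \<and> P \<alpha>\<^sub>0 = 0 \<and>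
    (\<exists>F G \<psi>. improper_affine_front (puncture (torus (cis \<alpha>\<^sub>0)) {cls (cis \<alpha>\<^sub>0) 0}) F G \<psi> \<and>
       complete_front (puncture (torus (cis \<alpha>\<^sub>0)) {cls (cis \<alpha>\<^sub>0) 0}) F G \<and>
       front_has_genus (puncture (torus (cis \<alpha>\<^sub>0)) {cls (cis \<alpha>\<^sub>0) 0}) F G 1 \<and>
       has_total_curvature (puncture (torus (cis \<alpha>\<^sub>0)) {cls (cis \<alpha>\<^sub>0) 0}) F G (- 8 * pi))"
proof -
  obtain \<alpha> where \<alpha>: "\<alpha> \<in> {pi / 3<..<pi / 2}" "P \<alpha> = 0" using P_zero by blast
  define \<tau> where "\<tau> = cis \<alpha>"
  have \<tau>: "Im \<tau> > 0" using cis_modular_region[of \<alpha>] \<alpha>(1) by (simp add: modular_region_def \<tau>_def)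
  obtain a where a: "a \<noteq> 0" "Re (a * p1 \<alpha>) = 0" "Re (a * p2 \<alpha>) = 0"
    using period_multiplier[of "p1 \<alpha>" "p2 \<alpha>"] \<alpha>(2) unfolding P_def by blast
  let ?F = "front_F \<tau> a" and ?G = "front_G \<tau>"
  obtain \<psi> where "improper_affine_front (punctured_torus \<tau>) ?F ?G \<psi>"
    using improper_affine_front_ex[OF \<tau> a(1)] a(2,3) unfolding p1_def p2_def \<tau>_def by blast
  moreover have "complete_front (punctured_torus \<tau>) ?F ?G"
    by (rule complete_front_torus[OF \<tau> a(1)])
  moreover have "front_has_genus (punctured_torus \<tau>) ?F ?G 1"
  proof (rule front_has_genus_1[OF \<tau>])
    show "(\<lambda>z. a * wp' \<tau> z) holomorphic_on - lattice \<tau>" by (intro holomorphic_intros holomorphic_wp' \<tau>)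
    have "filterlim (\<lambda>z. a * wp' \<tau> z) at_infinity (at 0)"
      by (rule tendsto_mult_filterlim_at_infinity[OF tendsto_const a(1) filterlim_wp'[OF \<tau>]])
    then show "is_pole (\<lambda>z. a * wp' \<tau> z) 0" by (simp add: is_pole_def)
    show "wp \<tau> holomorphic_on - lattice \<tau>" by (rule holomorphic_wp[OF \<tau>])
    show "is_pole (wp \<tau>) 0" using filterlim_wp[OF \<tau>] by (simp add: is_pole_def)
  qed (simp_all add: front_F_cls front_G_cls[OF \<tau>])
  moreover have "has_total_curvature (punctured_torus \<tau>) ?F ?G (- 8 * pi)"
    by (rule has_total_curvature_torus[OF \<tau> a(1)])
  ultimately show ?thesis using \<alpha> unfolding \<tau>_def by blast
qed

end
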